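(* Let $N\ge1$, let $p>1$ be an integer, let $D'\subset\mathbb R^N$ and $D\subset\mathbb R^{2N}$ be countable dense subsets, and let $f\in\mathfrak{LC}_p(\mathbb R^{2N},\mathbb R^N)$. For a topology $\mathcal T$ on $\mathfrak{LC}_p=\mathfrak{LC}_p(\mathbb R^{2N},\mathbb R^N)$ let $$\mathcal U_{(\mathfrak{LC}_p,\mathcal T)}=\{(t,g,\phi): g\in\mathrm{Hull}_{(\mathfrak{LC}_p,\mathcal T)}(f),\ \phi\in\mathcal C^{1,p},\ t\in I_{g,\phi},\ t\ge0\}$$ and consider the map $$\mathcal U_{(\mathfrak{LC}_p,\mathcal T)}\to\mathrm{Hull}_{(\mathfrak{LC}_p,\mathcal T)}(f)\times\mathcal C^{1,p},\qquad(t,g,\phi)\mapsto\big(g_t,x_t(\cdot,g,\phi)\big).\qquad( * )$$ (i) If $f$ has $L^1_{loc}$-equicontinuous $m$-bounds, let $\Theta=\{\theta^I_j\}$ be the suitable set of moduli of continuity given by the $m$-bounds, $\theta^I_j(s)=\sup_{t\in\mathbb R}\int_t^{t+s}m^j_f(u)\,du$, and let $\widehat\Theta=\{\hat\theta^I_j\}$ with $\hat\theta^I_j=\max\{\theta^I_j,\tau_j\}$, where $\tau_j(h)=\sup\{|\phi(t)-\phi(s)|: t,s\in[-1,0],\ |t-s|<h,\ \|\phi\|_{\mathcal C^{1,p}}\le j\}$ for $0\le h\le1$ (with $\tau_j(0)=0$) and $\tau_j(h)=\tau_j(1)$ for $h>1$. Then the map $( * )$ is a continuous skew-product semiflow for $\mathcal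 T=\mathcal T_{\Theta\widehat\Theta}$. (ii) If $f$ has $L^1_{loc}$-equicontinuous $m$-bounds and $L^p_{loc}$-bounded $l_2$-bounds, then the map $( * )$ defines a continuous skew-product semiflow for $\mathcal T=\mathcal T_{\Theta D'}$, where $\Theta$ is the suitable set of moduli of continuity given by the $m$-bounds (as in (i)). (iii) If $f$ has $L^p_{loc}$-bounded $l$-bounds, the map $( * )$ defines a continuous skew-product semiflow for $\mathcal T=\mathcal T_D$.
   Context: $B_j$ is the closed ball of radius $j$ centered at the origin; $C(I,W)$ is the space of continuous functions $I\to W$. $L^p_{loc}$ is the set of real functions on $\mathbb R$ belonging to $L^p(I)$ for every compact interval $I$. For a compact interval $I$, $\mathcal C^{1,p}(I)$ is the Sobolev space of (absolutely) continuous functions $x:I\to\mathbb R^N$ with $\dot x\in L^p(I)$, normed by $\|x\|_{\mathcal C^{1,p}(I)}=\|x\|_{L^\infty(I)}+\|\dot x\|_{L^p(I)}$; $\mathcal C^{1,p}=\mathcal C^{1,p}([-1,0])$. $\mathfrak{LC}_p(\mathbb R^{2N},\mathbb R^N)$ is the set of functions $f:\mathbb R\times\mathbb R^{2N}\to\mathbb R^N$ such that: $f$ is Borel measurable; for every compact $K\subset\mathbb R^{2N}$ there are $m^K,l^K\in L^p_{loc}$ such that for a.e. $t\in\mathbb R$, $|f(t,z)|\le m^K(t)$ and $|f(t,z_1)-f(t,z_2)|\le l^K(t)|z_1-z_2|$ for all $z,z_1,z_2\in K$. Functions differing only on a negligible set are identified. Points of $\mathbb R^{2N}$ are written $(x,u)$.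 Time translation: $f_t(s,z)=f(s+t,z)$. $\mathrm{Hull}_{(\mathfrak{LC}_p,\mathcal T)}(f)$ is the closure of $\{f_t: t\in\mathbb R\}$ in $(\mathfrak{LC}_p,\mathcal T)$, with the induced topology. Optimal bounds of $g$ on $B_j\subset\mathbb R^{2N}$: $m^j_g(t)=\sup_{z\in B_j}|g(t,z)|$, $l^j_g(t)=\sup_{z_1\neq z_2\in B_j}|g(t,z_1)-g(t,z_2)|/|z_1-z_2|$, $l^j_{2,g}(t)=\sup|g(t,x,u_1)-g(t,x,u_2)|/|u_1-u_2|$ over $(x,u_1),(x,u_2)\in B_j$, $u_1\ne u_2$. $f$ has $L^1_{loc}$-equicontinuous $m$-bounds if for every $j\in\mathbb N$, $r,\varepsilon>0$ there is $\delta>0$ with $\sup_{\tau\in\mathbb R}\int_s^t m^j_{f_\tau}(u)\,du<\varepsilon$ whenever $-r\le s\le t\le r$, $t-s<\delta$. $f$ has $L^p_{loc}$-bounded $l$-bounds (resp. $l_2$-bounds) if $\sup_{\tau\in\mathbb R}\int_{-r}^r l^j_{f_\tau}(t)^p\,dt<\infty$ (resp. $\sup_{\tau\in\mathbb R}\int_{-r}^r l^j_{2,f_\tau}(t)^p\,dt<\infty$) for every $j\in\mathbb N$, $r>0$. A suitable set of moduli of continuity is a countable set $\{\theta^I_j: j\in\mathbb N,\ I=[q_1,q_2],\ q_1,q_2\in\mathbb Q\}$ of non-decreasing continuous functions $[0,\infty)\to[0,\infty)$ with $\theta^I_j(0)=0$ and $\theta^{I_1}_{j_1}\le\theta^{I_2}_{j_2}$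 whenever $I_1\subseteq I_2$, $j_1\le j_2$. $\mathcal K^I_j$ (resp. $\widehat{\mathcal K}^I_j$) is the set of $x\in C(I,B_j)$, $B_j\subset\mathbb R^N$, with $|x(t)-x(s)|\le\theta^I_j(|t-s|)$ (resp. $\hat\theta^I_j(|t-s|)$) for all $t,s\in I$. Topologies, generated by the following seminorms over all $I=[q_1,q_2]$, $q_1,q_2\in\mathbb Q$, $j\in\mathbb N$ ($I-1$ is the translate of $I$): - $\mathcal T_{\Theta\widehat\Theta}$: $\sup_{x\in\mathcal K^I_j,\,u\in\widehat{\mathcal K}^{I-1}_j}[\int_I|f(t,x(t),u(t-1))|^pdt]^{1/p}$; - $\mathcal T_{\Theta D'}$: $\sup_{x\in\mathcal K^I_j}[\int_I|f(t,x(t),u)|^pdt]^{1/p}$, $u\in D'$; - $\mathcal T_D$: $[\int_I|f(t,z)|^pdt]^{1/p}$, $z\in D$. For $g\in\mathfrak{LC}_p(\mathbb R^{2N},\mathbb R^N)$ and $\phi\in C([-1,0],\mathbb R^N)$, $x(\cdot,g,\phi)$ denotes the unique maximal continuous (Carathéodory) solution, with maximal interval of definition $I_{g,\phi}=[-1,b_{g,\phi})$, of $\dot x=g(t,x(t),x(t-1))$ for $t>0$, $x(t)=\phi(t)$ for $t\in[-1,0]$. For $t\ge0$, $x_t(\cdot,g,\phi)$ is the function $s\mapsto x(t+s,g,\phi)$, $s\in[-1,0]$ (it belongs to $\mathcal C^{1,p}$ if $\phi\in\mathcal C^{1,p}$). Since solutions may blow up, "continuous semiflow" is understood locally: a continuous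 map $\Phi:\mathcal U\to X$, with $\mathcal U\subset[0,\infty)\times X$ relatively open and containing $\{0\}\times X$, such that $\Phi(0,x)=x$ and $\Phi(t+s,x)=\Phi(t,\Phi(s,x))$ whenever $(s,x)\in\mathcal U$ and $(t,\Phi(s,x))\in\mathcal U$. It is a skew-product semiflow if $X=Y\times Z$ and the $Y$-component of $\Phi(t,y,z)$ depends only on $(t,y)$. *)

theory Defs
  imports "HOL-Analysis.Analysis"
begin

text \<open>Functions on \<open>\<real> \<times> \<real>\<^sup>2\<^sup>N\<close> with values in \<open>\<real>\<^sup>N\<close>, where \<open>N = CARD('n)\<close>. The library norm of
  \<open>(real ^ 'n) \<times> (real ^ 'n)\<close> is the Euclidean norm of \<open>\<real>\<^sup>2\<^sup>N\<close>.\<close>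

type_synonym 'n delay_field = "real \<Rightarrow> (real ^ 'n) \<times> (real ^ 'n) \<Rightarrow> real ^ 'n"

definition Lp_loc :: "nat \<Rightarrow> (real \<Rightarrow> real) set" where
  "Lp_loc p = {m. m \<in> borel_measurable lebesgue \<and>
     (\<forall>a b. set_integrable lebesgue {a..b} (\<lambda>t. \<bar>m t\<bar> ^ p))}"

definition LC_fun :: "nat \<Rightarrow> 'n::finite delay_field set" where
  "LC_fun p = {f. (\<lambda>(t, z). f t z) \<in> borel_measurable borel \<and>
     (\<forall>K. compact K \<longrightarrow> (\<exists>m \<in> Lp_loc p. \<exists>l \<in> Lp_loc p. AE t in lborel.
        (\<forall>z \<in> K. norm (f t z) \<le> m t) \<and>
        (\<forall>z1 \<in> K. \<forall>z2 \<in> K. norm (f t z1 - f t z2) \<le> l t * norm (z1 - z2))))}"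

text \<open>The space itself consists of classes of functions that agree outside a null set of
  \<open>\<real> \<times> \<real>\<^sup>2\<^sup>N\<close>.\<close>

definition LC_rel :: "nat \<Rightarrow> ('n::finite delay_field \<times> 'n delay_field) set" where
  "LC_rel p = {(f, g). f \<in> LC_fun p \<and> g \<in> LC_fun p \<and>
     (AE q in lborel. f (fst q) (snd q) = g (fst q) (snd q))}"

definition LC_class :: "nat \<Rightarrow> 'n::finite delay_field \<Rightarrow> 'n delay_field set" where
  "LC_class p f = LC_rel p `` {f}"

definition LC :: "nat \<Rightarrow> 'n::finite delay_field set set" where
  "LC p = LC_fun p // LC_rel p"

text \<open>A chosen representative. Two functions in one class agree, for almost every \<open>t\<close>, at all
  \<open>z\<close> (both are continuous in \<open>z\<close>), so everything below that is defined through
  \<open>LC_rep\<close> does not depend on the choice.\<close>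

definition LC_rep :: "'n::finite delay_field set \<Rightarrow> 'n delay_field" where
  "LC_rep G = (SOME g. g \<in> G)"

definition translate :: "real \<Rightarrow> 'n::finite delay_field \<Rightarrow> 'n delay_field" where
  "translate t f = (\<lambda>s z. f (s + t) z)"

definition LC_hull ::
    "nat \<Rightarrow> 'n::finite delay_field set topology \<Rightarrow> 'n delay_field \<Rightarrow> 'n delay_field set set" where
  "LC_hull p T f = T closure_of range (\<lambda>t. LC_class p (translate t f))"


text \<open>The optimal bounds take values in \<open>[0, \<infinity>]\<close>; they are finite for almost every \<open>t\<close>, and
  measurable only up to a null set, hence the integrals with respect to \<^term>\<open>lebesgue\<close>.\<close>

definition m_bound :: "nat \<Rightarrow> 'n::finite delay_field \<Rightarrow> real \<Rightarrow> ennreal" where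
  "m_bound j g t = (SUP z \<in> cball 0 (real j). ennreal (norm (g t z)))"

definition l_bound :: "nat \<Rightarrow> 'n::finite delay_field \<Rightarrow> real \<Rightarrow> ennreal" where
  "l_bound j g t = (SUP (z1, z2) \<in> {(z1, z2). z1 \<in> cball 0 (real j) \<and> z2 \<in> cball 0 (real j) \<and> z1 \<noteq> z2}.
     ennreal (norm (g t z1 - g t z2) / norm (z1 - z2)))"

definition l2_bound :: "nat \<Rightarrow> 'n::finite delay_field \<Rightarrow> real \<Rightarrow> ennreal" where
  "l2_bound j g t =
     (SUP (x, u1, u2) \<in> {(x, u1, u2). (x, u1) \<in> cball 0 (real j) \<and> (x, u2) \<in> cball 0 (real j) \<and> u1 \<noteq> u2}.
     ennreal (norm (g t (x, u1) - g t (x, u2)) / norm (u1 - u2)))"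

definition L1_loc_equicontinuous_m_bounds :: "'n::finite delay_field \<Rightarrow> bool" where
  "L1_loc_equicontinuous_m_bounds f \<longleftrightarrow>
     (\<forall>j::nat. \<forall>r>0. \<forall>\<epsilon>>0. \<exists>\<delta>>0. \<forall>s t. - r \<le> s \<and> s \<le> t \<and> t \<le> r \<and> t - s < \<delta> \<longrightarrow>
        (SUP \<tau>::real. \<integral>\<^sup>+u\<in>{s..t}. m_bound j (translate \<tau> f) u \<partial>lebesgue) < ennreal \<epsilon>)"

definition Lp_loc_bounded_l_bounds :: "nat \<Rightarrow> 'n::finite delay_field \<Rightarrow> bool" where
  "Lp_loc_bounded_l_bounds p f \<longleftrightarrow>
     (\<forall>j::nat. \<forall>r>0. (SUP \<tau>::real. \<integral>\<^sup>+t\<in>{-r..r}. l_bound j (translate \<tau> f) t ^ p \<partial>lebesgue) < \<infinity>)"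

definition Lp_loc_bounded_l2_bounds :: "nat \<Rightarrow> 'n::finite delay_field \<Rightarrow> bool" where
  "Lp_loc_bounded_l2_bounds p f \<longleftrightarrow>
     (\<forall>j::nat. \<forall>r>0. (SUP \<tau>::real. \<integral>\<^sup>+t\<in>{-r..r}. l2_bound j (translate \<tau> f) t ^ p \<partial>lebesgue) < \<infinity>)"


definition absolutely_continuous_on :: "real set \<Rightarrow> (real \<Rightarrow> 'a::real_normed_vector) \<Rightarrow> bool" where
  "absolutely_continuous_on I x \<longleftrightarrow>
     (\<forall>\<epsilon>>0. \<exists>\<delta>>0. \<forall>(n::nat) a b.
        (\<forall>i<n. a i \<le> b i \<and> {a i..b i} \<subseteq> I) \<and>
        (\<forall>i<n. \<forall>k<n. i \<noteq> k \<longrightarrow> {a i<..<b i} \<inter> {a k<..<b k} = {}) \<and>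
        (\<Sum>i<n. b i - a i) < \<delta> \<longrightarrow>
        (\<Sum>i<n. norm (x (b i) - x (a i))) < \<epsilon>)"

text \<open>Functions on \<open>[-1, 0]\<close> are represented by functions on \<open>\<real>\<close> with the value
  \<open>undefined\<close> outside \<open>[-1, 0]\<close>.\<close>

definition C1p :: "nat \<Rightarrow> (real \<Rightarrow> real ^ 'n::finite) set" where
  "C1p p = {x \<in> extensional {-1..0}. absolutely_continuous_on {-1..0} x \<and>
     (\<exists>y. y \<in> borel_measurable lebesgue \<and>
          set_integrable lebesgue {-1..0} (\<lambda>t. norm (y t) ^ p) \<and>
          (AE t in lebesgue. t \<in> {-1..0} \<longrightarrow> (x has_vector_derivative y t) (at t within {-1..0})))}"

text \<open>For \<open>x\<close> in \<^term>\<open>C1p p\<close>, \<^const>\<open>vector_derivative\<close> is the derivative of \<open>x\<close> at almost every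
  \<open>t\<close>; its values at the other points do not affect the integral. The first summand is the
  \<open>L\<^sup>\<infinity>\<close> norm, since \<open>x\<close> is continuous.\<close>

definition C1p_norm :: "nat \<Rightarrow> (real \<Rightarrow> real ^ 'n::finite) \<Rightarrow> real" where
  "C1p_norm p x = (SUP t \<in> {-1..0}. norm (x t)) +
     root p (LINT t:{-1..0}|lebesgue. norm (vector_derivative x (at t within {-1..0})) ^ p)"


text \<open>A family \<open>\<theta>\<^sup>I\<^sub>j\<close> is written \<open>\<theta> a b j\<close> for \<open>I = [a, b]\<close>.\<close>

type_synonym moduli = "real \<Rightarrow> real \<Rightarrow> nat \<Rightarrow> real \<Rightarrow> real"

text \<open>The supremum is finite if \<open>f\<close> has \<open>L\<^sup>1\<close>-equicontinuous \<open>m\<close>-bounds; then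
  \<^const>\<open>enn2real\<close> loses nothing.\<close>

definition m_moduli :: "'n::finite delay_field \<Rightarrow> moduli" where
  "m_moduli f a b j s = enn2real (SUP t. \<integral>\<^sup>+u\<in>{t..t + s}. m_bound j f u \<partial>lebesgue)"

definition C1p_modulus :: "'n::finite itself \<Rightarrow> nat \<Rightarrow> nat \<Rightarrow> real \<Rightarrow> real" where
  "C1p_modulus N p j h =
     (if h \<le> 0 then 0
      else Sup {norm (\<phi> t - \<phi> s) | (\<phi> :: real \<Rightarrow> real ^ 'n) t s.
             \<phi> \<in> C1p p \<and> C1p_norm p \<phi> \<le> real j \<and>
             t \<in> {-1..0} \<and> s \<in> {-1..0} \<and> \<bar>t - s\<bar> < min h 1})"

definition m_moduli_hat :: "nat \<Rightarrow> 'n::finite delay_field \<Rightarrow> moduli" where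
  "m_moduli_hat p f a b j s = max (m_moduli f a b j s) (C1p_modulus TYPE('n) p j s)"

definition K_set :: "moduli \<Rightarrow> real \<Rightarrow> real \<Rightarrow> nat \<Rightarrow> (real \<Rightarrow> real ^ 'n::finite) set" where
  "K_set \<theta> a b j = {x. continuous_on {a..b} x \<and> x ` {a..b} \<subseteq> cball 0 (real j) \<and>
     (\<forall>t \<in> {a..b}. \<forall>s \<in> {a..b}. norm (x t - x s) \<le> \<theta> a b j \<bar>t - s\<bar>)}"


definition pseudometric_topology :: "'a set \<Rightarrow> ('a \<Rightarrow> 'a \<Rightarrow> real) set \<Rightarrow> 'a topology" where
  "pseudometric_topology S P =
     topology_generated_by {{y \<in> S. d x y < \<epsilon>} | x d \<epsilon>. x \<in> S \<and> d \<in> P \<and> \<epsilon> > 0}"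

definition C1p_topology :: "nat \<Rightarrow> (real \<Rightarrow> real ^ 'n::finite) topology" where
  "C1p_topology p = pseudometric_topology (C1p p) {\<lambda>x y. C1p_norm p (\<lambda>t. y t - x t)}"

definition LC_seminorm_topology ::
    "nat \<Rightarrow> ('n::finite delay_field \<Rightarrow> real) set \<Rightarrow> 'n delay_field set topology" where
  "LC_seminorm_topology p \<N> = pseudometric_topology (LC p)
     ((\<lambda>\<nu> F G. \<nu> (\<lambda>t z. LC_rep G t z - LC_rep F t z)) ` \<N>)"

definition T_Theta_Theta :: "nat \<Rightarrow> moduli \<Rightarrow> moduli \<Rightarrow> 'n::finite delay_field set topology" where
  "T_Theta_Theta p \<theta> \<theta>' = LC_seminorm_topology p
     {\<lambda>g. SUP (x, u) \<in> K_set \<theta> a b j \<times> K_set \<theta>' (a - 1) (b - 1) j.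
            root p (LINT t:{a..b}|lborel. norm (g t (x t, u (t - 1))) ^ p)
      | a b j. a \<in> \<rat> \<and> b \<in> \<rat> \<and> a \<le> b}"

definition T_Theta_D ::
    "nat \<Rightarrow> moduli \<Rightarrow> (real ^ 'n) set \<Rightarrow> 'n::finite delay_field set topology" where
  "T_Theta_D p \<theta> D' = LC_seminorm_topology p
     {\<lambda>g. SUP x \<in> K_set \<theta> a b j. root p (LINT t:{a..b}|lborel. norm (g t (x t, u)) ^ p)
      | a b j u. a \<in> \<rat> \<and> b \<in> \<rat> \<and> a \<le> b \<and> u \<in> D'}"

definition T_D ::
    "nat \<Rightarrow> ((real ^ 'n) \<times> (real ^ 'n)) set \<Rightarrow> 'n::finite delay_field set topology" where
  "T_D p D = LC_seminorm_topology p
     {\<lambda>g. root p (LINT t:{a..b}|lborel. norm (g t z) ^ p)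
      | a b z. a \<in> \<rat> \<and> b \<in> \<rat> \<and> a \<le> b \<and> z \<in> D}"


definition is_solution ::
    "'n::finite delay_field \<Rightarrow> (real \<Rightarrow> real ^ 'n) \<Rightarrow> ereal \<Rightarrow> (real \<Rightarrow> real ^ 'n) \<Rightarrow> bool" where
  "is_solution g \<phi> b x \<longleftrightarrow>
     0 < b \<and>
     x \<in> extensional {t. -1 \<le> t \<and> ereal t < b} \<and>
     continuous_on {t. -1 \<le> t \<and> ereal t < b} x \<and>
     (\<forall>t \<in> {-1..0}. x t = \<phi> t) \<and>
     (\<forall>c\<ge>0. ereal c < b \<longrightarrow> absolutely_continuous_on {0..c} x) \<and>
     (AE t in lborel. 0 < t \<and> ereal t < b \<longrightarrow>
        (x has_vector_derivative g t (x t, x (t - 1))) (at t))"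

definition is_maximal_solution ::
    "'n::finite delay_field \<Rightarrow> (real \<Rightarrow> real ^ 'n) \<Rightarrow> ereal \<Rightarrow> (real \<Rightarrow> real ^ 'n) \<Rightarrow> bool" where
  "is_maximal_solution g \<phi> b x \<longleftrightarrow>
     is_solution g \<phi> b x \<and>
     (\<forall>b' x'. is_solution g \<phi> b' x' \<and> b \<le> b' \<and>
        (\<forall>t. -1 \<le> t \<and> ereal t < b \<longrightarrow> x' t = x t) \<longrightarrow> b' = b)"

text \<open>For \<open>g\<close> in \<^term>\<open>LC_fun p\<close> and continuous \<open>\<phi>\<close> there is exactly one maximal solution; the
  \<^const>\<open>extensional\<close> condition makes it unique as a function on \<open>\<real>\<close>.\<close>

definition maximal_solution ::
    "'n::finite delay_field \<Rightarrow> (real \<Rightarrow> real ^ 'n) \<Rightarrow> ereal \<times> (real \<Rightarrow> real ^ 'n)" where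
  "maximal_solution g \<phi> = (THE (b, x). is_maximal_solution g \<phi> b x)"

definition sol_end :: "'n::finite delay_field \<Rightarrow> (real \<Rightarrow> real ^ 'n) \<Rightarrow> ereal" where
  "sol_end g \<phi> = fst (maximal_solution g \<phi>)"

definition sol :: "'n::finite delay_field \<Rightarrow> (real \<Rightarrow> real ^ 'n) \<Rightarrow> real \<Rightarrow> real ^ 'n" where
  "sol g \<phi> = snd (maximal_solution g \<phi>)"

definition sol_segment ::
    "'n::finite delay_field \<Rightarrow> (real \<Rightarrow> real ^ 'n) \<Rightarrow> real \<Rightarrow> real \<Rightarrow> real ^ 'n" where
  "sol_segment g \<phi> t = restrict (\<lambda>s. sol g \<phi> (t + s)) {-1..0}"


definition continuous_semiflow ::
    "'x topology \<Rightarrow> (real \<times> 'x) set \<Rightarrow> (real \<Rightarrow> 'x \<Rightarrow> 'x) \<Rightarrow> bool" where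
  "continuous_semiflow X U \<Phi> \<longleftrightarrow>
     openin (prod_topology (top_of_set {0..}) X) U \<and>
     {0} \<times> topspace X \<subseteq> U \<and>
     continuous_map (subtopology (prod_topology (top_of_set {0..}) X) U) X (\<lambda>(t, x). \<Phi> t x) \<and>
     (\<forall>x \<in> topspace X. \<Phi> 0 x = x) \<and>
     (\<forall>s t x. (s, x) \<in> U \<and> (t, \<Phi> s x) \<in> U \<longrightarrow>
        (t + s, x) \<in> U \<and> \<Phi> (t + s) x = \<Phi> t (\<Phi> s x))"

definition continuous_skew_product_semiflow ::
    "'y topology \<Rightarrow> 'z topology \<Rightarrow> (real \<times> 'y \<times> 'z) set \<Rightarrow> (real \<Rightarrow> 'y \<times> 'z \<Rightarrow> 'y \<times> 'z) \<Rightarrow> bool" where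
  "continuous_skew_product_semiflow Y Z U \<Phi> \<longleftrightarrow>
     continuous_semiflow (prod_topology Y Z) U \<Phi> \<and>
     (\<forall>t y z z'. (t, y, z) \<in> U \<and> (t, y, z') \<in> U \<longrightarrow> fst (\<Phi> t (y, z)) = fst (\<Phi> t (y, z')))"

definition hull_topology ::
    "nat \<Rightarrow> 'n::finite delay_field set topology \<Rightarrow> 'n delay_field \<Rightarrow> 'n delay_field set topology" where
  "hull_topology p T f = subtopology T (LC_hull p T f)"

definition delay_domain ::
    "nat \<Rightarrow> 'n::finite delay_field set topology \<Rightarrow> 'n delay_field \<Rightarrow>
     (real \<times> 'n delay_field set \<times> (real \<Rightarrow> real ^ 'n)) set" where
  "delay_domain p T f = {(t, G, \<phi>). G \<in> LC_hull p T f \<and> \<phi> \<in> C1p p \<and> 0 \<le> t \<and>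
     ereal t < sol_end (LC_rep G) \<phi>}"

definition delay_map ::
    "real \<Rightarrow> 'n::finite delay_field set \<times> (real \<Rightarrow> real ^ 'n) \<Rightarrow>
     'n delay_field set \<times> (real \<Rightarrow> real ^ 'n)" where
  "delay_map t = (\<lambda>(G, \<phi>). (translate t ` G, sol_segment (LC_rep G) \<phi> t))"

end

theory Submission
  imports Defs
begin

text \<open>Each of the three topologies comes from seminorms that measure a field in \<open>L\<^sup>p\<close> along the curves of a
  family. Translating a curve in time leads to a restriction of another curve of the family, and on a ball
  a field is Lipschitz with an \<open>L\<^sup>p\<close> constant; hence time translation is jointly continuous and preserves
  the hull.

  For the second component, replace \<open>g\<close> by the field truncated to a large ball, whose solutions exist for all
  times. By Gronwall's inequality with an integrable kernel, these solutions and their derivatives depend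
  continuously on the initial history and on the integral of \<open>|(g - g\<^sub>0)(s, w s, w (s - 1))|\<^sup>p\<close>, where \<open>w\<close> is
  the truncated solution for \<open>g\<close>. It remains to make this integral small for \<open>g\<close> in the hull close to
  \<open>g\<^sub>0\<close>. By Fatou's lemma the bounds of \<open>f\<close> pass to the hull. In case (i) the \<open>m\<close>-bounds make the pieces of
  \<open>(w s, w (s - 1))\<close> over unit intervals curves of the family. In cases (ii) and (iii) one replaces
  \<open>w (s - 1)\<close>, respectively the pair, by a nearby point of a finite net in the countable dense set; the
  error is controlled by the \<open>l\<^sub>2\<close>- respectively \<open>l\<close>-bounds.\<close>

section \<open>Absolutely continuous functions\<close>

text \<open>The comparison of two solutions is arranged so that a Lipschitz constant is used only
  for the fixed field \<open>g0\<close>: in case (i) nothing bounds the Lipschitz constants of the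
  fields \<open>g\<close> near \<open>g0\<close>. The price is that \<open>g - g0\<close> is
  integrated along the solution of \<open>g\<close>, a curve that moves with \<open>g\<close>.
  Smallness must therefore be uniform over a set of curves fixed before \<open>g\<close>. This is
  the purpose of the moduli: the \<open>m\<close>-bounds limit the oscillation of the solutions of
  all fields in the hull at once. On the history interval only the size of \<phi> in
  \<open>C1p\<close> is known, whence the second family of moduli.

  Blow-up is the other obstacle, since the existence time depends on \<open>g\<close>. Truncating
  each component at radius \<open>j / 2\<close> keeps the pair of present and delayed state in the
  ball of radius \<open>j\<close>, the ball to which the optimal bounds of index \<open>j\<close>
  refer.

  Solutions and \<open>C1p\<close> are defined through absolute continuity and derivatives almost
  everywhere, whereas the estimates use integrals; the first section makes the two descriptions
  interchangeable.\<close>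

lemma AE_right_derivative:
  fixes X :: "real \<Rightarrow> 'a::euclidean_space"
  assumes "\<And>a b. X integrable_on {a..b}"
  obtains N where "N \<in> null_sets lborel"
    "\<And>x e. x \<notin> N \<Longrightarrow> 0 < e \<Longrightarrow> \<exists>d>0. \<forall>h. 0 < h \<and> h < d \<longrightarrow> norm (integral {x..x + h} X - h *\<^sub>R X x) \<le> e * h"
proof -
  \<comment> \<open>The averages run over \<open>[x, x + h]\<close> only, so this controls the
    integral to the right of \<open>x\<close>; as the dimension is 1, the normalising factor is
    \<open>h\<close> itself.\<close>
  obtain N where N: "negligible N"
    "\<And>x e. \<lbrakk>x \<notin> N; 0 < e\<rbrakk> \<Longrightarrow> \<exists>d>0. \<forall>h. 0 < h \<and> h < d \<longrightarrow>
        norm (integral (cbox x (x + h *\<^sub>R One)) X /\<^sub>R h ^ DIM(real) - X x) < e"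
    using integrable_ccontinuous_explicit[of X] assms by (auto simp: cbox_interval)
  obtain N' where N': "N' \<in> null_sets lborel" "N \<subseteq> N'"
    using N(1) by (auto simp: negligible_iff_null_sets null_sets_completion_iff2)
  show thesis
  proof (rule that[OF N'(1)])
    fix x e :: real assume "x \<notin> N'" "0 < e"
    then obtain d where d: "d > 0" "\<And>h. 0 < h \<Longrightarrow> h < d \<Longrightarrow> norm (integral {x..x + h} X /\<^sub>R h - X x) < e"
      using N(2)[of x e] N'(2) by (auto simp: cbox_interval)
    have "norm (integral {x..x + h} X - h *\<^sub>R X x) \<le> e * h" if h: "0 < h" "h < d" for h
    proof -
      have "integral {x..x + h} X - h *\<^sub>R X x = h *\<^sub>R (integral {x..x + h} X /\<^sub>R h - X x)"
        using h by (simp add: scaleR_diff_right)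
      then have "norm (integral {x..x + h} X - h *\<^sub>R X x) = h * norm (integral {x..x + h} X /\<^sub>R h - X x)"
        using h by simp
      also have "\<dots> \<le> h * e" using d(2)[OF h] h by (intro mult_left_mono) auto
      finally show ?thesis by (simp add: mult.commute)
    qed
    then show "\<exists>d>0. \<forall>h. 0 < h \<and> h < d \<longrightarrow> norm (integral {x..x + h} X - h *\<^sub>R X x) \<le> e * h"
      using d(1) by blast
  qed
qed

text \<open>Averages to the left of \<open>t\<close> are averages to the right of \<open>- t\<close>
  for the reflected function, so the one-sided statement is applied twice; the reflected exceptional
  set is again null.\<close>

lemma AE_has_vector_derivative_integral:
  fixes X :: "real \<Rightarrow> 'a::euclidean_space"
  assumes int: "\<And>a b. X integrable_on {a..b}"
  shows "AE t in lborel. \<forall>a<t. ((\<lambda>u. integral {a..u} X) has_vector_derivative X t) (at t)"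
proof -
  have intr: "(\<lambda>t. X (- t)) integrable_on {a..b}" for a b
    using int[of "-b" "-a"] Henstock_Kurzweil_Integration.integrable_reflect_real[where f=X and a="-b" and b="-a"] by simp
  obtain N1 where N1: "N1 \<in> null_sets lborel"
    "\<And>x e. x \<notin> N1 \<Longrightarrow> 0 < e \<Longrightarrow> \<exists>d>0. \<forall>h. 0 < h \<and> h < d \<longrightarrow> norm (integral {x..x + h} X - h *\<^sub>R X x) \<le> e * h"
    using AE_right_derivative[OF int] by blast
  obtain N2 where N2: "N2 \<in> null_sets lborel"
    "\<And>x e. x \<notin> N2 \<Longrightarrow> 0 < e \<Longrightarrow> \<exists>d>0. \<forall>h. 0 < h \<and> h < d \<longrightarrow>
       norm (integral {x..x + h} (\<lambda>t. X (- t)) - h *\<^sub>R X (- x)) \<le> e * h"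
    using AE_right_derivative[OF intr] by blast
  have ae1: "AE t in lborel. t \<notin> N1" using N1(1) by (rule AE_not_in)
  have ae2: "AE t in lborel. - t \<notin> N2"
  proof -
    have "AE t in lborel. t \<notin> N2" using N2(1) by (rule AE_not_in)
    then have "AE t in lborel. 0 + (-1) * t \<notin> N2"
      using N2(1) by (intro AE_borel_affine) auto
    then show ?thesis by simp
  qed
  from ae1 ae2 show ?thesis
  proof eventually_elim
    case (elim t)
    show ?case
    proof (intro allI impI)
      fix a assume a: "a < t"
      let ?F = "\<lambda>u. integral {a..u} X"
      have "\<exists>d>0. \<forall>y. norm (y - t) < d \<longrightarrow> norm (?F y - ?F t - (y - t) *\<^sub>R X t) \<le> e * norm (y - t)" if e: "e > 0" for e
      proof -
        obtain d1 where d1: "d1 > 0" "\<And>h. 0 < h \<Longrightarrow> h < d1 \<Longrightarrow> norm (integral {t..t + h} X - h *\<^sub>R X t) \<le> e * h"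
          using N1(2)[OF elim(1) e] by blast
        obtain d2 where d2: "d2 > 0" "\<And>h. 0 < h \<Longrightarrow> h < d2 \<Longrightarrow>
            norm (integral {- t..- t + h} (\<lambda>t. X (- t)) - h *\<^sub>R X t) \<le> e * h"
          using N2(2)[OF elim(2) e] by auto
        have "norm (?F y - ?F t - (y - t) *\<^sub>R X t) \<le> e * norm (y - t)" if y: "norm (y - t) < min (min d1 d2) (t - a)" for y
        proof (cases "y = t")
          case False
          then consider "y > t" | "y < t" by linarith
          then show ?thesis
          proof cases
            case 1
            have "?F t + integral {t..y} X = ?F y"
              using 1 a by (intro Henstock_Kurzweil_Integration.integral_combine int) auto
            then have "?F y - ?F t = integral {t..y} X" by (metis add_diff_cancel_left')
            then show ?thesis using d1(2)[of "y - t"] 1 y by simp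
          next
            case 2
            have "?F y + integral {y..t} X = ?F t"
              using 2 y by (intro Henstock_Kurzweil_Integration.integral_combine int) auto
            moreover have "integral {- t..- y} (\<lambda>t. X (- t)) = integral {y..t} X"
              by (rule Henstock_Kurzweil_Integration.integral_reflect_real)
            ultimately have "?F y - ?F t - (y - t) *\<^sub>R X t = - (integral {- t..- t + (t - y)} (\<lambda>t. X (- t)) - (t - y) *\<^sub>R X t)"
              by (simp add: algebra_simps)
            then show ?thesis using d2(2)[of "t - y"] 2 y by (simp only: norm_minus_cancel) simp
          qed
        qed simp
        then show ?thesis using d1(1) d2(1) a by (intro exI[of _ "min (min d1 d2) (t - a)"]) auto
      qed
      then show "(?F has_vector_derivative X t) (at t)"
        unfolding has_vector_derivative_def has_derivative_within_alt
        by (auto intro: bounded_linear_scaleR_left)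
    qed
  qed
qed

text \<open>Fundamental theorem of calculus for the gauge integral, with no integrability assumed of
  \<open>X\<close>. At tags outside the null set \<open>M\<close> the gauge is the radius given by
  differentiability. At tags in \<open>M\<close> it is an open set of measure below \<delta>, in
  which absolute continuity bounds the total increment of \<open>x\<close>.\<close>

lemma absolutely_continuous_imp_has_integral:
  fixes x :: "real \<Rightarrow> 'a::euclidean_space"
  assumes ac: "absolutely_continuous_on {a..b} x" and ab: "a \<le> b"
    and ae: "AE t in lborel. a < t \<and> t < b \<longrightarrow> (x has_vector_derivative X t) (at t)"
  shows "(X has_integral (x b - x a)) {a..b}"
proof -
  obtain N where N: "N \<in> null_sets lborel" "{t. \<not> (a < t \<and> t < b \<longrightarrow> (x has_vector_derivative X t) (at t))} \<subseteq> N"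
    using ae by (auto elim!: AE_E simp: null_sets_def)
  define M where "M = N \<union> {a, b}"
  have M: "M \<in> null_sets lborel" using N(1) unfolding M_def by (intro null_sets.Un) (auto intro: finite_imp_null_set_lborel)
  have der: "(x has_vector_derivative X t) (at t)" if "t \<in> {a..b}" "t \<notin> M" for t
    using N(2) that unfolding M_def by (cases "a < t \<and> t < b") auto
  \<comment> \<open>With the integrand set to 0 on \<open>M\<close>, a summand tagged in
    \<open>M\<close> reduces to a mere increment of \<open>x\<close>.\<close>
  define Y where "Y t = (if t \<in> M then 0 else X t)" for t
  have "(Y has_integral (x b - x a)) (cbox a b)"
    unfolding has_integral
  proof (intro allI impI)
    fix e :: real assume e: "e > 0"
    obtain \<delta> where \<delta>: "\<delta> > 0" and \<delta>': "\<And>(n::nat) u v.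
        (\<forall>i<n. u i \<le> v i \<and> {u i..v i} \<subseteq> {a..b}) \<Longrightarrow>
        (\<forall>i<n. \<forall>k<n. i \<noteq> k \<longrightarrow> {u i<..<v i} \<inter> {u k<..<v k} = {}) \<Longrightarrow>
        (\<Sum>i<n. v i - u i) < \<delta> \<Longrightarrow> (\<Sum>i<n. norm (x (v i) - x (u i))) < e / 2"
      using ac[unfolded absolutely_continuous_on_def, rule_format, of "e/2"] e by (auto 0 3)
    obtain U where U: "open U" "M \<subseteq> U" "emeasure lborel (U - M) < ennreal \<delta>"
      using outer_regular_lborel[of M \<delta>] M \<delta> by (auto simp: null_sets_def)
    have Um: "emeasure lborel U < ennreal \<delta>"
    proof -
      have "emeasure lborel U = emeasure lborel (U - M)"
        using M U(1) by (simp add: emeasure_Diff_null_set)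
      then show ?thesis using U(3) by simp
    qed
    \<comment> \<open>The summand 2 in the denominator covers \<open>a = b\<close> and makes the
      estimate \<open>e' * (b - a) < e / 2\<close> strict.\<close>
    define e' where "e' = e / (2 * (b - a) + 2)"
    have e': "e' > 0" "e' * (b - a) < e / 2" using e ab by (auto simp: e'_def field_simps)
    have "\<exists>d>0. \<forall>y. norm (y - t) < d \<longrightarrow> norm (x y - x t - (y - t) *\<^sub>R X t) \<le> e' * norm (y - t)"
      if "t \<in> {a..b}" "t \<notin> M" for t
      using der[OF that] e'(1) unfolding has_vector_derivative_def has_derivative_within_alt by auto
    then obtain d where d: "\<And>t. t \<in> {a..b} \<Longrightarrow> t \<notin> M \<Longrightarrow> d t > 0"
      "\<And>t y. t \<in> {a..b} \<Longrightarrow> t \<notin> M \<Longrightarrow> norm (y - t) < d t \<Longrightarrow> norm (x y - x t - (y - t) *\<^sub>R X t) \<le> e' * norm (y - t)"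
      by metis
    define \<gamma> where "\<gamma> t = (if t \<in> M then U else if t \<in> {a..b} then ball t (d t) else UNIV)" for t
    have "gauge \<gamma>" using U d(1) by (auto simp: gauge_def \<gamma>_def)
    moreover have "norm ((\<Sum>(t, K)\<in>D. measure lborel K *\<^sub>R Y t) - (x b - x a)) < e"
      if D: "D tagged_division_of cbox a b" "\<gamma> fine D" for D
    proof -
      have fin: "finite D" using D(1) by blast
      have K: "\<exists>u v. K = {u..v} \<and> u \<le> t \<and> t \<le> v \<and> a \<le> u \<and> v \<le> b \<and> K \<subseteq> \<gamma> t" if "(t, K) \<in> D" for t K
        using tagged_division_ofD(2,3,4)[OF D(1) that] fineD[OF D(2) that]
        by (auto simp: cbox_interval)
      define D1 where "D1 = {(t, K) \<in> D. t \<in> M}"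
      define D2 where "D2 = {(t, K) \<in> D. t \<notin> M}"
      have DD: "D = D1 \<union> D2" "D1 \<inter> D2 = {}" by (auto simp: D1_def D2_def)
      have fin12: "finite D1" "finite D2" using fin DD by auto
      define q where "q = (\<lambda>(t::real, K). norm (measure lborel K *\<^sub>R Y t - (x (Sup K) - x (Inf K))))"
      have "x b - x a = (\<Sum>(t, K)\<in>D. x (Sup K) - x (Inf K))"
        using additive_tagged_division_1[OF ab, of D x] D(1) by (simp add: cbox_interval)
      then have "norm ((\<Sum>(t, K)\<in>D. measure lborel K *\<^sub>R Y t) - (x b - x a))
          = norm (\<Sum>(t, K)\<in>D. measure lborel K *\<^sub>R Y t - (x (Sup K) - x (Inf K)))"
        by (simp add: sum_subtractf split_def)
      also have "\<dots> \<le> sum q D" unfolding q_def split_def by (rule norm_sum)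
      also have "\<dots> = sum q D1 + sum q D2" using DD fin12 by (simp add: sum.union_disjoint)
      also have "sum q D2 \<le> e' * (b - a)"
      proof -
        have "q (t, K) \<le> e' * measure lborel K" if tK: "(t, K) \<in> D2" for t K
        proof -
          have t: "t \<notin> M" "(t, K) \<in> D" using tK by (auto simp: D2_def)
          obtain u v where uv: "K = {u..v}" "u \<le> t" "t \<le> v" "a \<le> u" "v \<le> b" "K \<subseteq> \<gamma> t" using K[OF t(2)] by blast
          have tab: "t \<in> {a..b}" using uv by auto
          have "u \<in> K" "v \<in> K" using uv by auto
          then have "u \<in> ball t (d t)" "v \<in> ball t (d t)" using uv(6) t(1) tab by (auto simp: \<gamma>_def)
          then have 1: "norm (x u - x t - (u - t) *\<^sub>R X t) \<le> e' * (t - u)" "norm (x v - x t - (v - t) *\<^sub>R X t) \<le> e' * (v - t)"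
            using d(2)[OF tab t(1), of u] d(2)[OF tab t(1), of v] uv by (auto simp: dist_real_def)
          have "measure lborel K *\<^sub>R Y t - (x (Sup K) - x (Inf K))
             = (x u - x t - (u - t) *\<^sub>R X t) - (x v - x t - (v - t) *\<^sub>R X t)"
            using uv t by (simp add: Y_def algebra_simps)
          then have "q (t, K) \<le> e' * (t - u) + e' * (v - t)"
            using 1 norm_triangle_ineq4[of "x u - x t - (u - t) *\<^sub>R X t" "x v - x t - (v - t) *\<^sub>R X t"]
            unfolding q_def by simp
          also have "\<dots> = e' * measure lborel K" using uv by (simp add: algebra_simps)
          finally show ?thesis .
        qed
        then have "sum q D2 \<le> (\<Sum>(t, K)\<in>D2. e' * measure lborel K)"
          by (intro sum_mono) auto
        also have "\<dots> \<le> (\<Sum>(t, K)\<in>D. e' * measure lborel K)"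
          using fin DD e' by (intro sum_mono2) auto
        also have "\<dots> = e' * (\<Sum>(t, K)\<in>D. measure lborel K)" by (simp add: sum_distrib_left split_def)
        also have "(\<Sum>(t, K)\<in>D. measure lborel K) = b - a"
          using additive_content_tagged_division[OF D(1)] ab by (simp add: split_def)
        finally show ?thesis .
      qed
      \<comment> \<open>The intervals tagged in \<open>M\<close> do not overlap and lie in
        \<open>U\<close>, so their total length is below \<delta>. They are enumerated by naturals
        because absolute continuity is stated for finite sequences.\<close>
      also have "sum q D1 < e / 2"
      proof -
        obtain h where h: "bij_betw h {..<card D1} D1"
          using ex_bij_betw_nat_finite[OF fin12(1)] by (auto simp: atLeast0LessThan)
        define u where "u i = Inf (snd (h i))" for i
        define v where "v i = Sup (snd (h i))" for i
        have hi: "h i \<in> D" "fst (h i) \<in> M" "h i \<in> D1" if "i < card D1" for i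
        proof -
          show "h i \<in> D1" using bij_betwE[OF h] that by (simp add: Ball_def)
          then show "h i \<in> D" "fst (h i) \<in> M" by (auto simp: D1_def)
        qed
        have uv: "snd (h i) = {u i..v i} \<and> u i \<le> v i \<and> {u i..v i} \<subseteq> {a..b} \<and> {u i..v i} \<subseteq> U" if i: "i < card D1" for i
        proof -
          obtain t K' where tk: "h i = (t, K')" by force
          then obtain u' v' where "K' = {u'..v'}" "u' \<le> t" "t \<le> v'" "a \<le> u'" "v' \<le> b" "K' \<subseteq> \<gamma> t"
            using K[of t K'] hi(1)[OF i] by auto
          then show ?thesis using hi(2)[OF i] tk by (simp add: u_def v_def \<gamma>_def)
        qed
        have dis: "{u i<..<v i} \<inter> {u k<..<v k} = {}" if "i < card D1" "k < card D1" "i \<noteq> k" for i k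
        proof -
          have "h i \<noteq> h k" using h that bij_betw_imp_inj_on[OF h, THEN inj_onD, of i k] by blast
          then have "interior (snd (h i)) \<inter> interior (snd (h k)) = {}"
            using tagged_division_ofD(5)[OF D(1), of "fst (h i)" "snd (h i)" "fst (h k)" "snd (h k)"] hi(1)[OF that(1)] hi(1)[OF that(2)]
            by simp
          then show ?thesis using uv[OF that(1)] uv[OF that(2)] by (metis interior_atLeastAtMost_real)
        qed
        have len: "(\<Sum>i<card D1. v i - u i) < \<delta>"
        proof -
          have "ennreal (\<Sum>i<card D1. v i - u i) = (\<Sum>i<card D1. emeasure lborel {u i<..<v i})"
            by (subst sum_ennreal[symmetric]) (use uv in \<open>auto intro!: sum.cong\<close>)
          also have "\<dots> = emeasure lborel (\<Union>i<card D1. {u i<..<v i})"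
            using dis by (intro sum_emeasure) (simp_all only: disjoint_family_on_def lessThan_iff, auto)
          also have "\<dots> \<le> emeasure lborel U"
            proof (rule emeasure_mono)
            have "{u i<..<v i} \<subseteq> U" if "i < card D1" for i
              using uv[OF that] greaterThanLessThan_subseteq_atLeastAtMost_iff by blast
            then show "(\<Union>i<card D1. {u i<..<v i}) \<subseteq> U" by blast
          qed (use U(1) in simp)
          also note Um
          finally have "ennreal (\<Sum>i<card D1. v i - u i) < ennreal \<delta>" .
          moreover have "0 \<le> (\<Sum>i<card D1. v i - u i)" using uv by (intro sum_nonneg) force
          ultimately show ?thesis by (simp add: ennreal_less_iff)
        qed
        have "sum q D1 = (\<Sum>i<card D1. q (h i))"
          using sum.reindex_bij_betw[OF h, of q] by simp
        also have "\<dots> = (\<Sum>i<card D1. norm (x (v i) - x (u i)))"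
        proof (rule sum.cong)
          fix i assume "i \<in> {..<card D1}"
          then have "Y (fst (h i)) = 0" using hi(2) by (simp add: Y_def)
          then show "q (h i) = norm (x (v i) - x (u i))"
            by (simp add: q_def split_def u_def v_def norm_minus_commute)
        qed simp
        also have "\<dots> < e / 2" proof (rule \<delta>')
          show "\<forall>i<card D1. u i \<le> v i \<and> {u i..v i} \<subseteq> {a..b}" using uv by blast
          show "\<forall>i<card D1. \<forall>k<card D1. i \<noteq> k \<longrightarrow> {u i<..<v i} \<inter> {u k<..<v k} = {}" using dis by blast
        qed (rule len)
        finally show ?thesis .
      qed
      finally show ?thesis using e'(2) by linarith
    qed
    ultimately show "\<exists>\<gamma>. gauge \<gamma> \<and> (\<forall>D. D tagged_division_of cbox a b \<and> \<gamma> fine D \<longrightarrow>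
        norm ((\<Sum>(t, K)\<in>D. measure lborel K *\<^sub>R Y t) - (x b - x a)) < e)"
      by (intro exI[of _ \<gamma>] conjI allI impI) simp_all
  qed
  then have "(Y has_integral (x b - x a)) {a..b}" by (simp add: cbox_interval)
  moreover have "negligible M"
    using M by (simp add: negligible_iff_null_sets null_sets_completionI)
  ultimately show ?thesis
    by (intro has_integral_spike[of M "{a..b}" X Y]) (simp_all add: Y_def)
qed

text \<open>The integral form of "absolutely continuous with derivative \<open>X\<close>". It
  carries no exceptional set and passes easily to subintervals, unions of adjacent intervals and
  translates.\<close>

definition primitive_on :: "real \<Rightarrow> real \<Rightarrow> (real \<Rightarrow> 'a::euclidean_space) \<Rightarrow> (real \<Rightarrow> 'a) \<Rightarrow> bool" where
  "primitive_on a b x X \<longleftrightarrow> set_integrable lborel {a..b} X \<and>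
     (\<forall>s t. a \<le> s \<and> s \<le> t \<and> t \<le> b \<longrightarrow> x t - x s = (LINT r:{s..t}|lborel. X r))"

lemma set_integrable_Icc_subset:
  fixes X :: "real \<Rightarrow> 'a::euclidean_space"
  assumes "set_integrable lborel {a..b} X" "a \<le> c" "d \<le> b"
  shows "set_integrable lborel {c..d} X"
  using assms by (intro set_integrable_subset[OF assms(1)]) auto

lemma set_integral_Icc_split:
  fixes X :: "real \<Rightarrow> 'a::euclidean_space"
  assumes "set_integrable lborel {a..c} X" "a \<le> b" "b \<le> c"
  shows "(LINT r:{a..c}|lborel. X r) = (LINT r:{a..b}|lborel. X r) + (LINT r:{b..c}|lborel. X r)"
proof -
  have i: "set_integrable lborel {a..b} X" "set_integrable lborel {b..c} X"
    using assms by (auto intro: set_integrable_Icc_subset)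
  show ?thesis
    using Henstock_Kurzweil_Integration.integral_combine[OF assms(2,3) set_borel_integral_eq_integral(1)[OF assms(1)]]
    by (simp add: set_borel_integral_eq_integral(2)[OF i(1)] set_borel_integral_eq_integral(2)[OF i(2)]
        set_borel_integral_eq_integral(2)[OF assms(1)])
qed

lemma primitive_onI:
  assumes "set_integrable lborel {a..b} X"
    and "\<And>t. a \<le> t \<Longrightarrow> t \<le> b \<Longrightarrow> x t = x a + (LINT r:{a..t}|lborel. X r)"
  shows "primitive_on a b x X"
  unfolding primitive_on_def
proof (intro conjI allI impI assms(1))
  fix s t assume st: "a \<le> s \<and> s \<le> t \<and> t \<le> b"
  then have "(LINT r:{a..t}|lborel. X r) = (LINT r:{a..s}|lborel. X r) + (LINT r:{s..t}|lborel. X r)"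
    by (intro set_integral_Icc_split set_integrable_Icc_subset[OF assms(1)]) auto
  then show "x t - x s = (LINT r:{s..t}|lborel. X r)"
    using assms(2)[of s] assms(2)[of t] st by simp
qed

lemma primitive_on_subset:
  "primitive_on a b x X \<Longrightarrow> a \<le> c \<Longrightarrow> d \<le> b \<Longrightarrow> primitive_on c d x X"
  unfolding primitive_on_def by (auto intro: set_integrable_Icc_subset)

lemma primitive_on_cong:
  assumes "primitive_on a b x X" "\<And>t. a \<le> t \<Longrightarrow> t \<le> b \<Longrightarrow> x t = x' t"
  shows "primitive_on a b x' X"
  using assms unfolding primitive_on_def by auto

lemma primitive_on_join:
  assumes 1: "primitive_on a b x X" and 2: "primitive_on b c x X" and "a \<le> b" "b \<le> c"
  shows "primitive_on a c x X"
proof (rule primitive_onI)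
  have "set_integrable lborel ({a..b} \<union> {b..c}) X"
    using 1 2 by (intro set_integrable_Un) (auto simp: primitive_on_def)
  moreover have "{a..b} \<union> {b..c} = {a..c}" using assms by auto
  ultimately show i: "set_integrable lborel {a..c} X" by simp
  fix t assume t: "a \<le> t" "t \<le> c"
  show "x t = x a + (LINT r:{a..t}|lborel. X r)"
  proof (cases "t \<le> b")
    case True
    then have "x t - x a = (LINT r:{a..t}|lborel. X r)" using 1 t by (auto simp: primitive_on_def)
    then show ?thesis by (simp add: algebra_simps)
  next
    case False
    have "x t - x b = (LINT r:{b..t}|lborel. X r)" "x b - x a = (LINT r:{a..b}|lborel. X r)"
      using 1 2 t False assms by (auto simp: primitive_on_def)
    moreover have "(LINT r:{a..t}|lborel. X r) = (LINT r:{a..b}|lborel. X r) + (LINT r:{b..t}|lborel. X r)"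
      using False assms t by (intro set_integral_Icc_split set_integrable_Icc_subset[OF i]) auto
    ultimately show ?thesis by (simp add: algebra_simps)
  qed
qed

lemma set_integral_Icc_shift:
  fixes X :: "real \<Rightarrow> 'a::euclidean_space"
  shows "(LINT r:{a..b}|lborel. X (r + c)) = (LINT r:{a + c..b + c}|lborel. X r)"
    and "set_integrable lborel {a..b} (\<lambda>r. X (r + c)) \<longleftrightarrow> set_integrable lborel {a + c..b + c} X"
proof -
  have eq: "indicator {a..b} r *\<^sub>R X (r + c) = (\<lambda>r. indicator {a + c..b + c} r *\<^sub>R X r) (c + 1 * r)" for r
    by (auto simp: indicator_def algebra_simps)
  show "(LINT r:{a..b}|lborel. X (r + c)) = (LINT r:{a + c..b + c}|lborel. X r)"
    unfolding set_lebesgue_integral_def eq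
    by (subst (2) lborel_integral_real_affine[of 1 _ c]) auto
  show "set_integrable lborel {a..b} (\<lambda>r. X (r + c)) \<longleftrightarrow> set_integrable lborel {a + c..b + c} X"
    unfolding set_integrable_def eq by (rule lborel_integrable_real_affine_iff) simp
qed

lemma primitive_on_shift:
  assumes "primitive_on (a + c) (b + c) x X"
  shows "primitive_on a b (\<lambda>t. x (t + c)) (\<lambda>t. X (t + c))"
  using assms unfolding primitive_on_def set_integral_Icc_shift by auto

lemma primitive_on_AE_deriv:
  assumes "primitive_on a b x X"
  shows "AE t in lborel. a < t \<and> t < b \<longrightarrow> (x has_vector_derivative X t) (at t)"
proof (cases "a < b")
  case True
  note ab = this
  have X: "set_integrable lborel {a..b} X" using assms by (simp add: primitive_on_def)
  \<comment> \<open>The differentiation theorem wants integrability over every interval, which the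
    cut-off supplies.\<close>
  define Y where "Y t = (if t \<in> {a..b} then X t else 0)" for t
  have "Y integrable_on {c..d}" for c d
  proof -
    have "integrable lborel Y"
      using X unfolding set_integrable_def Y_def by (auto cong: if_cong simp: indicator_scaleR_eq_if)
    then have "set_integrable lborel {c..d} Y"
      by (auto simp: set_integrable_def intro: integrable_mult_indicator)
    then show ?thesis by (rule set_borel_integral_eq_integral(1))
  qed
  then have "AE t in lborel. \<forall>a<t. ((\<lambda>u. integral {a..u} Y) has_vector_derivative Y t) (at t)"
    by (rule AE_has_vector_derivative_integral)
  then show ?thesis
  proof eventually_elim
    case (elim t)
    show ?case
    proof
      assume t: "a < t \<and> t < b"
      have "((\<lambda>u. x a + integral {a..u} Y) has_vector_derivative Y t) (at t)"
        using elim t by (auto intro: derivative_eq_intros)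
      then have "(x has_vector_derivative Y t) (at t)"
      proof (rule has_vector_derivative_transform_within_open[of _ _ _ "{a<..<b}"])
        fix u assume u: "u \<in> {a<..<b}"
        have "integral {a..u} Y = integral {a..u} X"
          using u by (intro integral_cong) (auto simp: Y_def)
        also have "\<dots> = (LINT r:{a..u}|lborel. X r)"
          using u by (intro set_borel_integral_eq_integral(2)[symmetric] set_integrable_Icc_subset[OF X]) auto
        also have "\<dots> = x u - x a" using assms u by (auto simp: primitive_on_def)
        finally show "x a + integral {a..u} Y = x u" by simp
      qed (use t in auto)
      then show "(x has_vector_derivative X t) (at t)" using t by (simp add: Y_def)
    qed
  qed
qed auto

lemma absolutely_continuous_on_subset:
  assumes "absolutely_continuous_on I x" "J \<subseteq> I"
  shows "absolutely_continuous_on J x"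
  unfolding absolutely_continuous_on_def
proof (intro allI impI)
  fix e :: real assume "e > 0"
  then obtain d where "d > 0" and d: "\<And>(n::nat) a b. (\<forall>i<n. a i \<le> b i \<and> {a i..b i} \<subseteq> I) \<and>
        (\<forall>i<n. \<forall>k<n. i \<noteq> k \<longrightarrow> {a i<..<b i} \<inter> {a k<..<b k} = {}) \<and>
        (\<Sum>i<n. b i - a i) < d \<Longrightarrow> (\<Sum>i<n. norm (x (b i) - x (a i))) < e"
    using assms(1) unfolding absolutely_continuous_on_def by blast
  show "\<exists>d>0. \<forall>(n::nat) a b. (\<forall>i<n. a i \<le> b i \<and> {a i..b i} \<subseteq> J) \<and>
        (\<forall>i<n. \<forall>k<n. i \<noteq> k \<longrightarrow> {a i<..<b i} \<inter> {a k<..<b k} = {}) \<and>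
        (\<Sum>i<n. b i - a i) < d \<longrightarrow> (\<Sum>i<n. norm (x (b i) - x (a i))) < e"
  proof (intro exI[of _ d] conjI allI impI \<open>d > 0\<close>, rule d, elim conjE, intro conjI)
    fix n :: nat and a b :: "nat \<Rightarrow> real"
    assume "\<forall>i<n. a i \<le> b i \<and> {a i..b i} \<subseteq> J"
    then show "\<forall>i<n. a i \<le> b i \<and> {a i..b i} \<subseteq> I" using assms(2) by (meson order_trans)
  qed
qed

lemma absolutely_continuous_imp_primitive_on:
  fixes x :: "real \<Rightarrow> 'a::euclidean_space"
  assumes ac: "absolutely_continuous_on {a..b} x"
    and ae: "AE t in lborel. a < t \<and> t < b \<longrightarrow> (x has_vector_derivative X t) (at t)"
    and X: "set_integrable lborel {a..b} X"
  shows "primitive_on a b x X"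
proof (rule primitive_onI[OF X])
  fix t assume t: "a \<le> t" "t \<le> b"
  have "absolutely_continuous_on {a..t} x"
    by (rule absolutely_continuous_on_subset[OF ac]) (use t in auto)
  moreover have "AE s in lborel. a < s \<and> s < t \<longrightarrow> (x has_vector_derivative X s) (at s)"
    using ae by eventually_elim (use t in auto)
  ultimately have "(X has_integral (x t - x a)) {a..t}"
    using t by (intro absolutely_continuous_imp_has_integral) auto
  moreover have "(LINT r:{a..t}|lborel. X r) = integral {a..t} X"
    using t by (intro set_borel_integral_eq_integral(2) set_integrable_Icc_subset[OF X]) auto
  ultimately show "x t = x a + (LINT r:{a..t}|lborel. X r)"
    by (simp add: integral_unique)
qed

text \<open>Absolute continuity of the integral. The part of \<open>norm (X s)\<close> above a level
  \<open>k\<close> has integral below \<open>e / 2\<close> for large \<open>k\<close>, by dominated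
  convergence; the part below contributes at most \<open>k\<close> times the measure of
  \<open>A\<close>.\<close>

lemma integral_small_on_small_sets:
  fixes X :: "'a \<Rightarrow> 'b::{banach, second_countable_topology}"
  assumes X: "integrable M X" and e: "(e::real) > 0"
  obtains d :: real where "d > 0"
    "\<And>A. A \<in> sets M \<Longrightarrow> emeasure M A < ennreal d \<Longrightarrow> (\<integral>\<^sup>+s\<in>A. norm (X s) \<partial>M) < ennreal e"
proof -
  have [measurable]: "X \<in> borel_measurable M" using X by simp
  have "(\<lambda>k. LINT s|M. max 0 (norm (X s) - real k)) \<longlonglongrightarrow> (LINT s|M. (0::real))"
  proof (rule integral_dominated_convergence[where w = "\<lambda>s. norm (X s)"])
    show "AE s in M. (\<lambda>k. max 0 (norm (X s) - real k)) \<longlonglongrightarrow> 0"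
    proof (rule AE_I2)
      fix s
      have "eventually (\<lambda>k. max 0 (norm (X s) - real k) = 0) sequentially"
        using eventually_ge_at_top[of "nat \<lceil>norm (X s)\<rceil>"] by eventually_elim linarith
      then show "(\<lambda>k. max 0 (norm (X s) - real k)) \<longlonglongrightarrow> 0" by (rule tendsto_eventually)
    qed
  qed (use X in auto)
  then have "eventually (\<lambda>k. (LINT s|M. max 0 (norm (X s) - real k)) < e / 2) sequentially"
    using e by (intro order_tendstoD(2)) auto
  then obtain k :: nat where k: "(LINT s|M. max 0 (norm (X s) - real k)) < e / 2"
    by (auto simp: eventually_sequentially)
  have int: "integrable M (\<lambda>s. max 0 (norm (X s) - real k))"
    by (rule Bochner_Integration.integrable_bound[OF integrable_norm[OF X]]) auto
  show thesis
  proof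
    \<comment> \<open>Chosen so that \<open>k\<close> times this number is at most
      \<open>e / 2\<close>; the summand 2 covers \<open>k = 0\<close>.\<close>
    show "e / (2 * real k + 2) > 0" using e by auto
    fix A assume [measurable]: "A \<in> sets M" and A: "emeasure M A < ennreal (e / (2 * real k + 2))"
    have "(\<integral>\<^sup>+s\<in>A. norm (X s) \<partial>M) \<le> (\<integral>\<^sup>+s. ennreal (real k) * indicator A s + ennreal (max 0 (norm (X s) - real k)) \<partial>M)"
      by (intro nn_integral_mono) (auto simp: indicator_def simp flip: ennreal_plus intro!: ennreal_leI)
    also have "\<dots> = ennreal (real k) * emeasure M A + (\<integral>\<^sup>+s. ennreal (max 0 (norm (X s) - real k)) \<partial>M)"
      by (subst nn_integral_add) (auto simp: nn_integral_cmult)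
    also have "(\<integral>\<^sup>+s. ennreal (max 0 (norm (X s) - real k)) \<partial>M) = ennreal (LINT s|M. max 0 (norm (X s) - real k))"
      by (rule nn_integral_eq_integral[OF int]) auto
    also have "ennreal (real k) * emeasure M A + ennreal (LINT s|M. max 0 (norm (X s) - real k))
        \<le> ennreal (e / 2) + ennreal (LINT s|M. max 0 (norm (X s) - real k))"
    proof (rule add_right_mono)
      have "ennreal (real k) * emeasure M A \<le> ennreal (real k) * ennreal (e / (2 * real k + 2))"
        using A by (intro mult_left_mono) auto
      also have "\<dots> = ennreal (real k * (e / (2 * real k + 2)))"
        using e by (intro ennreal_mult[symmetric]) auto
      also have "\<dots> \<le> ennreal (e / 2)" using e by (intro ennreal_leI) (auto simp: field_simps)
      finally show "ennreal (real k) * emeasure M A \<le> ennreal (e / 2)" .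
    qed
    also have "\<dots> = ennreal (e / 2 + (LINT s|M. max 0 (norm (X s) - real k)))"
      using e by (intro ennreal_plus[symmetric]) auto
    also have "\<dots> < ennreal e" using k e by (intro ennreal_lessI) auto
    finally show "(\<integral>\<^sup>+s\<in>A. norm (X s) \<partial>M) < ennreal e" .
  qed
qed

lemma norm_set_integral_le_nn_integral:
  fixes X :: "'a \<Rightarrow> 'b::{banach, second_countable_topology}"
  shows "ennreal (norm (LINT s:A|M. X s)) \<le> (\<integral>\<^sup>+s\<in>A. norm (X s) \<partial>M)"
proof (cases "set_integrable M A X")
  case True
  have "ennreal (norm (LINT s:A|M. X s)) \<le> (\<integral>\<^sup>+s. norm (indicator A s *\<^sub>R X s) \<partial>M)"
    unfolding set_lebesgue_integral_def using True unfolding set_integrable_def by (rule integral_norm_bound_ennreal)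
  also have "\<dots> = (\<integral>\<^sup>+s\<in>A. norm (X s) \<partial>M)"
    by (intro nn_integral_cong) (auto simp: indicator_def)
  finally show ?thesis .
next
  case False
  then show ?thesis
    by (simp add: set_lebesgue_integral_def set_integrable_def not_integrable_integral_eq)
qed

lemma primitive_on_norm_diff_le:
  "primitive_on a b x X \<Longrightarrow> a \<le> s \<Longrightarrow> s \<le> t \<Longrightarrow> t \<le> b \<Longrightarrow> ennreal (norm (x t - x s)) \<le> (\<integral>\<^sup>+r\<in>{s..t}. norm (X r) \<partial>lborel)"
  using norm_set_integral_le_nn_integral[of lborel "{s..t}" X] by (auto simp: primitive_on_def)

text \<open>The sum of increments is at most the integral of \<open>norm X\<close> over the union of
  the intervals, and that integral is small when the union has small measure.\<close>

lemma primitive_on_absolutely_continuous: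
  assumes "primitive_on a b x X"
  shows "absolutely_continuous_on {a..b} x"
  unfolding absolutely_continuous_on_def
proof (intro allI impI)
  fix e :: real assume e: "e > 0"
  define Y where "Y t = indicator {a..b} t *\<^sub>R X t" for t
  have Y: "integrable lborel Y"
    using assms by (simp add: primitive_on_def set_integrable_def Y_def[abs_def])
  then have [measurable]: "Y \<in> borel_measurable borel" by (simp add: borel_measurable_integrable[of lborel, simplified])
  obtain d where d: "d > 0" "\<And>A. A \<in> sets lborel \<Longrightarrow> emeasure lborel A < ennreal d \<Longrightarrow> (\<integral>\<^sup>+s\<in>A. norm (Y s) \<partial>lborel) < ennreal e"
    using integral_small_on_small_sets[OF Y e] by blast
  show "\<exists>\<delta>>0. \<forall>(n::nat) u v. (\<forall>i<n. u i \<le> v i \<and> {u i..v i} \<subseteq> {a..b}) \<and>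
      (\<forall>i<n. \<forall>k<n. i \<noteq> k \<longrightarrow> {u i<..<v i} \<inter> {u k<..<v k} = {}) \<and> (\<Sum>i<n. v i - u i) < \<delta> \<longrightarrow>
      (\<Sum>i<n. norm (x (v i) - x (u i))) < e"
  proof (intro exI[of _ d] conjI allI impI d(1))
    fix n :: nat and u v :: "nat \<Rightarrow> real"
    assume H: "(\<forall>i<n. u i \<le> v i \<and> {u i..v i} \<subseteq> {a..b}) \<and>
      (\<forall>i<n. \<forall>k<n. i \<noteq> k \<longrightarrow> {u i<..<v i} \<inter> {u k<..<v k} = {}) \<and> (\<Sum>i<n. v i - u i) < d"
    define A where "A = (\<Union>i<n. {u i<..<v i})"
    have dis: "disjoint_family_on (\<lambda>i. {u i<..<v i}) {..<n}" using H by (auto simp: disjoint_family_on_def)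
    have "emeasure lborel A = (\<Sum>i<n. emeasure lborel {u i<..<v i})"
      unfolding A_def by (rule sum_emeasure[symmetric]) (auto simp: dis)
    also have "\<dots> = (\<Sum>i<n. ennreal (v i - u i))"
      using H by (intro sum.cong) auto
    also have "\<dots> = ennreal (\<Sum>i<n. v i - u i)" using H by (subst sum_ennreal) auto
    also have "\<dots> < ennreal d" using H d(1) by (subst ennreal_less_iff) (auto intro!: sum_nonneg)
    finally have A: "(\<integral>\<^sup>+s\<in>A. norm (Y s) \<partial>lborel) < ennreal e" by (intro d(2)) (auto simp: A_def)
    \<comment> \<open>As a measure, the integral is additive over disjoint sets. The open intervals
      are disjoint while the closed ones may share endpoints, which carry no mass.\<close>
    define D where "D = density lborel (\<lambda>s. ennreal (norm (Y s)))"
    have D: "emeasure D B = (\<integral>\<^sup>+s\<in>B. norm (Y s) \<partial>lborel)" if "B \<in> sets borel" for B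
      using that unfolding D_def by (subst emeasure_density) auto
    have "ennreal (\<Sum>i<n. norm (x (v i) - x (u i))) = (\<Sum>i<n. ennreal (norm (x (v i) - x (u i))))"
      by (subst sum_ennreal) auto
    also have "\<dots> \<le> (\<Sum>i<n. emeasure D {u i<..<v i})"
    proof (rule sum_mono)
      fix i assume i: "i \<in> {..<n}"
      then have uv: "a \<le> u i" "u i \<le> v i" "v i \<le> b" using H by auto
      have "ennreal (norm (x (v i) - x (u i))) \<le> (\<integral>\<^sup>+r\<in>{u i..v i}. norm (X r) \<partial>lborel)"
        using uv by (intro primitive_on_norm_diff_le[OF assms]) auto
      also have "\<dots> = (\<integral>\<^sup>+r\<in>{u i<..<v i}. norm (Y r) \<partial>lborel)"
        using AE_lborel_singleton[of "u i"] AE_lborel_singleton[of "v i"]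
        by (intro nn_integral_cong_AE, eventually_elim) (use uv in \<open>auto simp: indicator_def Y_def\<close>)
      also have "\<dots> = emeasure D {u i<..<v i}" by (simp add: D)
      finally show "ennreal (norm (x (v i) - x (u i))) \<le> emeasure D {u i<..<v i}" .
    qed
    also have "\<dots> = emeasure D A" unfolding A_def
      by (rule sum_emeasure) (auto simp: dis D_def)
    also have "\<dots> < ennreal e" using A by (subst D) (auto simp: A_def)
    finally show "(\<Sum>i<n. norm (x (v i) - x (u i))) < e"
      by (simp add: ennreal_less_iff sum_nonneg)
  qed
qed

lemma absolutely_continuous_on_compose_Lipschitz:
  assumes "absolutely_continuous_on I x" "\<And>s t. s \<in> I \<Longrightarrow> t \<in> I \<Longrightarrow> norm (f (x t) - f (x s)) \<le> B * norm (x t - x s)"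
  shows "absolutely_continuous_on I (\<lambda>t. f (x t))"
  unfolding absolutely_continuous_on_def
proof (intro allI impI)
  fix e :: real assume e: "e > 0"
  define B' where "B' = max B 1"
  obtain d where d: "d > 0" "\<And>(n::nat) u v. (\<forall>i<n. u i \<le> v i \<and> {u i..v i} \<subseteq> I) \<and>
      (\<forall>i<n. \<forall>k<n. i \<noteq> k \<longrightarrow> {u i<..<v i} \<inter> {u k<..<v k} = {}) \<and> (\<Sum>i<n. v i - u i) < d \<longrightarrow>
      (\<Sum>i<n. norm (x (v i) - x (u i))) < e / B'"
    using assms(1)[unfolded absolutely_continuous_on_def, rule_format, of "e / B'"] e by (auto simp: B'_def)
  show "\<exists>d>0. \<forall>(n::nat) u v. (\<forall>i<n. u i \<le> v i \<and> {u i..v i} \<subseteq> I) \<and>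
      (\<forall>i<n. \<forall>k<n. i \<noteq> k \<longrightarrow> {u i<..<v i} \<inter> {u k<..<v k} = {}) \<and> (\<Sum>i<n. v i - u i) < d \<longrightarrow>
      (\<Sum>i<n. norm (f (x (v i)) - f (x (u i)))) < e"
  proof (intro exI[of _ d] conjI allI impI d(1))
    fix n :: nat and u v :: "nat \<Rightarrow> real"
    assume H: "(\<forall>i<n. u i \<le> v i \<and> {u i..v i} \<subseteq> I) \<and>
      (\<forall>i<n. \<forall>k<n. i \<noteq> k \<longrightarrow> {u i<..<v i} \<inter> {u k<..<v k} = {}) \<and> (\<Sum>i<n. v i - u i) < d"
    have "(\<Sum>i<n. norm (f (x (v i)) - f (x (u i)))) \<le> (\<Sum>i<n. B' * norm (x (v i) - x (u i)))"
    proof (rule sum_mono)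
      fix i assume "i \<in> {..<n}"
      then have "u i \<le> v i" "{u i..v i} \<subseteq> I" using H by blast+
      then have "u i \<in> I" "v i \<in> I" by auto
      then have "norm (f (x (v i)) - f (x (u i))) \<le> B * norm (x (v i) - x (u i))" by (rule assms(2))
      also have "\<dots> \<le> B' * norm (x (v i) - x (u i))" by (intro mult_right_mono) (auto simp: B'_def)
      finally show "norm (f (x (v i)) - f (x (u i))) \<le> B' * norm (x (v i) - x (u i))" .
    qed
    also have "\<dots> = B' * (\<Sum>i<n. norm (x (v i) - x (u i)))" by (simp add: sum_distrib_left)
    also have "\<dots> < B' * (e / B')" using d(2) H by (intro mult_strict_left_mono) (auto simp: B'_def)
    also have "\<dots> = e" by (simp add: B'_def)
    finally show "(\<Sum>i<n. norm (f (x (v i)) - f (x (u i)))) < e" .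
  qed
qed

section \<open>Gronwall estimates with an integrable kernel\<close>

text \<open>For negative \<open>t\<close> the interval is empty, so a weight
  \<open>exp (c * kernel_int l t)\<close> equals 1 on the history interval and, for a nonnegative
  kernel and \<open>c > 0\<close>, is monotone on the whole line.\<close>

definition kernel_int :: "(real \<Rightarrow> real) \<Rightarrow> real \<Rightarrow> real" where
  "kernel_int l t = (LINT s:{0..t}|lborel. l s)"

locale kernel =
  fixes l :: "real \<Rightarrow> real"
  assumes measurable_l [measurable]: "l \<in> borel_measurable borel"
    and l_nonneg: "\<And>t. l t \<ge> 0"
    and l_integrable: "\<And>a b. set_integrable lborel {a..b} l"
begin

lemma kernel_int_nonpos: "t \<le> 0 \<Longrightarrow> kernel_int l t = 0"
proof -
  assume "t \<le> 0"
  then have "{0..t} \<subseteq> {0}" by auto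
  moreover have "AE s in lborel. s \<noteq> (0::real)" by (rule AE_lborel_singleton)
  ultimately show ?thesis
    unfolding kernel_int_def set_lebesgue_integral_def
    by (intro integral_eq_zero_AE) (auto elim!: eventually_mono simp: indicator_def)
qed

lemma kernel_int_split: "0 \<le> s \<Longrightarrow> s \<le> t \<Longrightarrow> kernel_int l t = kernel_int l s + (LINT r:{s..t}|lborel. l r)"
  unfolding kernel_int_def by (intro set_integral_Icc_split l_integrable)

lemma kernel_int_mono: "s \<le> t \<Longrightarrow> kernel_int l s \<le> kernel_int l t"
proof (cases "s \<ge> 0")
  case True
  assume "s \<le> t"
  moreover have "0 \<le> (LINT r:{s..t}|lborel. l r)" by (auto simp: set_lebesgue_integral_def l_nonneg)
  ultimately show ?thesis using kernel_int_split[of s t] True by simp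
next
  case False
  moreover have "0 \<le> kernel_int l t" by (auto simp: kernel_int_def set_lebesgue_integral_def l_nonneg)
  ultimately show ?thesis using kernel_int_nonpos[of s] by simp
qed

lemma kernel_int_nonneg: "0 \<le> kernel_int l t"
  by (auto simp: kernel_int_def set_lebesgue_integral_def l_nonneg)

lemma measurable_kernel_int [measurable]: "kernel_int l \<in> borel_measurable borel"
  by (intro borel_measurable_mono) (auto simp: mono_def kernel_int_mono)

text \<open>The integrand is \<open>1 / c\<close> times the derivative of
  \<open>exp (c * kernel_int l s)\<close>. This function is absolutely continuous because the
  exponential is Lipschitz on the bounded range of \<open>kernel_int l\<close>. Integrating against
  the kernel thus returns the weight divided by \<open>c\<close>, and the factor
  \<open>1 / c\<close> drives both Gronwall's inequality and the Picard iteration.\<close>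

lemma nn_integral_kernel_exp:
  assumes c: "c > 0"
  shows "(\<integral>\<^sup>+s\<in>{0..t}. ennreal (l s * exp (c * kernel_int l s)) \<partial>lborel) \<le> ennreal ((exp (c * kernel_int l t) - 1) / c)"
proof (cases "t \<ge> 0")
  case True
  note t = True
  let ?L = "kernel_int l"
  have L: "primitive_on 0 t ?L l"
    by (rule primitive_onI) (auto simp: l_integrable kernel_int_nonpos, simp add: kernel_int_def)
  have ac: "absolutely_continuous_on {0..t} (\<lambda>s. exp (c * ?L s))"
  proof (rule absolutely_continuous_on_compose_Lipschitz[OF primitive_on_absolutely_continuous[OF L]])
    fix s r assume sr: "s \<in> {0..t}" "r \<in> {0..t}"
    have *: "\<bar>exp (c * u) - exp (c * v)\<bar> \<le> (c * exp (c * ?L t)) * \<bar>u - v\<bar>" if "u \<le> ?L t" "v \<le> ?L t" "v \<le> u" for u v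
    proof -
      have "exp (c * u) - exp (c * v) = exp (c * u) * (1 - exp (- (c * (u - v))))"
        by (simp add: algebra_simps flip: exp_add)
      also have "\<dots> \<le> exp (c * u) * (c * (u - v))"
        using exp_ge_add_one_self[of "- (c * (u - v))"] by (intro mult_left_mono) auto
      also have "\<dots> \<le> exp (c * ?L t) * (c * (u - v))"
        using that c by (intro mult_right_mono) auto
      finally show ?thesis using that c by (simp add: mult_ac)
    qed
    have "?L s \<le> ?L t" "?L r \<le> ?L t" using sr by (auto intro: kernel_int_mono)
    then show "norm (exp (c * ?L r) - exp (c * ?L s)) \<le> (c * exp (c * ?L t)) * norm (?L r - ?L s)"
      using *[of "?L r" "?L s"] *[of "?L s" "?L r"] by (cases "?L r \<le> ?L s") (auto simp: abs_minus_commute)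
  qed
  have ae: "AE s in lborel. 0 < s \<and> s < t \<longrightarrow>
      ((\<lambda>s. exp (c * ?L s)) has_vector_derivative c * (l s * exp (c * ?L s))) (at s)"
    using primitive_on_AE_deriv[OF L]
  proof eventually_elim
    case (elim s)
    show ?case
    proof
      assume "0 < s \<and> s < t"
      then have "(?L has_real_derivative l s) (at s)"
        using elim by (simp add: has_real_derivative_iff_has_vector_derivative)
      then have "((\<lambda>s. exp (c * ?L s)) has_real_derivative c * (l s * exp (c * ?L s))) (at s)"
        by (auto intro!: derivative_eq_intros)
      then show "((\<lambda>s. exp (c * ?L s)) has_vector_derivative c * (l s * exp (c * ?L s))) (at s)"
        by (simp add: has_real_derivative_iff_has_vector_derivative)
    qed
  qed
  have int: "set_integrable lborel {0..t} (\<lambda>s. c * (l s * exp (c * ?L s)))"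
  proof -
    have "set_integrable lborel {0..t} (\<lambda>s. (c * exp (c * ?L t)) * l s)"
      using l_integrable by (intro set_integrable_mult_right)
    then show ?thesis
      unfolding set_integrable_def
    proof (rule Bochner_Integration.integrable_bound)
      show "AE s in lborel. norm (indicator {0..t} s *\<^sub>R (c * (l s * exp (c * ?L s))))
         \<le> norm (indicator {0..t} s *\<^sub>R (c * exp (c * ?L t) * l s))"
      proof (rule AE_I2)
        fix s
        have "l s * exp (c * ?L s) \<le> l s * exp (c * ?L t)" if "s \<le> t"
          using c kernel_int_mono[OF that] by (intro mult_left_mono) (auto simp: l_nonneg)
        then show "norm (indicator {0..t} s *\<^sub>R (c * (l s * exp (c * ?L s))))
           \<le> norm (indicator {0..t} s *\<^sub>R (c * exp (c * ?L t) * l s))"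
          using c by (auto simp: indicator_def abs_mult l_nonneg mult_ac)
      qed
    qed auto
  qed
  have "primitive_on 0 t (\<lambda>s. exp (c * ?L s)) (\<lambda>s. c * (l s * exp (c * ?L s)))"
    by (rule absolutely_continuous_imp_primitive_on[OF ac ae int])
  then have eq: "(LINT s:{0..t}|lborel. c * (l s * exp (c * ?L s))) = exp (c * ?L t) - 1"
  proof -
    have "exp (c * ?L t) - exp (c * ?L 0) = (LINT s:{0..t}|lborel. c * (l s * exp (c * ?L s)))"
      using \<open>primitive_on 0 t (\<lambda>s. exp (c * ?L s)) _\<close> t unfolding primitive_on_def by blast
    then show ?thesis by (simp only: kernel_int_nonpos) (simp add: kernel_int_nonpos)
  qed
  have "(\<integral>\<^sup>+s\<in>{0..t}. ennreal (l s * exp (c * ?L s)) \<partial>lborel)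
      = (\<integral>\<^sup>+s. ennreal (1 / c) * ennreal (indicator {0..t} s *\<^sub>R (c * (l s * exp (c * ?L s)))) \<partial>lborel)"
    using c by (intro nn_integral_cong) (auto simp: indicator_def l_nonneg simp flip: ennreal_mult)
  also have "\<dots> = ennreal (1 / c) * (\<integral>\<^sup>+s. ennreal (indicator {0..t} s *\<^sub>R (c * (l s * exp (c * ?L s)))) \<partial>lborel)"
    by (subst nn_integral_cmult) auto
  also have "(\<integral>\<^sup>+s. ennreal (indicator {0..t} s *\<^sub>R (c * (l s * exp (c * ?L s)))) \<partial>lborel) = ennreal (exp (c * ?L t) - 1)"
    using int c unfolding eq[symmetric] set_integrable_def set_lebesgue_integral_def
    by (intro nn_integral_eq_integral) (auto simp: l_nonneg indicator_def)
  also have "ennreal (1 / c) * ennreal (exp (c * ?L t) - 1) = ennreal ((exp (c * ?L t) - 1) / c)"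
    using c kernel_int_nonneg[of t] by (subst ennreal_mult[symmetric]) auto
  finally show ?thesis by simp
qed simp

text \<open>Let \<open>M\<close> be the supremum of \<open>W / E\<close> for the weight
  \<open>E\<close> with exponent factor 4. Since \<open>E\<close> is monotone, the delayed term is
  no worse than the present one, so the integral is at most \<open>2 * M * (E s - 1) / 4\<close>.
  This gives \<open>M \<le> A + M / 2\<close>, hence \<open>M \<le> 2 * A\<close>. The bound
  \<open>C\<close> makes \<open>M\<close> finite, so that \<open>M / 2\<close> can be
  absorbed.\<close>

lemma delay_gronwall:
  assumes bounded: "\<And>t. -1 \<le> t \<Longrightarrow> t \<le> c \<Longrightarrow> 0 \<le> W t \<and> W t \<le> C"
    and init: "\<And>t. -1 \<le> t \<Longrightarrow> t \<le> 0 \<Longrightarrow> W t \<le> A"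
    and ineq: "\<And>t. 0 \<le> t \<Longrightarrow> t \<le> c \<Longrightarrow>
      ennreal (W t) \<le> ennreal A + (\<integral>\<^sup>+s\<in>{0..t}. ennreal (l s * (W s + W (s - 1))) \<partial>lborel)"
    and A: "A \<ge> 0" and t: "-1 \<le> t" "t \<le> c"
  shows "W t \<le> 2 * A * exp (4 * kernel_int l c)"
proof -
  define E where "E s = exp (4 * kernel_int l s)" for s
  have E1: "E s \<ge> 1" for s by (simp add: E_def kernel_int_nonneg)
  have E_mono: "E s \<le> E r" if "s \<le> r" for s r by (simp add: E_def kernel_int_mono that)
  have [measurable]: "E \<in> borel_measurable borel" unfolding E_def[abs_def] by measurable
  define M where "M = (SUP s\<in>{-1..c}. W s / E s)"
  have Wle: "W s / E s \<le> C" if "s \<in> {-1..c}" for s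
  proof -
    have "W s / E s \<le> W s / 1" using bounded[of s] that E1[of s] by (intro divide_left_mono) auto
    then show ?thesis using bounded[of s] that by auto
  qed
  have bdd: "bdd_above ((\<lambda>s. W s / E s) ` {-1..c})" using Wle by (intro bdd_aboveI2) auto
  have WM: "W s \<le> M * E s" if "s \<in> {-1..c}" for s
    using cSUP_upper[OF that bdd] E1[of s] unfolding M_def by (simp add: field_simps)
  have M0: "M \<ge> 0"
  proof -
    have "0 \<le> W t / E t" using bounded[of t] t E1[of t] by simp
    also have "\<dots> \<le> M" unfolding M_def by (rule cSUP_upper[OF _ bdd]) (use t in auto)
    finally show ?thesis .
  qed
  have key: "W s \<le> (A + M / 2) * E s" if s: "s \<in> {-1..c}" for s
  proof (cases "s \<le> 0")
    case True
    have "W s \<le> A * 1 + 0" using init[of s] s True by auto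
    also have "\<dots> \<le> A * E s + M / 2 * E s" using A M0 E1[of s] by (intro add_mono mult_left_mono) auto
    finally show ?thesis by (simp add: algebra_simps)
  next
    case False
    have "(\<integral>\<^sup>+r\<in>{0..s}. ennreal (l r * (W r + W (r - 1))) \<partial>lborel)
        \<le> (\<integral>\<^sup>+r. ennreal (2 * M) * (ennreal (l r * E r) * indicator {0..s} r) \<partial>lborel)"
    proof (rule nn_integral_mono)
      fix r
      have "l r * (W r + W (r - 1)) \<le> 2 * M * (l r * E r)" if "r \<in> {0..s}"
      proof -
        have "W (r - 1) \<le> M * E (r - 1)" using that s by (intro WM) auto
        also have "\<dots> \<le> M * E r" using M0 by (intro mult_left_mono E_mono) auto
        finally have "W r + W (r - 1) \<le> 2 * M * E r" using WM[of r] that s by auto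
        then have "l r * (W r + W (r - 1)) \<le> l r * (2 * M * E r)" by (intro mult_left_mono l_nonneg)
        then show ?thesis by (simp add: algebra_simps)
      qed
      then show "ennreal (l r * (W r + W (r - 1))) * indicator {0..s} r
        \<le> ennreal (2 * M) * (ennreal (l r * E r) * indicator {0..s} r)"
        using M0 l_nonneg[of r] E1[of r] by (auto simp: indicator_def simp flip: ennreal_mult' intro!: ennreal_leI)
    qed
    also have "\<dots> = ennreal (2 * M) * (\<integral>\<^sup>+r\<in>{0..s}. ennreal (l r * E r) \<partial>lborel)"
      by (subst nn_integral_cmult) auto
    also have "\<dots> \<le> ennreal (2 * M) * ennreal ((E s - 1) / 4)"
      using nn_integral_kernel_exp[of 4 s] by (intro mult_left_mono) (auto simp: E_def)
    also have "\<dots> = ennreal (M * (E s - 1) / 2)"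
      using M0 E1[of s] by (subst ennreal_mult[symmetric]) auto
    finally have "ennreal A + (\<integral>\<^sup>+r\<in>{0..s}. ennreal (l r * (W r + W (r - 1))) \<partial>lborel)
        \<le> ennreal A + ennreal (M * (E s - 1) / 2)" by (rule add_left_mono)
    then have "ennreal (W s) \<le> ennreal A + ennreal (M * (E s - 1) / 2)"
      using ineq[of s] False s by (intro order_trans[OF ineq]) auto
    also have "\<dots> = ennreal (A + M * (E s - 1) / 2)"
      using A M0 E1[of s] by (subst ennreal_plus) auto
    finally have "W s \<le> A + M * (E s - 1) / 2"
      using A M0 E1[of s] by (subst (asm) ennreal_le_iff) auto
    also have "\<dots> \<le> A * E s + M * E s / 2"
      using A M0 E1[of s] mult_left_mono[OF E1[of s] A] by (auto simp: field_simps)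
    finally show ?thesis by (simp add: algebra_simps)
  qed
  have "M \<le> A + M / 2"
    unfolding M_def
  proof (rule cSUP_least)
    fix s assume "s \<in> {-1..c}"
    then have "W s \<le> (A + M / 2) * E s" by (rule key)
    then show "W s / E s \<le> A + (SUP s\<in>{-1..c}. W s / E s) / 2"
      using E1[of s] by (simp add: M_def[symmetric] field_simps)
  qed (use t in auto)
  then have "M \<le> 2 * A" by simp
  have "W t \<le> M * E t" using t by (intro WM) auto
  also have "\<dots> \<le> (2 * A) * E c" using \<open>M \<le> 2 * A\<close> M0 E1[of t] t by (intro mult_mono E_mono) auto
  finally show ?thesis by (simp add: E_def)
qed

end

section \<open>Power inequalities, Minkowski's inequality and approximation in L^p\<close>

lemma convex_on_power_nonneg: "convex_on {0::real..} (\<lambda>x. x ^ n)"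
proof (cases "even n")
  case True
  then show ?thesis using convex_power_even[of n] by (rule_tac convex_on_subset) auto
qed (use convex_power_odd in auto)

lemma power_add_le: "0 \<le> a \<Longrightarrow> 0 \<le> b \<Longrightarrow> ((a::real) + b) ^ p \<le> 2 ^ p * (a ^ p + b ^ p)"
proof -
  assume ab: "0 \<le> a" "0 \<le> b"
  have "(a + b) ^ p \<le> (2 * max a b) ^ p" using ab by (intro power_mono) auto
  also have "\<dots> = 2 ^ p * max a b ^ p" by (simp add: power_mult_distrib)
  also have "\<dots> \<le> 2 ^ p * (a ^ p + b ^ p)" using ab by (intro mult_left_mono) (auto simp: max_def)
  finally show ?thesis .
qed

lemma integrable_norm_power_add:
  fixes u v :: "'a \<Rightarrow> 'b::{banach, second_countable_topology}"
  assumes [measurable]: "u \<in> borel_measurable M" "v \<in> borel_measurable M"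
    and u: "integrable M (\<lambda>s. norm (u s) ^ p)" and v: "integrable M (\<lambda>s. norm (v s) ^ p)"
  shows "integrable M (\<lambda>s. norm (u s + v s) ^ p)"
proof -
  have "integrable M (\<lambda>s. 2 ^ p * (norm (u s) ^ p + norm (v s) ^ p))"
    using u v by auto
  then show ?thesis
  proof (rule Bochner_Integration.integrable_bound)
    have "norm (u s + v s) ^ p \<le> 2 ^ p * (norm (u s) ^ p + norm (v s) ^ p)" for s
    proof -
      have "norm (u s + v s) ^ p \<le> (norm (u s) + norm (v s)) ^ p" by (intro power_mono norm_triangle_ineq) auto
      also have "\<dots> \<le> 2 ^ p * (norm (u s) ^ p + norm (v s) ^ p)" by (intro power_add_le) auto
      finally show ?thesis .
    qed
    then show "AE s in M. norm (norm (u s + v s) ^ p) \<le> norm (2 ^ p * (norm (u s) ^ p + norm (v s) ^ p))"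
      by (auto intro!: AE_I2)
  qed auto
qed

text \<open>Convexity of the power function is applied to the convex combination of the rescaled
  norms with weights \<open>A / (A + B)\<close> and \<open>B / (A + B)\<close>. Here
  \<open>A\<close> and \<open>B\<close> are the two L^p norms, each increased by
  \<open>e / 2\<close> so that division by them is possible when a norm vanishes.\<close>

lemma Minkowski_inequality:
  fixes u v :: "'a \<Rightarrow> 'b::{banach, second_countable_topology}"
  assumes p: "p > 0" and [measurable]: "u \<in> borel_measurable M" "v \<in> borel_measurable M"
    and u: "integrable M (\<lambda>s. norm (u s) ^ p)" and v: "integrable M (\<lambda>s. norm (v s) ^ p)"
  shows "root p (LINT s|M. norm (u s + v s) ^ p) \<le> root p (LINT s|M. norm (u s) ^ p) + root p (LINT s|M. norm (v s) ^ p)"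
proof -
  define \<alpha> where "\<alpha> = root p (LINT s|M. norm (u s) ^ p)"
  define \<beta> where "\<beta> = root p (LINT s|M. norm (v s) ^ p)"
  have \<alpha>: "\<alpha> \<ge> 0" "\<alpha> ^ p = (LINT s|M. norm (u s) ^ p)" using p by (auto simp: \<alpha>_def)
  have \<beta>: "\<beta> \<ge> 0" "\<beta> ^ p = (LINT s|M. norm (v s) ^ p)" using p by (auto simp: \<beta>_def)
  have "root p (LINT s|M. norm (u s + v s) ^ p) \<le> \<alpha> + \<beta> + e" if e: "e > 0" for e
  proof -
    define A where "A = \<alpha> + e / 2"
    define B where "B = \<beta> + e / 2"
    define r where "r = A / (A + B)"
    have AB: "A > 0" "B > 0" using \<alpha> \<beta> e by (auto simp: A_def B_def)
    have r: "0 \<le> r" "r \<le> 1" "1 - r = B / (A + B)" using AB by (auto simp: r_def field_simps)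
    have "norm (u s + v s) ^ p \<le> (A + B) ^ p * (r * (norm (u s) ^ p / A ^ p) + (1 - r) * (norm (v s) ^ p / B ^ p))" for s
    proof -
      have "norm (u s + v s) ^ p \<le> (norm (u s) + norm (v s)) ^ p" by (intro power_mono norm_triangle_ineq) auto
      also have "norm (u s) + norm (v s) = (A + B) * ((1 - r) * (norm (v s) / B) + r * (norm (u s) / A))"
        using AB unfolding r(3) by (simp add: r_def flip: add_divide_distrib)
      also have "\<dots> ^ p = (A + B) ^ p * ((1 - r) *\<^sub>R (norm (v s) / B) + r *\<^sub>R (norm (u s) / A)) ^ p"
        by (simp add: power_mult_distrib)
      also have "\<dots> \<le> (A + B) ^ p * ((1 - r) * (norm (v s) / B) ^ p + r * (norm (u s) / A) ^ p)"
        using AB r by (intro mult_left_mono convex_onD[OF convex_on_power_nonneg]) auto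
      finally show ?thesis by (simp add: power_divide add.commute)
    qed
    then have "(LINT s|M. norm (u s + v s) ^ p)
       \<le> (LINT s|M. (A + B) ^ p * (r * (norm (u s) ^ p / A ^ p) + (1 - r) * (norm (v s) ^ p / B ^ p)))"
      by (intro integral_mono integrable_norm_power_add u v integrable_mult_right
          Bochner_Integration.integrable_add integrable_divide) auto
    also have "\<dots> = (A + B) ^ p * (r * (\<alpha> ^ p / A ^ p) + (1 - r) * (\<beta> ^ p / B ^ p))"
      using u v by (simp add: \<alpha>(2) \<beta>(2))
    also have "\<dots> \<le> (A + B) ^ p * (r * 1 + (1 - r) * 1)"
    proof -
      have "\<alpha> ^ p \<le> A ^ p" "\<beta> ^ p \<le> B ^ p"
        using \<alpha>(1) \<beta>(1) e by (auto intro!: power_mono simp: A_def B_def)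
      then show ?thesis using AB r by (intro mult_left_mono add_mono) auto
    qed
    finally have "(LINT s|M. norm (u s + v s) ^ p) \<le> (A + B) ^ p" by simp
    then have "root p (LINT s|M. norm (u s + v s) ^ p) \<le> root p ((A + B) ^ p)" using p by simp
    also have "\<dots> = A + B" using p AB by (simp add: real_root_power_cancel)
    finally show ?thesis by (simp add: A_def B_def)
  qed
  then show ?thesis unfolding \<alpha>_def[symmetric] \<beta>_def[symmetric] by (rule field_le_epsilon)
qed

text \<open>First \<open>h\<close> is projected to a large ball, which costs little by dominated
  convergence. Then continuous functions converging to \<open>h\<close> almost everywhere are
  projected to the same ball; the projected functions are bounded, and dominated convergence applies
  on \<open>[a, b]\<close> a second time.\<close>

lemma Lp_approximate_continuous:
  fixes h :: "real \<Rightarrow> 'a::euclidean_space"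
  assumes [measurable]: "h \<in> borel_measurable borel" and p: "p > 0"
    and fin: "(\<integral>\<^sup>+s\<in>{a..b}. norm (h s) ^ p \<partial>lborel) < \<infinity>" and e: "e > 0"
  obtains k where "continuous_on UNIV k" "(\<integral>\<^sup>+s\<in>{a..b}. norm (h s - k s) ^ p \<partial>lborel) < ennreal e"
proof -
  define e1 where "e1 = e / 2 ^ p / 2"
  have e1: "e1 > 0" using e by (simp add: e1_def)
  define c where "c M = closest_point (cball (0::'a) (real M))" for M :: nat
  have c_cont: "continuous_on S (c M)" for S M
    unfolding c_def by (rule continuous_on_closest_point) auto
  have [measurable]: "c M \<in> borel_measurable borel" for M
    by (intro borel_measurable_continuous_onI c_cont)
  have c_self: "c M z = z" if "norm z \<le> real M" for z M
    unfolding c_def by (rule closest_point_self) (use that in auto)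
  have c_in: "norm (c M z) \<le> real M" for M z
    using closest_point_in_set[of "cball (0::'a) (real M)" z] by (auto simp: c_def)
  have c_le: "norm (z - c M z) \<le> norm z" for M z
    using closest_point_le[of "cball (0::'a) (real M)" 0 z] by (auto simp: c_def dist_norm)
  have "(\<lambda>M. \<integral>\<^sup>+s\<in>{a..b}. norm (h s - c M (h s)) ^ p \<partial>lborel) \<longlonglongrightarrow> (\<integral>\<^sup>+s. 0 \<partial>(lborel::real measure))"
  proof (rule nn_integral_dominated_convergence[where w = "\<lambda>s. ennreal (norm (h s) ^ p) * indicator {a..b} s"])
    show "AE s in lborel. (\<lambda>M. ennreal (norm (h s - c M (h s)) ^ p) * indicator {a..b} s) \<longlonglongrightarrow> 0"
    proof (rule AE_I2)
      fix s
      have "eventually (\<lambda>M. ennreal (norm (h s - c M (h s)) ^ p) * indicator {a..b} s = 0) sequentially"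
        using eventually_ge_at_top[of "nat \<lceil>norm (h s)\<rceil>"]
      proof eventually_elim
        case (elim M)
        then have "norm (h s) \<le> real M" by linarith
        then show ?case using p by (simp add: c_self)
      qed
      then show "(\<lambda>M. ennreal (norm (h s - c M (h s)) ^ p) * indicator {a..b} s) \<longlonglongrightarrow> 0"
        by (rule tendsto_eventually)
    qed
    show "AE s in lborel. ennreal (norm (h s - c M (h s)) ^ p) * indicator {a..b} s
        \<le> ennreal (norm (h s) ^ p) * indicator {a..b} s" for M
      by (intro AE_I2 mult_right_mono ennreal_leI power_mono c_le) auto
  qed (use fin in auto)
  then have "eventually (\<lambda>M. (\<integral>\<^sup>+s\<in>{a..b}. norm (h s - c M (h s)) ^ p \<partial>lborel) < ennreal e1) sequentially"
    using e1 by (intro order_tendstoD(2)) auto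
  then obtain M where M: "(\<integral>\<^sup>+s\<in>{a..b}. norm (h s - c M (h s)) ^ p \<partial>lborel) < ennreal e1"
    by (auto simp: eventually_sequentially)
  have "h measurable_on UNIV"
    by (intro lebesgue_measurable_imp_measurable_on measurable_completion) auto
  then obtain N g where N: "negligible N" and g: "\<And>n. continuous_on UNIV (g n)"
    "\<And>s. s \<notin> N \<Longrightarrow> (\<lambda>n. g n s) \<longlonglongrightarrow> h s"
    unfolding measurable_on_def by auto
  have [measurable]: "g n \<in> borel_measurable borel" for n using g(1) by (rule borel_measurable_continuous_onI)
  have "AE s in lebesgue. s \<notin> N" using N by (intro AE_not_in) (simp add: negligible_iff_null_sets)
  then have N': "AE s in lborel. s \<notin> N" by (simp add: AE_completion_iff)
  have "(\<lambda>n. \<integral>\<^sup>+s\<in>{a..b}. norm (c M (h s) - c M (g n s)) ^ p \<partial>lborel) \<longlonglongrightarrow> (\<integral>\<^sup>+s. 0 \<partial>(lborel::real measure))"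
  proof (rule nn_integral_dominated_convergence[where w = "\<lambda>s. ennreal ((2 * real M) ^ p) * indicator {a..b} s"])
    show "AE s in lborel. (\<lambda>n. ennreal (norm (c M (h s) - c M (g n s)) ^ p) * indicator {a..b} s) \<longlonglongrightarrow> 0"
      using N'
    proof eventually_elim
      case (elim s)
      have "(\<lambda>n. c M (g n s)) \<longlonglongrightarrow> c M (h s)"
        by (rule continuous_on_tendsto_compose[OF c_cont[of UNIV] g(2)[OF elim]]) auto
      then have "(\<lambda>n. norm (c M (h s) - c M (g n s)) ^ p) \<longlonglongrightarrow> norm (c M (h s) - c M (h s)) ^ p"
        by (intro tendsto_intros)
      then have "(\<lambda>n. ennreal (norm (c M (h s) - c M (g n s)) ^ p)) \<longlonglongrightarrow> ennreal 0"
        using p by (intro tendsto_ennrealI) (simp add: power_0_left)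
      then show ?case by (cases "s \<in> {a..b}") auto
    qed
    show "AE s in lborel. ennreal (norm (c M (h s) - c M (g n s)) ^ p) * indicator {a..b} s
       \<le> ennreal ((2 * real M) ^ p) * indicator {a..b} s" for n
    proof (intro AE_I2 mult_right_mono ennreal_leI power_mono)
      fix s show "norm (c M (h s) - c M (g n s)) \<le> 2 * real M"
        using norm_triangle_ineq4[of "c M (h s)" "c M (g n s)"] c_in[of M "h s"] c_in[of M "g n s"] by linarith
    qed auto
    show "(\<integral>\<^sup>+s. ennreal ((2 * real M) ^ p) * indicator {a..b} s \<partial>lborel) < \<infinity>"
      by (subst nn_integral_cmult_indicator) (auto simp: emeasure_lborel_Icc_eq ennreal_mult_less_top)
  qed auto
  then have "eventually (\<lambda>n. (\<integral>\<^sup>+s\<in>{a..b}. norm (c M (h s) - c M (g n s)) ^ p \<partial>lborel) < ennreal e1) sequentially"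
    using e1 by (intro order_tendstoD(2)) auto
  then obtain n where n: "(\<integral>\<^sup>+s\<in>{a..b}. norm (c M (h s) - c M (g n s)) ^ p \<partial>lborel) < ennreal e1"
    by (auto simp: eventually_sequentially)
  show thesis
  proof
    show "continuous_on UNIV (\<lambda>s. c M (g n s))"
      using continuous_on_compose2[OF c_cont[of UNIV] g(1)] by auto
    have "(\<integral>\<^sup>+s\<in>{a..b}. norm (h s - c M (g n s)) ^ p \<partial>lborel)
       \<le> (\<integral>\<^sup>+s. ennreal (2 ^ p) * (ennreal (norm (h s - c M (h s)) ^ p) * indicator {a..b} s
           + ennreal (norm (c M (h s) - c M (g n s)) ^ p) * indicator {a..b} s) \<partial>lborel)"
    proof (rule nn_integral_mono)
      fix s
      have "norm (h s - c M (g n s)) ^ p \<le> (norm (h s - c M (h s)) + norm (c M (h s) - c M (g n s))) ^ p"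
        using norm_triangle_ineq[of "h s - c M (h s)" "c M (h s) - c M (g n s)"] by (intro power_mono) auto
      also have "\<dots> \<le> 2 ^ p * (norm (h s - c M (h s)) ^ p + norm (c M (h s) - c M (g n s)) ^ p)"
        by (intro power_add_le) auto
      finally show "ennreal (norm (h s - c M (g n s)) ^ p) * indicator {a..b} s
        \<le> ennreal (2 ^ p) * (ennreal (norm (h s - c M (h s)) ^ p) * indicator {a..b} s
           + ennreal (norm (c M (h s) - c M (g n s)) ^ p) * indicator {a..b} s)"
        by (auto simp: indicator_def simp flip: ennreal_plus ennreal_mult intro!: ennreal_leI)
    qed
    also have "\<dots> = ennreal (2 ^ p) * ((\<integral>\<^sup>+s\<in>{a..b}. norm (h s - c M (h s)) ^ p \<partial>lborel)
         + (\<integral>\<^sup>+s\<in>{a..b}. norm (c M (h s) - c M (g n s)) ^ p \<partial>lborel))"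
      by (subst nn_integral_cmult, measurable, subst nn_integral_add) auto
    also have "\<dots> < ennreal (2 ^ p) * (ennreal e1 + ennreal e1)"
      using add_strict_mono[OF M n] by (intro ennreal_mult_strict_left_mono) auto
    also have "\<dots> = ennreal e" using e1 by (simp add: e1_def flip: ennreal_plus ennreal_mult)
    finally show "(\<integral>\<^sup>+s\<in>{a..b}. norm (h s - c M (g n s)) ^ p \<partial>lborel) < ennreal e" .
  qed
qed

section \<open>Integrals of p-th powers\<close>

text \<open>The p-th power of the L^p norm on \<open>[a, b]\<close>. With values in
  \<open>ennreal\<close>, monotonicity in the interval and in the integrand needs no
  integrability.\<close>

definition pint :: "nat \<Rightarrow> real \<Rightarrow> real \<Rightarrow> (real \<Rightarrow> 'a::real_normed_vector) \<Rightarrow> ennreal" where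
  "pint p a b u = (\<integral>\<^sup>+s\<in>{a..b}. ennreal (norm (u s) ^ p) \<partial>lborel)"

lemma pint_mono_interval: "a' \<le> a \<Longrightarrow> b \<le> b' \<Longrightarrow> pint p a b u \<le> pint p a' b' u"
  unfolding pint_def by (intro nn_integral_mono) (auto simp: indicator_def)

lemma pint_mono_AE:
  assumes "AE s in lborel. a \<le> s \<and> s \<le> b \<longrightarrow> norm (u s) \<le> norm (v s)"
  shows "pint p a b u \<le> pint p a b v"
  unfolding pint_def using assms
  by (intro nn_integral_mono_AE, eventually_elim) (auto simp: indicator_def intro!: ennreal_leI power_mono)

lemma pint_cong_AE:
  assumes "AE s in lborel. a \<le> s \<and> s \<le> b \<longrightarrow> norm (u s) = norm (v s)"
  shows "pint p a b u = pint p a b v"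
  using assms by (intro antisym pint_mono_AE) (auto elim!: eventually_mono)

text \<open>Curves and solutions are measurable on an interval only. Extension by 0 makes them Borel
  on the line without changing the integral, since \<open>0 ^ p = 0\<close> for positive
  \<open>p\<close>.\<close>

lemma pint_extend:
  fixes u :: "real \<Rightarrow> 'a::{banach, second_countable_topology}"
  assumes p: "p > 0" and u: "set_borel_measurable borel {a..b} u"
  obtains U where "U \<in> borel_measurable borel" "\<And>s. s \<in> {a..b} \<Longrightarrow> U s = u s" "\<And>s. s \<notin> {a..b} \<Longrightarrow> U s = 0"
    "pint p a b u = (\<integral>\<^sup>+s. ennreal (norm (U s) ^ p) \<partial>lborel)"
proof (rule that[of "\<lambda>s. indicator {a..b} s *\<^sub>R u s"])
  show "(\<lambda>s. indicator {a..b} s *\<^sub>R u s) \<in> borel_measurable borel"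
    using u by (simp add: set_borel_measurable_def)
  show "pint p a b u = (\<integral>\<^sup>+s. ennreal (norm (indicator {a..b} s *\<^sub>R u s) ^ p) \<partial>lborel)"
    unfolding pint_def using p by (intro nn_integral_cong) (auto simp: indicator_def)
qed auto

lemma pint_add_le:
  fixes u v :: "real \<Rightarrow> 'a::{banach, second_countable_topology}"
  assumes p: "p > 0" and u: "set_borel_measurable borel {a..b} u" and v: "set_borel_measurable borel {a..b} v"
  shows "pint p a b (\<lambda>s. u s + v s) \<le> ennreal (2 ^ p) * (pint p a b u + pint p a b v)"
proof -
  obtain U where U [measurable]: "U \<in> borel_measurable borel" and U': "\<And>s. s \<in> {a..b} \<Longrightarrow> U s = u s"
    "pint p a b u = (\<integral>\<^sup>+s. ennreal (norm (U s) ^ p) \<partial>lborel)"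
    using pint_extend[OF p u] by metis
  obtain V where V [measurable]: "V \<in> borel_measurable borel" and V': "\<And>s. s \<in> {a..b} \<Longrightarrow> V s = v s"
    "pint p a b v = (\<integral>\<^sup>+s. ennreal (norm (V s) ^ p) \<partial>lborel)"
    using pint_extend[OF p v] by metis
  have "pint p a b (\<lambda>s. u s + v s) \<le> (\<integral>\<^sup>+s. ennreal (2 ^ p) * (ennreal (norm (U s) ^ p) + ennreal (norm (V s) ^ p)) \<partial>lborel)"
    unfolding pint_def
  proof (rule nn_integral_mono)
    fix s
    have "norm (U s + V s) ^ p \<le> (norm (U s) + norm (V s)) ^ p" by (intro power_mono norm_triangle_ineq) auto
    also have "\<dots> \<le> 2 ^ p * (norm (U s) ^ p + norm (V s) ^ p)" by (intro power_add_le) auto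
    finally have "ennreal (norm (U s + V s) ^ p) \<le> ennreal (2 ^ p) * (ennreal (norm (U s) ^ p) + ennreal (norm (V s) ^ p))"
      by (simp add: ennreal_leI flip: ennreal_plus ennreal_mult)
    then show "ennreal (norm (u s + v s) ^ p) * indicator {a..b} s
       \<le> ennreal (2 ^ p) * (ennreal (norm (U s) ^ p) + ennreal (norm (V s) ^ p))"
      using U'(1)[of s] V'(1)[of s] by (cases "s \<in> {a..b}") auto
  qed
  also have "\<dots> = ennreal (2 ^ p) * (pint p a b u + pint p a b v)"
    unfolding U'(2) V'(2) by (subst nn_integral_cmult, measurable, subst nn_integral_add) auto
  finally show ?thesis .
qed

text \<open>The index \<open>i\<close> that works may depend on \<open>s\<close> in a non-measurable
  way. Replacing the term with that index by the sum over all of \<open>F\<close> avoids any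
  measurable selection and any measurability of \<open>h\<close>.\<close>

lemma pint_sum_le:
  fixes u :: "'i \<Rightarrow> real \<Rightarrow> 'a::{banach, second_countable_topology}"
    and h :: "real \<Rightarrow> 'b::real_normed_vector"
  assumes p: "p > 0" and F: "finite F" and u: "\<And>i. i \<in> F \<Longrightarrow> set_borel_measurable borel {a..b} (u i)"
    and l: "set_borel_measurable borel {a..b} l" and e: "e \<ge> 0"
    and ae: "AE s in lborel. a \<le> s \<and> s \<le> b \<longrightarrow> (\<exists>i\<in>F. norm (h s) \<le> norm (u i s) + e * norm (l s))"
  shows "pint p a b h \<le> ennreal (2 ^ p) * ((\<Sum>i\<in>F. pint p a b (u i)) + ennreal (e ^ p) * pint p a b (l :: real \<Rightarrow> real))"
proof -
  obtain L where L [measurable]: "L \<in> borel_measurable borel" and L': "\<And>s. s \<in> {a..b} \<Longrightarrow> L s = l s"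
    "pint p a b l = (\<integral>\<^sup>+s. ennreal (norm (L s) ^ p) \<partial>lborel)"
    using pint_extend[OF p l] by metis
  have "\<exists>U. \<forall>i\<in>F. U i \<in> borel_measurable borel \<and> (\<forall>s\<in>{a..b}. U i s = u i s) \<and>
      pint p a b (u i) = (\<integral>\<^sup>+s. ennreal (norm (U i s) ^ p) \<partial>lborel)"
    by (intro bchoice ballI) (metis pint_extend[OF p u])
  then obtain U where U: "\<And>i. i \<in> F \<Longrightarrow> U i \<in> borel_measurable borel" "\<And>i s. i \<in> F \<Longrightarrow> s \<in> {a..b} \<Longrightarrow> U i s = u i s"
      "\<And>i. i \<in> F \<Longrightarrow> pint p a b (u i) = (\<integral>\<^sup>+s. ennreal (norm (U i s) ^ p) \<partial>lborel)" by blast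
  have m1: "(\<lambda>s. ennreal (norm (U i s) ^ p)) \<in> borel_measurable lborel" if "i \<in> F" for i
  proof -
    note [measurable] = U(1)[OF that]
    show ?thesis by measurable
  qed
  have m2: "(\<lambda>s. ennreal (e ^ p) * ennreal (norm (L s) ^ p)) \<in> borel_measurable lborel" by measurable
  have "pint p a b h \<le> (\<integral>\<^sup>+s. ennreal (2 ^ p) * ((\<Sum>i\<in>F. ennreal (norm (U i s) ^ p)) + ennreal (e ^ p) * ennreal (norm (L s) ^ p)) \<partial>lborel)"
    unfolding pint_def
  proof (rule nn_integral_mono_AE)
    show "AE s in lborel. ennreal (norm (h s) ^ p) * indicator {a..b} s
       \<le> ennreal (2 ^ p) * ((\<Sum>i\<in>F. ennreal (norm (U i s) ^ p)) + ennreal (e ^ p) * ennreal (norm (L s) ^ p))"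
      using ae
    proof eventually_elim
      case (elim s)
      show ?case
      proof (cases "s \<in> {a..b}")
        case True
        then obtain i where i: "i \<in> F" "norm (h s) \<le> norm (U i s) + e * norm (L s)"
          using elim U(2) L'(1) by auto
        have "norm (h s) ^ p \<le> (norm (U i s) + e * norm (L s)) ^ p" using i(2) by (intro power_mono) auto
        also have "\<dots> \<le> 2 ^ p * (norm (U i s) ^ p + (e * norm (L s)) ^ p)" using e by (intro power_add_le) auto
        also have "\<dots> \<le> 2 ^ p * ((\<Sum>i\<in>F. norm (U i s) ^ p) + e ^ p * norm (L s) ^ p)"
          using F i(1) by (intro mult_left_mono add_mono) (auto simp: power_mult_distrib intro!: member_le_sum[where f = "\<lambda>i. norm (U i s) ^ p"])
        finally have "ennreal (norm (h s) ^ p) \<le> ennreal (2 ^ p * ((\<Sum>i\<in>F. norm (U i s) ^ p) + e ^ p * norm (L s) ^ p))"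
          by (rule ennreal_leI)
        also have "\<dots> = ennreal (2 ^ p) * ((\<Sum>i\<in>F. ennreal (norm (U i s) ^ p)) + ennreal (e ^ p) * ennreal (norm (L s) ^ p))"
          using e by (simp add: ennreal_mult ennreal_plus sum_nonneg sum_ennreal)
        finally show ?thesis using True by simp
      qed simp
    qed
  qed
  also have "\<dots> = ennreal (2 ^ p) * (\<integral>\<^sup>+s. (\<Sum>i\<in>F. ennreal (norm (U i s) ^ p)) + ennreal (e ^ p) * ennreal (norm (L s) ^ p) \<partial>lborel)"
    by (intro nn_integral_cmult borel_measurable_add borel_measurable_sum m1 m2)
  also have "(\<integral>\<^sup>+s. (\<Sum>i\<in>F. ennreal (norm (U i s) ^ p)) + ennreal (e ^ p) * ennreal (norm (L s) ^ p) \<partial>lborel)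
     = (\<integral>\<^sup>+s. (\<Sum>i\<in>F. ennreal (norm (U i s) ^ p)) \<partial>lborel) + (\<integral>\<^sup>+s. ennreal (e ^ p) * ennreal (norm (L s) ^ p) \<partial>lborel)"
    by (intro nn_integral_add borel_measurable_sum m1 m2)
  also have "(\<integral>\<^sup>+s. (\<Sum>i\<in>F. ennreal (norm (U i s) ^ p)) \<partial>lborel) = (\<Sum>i\<in>F. \<integral>\<^sup>+s. ennreal (norm (U i s) ^ p) \<partial>lborel)"
    by (intro nn_integral_sum m1)
  also have "\<dots> = (\<Sum>i\<in>F. pint p a b (u i))" by (intro sum.cong refl U(3)[symmetric])
  also have "(\<integral>\<^sup>+s. ennreal (e ^ p) * ennreal (norm (L s) ^ p) \<partial>lborel) = ennreal (e ^ p) * pint p a b l"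
    unfolding L'(2) by (intro nn_integral_cmult) measurable
  finally show ?thesis .
qed

lemma pint_shift:
  assumes [measurable]: "u \<in> borel_measurable borel"
  shows "pint p a b (\<lambda>s. u (s + c)) = pint p (a + c) (b + c) u"
proof -
  have "pint p (a + c) (b + c) u = (\<integral>\<^sup>+s. ennreal (norm (u (c + 1 * s)) ^ p) * indicator {a + c..b + c} (c + 1 * s) \<partial>lborel)"
    unfolding pint_def by (subst nn_integral_real_affine[of _ 1 c]) auto
  also have "\<dots> = pint p a b (\<lambda>s. u (s + c))"
    unfolding pint_def by (intro nn_integral_cong) (auto simp: indicator_def add.commute)
  finally show ?thesis by simp
qed

lemma pint_combine:
  fixes u :: "real \<Rightarrow> 'a::{banach, second_countable_topology}"
  assumes u: "set_borel_measurable borel {a..c} u" and p: "p > 0" and "a \<le> b" "b \<le> c"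
  shows "pint p a c u \<le> pint p a b u + pint p b c u"
proof -
  have m: "set_borel_measurable borel {a..b} u" "set_borel_measurable borel {b..c} u"
    using assms by (auto intro: set_borel_measurable_subset)
  obtain U where U [measurable]: "U \<in> borel_measurable borel" and U': "\<And>s. s \<in> {a..b} \<Longrightarrow> U s = u s"
    "pint p a b u = (\<integral>\<^sup>+s. ennreal (norm (U s) ^ p) \<partial>lborel)"
    using pint_extend[OF p m(1)] by metis
  obtain V where V [measurable]: "V \<in> borel_measurable borel" and V': "\<And>s. s \<in> {b..c} \<Longrightarrow> V s = u s"
    "pint p b c u = (\<integral>\<^sup>+s. ennreal (norm (V s) ^ p) \<partial>lborel)"
    using pint_extend[OF p m(2)] by metis
  have "pint p a c u \<le> (\<integral>\<^sup>+s. ennreal (norm (U s) ^ p) + ennreal (norm (V s) ^ p) \<partial>lborel)"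
    unfolding pint_def
  proof (rule nn_integral_mono)
    fix s
    show "ennreal (norm (u s) ^ p) * indicator {a..c} s \<le> ennreal (norm (U s) ^ p) + ennreal (norm (V s) ^ p)"
      using U'(1)[of s] V'(1)[of s] by (cases "s \<in> {a..c}"; cases "s \<le> b") auto
  qed
  also have "\<dots> = pint p a b u + pint p b c u"
    unfolding U'(2) V'(2) by (intro nn_integral_add) measurable
  finally show ?thesis .
qed

text \<open>Takes the place of Hoelder's inequality. Where \<open>norm (u s)\<close> exceeds
  \<open>K\<close> it is at most \<open>norm (u s) ^ p / K ^ (p - 1)\<close>, elsewhere it is at
  most \<open>K\<close>. A small \<open>K\<close> followed by a much smaller p-th power integral
  makes both terms small.\<close>

lemma nn_integral_le_pint:
  fixes u :: "real \<Rightarrow> 'a::{banach, second_countable_topology}"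
  assumes p: "p > 0" and K: "K > 0" and u: "set_borel_measurable borel {a..b} u"
  shows "(\<integral>\<^sup>+s\<in>{a..b}. norm (u s) \<partial>lborel) \<le> ennreal (K * (b - a)) + ennreal (1 / K ^ (p - 1)) * pint p a b u"
proof (cases "a \<le> b")
  case True
  obtain U where U [measurable]: "U \<in> borel_measurable borel" and U': "\<And>s. s \<in> {a..b} \<Longrightarrow> U s = u s"
    "pint p a b u = (\<integral>\<^sup>+s. ennreal (norm (U s) ^ p) \<partial>lborel)"
    using pint_extend[OF p u] by metis
  have "(\<integral>\<^sup>+s\<in>{a..b}. norm (u s) \<partial>lborel)
     \<le> (\<integral>\<^sup>+s. ennreal K * indicator {a..b} s + ennreal (1 / K ^ (p - 1)) * ennreal (norm (U s) ^ p) \<partial>lborel)"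
  proof (rule nn_integral_mono)
    fix s
    have "norm (U s) \<le> K + 1 / K ^ (p - 1) * norm (U s) ^ p"
    proof (cases "norm (U s) \<le> K")
      case True
      moreover have "0 \<le> 1 / K ^ (p - 1) * norm (U s) ^ p" using K by simp
      ultimately show ?thesis by linarith
    next
      case False
      then have "K ^ (p - 1) * norm (U s) \<le> norm (U s) ^ (p - 1) * norm (U s)"
        using K by (intro mult_right_mono power_mono) auto
      also have "\<dots> = norm (U s) ^ p" by (rule power_minus_mult[OF p])
      finally have "norm (U s) \<le> norm (U s) ^ p / K ^ (p - 1)" using K by (simp add: field_simps)
      then show ?thesis using K by simp
    qed
    then have "ennreal (norm (U s)) \<le> ennreal K + ennreal (1 / K ^ (p - 1)) * ennreal (norm (U s) ^ p)"
      using K by (simp add: ennreal_leI flip: ennreal_plus ennreal_mult)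
    then show "ennreal (norm (u s)) * indicator {a..b} s
       \<le> ennreal K * indicator {a..b} s + ennreal (1 / K ^ (p - 1)) * ennreal (norm (U s) ^ p)"
      using U'(1)[of s] by (cases "s \<in> {a..b}") auto
  qed
  also have "\<dots> = (\<integral>\<^sup>+s. ennreal K * indicator {a..b} s \<partial>lborel) + (\<integral>\<^sup>+s. ennreal (1 / K ^ (p - 1)) * ennreal (norm (U s) ^ p) \<partial>lborel)"
    by (intro nn_integral_add) measurable
  also have "(\<integral>\<^sup>+s. ennreal K * indicator {a..b} s \<partial>lborel) = ennreal (K * (b - a))"
    using True K by (subst nn_integral_cmult_indicator) (auto simp: ennreal_mult)
  also have "(\<integral>\<^sup>+s. ennreal (1 / K ^ (p - 1)) * ennreal (norm (U s) ^ p) \<partial>lborel) = ennreal (1 / K ^ (p - 1)) * pint p a b u"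
    unfolding U'(2) by (intro nn_integral_cmult) measurable
  finally show ?thesis .
qed simp

text \<open>A continuous \<open>k\<close> near \<open>h\<close> in L^p is uniformly continuous on a
  compact interval. The difference of two translates of \<open>h\<close> is split into two
  approximation errors, which are translates of the error on a larger interval, and a difference of
  translates of \<open>k\<close>.\<close>

lemma pint_translation_continuous:
  fixes h :: "real \<Rightarrow> 'a::euclidean_space"
  assumes h [measurable]: "h \<in> borel_measurable borel" and p: "p > 0"
    and fin: "\<And>a b. pint p a b h < \<infinity>" and e: "e > 0"
  obtains d where "d > 0" "\<And>t. \<bar>t - t0\<bar> < d \<Longrightarrow> pint p a b (\<lambda>s. h (s + t) - h (s + t0)) < ennreal e"
proof -
  \<comment> \<open>The loss from two nested applications of \<open>pint_add_le\<close> to three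
    errors \<open>e1\<close>: the sum is \<open>C * e1\<close>, which is
    \<open>e / 2\<close>.\<close>
  define C where "C = (2::real) ^ p * (1 + 2 ^ p * 2)"
  have C: "C > 0" unfolding C_def by (intro mult_pos_pos add_pos_pos zero_less_power) auto
  define e1 where "e1 = e / C / 2"
  have e1: "e1 > 0" using e C by (auto simp: e1_def)
  define A where "A = a + t0 - 1"
  define B where "B = b + t0 + 1"
  have "(\<integral>\<^sup>+s\<in>{A..B}. norm (h s) ^ p \<partial>lborel) < \<infinity>" using fin[of A B] by (simp only: pint_def)
  from Lp_approximate_continuous[OF h p this e1]
  obtain k where k: "continuous_on UNIV k" "pint p A B (\<lambda>s. h s - k s) < ennreal e1"
    unfolding pint_def by metis
  have [measurable]: "k \<in> borel_measurable borel" using k(1) by (rule borel_measurable_continuous_onI)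
  \<comment> \<open>The bound 1 gives \<open>\<eta> ^ p \<le> \<eta>\<close>, so the second bound
    controls the integral of the p-th power over \<open>[a, b]\<close>.\<close>
  define \<eta> where "\<eta> = min 1 (e1 / (\<bar>b - a\<bar> + 1))"
  have \<eta>: "\<eta> > 0" using e1 by (auto simp: \<eta>_def)
  have "uniformly_continuous_on {A..B} k"
    by (rule compact_uniformly_continuous[OF continuous_on_subset[OF k(1)]]) auto
  then have "\<exists>d>0. \<forall>s\<in>{A..B}. \<forall>r\<in>{A..B}. dist r s < d \<longrightarrow> dist (k r) (k s) < \<eta>"
    unfolding uniformly_continuous_on_def by (elim allE[of _ \<eta>] impE) (rule \<eta>)
  then obtain d0 where "d0 > 0" and d0': "\<forall>s\<in>{A..B}. \<forall>r\<in>{A..B}. dist r s < d0 \<longrightarrow> dist (k r) (k s) < \<eta>"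
    by (elim exE conjE)
  then have d0: "d0 > 0" "\<And>s r. s \<in> {A..B} \<Longrightarrow> r \<in> {A..B} \<Longrightarrow> dist r s < d0 \<Longrightarrow> dist (k r) (k s) < \<eta>"
    by simp_all
  show thesis
  proof
    show "min d0 1 > 0" using d0 by simp
    fix t assume t: "\<bar>t - t0\<bar> < min d0 1"
    have 1: "pint p a b (\<lambda>s. h (s + t) - k (s + t)) \<le> ennreal e1"
    proof -
      have "pint p a b (\<lambda>s. h (s + t) - k (s + t)) = pint p (a + t) (b + t) (\<lambda>s. h s - k s)"
        by (rule pint_shift) auto
      also have "\<dots> \<le> pint p A B (\<lambda>s. h s - k s)" using t by (intro pint_mono_interval) (auto simp: A_def B_def)
      finally show ?thesis using k(2) by auto
    qed
    have 2: "pint p a b (\<lambda>s. k (s + t0) - h (s + t0)) \<le> ennreal e1"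
    proof -
      have "pint p a b (\<lambda>s. k (s + t0) - h (s + t0)) = pint p a b (\<lambda>s. h (s + t0) - k (s + t0))"
        by (intro pint_cong_AE AE_I2) (auto simp: norm_minus_commute)
      also have "\<dots> = pint p (a + t0) (b + t0) (\<lambda>s. h s - k s)"
        by (rule pint_shift) auto
      also have "\<dots> \<le> pint p A B (\<lambda>s. h s - k s)" by (intro pint_mono_interval) (auto simp: A_def B_def)
      finally show ?thesis using k(2) by auto
    qed
    have 3: "pint p a b (\<lambda>s. k (s + t) - k (s + t0)) \<le> ennreal e1"
    proof (cases "a \<le> b")
      case True
      have "pint p a b (\<lambda>s. k (s + t) - k (s + t0)) \<le> pint p a b (\<lambda>s. \<eta>)"
      proof (intro pint_mono_AE AE_I2 impI)
        fix s assume "a \<le> s \<and> s \<le> b"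
        then have "dist (k (s + t)) (k (s + t0)) < \<eta>"
          using t by (intro d0(2)) (auto simp: A_def B_def dist_real_def)
        then show "norm (k (s + t) - k (s + t0)) \<le> norm \<eta>" using \<eta> by (simp add: dist_norm)
      qed
      also have "\<dots> = ennreal (\<eta> ^ p * (b - a))"
        using True \<eta> unfolding pint_def by (subst nn_integral_cmult_indicator) (auto simp: ennreal_mult)
      also have "\<dots> \<le> ennreal e1"
      proof (rule ennreal_leI)
        have "\<eta> ^ p \<le> \<eta>" using \<eta> p power_decreasing[of 1 p \<eta>] by (auto simp: \<eta>_def)
        then have "\<eta> ^ p * (b - a) \<le> e1 / (\<bar>b - a\<bar> + 1) * (b - a)"
          using True by (intro mult_right_mono) (auto simp: \<eta>_def)
        also have "\<dots> \<le> e1" using True e1 by (simp add: field_simps)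
        finally show "\<eta> ^ p * (b - a) \<le> e1" .
      qed
      finally show ?thesis .
    qed (simp add: pint_def)
    have m [simp]: "set_borel_measurable borel {a..b} u" if "u \<in> borel_measurable borel" for u :: "real \<Rightarrow> 'a"
      using that by (simp add: set_borel_measurable_def)
    have "pint p a b (\<lambda>s. h (s + t) - h (s + t0))
       = pint p a b (\<lambda>s. (h (s + t) - k (s + t)) + ((k (s + t) - k (s + t0)) + (k (s + t0) - h (s + t0))))"
      by simp
    also have "\<dots> \<le> ennreal (2 ^ p) * (pint p a b (\<lambda>s. h (s + t) - k (s + t)) +
        pint p a b (\<lambda>s. (k (s + t) - k (s + t0)) + (k (s + t0) - h (s + t0))))"
      by (intro pint_add_le p m) auto
    also have "\<dots> \<le> ennreal (2 ^ p) * (ennreal e1 + ennreal (2 ^ p) * (ennreal e1 + ennreal e1))"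
    proof (intro mult_left_mono add_mono 1)
      have "pint p a b (\<lambda>s. (k (s + t) - k (s + t0)) + (k (s + t0) - h (s + t0)))
        \<le> ennreal (2 ^ p) * (pint p a b (\<lambda>s. k (s + t) - k (s + t0)) + pint p a b (\<lambda>s. k (s + t0) - h (s + t0)))"
        by (intro pint_add_le p m) auto
      also have "\<dots> \<le> ennreal (2 ^ p) * (ennreal e1 + ennreal e1)"
        by (intro mult_left_mono add_mono 2 3) auto
      finally show "pint p a b (\<lambda>s. (k (s + t) - k (s + t0)) + (k (s + t0) - h (s + t0)))
        \<le> ennreal (2 ^ p) * (ennreal e1 + ennreal e1)" .
    qed auto
    also have "\<dots> = ennreal (2 ^ p * (e1 + 2 ^ p * (e1 + e1)))"
      using e1 by (simp only: ennreal_mult[symmetric] ennreal_plus[symmetric] zero_le_power zero_le_numeral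
          add_nonneg_nonneg less_imp_le mult_nonneg_nonneg)
    also have "2 ^ p * (e1 + 2 ^ p * (e1 + e1)) = C * e1" by (simp add: C_def algebra_simps)
    also have "C * e1 = e / 2" using C by (simp add: e1_def)
    also have "\<dots> < ennreal e" using e by (intro ennreal_lessI) auto
    finally show "pint p a b (\<lambda>s. h (s + t) - h (s + t0)) < ennreal e" .
  qed
qed

lemma AE_lborel_shift:
  assumes "AE t::real in lborel. P t"
  shows "AE t in lborel. P (t + c)"
proof -
  obtain N where N: "N \<in> null_sets lborel" "{t. \<not> P t} \<subseteq> N"
    using assms by (auto elim!: AE_E simp: null_sets_def)
  have "AE t in lborel. t \<notin> N" using N(1) by (rule AE_not_in)
  then have "AE t in lborel. c + 1 * t \<notin> N"
    using N(1) by (intro AE_borel_affine) auto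
  then show ?thesis by eventually_elim (use N(2) in \<open>auto simp: add.commute\<close>)
qed

text \<open>A Borel and nonnegative substitute for members of \<open>Lp_loc\<close>, whose elements
  are only Lebesgue measurable; with it all integrals can be taken with respect to
  \<open>lborel\<close>.\<close>

definition lp_fun :: "nat \<Rightarrow> (real \<Rightarrow> real) \<Rightarrow> bool" where
  "lp_fun p m \<longleftrightarrow> m \<in> borel_measurable borel \<and> (\<forall>t. 0 \<le> m t) \<and> (\<forall>a b. set_integrable lborel {a..b} (\<lambda>t. m t ^ p))"

lemma lp_fun_pint:
  assumes "lp_fun p m"
  shows "pint p a b m = ennreal (LINT t:{a..b}|lborel. m t ^ p)"
proof -
  have "set_integrable lborel {a..b} (\<lambda>t. m t ^ p)" using assms by (simp add: lp_fun_def)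
  then have "(\<integral>\<^sup>+t. ennreal (indicator {a..b} t *\<^sub>R m t ^ p) \<partial>lborel) = ennreal (LINT t:{a..b}|lborel. m t ^ p)"
    unfolding set_integrable_def set_lebesgue_integral_def using assms
    by (intro nn_integral_eq_integral) (auto simp: lp_fun_def)
  moreover have "ennreal (norm (m t) ^ p) * indicator {a..b} t = ennreal (indicator {a..b} t *\<^sub>R m t ^ p)" for t
    using assms by (cases "t \<in> {a..b}") (auto simp: lp_fun_def)
  ultimately show ?thesis by (simp only: pint_def)
qed

lemma lp_fun_pint_finite: "lp_fun p m \<Longrightarrow> pint p a b m < \<infinity>"
  by (simp add: lp_fun_pint)

lemma lp_funI_pint:
  assumes [measurable]: "m \<in> borel_measurable borel" and "\<And>t. 0 \<le> m t" and fin: "\<And>a b. pint p a b m < \<infinity>"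
  shows "lp_fun p m"
  unfolding lp_fun_def
proof (intro conjI allI assms)
  fix a b
  have eq: "ennreal (norm (indicator {a..b} t *\<^sub>R m t ^ p)) = ennreal (norm (m t) ^ p) * indicator {a..b} t" for t
    using assms(2)[of t] by (cases "t \<in> {a..b}") auto
  show "set_integrable lborel {a..b} (\<lambda>t. m t ^ p)"
    unfolding set_integrable_def
  proof (rule integrableI_bounded)
    show "(\<integral>\<^sup>+t. ennreal (norm (indicator {a..b} t *\<^sub>R m t ^ p)) \<partial>lborel) < \<infinity>"
      using fin[of a b] by (simp only: eq pint_def)
  qed measurable
qed

lemma lp_fun_shift: "lp_fun p m \<Longrightarrow> lp_fun p (\<lambda>t. m (t + c))"
  unfolding lp_fun_def by (auto simp: set_integral_Icc_shift(2)[where X = "\<lambda>t. m t ^ p"])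

lemma lp_fun_add:
  assumes "lp_fun p m" "lp_fun p n" "p > 0"
  shows "lp_fun p (\<lambda>t. m t + n t)"
proof (rule lp_funI_pint)
  have [measurable]: "m \<in> borel_measurable borel" "n \<in> borel_measurable borel" using assms by (auto simp: lp_fun_def)
  show "(\<lambda>t. m t + n t) \<in> borel_measurable borel" by measurable
  fix a b
  have "pint p a b (\<lambda>t. m t + n t) \<le> ennreal (2 ^ p) * (pint p a b m + pint p a b n)"
    by (intro pint_add_le assms) (auto simp: set_borel_measurable_def)
  also have "\<dots> < \<infinity>"
    using lp_fun_pint_finite[OF assms(1)] lp_fun_pint_finite[OF assms(2)] by (auto simp: ennreal_mult_less_top)
  finally show "pint p a b (\<lambda>t. m t + n t) < \<infinity>" .
qed (use assms in \<open>auto simp: lp_fun_def\<close>)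

lemma lp_fun_cmult:
  assumes "lp_fun p m" "c \<ge> 0"
  shows "lp_fun p (\<lambda>t. c * m t)"
  using assms unfolding lp_fun_def by (auto simp: power_mult_distrib)

lemma set_integrable_Icc_const: "set_integrable lborel {a..b::real} (\<lambda>t. c::real)"
  unfolding set_integrable_def
  by (rule integrableI_bounded_set_indicator[where B = "\<bar>c\<bar>"]) (auto simp: emeasure_lborel_Icc_eq)

lemma lp_fun_integrable:
  assumes "lp_fun p m" "p > 0"
  shows "set_integrable lborel {a..b} m"
proof -
  have [measurable]: "m \<in> borel_measurable borel" using assms by (auto simp: lp_fun_def)
  have "set_integrable lborel {a..b} (\<lambda>t. 1 + m t ^ p)"
    using assms by (intro set_integral_add) (auto simp: lp_fun_def set_integrable_Icc_const)
  then show ?thesis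
    unfolding set_integrable_def
  proof (rule Bochner_Integration.integrable_bound)
    have "m t \<le> 1 + m t ^ p" for t
    proof (cases "m t \<le> 1")
      case True
      then show ?thesis using assms zero_le_power[of "m t" p] by (auto simp: lp_fun_def intro: order_trans)
    next
      case False
      then have "m t ^ 1 \<le> m t ^ p" using assms by (intro power_increasing) auto
      then show ?thesis by simp
    qed
    then show "AE t in lborel. norm (indicator {a..b} t *\<^sub>R m t) \<le> norm (indicator {a..b} t *\<^sub>R (1 + m t ^ p))"
      using assms by (intro AE_I2) (auto simp: indicator_def lp_fun_def abs_of_nonneg add_nonneg_nonneg)
  qed auto
qed

lemma lp_fun_kernel: "lp_fun p l \<Longrightarrow> p > 0 \<Longrightarrow> kernel l"
  by unfold_locales (auto simp: lp_fun_def lp_fun_integrable)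

section \<open>Fields in the Caratheodory class\<close>

lemma pint_eq_set_integral:
  fixes u :: "real \<Rightarrow> 'a::{banach, second_countable_topology}"
  assumes p: "p > 0" and u: "set_borel_measurable borel {a..b} u" and fin: "pint p a b u < \<infinity>"
  shows "set_integrable lborel {a..b} (\<lambda>t. norm (u t) ^ p)"
    and "pint p a b u = ennreal (LINT t:{a..b}|lborel. norm (u t) ^ p)"
proof -
  obtain U where U [measurable]: "U \<in> borel_measurable borel" and U': "\<And>s. s \<in> {a..b} \<Longrightarrow> U s = u s"
    "\<And>s. s \<notin> {a..b} \<Longrightarrow> U s = 0" "pint p a b u = (\<integral>\<^sup>+s. ennreal (norm (U s) ^ p) \<partial>lborel)"
    using pint_extend[OF p u] by metis
  have eq: "indicator {a..b} t *\<^sub>R norm (u t) ^ p = norm (U t) ^ p" for t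
    using U'(1,2)[of t] p by (cases "t \<in> {a..b}") auto
  have i: "integrable lborel (\<lambda>t. norm (U t) ^ p)"
    by (rule integrableI_bounded) (use fin U'(3) in auto)
  then show "set_integrable lborel {a..b} (\<lambda>t. norm (u t) ^ p)"
    unfolding set_integrable_def eq .
  show "pint p a b u = ennreal (LINT t:{a..b}|lborel. norm (u t) ^ p)"
    unfolding set_lebesgue_integral_def eq U'(3) by (rule nn_integral_eq_integral[OF i]) auto
qed

definition lp_bounds :: "nat \<Rightarrow> 'n::finite delay_field \<Rightarrow> real \<Rightarrow> (real \<Rightarrow> real) \<Rightarrow> (real \<Rightarrow> real) \<Rightarrow> bool" where
  "lp_bounds p f r m l \<longleftrightarrow> lp_fun p m \<and> lp_fun p l \<and> (AE t in lborel.
     (\<forall>z \<in> cball 0 r. norm (f t z) \<le> m t) \<and>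
     (\<forall>z1 \<in> cball 0 r. \<forall>z2 \<in> cball 0 r. norm (f t z1 - f t z2) \<le> l t * norm (z1 - z2)))"

lemma lp_boundsD:
  assumes "lp_bounds p f r m l"
  shows "lp_fun p m" "lp_fun p l" "AE t in lborel. \<forall>z \<in> cball 0 r. norm (f t z) \<le> m t"
    "AE t in lborel. \<forall>z1 \<in> cball 0 r. \<forall>z2 \<in> cball 0 r. norm (f t z1 - f t z2) \<le> l t * norm (z1 - z2)"
  using assms unfolding lp_bounds_def AE_conj_iff by blast+

lemma Lp_loc_imp_lp_fun:
  assumes m: "m \<in> Lp_loc p"
  obtains m' where "lp_fun p m'" "AE t in lborel. m t \<le> m' t"
proof -
  have "m \<in> borel_measurable (completion lborel)" using m by (simp add: Lp_loc_def)
  then obtain n where n [measurable]: "n \<in> borel_measurable lborel" and ae: "AE t in lborel. m t = n t"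
    using completion_ex_borel_measurable_real by blast
  show thesis
  proof
    show "lp_fun p (\<lambda>t. \<bar>n t\<bar>)"
      unfolding lp_fun_def
    proof (intro conjI allI)
      fix a b
      have "set_integrable lebesgue {a..b} (\<lambda>t. \<bar>m t\<bar> ^ p)" using m by (simp add: Lp_loc_def)
      then have "integrable (completion lborel) (\<lambda>t. indicator {a..b} t *\<^sub>R \<bar>n t\<bar> ^ p)"
        unfolding set_integrable_def
      proof (rule integrable_cong_AE_imp)
        show "AE t in lebesgue. indicator {a..b} t *\<^sub>R \<bar>m t\<bar> ^ p = indicator {a..b} t *\<^sub>R \<bar>n t\<bar> ^ p"
          using AE_completion[OF ae] by eventually_elim simp
      qed (intro measurable_completion, measurable)
      then show "set_integrable lborel {a..b} (\<lambda>t. \<bar>n t\<bar> ^ p)"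
        unfolding set_integrable_def by (subst (asm) integrable_completion) auto
    qed (use n in auto)
    show "AE t in lborel. m t \<le> \<bar>n t\<bar>" using ae by eventually_elim simp
  qed
qed

lemma lp_fun_imp_Lp_loc: "lp_fun p m \<Longrightarrow> m \<in> Lp_loc p"
  unfolding Lp_loc_def lp_fun_def set_integrable_def
  by (auto intro!: measurable_completion simp: integrable_completion)

text \<open>Every compact set lies in a ball, and a bound in \<open>Lp_loc\<close> can be replaced
  by a Borel one that dominates it off a null set.\<close>

lemma LC_fun_iff:
  "f \<in> LC_fun p \<longleftrightarrow> (\<lambda>(t, z). f t z) \<in> borel_measurable borel \<and> (\<forall>r. \<exists>m l. lp_bounds p f r m l)"
proof
  assume f: "f \<in> LC_fun p"
  have "\<exists>m l. lp_bounds p f r m l" for r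
  proof -
    obtain m l where ml: "m \<in> Lp_loc p" "l \<in> Lp_loc p" and ae: "AE t in lborel.
        (\<forall>z \<in> cball 0 r. norm (f t z) \<le> m t) \<and>
        (\<forall>z1 \<in> cball 0 r. \<forall>z2 \<in> cball 0 r. norm (f t z1 - f t z2) \<le> l t * norm (z1 - z2))"
      using f compact_cball[of 0 r] unfolding LC_fun_def by blast
    obtain m' where m': "lp_fun p m'" "AE t in lborel. m t \<le> m' t" using Lp_loc_imp_lp_fun[OF ml(1)] .
    obtain l' where l': "lp_fun p l'" "AE t in lborel. l t \<le> l' t" using Lp_loc_imp_lp_fun[OF ml(2)] .
    have "lp_bounds p f r m' l'"
      unfolding lp_bounds_def
    proof (intro conjI m'(1) l'(1))
      show "AE t in lborel. (\<forall>z \<in> cball 0 r. norm (f t z) \<le> m' t) \<and>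
        (\<forall>z1 \<in> cball 0 r. \<forall>z2 \<in> cball 0 r. norm (f t z1 - f t z2) \<le> l' t * norm (z1 - z2))"
        using ae m'(2) l'(2)
      proof eventually_elim
        case (elim t)
        have "l t * norm (z1 - z2) \<le> l' t * norm (z1 - z2)" for z1 z2 :: "(real ^ 'n) \<times> (real ^ 'n)"
          using elim(3) by (intro mult_right_mono) auto
        then show ?case using elim(1,2) by (meson order_trans)
      qed
    qed
    then show ?thesis by blast
  qed
  then show "(\<lambda>(t, z). f t z) \<in> borel_measurable borel \<and> (\<forall>r. \<exists>m l. lp_bounds p f r m l)"
    using f by (auto simp: LC_fun_def)
next
  assume f: "(\<lambda>(t, z). f t z) \<in> borel_measurable borel \<and> (\<forall>r. \<exists>m l. lp_bounds p f r m l)"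
  have "\<exists>m \<in> Lp_loc p. \<exists>l \<in> Lp_loc p. AE t in lborel. (\<forall>z \<in> K. norm (f t z) \<le> m t) \<and>
        (\<forall>z1 \<in> K. \<forall>z2 \<in> K. norm (f t z1 - f t z2) \<le> l t * norm (z1 - z2))" if K: "compact K" for K
  proof -
    obtain r where r: "K \<subseteq> cball 0 r"
      using compact_imp_bounded[OF K] by (auto simp: bounded_iff subset_eq)
    obtain m l where ml: "lp_bounds p f r m l" using f by blast
    have "AE t in lborel. (\<forall>z \<in> cball 0 r. norm (f t z) \<le> m t) \<and>
        (\<forall>z1 \<in> cball 0 r. \<forall>z2 \<in> cball 0 r. norm (f t z1 - f t z2) \<le> l t * norm (z1 - z2))"
      using ml by (simp only: lp_bounds_def)
    then have "AE t in lborel. (\<forall>z \<in> K. norm (f t z) \<le> m t) \<and>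
        (\<forall>z1 \<in> K. \<forall>z2 \<in> K. norm (f t z1 - f t z2) \<le> l t * norm (z1 - z2))"
      by eventually_elim (use r in blast)
    then show ?thesis using ml lp_fun_imp_Lp_loc[of p m] lp_fun_imp_Lp_loc[of p l] unfolding lp_bounds_def by blast
  qed
  then show "f \<in> LC_fun p" using f by (auto simp: LC_fun_def)
qed

lemma LC_fun_lp_bounds: "f \<in> LC_fun p \<Longrightarrow> \<exists>m l. lp_bounds p f r m l"
  by (simp add: LC_fun_iff)

lemma LC_fun_measurable:
  assumes "f \<in> LC_fun p" "w \<in> borel_measurable borel"
  shows "(\<lambda>t. f t (w t)) \<in> borel_measurable borel"
proof -
  have "(\<lambda>t. (t, w t)) \<in> borel_measurable borel"
    using assms(2) by (intro borel_measurable_Pair) auto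
  moreover have "(\<lambda>(t, z). f t z) \<in> borel_measurable borel" using assms(1) by (simp add: LC_fun_def)
  ultimately have "(\<lambda>t. (\<lambda>(t, z). f t z) (t, w t)) \<in> borel_measurable borel"
    by (rule measurable_compose)
  then show ?thesis by simp
qed

lemma LC_fun_set_measurable:
  assumes f: "f \<in> LC_fun p" and w: "set_borel_measurable borel {a..b::real} w"
  shows "set_borel_measurable borel {a..b} (\<lambda>t. f t (w t))"
proof -
  have "(\<lambda>t. f t (indicator {a..b} t *\<^sub>R w t)) \<in> borel_measurable borel"
    using w by (intro LC_fun_measurable[OF f]) (simp add: set_borel_measurable_def)
  then have "(\<lambda>t. indicator {a..b} t *\<^sub>R f t (indicator {a..b} t *\<^sub>R w t)) \<in> borel_measurable borel"
    by measurable
  also have "(\<lambda>t. indicator {a..b} t *\<^sub>R f t (indicator {a..b} t *\<^sub>R w t)) = (\<lambda>t. indicator {a..b} t *\<^sub>R f t (w t))"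
    by (auto simp: indicator_def)
  finally show ?thesis by (simp add: set_borel_measurable_def)
qed

lemma LC_fun_pint_le:
  assumes b: "lp_bounds p f r m l" and w: "\<And>t. a \<le> t \<Longrightarrow> t \<le> b \<Longrightarrow> norm (w t) \<le> r"
  shows "pint p a b (\<lambda>t. f t (w t)) \<le> pint p a b m"
proof (rule pint_mono_AE)
  show "AE s in lborel. a \<le> s \<and> s \<le> b \<longrightarrow> norm (f s (w s)) \<le> norm (m s)"
    using lp_boundsD(3)[OF b]
  proof eventually_elim
    case (elim s)
    then show ?case using w[of s] by (auto intro: order_trans[OF _ abs_ge_self])
  qed
qed

lemma LC_fun_pint_finite:
  assumes f: "f \<in> LC_fun p" and w: "\<And>t. a \<le> t \<Longrightarrow> t \<le> b \<Longrightarrow> norm (w t) \<le> r"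
  shows "pint p a b (\<lambda>t. f t (w t)) < \<infinity>"
proof -
  obtain m l where b: "lp_bounds p f r m l" using LC_fun_lp_bounds[OF f] by blast
  have "pint p a b (\<lambda>t. f t (w t)) \<le> pint p a b m" by (rule LC_fun_pint_le[OF b w])
  also have "\<dots> < \<infinity>" using b by (intro lp_fun_pint_finite) (simp add: lp_bounds_def)
  finally show ?thesis .
qed

lemma lp_bounds_translate:
  "lp_bounds p f r m l \<Longrightarrow> lp_bounds p (translate c f) r (\<lambda>t. m (t + c)) (\<lambda>t. l (t + c))"
  unfolding lp_bounds_def translate_def
  by (elim conjE, intro conjI lp_fun_shift) (assumption | erule AE_lborel_shift)+

lemma LC_fun_translate:
  assumes "f \<in> LC_fun p" shows "translate c f \<in> LC_fun p"
  unfolding LC_fun_iff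
proof (intro conjI allI)
  have [measurable]: "(\<lambda>(t, z). f t z) \<in> borel_measurable borel" using assms by (simp add: LC_fun_def)
  have "(\<lambda>q::real \<times> ((real ^ 'a) \<times> (real ^ 'a)). (fst q + c, snd q)) \<in> borel_measurable borel"
    by (intro borel_measurable_continuous_onI continuous_intros)
  then have "(\<lambda>q. (\<lambda>(t, z). f t z) (fst q + c, snd q)) \<in> borel_measurable borel"
    by (rule measurable_compose) fact
  then show "(\<lambda>(t, z). translate c f t z) \<in> borel_measurable borel"
    by (simp add: translate_def split_def)
  show "\<exists>m l. lp_bounds p (translate c f) r m l" for r
    using LC_fun_lp_bounds[OF assms, of r] lp_bounds_translate by blast
qed

lemma lp_bounds_diff:
  assumes p: "p > 0" and f: "lp_bounds p f r m l" and g: "lp_bounds p g r m' l'"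
  shows "lp_bounds p (\<lambda>t z. f t z - g t z) r (\<lambda>t. m t + m' t) (\<lambda>t. l t + l' t)"
  unfolding lp_bounds_def
proof (intro conjI)
  show "lp_fun p (\<lambda>t. m t + m' t)" "lp_fun p (\<lambda>t. l t + l' t)"
    using assms by (auto simp: lp_bounds_def intro: lp_fun_add)
  show "AE t in lborel. (\<forall>z \<in> cball 0 r. norm (f t z - g t z) \<le> m t + m' t) \<and>
     (\<forall>z1 \<in> cball 0 r. \<forall>z2 \<in> cball 0 r. norm ((f t z1 - g t z1) - (f t z2 - g t z2)) \<le> (l t + l' t) * norm (z1 - z2))"
    using lp_boundsD(3)[OF f] lp_boundsD(3)[OF g] lp_boundsD(4)[OF f] lp_boundsD(4)[OF g]
  proof eventually_elim
    case (elim t)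
    show ?case
    proof (intro conjI ballI)
      fix z :: "(real ^ 'a) \<times> (real ^ 'a)" assume z: "z \<in> cball 0 r"
      show "norm (f t z - g t z) \<le> m t + m' t"
        using elim z norm_triangle_ineq4[of "f t z" "g t z"] by (meson add_mono order_trans)
    next
      fix z1 z2 :: "(real ^ 'a) \<times> (real ^ 'a)" assume z: "z1 \<in> cball 0 r" "z2 \<in> cball 0 r"
      have "norm ((f t z1 - g t z1) - (f t z2 - g t z2)) \<le> norm (f t z1 - f t z2) + norm (g t z1 - g t z2)"
        using norm_triangle_ineq4[of "f t z1 - f t z2" "g t z1 - g t z2"] by (simp add: algebra_simps)
      also have "\<dots> \<le> l t * norm (z1 - z2) + l' t * norm (z1 - z2)" using elim z by (intro add_mono) auto
      finally show "norm ((f t z1 - g t z1) - (f t z2 - g t z2)) \<le> (l t + l' t) * norm (z1 - z2)"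
        by (simp add: algebra_simps)
    qed
  qed
qed

lemma LC_fun_diff:
  assumes p: "p > 0" and f: "f \<in> LC_fun p" and g: "g \<in> LC_fun p"
  shows "(\<lambda>t z. f t z - g t z) \<in> LC_fun p"
  unfolding LC_fun_iff
proof (intro conjI allI)
  have "(\<lambda>q. (\<lambda>(t, z). f t z) q - (\<lambda>(t, z). g t z) q) \<in> borel_measurable borel"
    using f g by (intro borel_measurable_diff) (auto simp: LC_fun_def)
  then show "(\<lambda>(t, z). f t z - g t z) \<in> borel_measurable borel" by (simp add: split_def)
  show "\<exists>m l. lp_bounds p (\<lambda>t z. f t z - g t z) r m l" for r
    using LC_fun_lp_bounds[OF f, of r] LC_fun_lp_bounds[OF g, of r] lp_bounds_diff[OF p] by blast
qed

text \<open>Countably many balls exhaust the space, so the null sets on which the Lipschitz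
  estimates fail can be united.\<close>

lemma LC_fun_AE_continuous:
  assumes "f \<in> LC_fun p"
  shows "AE t in lborel. continuous_on UNIV (f t)"
proof -
  have "AE t in lborel. \<exists>l\<ge>0. \<forall>z1 \<in> cball 0 (real n). \<forall>z2 \<in> cball 0 (real n). norm (f t z1 - f t z2) \<le> l * norm (z1 - z2)" for n
  proof -
    obtain m l where "lp_bounds p f (real n) m l" using LC_fun_lp_bounds[OF assms] by blast
    from lp_boundsD(4)[OF this] lp_boundsD(2)[OF this] show ?thesis
      unfolding lp_fun_def by (auto elim!: eventually_mono)
  qed
  then have "AE t in lborel. \<forall>n. \<exists>l\<ge>0. \<forall>z1 \<in> cball 0 (real n). \<forall>z2 \<in> cball 0 (real n). norm (f t z1 - f t z2) \<le> l * norm (z1 - z2)"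
    by (simp add: AE_all_countable)
  then show ?thesis
  proof eventually_elim
    case (elim t)
    have "continuous (at z) (f t)" for z
    proof -
      obtain n where n: "norm z < real n" using reals_Archimedean2 by blast
      obtain l where l: "l \<ge> 0" "\<forall>z1 \<in> cball 0 (real n). \<forall>z2 \<in> cball 0 (real n). norm (f t z1 - f t z2) \<le> l * norm (z1 - z2)"
        using elim by blast
      have "l-lipschitz_on (ball 0 (real n)) (f t)"
        using l by (intro lipschitz_onI) (auto simp: dist_norm)
      then have "continuous_on (ball 0 (real n)) (f t)" by (rule lipschitz_on_continuous_on)
      then show ?thesis using n by (auto simp: continuous_on_eq_continuous_at)
    qed
    then show ?case by (simp add: continuous_at_imp_continuous_on)
  qed
qed

lemma AE_eq_continuous_imp_eq:
  fixes f g :: "'a::euclidean_space \<Rightarrow> 'b::t2_space"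
  assumes f: "continuous_on UNIV f" and g: "continuous_on UNIV g" and ae: "AE z in lborel. f z = g z"
  shows "f = g"
proof (rule ccontr)
  assume "f \<noteq> g"
  have "open {z. f z \<noteq> g z}" using open_Collect_neq[OF f g] .
  then have "\<not> negligible {z. f z \<noteq> g z}" using \<open>f \<noteq> g\<close> by (intro open_not_negligible) auto
  moreover have "negligible {z. f z \<noteq> g z}"
  proof -
    have "{z. f z \<noteq> g z} \<in> null_sets lborel"
      using ae \<open>open {z. f z \<noteq> g z}\<close> by (subst AE_iff_null_sets) auto
    then show ?thesis by (simp add: negligible_iff_null_sets null_sets_completionI)
  qed
  ultimately show False by blast
qed

text \<open>By Fubini, equality almost everywhere gives for almost every \<open>t\<close> equality
  at almost every \<open>z\<close>, and continuity in \<open>z\<close> extends it to all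
  \<open>z\<close>. This is what makes evaluation along a curve meaningful for a class, although the
  graph of a curve is a null set.\<close>

lemma LC_rel_iff:
  assumes f: "f \<in> LC_fun p" and g: "g \<in> LC_fun p"
  shows "(f, g) \<in> LC_rel p \<longleftrightarrow> (AE t in lborel. \<forall>z. f t z = g t z)"
proof
  assume "(f, g) \<in> LC_rel p"
  then have "AE q in lborel \<Otimes>\<^sub>M lborel. f (fst q) (snd q) = g (fst q) (snd q)"
    unfolding lborel_prod by (simp add: LC_rel_def)
  from lborel_pair.AE_pair[OF this] have "AE t in lborel. AE z in lborel. f t z = g t z"
    by simp
  then show "AE t in lborel. \<forall>z. f t z = g t z"
    using LC_fun_AE_continuous[OF f] LC_fun_AE_continuous[OF g]
  proof eventually_elim
    case (elim t)
    then show ?case using AE_eq_continuous_imp_eq[of "f t" "g t"] by auto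
  qed
next
  assume ae: "AE t in lborel. \<forall>z. f t z = g t z"
  have "(\<lambda>q. f (fst q) (snd q)) \<in> borel_measurable borel" "(\<lambda>q. g (fst q) (snd q)) \<in> borel_measurable borel"
    using f g by (auto simp: LC_fun_def split_def)
  then have "(\<lambda>q. f (fst q) (snd q) - g (fst q) (snd q)) \<in> borel_measurable borel"
    by (rule borel_measurable_diff)
  from measurable_sets[OF this, of "{0}"]
  have "{q \<in> space borel. f (fst q) (snd q) = g (fst q) (snd q)} \<in> sets borel"
    by (simp add: vimage_def)
  then have "{q \<in> space (lborel \<Otimes>\<^sub>M lborel). f (fst q) (snd q) = g (fst q) (snd q)} \<in> sets (lborel \<Otimes>\<^sub>M lborel)"
    unfolding lborel_prod by simp
  then have "AE q in lborel \<Otimes>\<^sub>M lborel. f (fst q) (snd q) = g (fst q) (snd q)"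
    by (rule lborel_pair.AE_pair_measure) (use ae in \<open>auto elim!: eventually_mono\<close>)
  then show "(f, g) \<in> LC_rel p" using f g unfolding lborel_prod LC_rel_def by simp
qed

lemma equiv_LC_rel: "equiv (LC_fun p) (LC_rel p :: ('n::finite delay_field \<times> 'n delay_field) set)"
proof (rule equivI)
  let ?R = "LC_rel p :: ('n delay_field \<times> 'n delay_field) set"
  show "?R \<subseteq> LC_fun p \<times> LC_fun p" by (auto simp: LC_rel_def)
  show "refl_on (LC_fun p) ?R" by (auto simp: refl_on_def LC_rel_def)
  show "sym ?R" by (auto simp: sym_def LC_rel_def elim!: eventually_mono)
  show "trans ?R"
  proof (rule transI)
    fix f g h :: "'n delay_field" assume "(f, g) \<in> LC_rel p" "(g, h) \<in> LC_rel p"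
    then have "f \<in> LC_fun p" "h \<in> LC_fun p" "AE q in lborel. f (fst q) (snd q) = g (fst q) (snd q)"
      "AE q in lborel. g (fst q) (snd q) = h (fst q) (snd q)" by (auto simp: LC_rel_def)
    moreover from this(3,4) have "AE q in lborel. f (fst q) (snd q) = h (fst q) (snd q)" by eventually_elim simp
    ultimately show "(f, h) \<in> LC_rel p" by (simp add: LC_rel_def)
  qed
qed

lemma LC_rep_in: "G \<in> LC p \<Longrightarrow> LC_rep G \<in> G"
  unfolding LC_rep_def LC_def by (simp add: in_quotient_imp_non_empty[OF equiv_LC_rel] some_in_eq)

lemma LC_rep_LC_fun: "G \<in> LC p \<Longrightarrow> LC_rep G \<in> LC_fun p"
proof -
  assume G: "G \<in> LC p"
  then have "G \<subseteq> LC_fun p" unfolding LC_def by (rule in_quotient_imp_subset[OF equiv_LC_rel])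
  then show ?thesis using LC_rep_in[OF G] by (rule subsetD)
qed

lemma LC_memI: "f \<in> LC_fun p \<Longrightarrow> LC_class p f \<in> LC p"
  unfolding LC_class_def LC_def by (rule quotientI)

lemma LC_eq_class: "G \<in> LC p \<Longrightarrow> g \<in> G \<Longrightarrow> G = LC_class p g"
proof -
  assume G: "G \<in> LC p" "g \<in> G"
  then obtain f where f: "f \<in> LC_fun p" "G = LC_rel p `` {f}" unfolding LC_def by (elim quotientE)
  then have "(f, g) \<in> LC_rel p" using G(2) by simp
  then show ?thesis unfolding LC_class_def f(2) by (rule equiv_class_eq[OF equiv_LC_rel])
qed

lemma LC_class_rep: "G \<in> LC p \<Longrightarrow> LC_class p (LC_rep G) = G"
  by (rule LC_eq_class[OF _ LC_rep_in, symmetric])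

lemma LC_rep_class_AE:
  assumes "f \<in> LC_fun p"
  shows "AE t in lborel. \<forall>z. LC_rep (LC_class p f) t z = f t z"
proof -
  have "LC_rep (LC_class p f) \<in> LC_class p f" using LC_rep_in[OF LC_memI[OF assms]] .
  then have "(f, LC_rep (LC_class p f)) \<in> LC_rel p" by (simp add: LC_class_def)
  then have "AE t in lborel. \<forall>z. f t z = LC_rep (LC_class p f) t z"
    using LC_rel_iff[OF assms LC_rep_LC_fun[OF LC_memI[OF assms]]] by simp
  then show ?thesis by eventually_elim simp
qed

lemma translate_translate: "translate s (translate t f) = translate (s + t) f"
  by (simp add: translate_def add.assoc)

lemma translate_0: "translate 0 f = f"
  by (simp add: translate_def)

lemma LC_rel_translate:
  assumes "(f, g) \<in> LC_rel p" shows "(translate c f, translate c g) \<in> LC_rel p"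
proof -
  have fg: "f \<in> LC_fun p" "g \<in> LC_fun p" using assms by (auto simp: LC_rel_def)
  then have "AE t in lborel. \<forall>z. f t z = g t z" using assms LC_rel_iff by blast
  then have "AE t in lborel. \<forall>z. f (t + c) z = g (t + c) z" by (rule AE_lborel_shift)
  then show ?thesis
    using fg by (subst LC_rel_iff) (auto simp: LC_fun_translate, simp add: translate_def)
qed

lemma translate_image_class:
  assumes "f \<in> LC_fun p"
  shows "translate c ` LC_class p f = LC_class p (translate c f)"
proof (rule set_eqI iffI)+
  fix g assume "g \<in> translate c ` LC_class p f"
  then show "g \<in> LC_class p (translate c f)" by (auto simp: LC_class_def LC_rel_translate)
next
  fix g assume "g \<in> LC_class p (translate c f)"
  then have "(translate (- c) (translate c f), translate (- c) g) \<in> LC_rel p"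
    by (intro LC_rel_translate) (simp add: LC_class_def)
  then have "translate (- c) g \<in> LC_class p f" by (simp add: LC_class_def translate_translate translate_0)
  moreover have "g = translate c (translate (- c) g)" by (simp add: translate_translate translate_0)
  ultimately show "g \<in> translate c ` LC_class p f" by blast
qed

lemma translate_image:
  assumes "G \<in> LC p"
  shows "translate c ` G = LC_class p (translate c (LC_rep G))" "translate c ` G \<in> LC p"
    "AE t in lborel. \<forall>z. LC_rep (translate c ` G) t z = LC_rep G (t + c) z"
proof -
  show 1: "translate c ` G = LC_class p (translate c (LC_rep G))"
    using translate_image_class[OF LC_rep_LC_fun[OF assms], of c] LC_class_rep[OF assms] by simp
  show "translate c ` G \<in> LC p" unfolding 1 by (intro LC_memI LC_fun_translate LC_rep_LC_fun assms)
  show "AE t in lborel. \<forall>z. LC_rep (translate c ` G) t z = LC_rep G (t + c) z"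
    using LC_rep_class_AE[OF LC_fun_translate[OF LC_rep_LC_fun[OF assms], of c]]
    unfolding 1 by (simp add: translate_def)
qed

section \<open>Topologies generated by families of curves\<close>

declare split_paired_All [simp del] split_paired_Ex [simp del]

definition curve_seminorm :: "nat \<Rightarrow> real \<Rightarrow> real \<Rightarrow> (real \<Rightarrow> (real ^ 'n) \<times> (real ^ 'n)) set \<Rightarrow> 'n::finite delay_field \<Rightarrow> real" where
  "curve_seminorm p a b W h = (SUP w\<in>W. root p (LINT t:{a..b}|lborel. norm (h t (w t)) ^ p))"

lemma AE_shift_pint_le:
  assumes h: "h \<in> LC_fun p" and p: "p > 0" and w': "set_borel_measurable borel {a'..b'} w'"
    and ab: "a' \<le> a + t" "b + t \<le> b'" and eq: "\<And>s. a \<le> s \<Longrightarrow> s \<le> b \<Longrightarrow> w' (s + t) = w s"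
  shows "pint p a b (\<lambda>s. translate t h s (w s)) \<le> pint p a' b' (\<lambda>s. h s (w' s))"
proof -
  define v where "v s = indicator {a'..b'} s *\<^sub>R w' s" for s
  have v: "v \<in> borel_measurable borel"
    using w' by (simp add: v_def[abs_def] set_borel_measurable_def)
  have "pint p a b (\<lambda>s. translate t h s (w s)) = pint p a b (\<lambda>s. (\<lambda>s. h s (v s)) (s + t))"
    by (intro pint_cong_AE AE_I2) (use ab in \<open>simp add: translate_def v_def eq\<close>)
  also have "\<dots> = pint p (a + t) (b + t) (\<lambda>s. h s (v s))"
    by (rule pint_shift) (rule LC_fun_measurable[OF h v])
  also have "\<dots> \<le> pint p a' b' (\<lambda>s. h s (v s))" by (rule pint_mono_interval[OF ab])
  also have "\<dots> = pint p a' b' (\<lambda>s. h s (w' s))"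
    by (intro pint_cong_AE AE_I2) (simp add: v_def)
  finally show ?thesis .
qed

text \<open>In the last assumption a single member of the family has to absorb all translates by at
  most \<open>R\<close>. This gives the local uniformity in \<open>t\<close> behind joint continuity
  of the translation; the translated interval itself may fail to have rational endpoints and then
  does not occur in the family.\<close>

locale curve_family =
  fixes p :: nat and \<W> :: "(real \<times> real \<times> (real \<Rightarrow> (real ^ 'n::finite) \<times> (real ^ 'n)) set) set"
  assumes p1: "p > 1"
    and family_nonempty: "\<W> \<noteq> {}"
    and curves: "\<And>a b W. (a, b, W) \<in> \<W> \<Longrightarrow> W \<noteq> {} \<and> (\<exists>r. \<forall>w\<in>W. set_borel_measurable borel {a..b} w \<and>
        (\<forall>t. a \<le> t \<longrightarrow> t \<le> b \<longrightarrow> norm (w t) \<le> r))"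
    and curves_shift: "\<And>a b W R. (a, b, W) \<in> \<W> \<Longrightarrow> \<exists>a' b' W'. (a', b', W') \<in> \<W> \<and> (\<forall>t. \<bar>t\<bar> \<le> R \<longrightarrow>
        a' \<le> a + t \<and> b + t \<le> b' \<and> (\<forall>w\<in>W. \<exists>w'\<in>W'. \<forall>s. a \<le> s \<longrightarrow> s \<le> b \<longrightarrow> w' (s + t) = w s))"
begin

lemma p0: "p > 0" using p1 by simp

definition curve_topology :: "'n delay_field set topology" where
  "curve_topology = LC_seminorm_topology p {curve_seminorm p a b W | a b W. (a, b, W) \<in> \<W>}"

lemma curve_measurable:
  "(a, b, W) \<in> \<W> \<Longrightarrow> w \<in> W \<Longrightarrow> set_borel_measurable borel {a..b} w"
  using curves[of a b W] by auto

lemma curve_pint_finite: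
  assumes "(a, b, W) \<in> \<W>" "w \<in> W" "h \<in> LC_fun p"
  shows "pint p a b (\<lambda>t. h t (w t)) < \<infinity>"
proof -
  obtain r where "\<And>t. a \<le> t \<Longrightarrow> t \<le> b \<Longrightarrow> norm (w t) \<le> r" using curves[OF assms(1)] assms(2) by auto
  then show ?thesis by (rule LC_fun_pint_finite[OF assms(3)])
qed

lemma curve_pint_eq:
  assumes "(a, b, W) \<in> \<W>" "w \<in> W" "h \<in> LC_fun p"
  shows "pint p a b (\<lambda>t. h t (w t)) = ennreal (LINT t:{a..b}|lborel. norm (h t (w t)) ^ p)"
    and "set_integrable lborel {a..b} (\<lambda>t. norm (h t (w t)) ^ p)"
  using pint_eq_set_integral[OF p0 LC_fun_set_measurable[OF assms(3) curve_measurable[OF assms(1,2)]] curve_pint_finite[OF assms]]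
  by simp_all

lemma set_integral_norm_power_nonneg: "0 \<le> (LINT t:A|M. norm (u t) ^ p)"
  unfolding set_lebesgue_integral_def by (rule Bochner_Integration.integral_nonneg) auto

lemma root_le_if_pint_le:
  assumes "(a, b, W) \<in> \<W>" "w \<in> W" "h \<in> LC_fun p" "pint p a b (\<lambda>t. h t (w t)) \<le> ennreal (c ^ p)" "c \<ge> 0"
  shows "root p (LINT t:{a..b}|lborel. norm (h t (w t)) ^ p) \<le> c"
proof -
  have "(LINT t:{a..b}|lborel. norm (h t (w t)) ^ p) \<le> c ^ p"
    using assms(4,5) by (simp add: curve_pint_eq(1)[OF assms(1-3)] ennreal_le_iff)
  then have "root p (LINT t:{a..b}|lborel. norm (h t (w t)) ^ p) \<le> root p (c ^ p)" using p0 by simp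
  then show ?thesis using p0 assms(5) by (simp add: real_root_power_cancel)
qed

lemma curve_seminorm_leI:
  assumes "(a, b, W) \<in> \<W>" "h \<in> LC_fun p" "c \<ge> 0"
    and "\<And>w. w \<in> W \<Longrightarrow> pint p a b (\<lambda>t. h t (w t)) \<le> ennreal (c ^ p)"
  shows "curve_seminorm p a b W h \<le> c"
  unfolding curve_seminorm_def
  by (rule cSUP_least) (use curves[OF assms(1)] root_le_if_pint_le[OF assms(1) _ assms(2) assms(4) assms(3)] in auto)

text \<open>A real supremum says something only for a set that is bounded above. The bound comes
  from the \<open>m\<close> function of \<open>h\<close> on a ball that contains all curves of
  \<open>W\<close>.\<close>

lemma curve_seminorm_upper:
  assumes W: "(a, b, W) \<in> \<W>" and w: "w \<in> W" and h: "h \<in> LC_fun p"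
  shows "root p (LINT t:{a..b}|lborel. norm (h t (w t)) ^ p) \<le> curve_seminorm p a b W h"
  unfolding curve_seminorm_def
proof (rule cSUP_upper[OF w])
  obtain r where r: "\<And>w t. w \<in> W \<Longrightarrow> a \<le> t \<Longrightarrow> t \<le> b \<Longrightarrow> norm (w t) \<le> r" using curves[OF W] by auto
  obtain m l where ml: "lp_bounds p h r m l" using LC_fun_lp_bounds[OF h] by blast
  define c where "c = root p (LINT t:{a..b}|lborel. m t ^ p)"
  have nn: "0 \<le> (LINT t:{a..b}|lborel. m t ^ p)"
    unfolding set_lebesgue_integral_def using lp_boundsD(1)[OF ml]
    by (intro Bochner_Integration.integral_nonneg) (auto simp: lp_fun_def)
  have c: "c \<ge> 0" "ennreal (c ^ p) = pint p a b m"
    using p0 nn by (simp_all add: c_def lp_fun_pint[OF lp_boundsD(1)[OF ml]])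
  show "bdd_above ((\<lambda>w. root p (LINT t:{a..b}|lborel. norm (h t (w t)) ^ p)) ` W)"
  proof (rule bdd_aboveI2)
    fix w assume "w \<in> W"
    then show "root p (LINT t:{a..b}|lborel. norm (h t (w t)) ^ p) \<le> c"
      using LC_fun_pint_le[OF ml, of a b w] r by (intro root_le_if_pint_le[OF W _ h _ c(1)]) (auto simp: c(2))
  qed
qed

lemma curve_seminorm_nonneg:
  assumes W: "(a, b, W) \<in> \<W>" and h: "h \<in> LC_fun p"
  shows "0 \<le> curve_seminorm p a b W h"
proof -
  obtain w where w: "w \<in> W" using curves[OF W] by auto
  have "0 \<le> root p (LINT t:{a..b}|lborel. norm (h t (w t)) ^ p)"
    using p0 by (simp add: set_integral_norm_power_nonneg)
  also have "\<dots> \<le> curve_seminorm p a b W h" by (rule curve_seminorm_upper[OF W w h])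
  finally show ?thesis .
qed

lemma pint_le_curve_seminorm:
  assumes W: "(a, b, W) \<in> \<W>" and w: "w \<in> W" and h: "h \<in> LC_fun p"
  shows "pint p a b (\<lambda>t. h t (w t)) \<le> ennreal (curve_seminorm p a b W h ^ p)"
proof -
  let ?I = "LINT t:{a..b}|lborel. norm (h t (w t)) ^ p"
  have "?I = root p ?I ^ p" using p0 by (simp add: set_integral_norm_power_nonneg)
  also have "\<dots> \<le> curve_seminorm p a b W h ^ p"
    using p0 by (intro power_mono curve_seminorm_upper[OF W w h]) (simp add: set_integral_norm_power_nonneg)
  finally show ?thesis unfolding curve_pint_eq(1)[OF W w h] by (rule ennreal_leI)
qed

lemma curve_seminorm_mono:
  assumes W: "(a, b, W) \<in> \<W>" and W': "(a', b', W') \<in> \<W>" and h: "h \<in> LC_fun p" and h': "h' \<in> LC_fun p"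
    and le: "\<And>w. w \<in> W \<Longrightarrow> \<exists>w'\<in>W'. pint p a b (\<lambda>t. h t (w t)) \<le> pint p a' b' (\<lambda>t. h' t (w' t))"
  shows "curve_seminorm p a b W h \<le> curve_seminorm p a' b' W' h'"
proof (rule curve_seminorm_leI[OF W h curve_seminorm_nonneg[OF W' h']])
  fix w assume "w \<in> W"
  then obtain w' where w': "w' \<in> W'" "pint p a b (\<lambda>t. h t (w t)) \<le> pint p a' b' (\<lambda>t. h' t (w' t))" using le by blast
  show "pint p a b (\<lambda>t. h t (w t)) \<le> ennreal (curve_seminorm p a' b' W' h' ^ p)"
    using w'(2) pint_le_curve_seminorm[OF W' w'(1) h'] by (rule order_trans)
qed

lemma curve_seminorm_cong:
  assumes W: "(a, b, W) \<in> \<W>" and h: "h \<in> LC_fun p" and h': "h' \<in> LC_fun p"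
    and ae: "AE t in lborel. \<forall>z. h t z = h' t z"
  shows "curve_seminorm p a b W h = curve_seminorm p a b W h'"
proof -
  have "pint p a b (\<lambda>t. h t (w t)) = pint p a b (\<lambda>t. h' t (w t))" for w
  proof (rule pint_cong_AE)
    show "AE s in lborel. a \<le> s \<and> s \<le> b \<longrightarrow> norm (h s (w s)) = norm (h' s (w s))"
      using ae
    proof eventually_elim
      case (elim s)
      from elim[THEN spec[of _ "w s"]] show ?case by simp
    qed
  qed
  then show ?thesis
    by (intro antisym curve_seminorm_mono[OF W W h h'] curve_seminorm_mono[OF W W h' h]) force+
qed

lemma curve_seminorm_triangle:
  assumes W: "(a, b, W) \<in> \<W>" and f: "f \<in> LC_fun p" and g: "g \<in> LC_fun p" and k: "k \<in> LC_fun p"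
  shows "curve_seminorm p a b W (\<lambda>t z. f t z - g t z)
    \<le> curve_seminorm p a b W (\<lambda>t z. f t z - k t z) + curve_seminorm p a b W (\<lambda>t z. k t z - g t z)"
  unfolding curve_seminorm_def[of p a b W "\<lambda>t z. f t z - g t z"]
proof (rule cSUP_least)
  show "W \<noteq> {}" using curves[OF W] by simp
  fix w assume w: "w \<in> W"
  let ?u = "\<lambda>t. indicator {a..b} t *\<^sub>R (f t (w t) - k t (w t))" and ?v = "\<lambda>t. indicator {a..b} t *\<^sub>R (k t (w t) - g t (w t))"
  have fk: "(\<lambda>t z. f t z - k t z) \<in> LC_fun p" and kg: "(\<lambda>t z. k t z - g t z) \<in> LC_fun p"
    using LC_fun_diff[OF p0] f g k by auto
  have eq: "indicator {a..b} t *\<^sub>R norm v ^ p = norm (indicator {a..b} t *\<^sub>R v) ^ p" for t and v :: "real ^ 'n"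
    using p0 by (cases "t \<in> {a..b}") auto
  have "root p (LINT t|lborel. norm (?u t + ?v t) ^ p)
     \<le> root p (LINT t|lborel. norm (?u t) ^ p) + root p (LINT t|lborel. norm (?v t) ^ p)"
  proof (rule Minkowski_inequality[OF p0])
    show "?u \<in> borel_measurable lborel" "?v \<in> borel_measurable lborel"
      using LC_fun_set_measurable[OF fk curve_measurable[OF W w]] LC_fun_set_measurable[OF kg curve_measurable[OF W w]]
      by (simp_all add: set_borel_measurable_def)
    show "integrable lborel (\<lambda>t. norm (?u t) ^ p)" "integrable lborel (\<lambda>t. norm (?v t) ^ p)"
      using curve_pint_eq(2)[OF W w fk] curve_pint_eq(2)[OF W w kg] unfolding set_integrable_def eq .
  qed
  moreover have "?u t + ?v t = indicator {a..b} t *\<^sub>R (f t (w t) - g t (w t))" for t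
    by (simp flip: scaleR_add_right)
  moreover have "(LINT t:{a..b}|lborel. norm (u t) ^ p) = (LINT t|lborel. norm (indicator {a..b} t *\<^sub>R u t) ^ p)"
    for u :: "real \<Rightarrow> real ^ 'n"
    unfolding set_lebesgue_integral_def eq ..
  ultimately have "root p (LINT t:{a..b}|lborel. norm (f t (w t) - g t (w t)) ^ p)
     \<le> root p (LINT t:{a..b}|lborel. norm (f t (w t) - k t (w t)) ^ p) + root p (LINT t:{a..b}|lborel. norm (k t (w t) - g t (w t)) ^ p)"
    by (simp only:)
  also have "\<dots> \<le> curve_seminorm p a b W (\<lambda>t z. f t z - k t z) + curve_seminorm p a b W (\<lambda>t z. k t z - g t z)"
    by (intro add_mono curve_seminorm_upper[OF W w fk] curve_seminorm_upper[OF W w kg])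
  finally show "root p (LINT t:{a..b}|lborel. norm (f t (w t) - g t (w t)) ^ p)
     \<le> curve_seminorm p a b W (\<lambda>t z. f t z - k t z) + curve_seminorm p a b W (\<lambda>t z. k t z - g t z)" .
qed

lemma curve_seminorm_translate:
  assumes W: "(a, b, W) \<in> \<W>"
  obtains a' b' W' where "(a', b', W') \<in> \<W>"
    "\<And>(h :: 'n delay_field) t. h \<in> LC_fun p \<Longrightarrow> \<bar>t\<bar> \<le> R \<Longrightarrow> curve_seminorm p a b W (translate t h) \<le> curve_seminorm p a' b' W' h"
proof -
  obtain a' b' W' where W': "(a', b', W') \<in> \<W>" and sh: "\<And>t. \<bar>t\<bar> \<le> R \<Longrightarrow>
        a' \<le> a + t \<and> b + t \<le> b' \<and> (\<forall>w\<in>W. \<exists>w'\<in>W'. \<forall>s. a \<le> s \<longrightarrow> s \<le> b \<longrightarrow> w' (s + t) = w s)"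
    using curves_shift[OF W, of R] by blast
  show thesis
  proof (rule that[OF W'])
    fix h :: "'n delay_field" and t assume h: "h \<in> LC_fun p" and t: "\<bar>t\<bar> \<le> R"
    show "curve_seminorm p a b W (translate t h) \<le> curve_seminorm p a' b' W' h"
    proof (rule curve_seminorm_mono[OF W W' LC_fun_translate[OF h] h])
      fix w assume "w \<in> W"
      then obtain w' where w': "w' \<in> W'" "\<And>s. a \<le> s \<Longrightarrow> s \<le> b \<Longrightarrow> w' (s + t) = w s" using sh[OF t] by blast
      have "pint p a b (\<lambda>s. translate t h s (w s)) \<le> pint p a' b' (\<lambda>s. h s (w' s))"
        using sh[OF t] by (intro AE_shift_pint_le[OF h p0 curve_measurable[OF W' w'(1)]]) (auto simp: w'(2))
      then show "\<exists>w'\<in>W'. pint p a b (\<lambda>s. translate t h s (w s)) \<le> pint p a' b' (\<lambda>s. h s (w' s))"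
        using w'(1) by blast
    qed
  qed
qed

text \<open>On a ball, a Lipschitz field is controlled by its values on a finite net, so
  translation continuity of finitely many \<open>L\<^sup>p\<close> functions suffices.\<close>

lemma curve_seminorm_translation_continuous:
  assumes W: "(a, b, W) \<in> \<W>" and g: "g \<in> LC_fun p" and e: "e > 0"
  obtains d where "d > 0"
    "\<And>t. \<bar>t - t0\<bar> < d \<Longrightarrow> curve_seminorm p a b W (\<lambda>s z. translate t g s z - translate t0 g s z) < e"
proof -
  obtain r where r: "\<And>w t. w \<in> W \<Longrightarrow> a \<le> t \<Longrightarrow> t \<le> b \<Longrightarrow> norm (w t) \<le> r" using curves[OF W] by auto
  obtain m l where ml: "lp_bounds p g r m l" using LC_fun_lp_bounds[OF g] by blast
  note l = lp_boundsD(2)[OF ml]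
  have lm: "l \<in> borel_measurable borel" and l0: "l s \<ge> 0" for s using l by (auto simp: lp_fun_def)
  have lsh [measurable]: "(\<lambda>s. l (s + x)) \<in> borel_measurable borel" for x
    using lp_fun_shift[OF l, of x] by (simp add: lp_fun_def)
  define I where "I = (LINT s:{a - \<bar>t0\<bar> - 1..b + \<bar>t0\<bar> + 1}|lborel. l s ^ p)"
  have I0: "I \<ge> 0" unfolding I_def set_lebesgue_integral_def using l0
    by (intro Bochner_Integration.integral_nonneg) auto
  \<comment> \<open>The budget: \<open>J\<close> collects the factors \<open>2 ^ p\<close> of
    \<open>pint_sum_le\<close> and \<open>pint_add_le\<close> in the Lipschitz error, which \<eta>
    brings below \<open>c / 2\<close>; \<open>c1\<close> is such that the errors at all points of
    the net together stay below \<open>c / 4\<close>.\<close>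
  define c where "c = (e / 2) ^ p"
  have c: "c > 0" using e by (simp add: c_def)
  define J where "J = 2 ^ p * (2 ^ p * (I + I))"
  have J0: "J \<ge> 0" using I0 by (simp add: J_def)
  define \<eta> where "\<eta> = min 1 (c / 2 / (J + 1))"
  have \<eta>: "\<eta> > 0" "\<eta> \<le> 1" "\<eta> * J \<le> c / 2"
  proof -
    show "\<eta> > 0" "\<eta> \<le> 1" using c J0 by (auto simp: \<eta>_def)
    have "\<eta> * J \<le> c / 2 / (J + 1) * (J + 1)" using c J0 by (intro mult_mono) (auto simp: \<eta>_def)
    also have "\<dots> = c / 2" using J0 by (subst nonzero_eq_divide_eq[symmetric]) auto
    finally show "\<eta> * J \<le> c / 2" .
  qed
  obtain F :: "((real ^ 'n) \<times> (real ^ 'n)) set" where F: "finite F" "F \<subseteq> cball 0 r" "cball 0 r \<subseteq> (\<Union>z\<in>F. ball z \<eta>)"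
    using seq_compact_imp_totally_bounded[OF compact_imp_seq_compact[OF compact_cball, of 0 r], rule_format, OF \<eta>(1)]
    by (elim exE conjE)
  define c1 where "c1 = c / 4 / 2 ^ p / (real (card F) + 1)"
  have c1: "c1 > 0" using c by (auto simp: c1_def)
  have "\<exists>d. d > 0 \<and> (\<forall>t. \<bar>t - t0\<bar> < d \<longrightarrow> pint p a b (\<lambda>s. g (s + t) z - g (s + t0) z) < ennreal c1)" for z
  proof -
    have gm: "(\<lambda>s. g s z) \<in> borel_measurable borel" by (rule LC_fun_measurable[OF g]) simp
    have gf: "pint p a b (\<lambda>s. g s z) < \<infinity>" for a b
      by (rule LC_fun_pint_finite[OF g, of _ _ "\<lambda>_. z" "norm z"]) simp
    show ?thesis
      by (rule pint_translation_continuous[OF gm p0 gf c1, of t0 a b]) blast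
  qed
  then obtain d where "\<forall>z. d z > 0 \<and> (\<forall>t. \<bar>t - t0\<bar> < d z \<longrightarrow> pint p a b (\<lambda>s. g (s + t) z - g (s + t0) z) < ennreal c1)"
    using choice[of "\<lambda>z d. d > 0 \<and> (\<forall>t. \<bar>t - t0\<bar> < d \<longrightarrow> pint p a b (\<lambda>s. g (s + t) z - g (s + t0) z) < ennreal c1)"] by auto
  then have d: "\<And>z. d z > 0"
    "\<And>z t. \<bar>t - t0\<bar> < d z \<Longrightarrow> pint p a b (\<lambda>s. g (s + t) z - g (s + t0) z) < ennreal c1" by simp_all
  show thesis
  proof
    \<comment> \<open>The element 1 keeps \<open>t\<close> within distance 1 of \<open>t0\<close>,
      so that one interval serves all integrals of the Lipschitz bound, and it makes the minimum
      meaningful for an empty net.\<close>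
    show "Min (insert 1 (d ` F)) > 0" using F(1) d(1) by auto
    fix t assume t: "\<bar>t - t0\<bar> < Min (insert 1 (d ` F))"
    then have t1: "\<bar>t - t0\<bar> < 1" and tz: "\<And>z. z \<in> F \<Longrightarrow> \<bar>t - t0\<bar> < d z" using F(1) by auto
    have tr: "translate t g \<in> LC_fun p" "translate t0 g \<in> LC_fun p" by (rule LC_fun_translate[OF g])+
    have "curve_seminorm p a b W (\<lambda>s z. translate t g s z - translate t0 g s z) \<le> e / 2"
    proof (rule curve_seminorm_leI[OF W LC_fun_diff[OF p0 tr]])
      fix w assume w: "w \<in> W"
      have "pint p a b (\<lambda>s. translate t g s (w s) - translate t0 g s (w s))
        \<le> ennreal (2 ^ p) * ((\<Sum>z\<in>F. pint p a b (\<lambda>s. g (s + t) z - g (s + t0) z))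
             + ennreal (\<eta> ^ p) * pint p a b (\<lambda>s. l (s + t) + l (s + t0)))"
      proof (rule pint_sum_le[OF p0 F(1)])
        show "set_borel_measurable borel {a..b} (\<lambda>s. g (s + t) z - g (s + t0) z)" for z
        proof -
          have "set_borel_measurable borel {a..b} (\<lambda>s. (\<lambda>s z. translate t g s z - translate t0 g s z) s ((\<lambda>_. z) s))"
            by (rule LC_fun_set_measurable[OF LC_fun_diff[OF p0 tr]]) (simp add: set_borel_measurable_def)
          then show ?thesis by (simp add: translate_def)
        qed
        show "set_borel_measurable borel {a..b} (\<lambda>s. l (s + t) + l (s + t0))"
          unfolding set_borel_measurable_def by measurable
        show "AE s in lborel. a \<le> s \<and> s \<le> b \<longrightarrow> (\<exists>z\<in>F. norm (translate t g s (w s) - translate t0 g s (w s))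
            \<le> norm (g (s + t) z - g (s + t0) z) + \<eta> * norm (l (s + t) + l (s + t0)))"
          using AE_lborel_shift[OF lp_boundsD(4)[OF ml], of t] AE_lborel_shift[OF lp_boundsD(4)[OF ml], of t0]
        proof eventually_elim
          case (elim s)
          show ?case
          proof
            assume s: "a \<le> s \<and> s \<le> b"
            have ws: "w s \<in> cball 0 r" using r[OF w] s by simp
            then obtain z where z: "z \<in> F" "w s \<in> ball z \<eta>" using F(3) by blast
            have zr: "z \<in> cball 0 r" using z(1) F(2) by blast
            have nz: "norm (w s - z) \<le> \<eta>" using z(2) by (simp add: dist_norm norm_minus_commute)
            have 1: "norm (g (s + t) (w s) - g (s + t) z) \<le> l (s + t) * \<eta>"
              using elim(1)[rule_format, OF ws zr] mult_left_mono[OF nz l0, of "s + t"] by linarith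
            have 2: "norm (g (s + t0) (w s) - g (s + t0) z) \<le> l (s + t0) * \<eta>"
              using elim(2)[rule_format, OF ws zr] mult_left_mono[OF nz l0, of "s + t0"] by linarith
            have "g (s + t) (w s) - g (s + t0) (w s) = (g (s + t) z - g (s + t0) z)
               + ((g (s + t) (w s) - g (s + t) z) - (g (s + t0) (w s) - g (s + t0) z))" by simp
            then have "norm (g (s + t) (w s) - g (s + t0) (w s)) \<le> norm (g (s + t) z - g (s + t0) z)
               + norm ((g (s + t) (w s) - g (s + t) z) - (g (s + t0) (w s) - g (s + t0) z))"
              by (metis norm_triangle_ineq)
            also have "norm ((g (s + t) (w s) - g (s + t) z) - (g (s + t0) (w s) - g (s + t0) z))
               \<le> l (s + t) * \<eta> + l (s + t0) * \<eta>"
              by (rule order_trans[OF norm_triangle_ineq4 add_mono[OF 1 2]])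
            finally have "norm (g (s + t) (w s) - g (s + t0) (w s))
               \<le> norm (g (s + t) z - g (s + t0) z) + \<eta> * norm (l (s + t) + l (s + t0))"
              using l0[of "s + t"] l0[of "s + t0"] by (simp add: algebra_simps)
            then show "\<exists>z\<in>F. norm (translate t g s (w s) - translate t0 g s (w s))
               \<le> norm (g (s + t) z - g (s + t0) z) + \<eta> * norm (l (s + t) + l (s + t0))"
              using z(1) by (auto simp: translate_def)
          qed
        qed
      qed (use \<eta> in auto)
      also have "\<dots> \<le> ennreal (2 ^ p) * (ennreal (card F * c1) + ennreal (\<eta> ^ p) * ennreal (2 ^ p * (I + I)))"
      proof (intro mult_left_mono add_mono)
        have "(\<Sum>z\<in>F. pint p a b (\<lambda>s. g (s + t) z - g (s + t0) z)) \<le> (\<Sum>z\<in>F. ennreal c1)"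
          using tz d(2) by (intro sum_mono less_imp_le) auto
        also have "\<dots> = ennreal (card F * c1)" using c1 by (simp add: ennreal_mult ennreal_of_nat_eq_real_of_nat)
        finally show "(\<Sum>z\<in>F. pint p a b (\<lambda>s. g (s + t) z - g (s + t0) z)) \<le> ennreal (card F * c1)" .
        have sh: "pint p a b (\<lambda>s. l (s + x)) \<le> ennreal I" if "\<bar>x - t0\<bar> < 1" for x
        proof -
          have "pint p a b (\<lambda>s. l (s + x)) = pint p (a + x) (b + x) l" by (rule pint_shift[OF lm])
          also have "\<dots> \<le> pint p (a - \<bar>t0\<bar> - 1) (b + \<bar>t0\<bar> + 1) l"
            using that by (intro pint_mono_interval) linarith+
          also have "\<dots> = ennreal I" unfolding I_def by (rule lp_fun_pint[OF l])
          finally show ?thesis .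
        qed
        have "pint p a b (\<lambda>s. l (s + t) + l (s + t0)) \<le> ennreal (2 ^ p) * (pint p a b (\<lambda>s. l (s + t)) + pint p a b (\<lambda>s. l (s + t0)))"
          by (intro pint_add_le p0) (unfold set_borel_measurable_def, measurable)
        also have "\<dots> \<le> ennreal (2 ^ p) * (ennreal I + ennreal I)"
          using sh[of t] sh[of t0] t1 by (intro mult_left_mono add_mono) auto
        also have "\<dots> = ennreal (2 ^ p * (I + I))" using I0 by (simp only: ennreal_mult ennreal_plus add_nonneg_nonneg zero_le_power zero_le_numeral)
        finally show "pint p a b (\<lambda>s. l (s + t) + l (s + t0)) \<le> ennreal (2 ^ p * (I + I))" .
      qed auto
      also have "\<dots> = ennreal (2 ^ p * (card F * c1 + \<eta> ^ p * (2 ^ p * (I + I))))"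
        using c1 \<eta>(1) I0 by (simp only: ennreal_mult ennreal_plus add_nonneg_nonneg mult_nonneg_nonneg zero_le_power
            zero_le_numeral of_nat_0_le_iff less_imp_le)
      also have "\<dots> \<le> ennreal c"
      proof (rule ennreal_leI)
        have "2 ^ p * (real (card F) * c1) = (c / 4) * (real (card F) / (real (card F) + 1))"
          by (simp add: c1_def)
        also have "\<dots> \<le> (c / 4) * 1" using c by (intro mult_left_mono) auto
        finally have 1: "2 ^ p * (real (card F) * c1) \<le> c / 4" by simp
        have "\<eta> ^ p \<le> \<eta> ^ 1" using \<eta> p0 by (intro power_decreasing) auto
        then have "\<eta> ^ p * J \<le> \<eta> * J" using J0 by (intro mult_right_mono) auto
        also have "\<dots> \<le> c / 2" by (rule \<eta>(3))
        finally have "\<eta> ^ p * J \<le> c / 2" .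
        moreover have "2 ^ p * (card F * c1 + \<eta> ^ p * (2 ^ p * (I + I))) = 2 ^ p * (card F * c1) + \<eta> ^ p * J"
          by (simp add: J_def algebra_simps)
        ultimately show "2 ^ p * (card F * c1 + \<eta> ^ p * (2 ^ p * (I + I))) \<le> c" using 1 c by linarith
      qed
      finally show "pint p a b (\<lambda>s. translate t g s (w s) - translate t0 g s (w s)) \<le> ennreal ((e / 2) ^ p)"
        by (simp add: c_def)
    qed (use e in auto)
    then show "curve_seminorm p a b W (\<lambda>s z. translate t g s z - translate t0 g s z) < e" using e by simp
  qed
qed

end

section \<open>Continuity into generated topologies, time translation and the hull\<close>

lemma topspace_pseudometric_topology:
  assumes "P \<noteq> {}"
  shows "topspace (pseudometric_topology S P) = S"
proof -
  obtain d where d: "d \<in> P" using assms by blast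
  have "S \<subseteq> \<Union>{{y \<in> S. d x y < \<epsilon>} | x d \<epsilon>. x \<in> S \<and> d \<in> P \<and> \<epsilon> > 0}"
  proof
    fix x assume x: "x \<in> S"
    then have "x \<in> {y \<in> S. d x y < \<bar>d x x\<bar> + 1}" by simp
    moreover have "{y \<in> S. d x y < \<bar>d x x\<bar> + 1} \<in> {{y \<in> S. d x y < \<epsilon>} | x d \<epsilon>. x \<in> S \<and> d \<in> P \<and> \<epsilon> > 0}"
      using x d by (intro CollectI exI[of _ x] exI[of _ d] exI[of _ "\<bar>d x x\<bar> + 1"]) auto
    ultimately show "x \<in> \<Union>{{y \<in> S. d x y < \<epsilon>} | x d \<epsilon>. x \<in> S \<and> d \<in> P \<and> \<epsilon> > 0}" by (rule UnionI[rotated])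
  qed
  then show ?thesis
    unfolding pseudometric_topology_def topology_generated_by_topspace by auto
qed

lemma openin_pseudometric_ball:
  "x \<in> S \<Longrightarrow> d \<in> P \<Longrightarrow> \<epsilon> > 0 \<Longrightarrow> openin (pseudometric_topology S P) {y \<in> S. d x y < \<epsilon>}"
  unfolding pseudometric_topology_def
  by (rule topology_generated_by_Basis) blast

text \<open>A subbasic ball containing \<open>f x\<close> may be centred elsewhere; by the triangle
  inequality it contains a ball around \<open>f x\<close>, so the local condition at
  \<open>f x\<close> suffices.\<close>

lemma continuous_map_pseudometric_topologyI:
  assumes "P \<noteq> {}"
    and triangle: "\<And>d x y z. d \<in> P \<Longrightarrow> x \<in> S \<Longrightarrow> y \<in> S \<Longrightarrow> z \<in> S \<Longrightarrow> d x z \<le> d x y + d y z"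
    and maps: "\<And>x. x \<in> topspace X \<Longrightarrow> f x \<in> S"
    and loc: "\<And>x d e. x \<in> topspace X \<Longrightarrow> d \<in> P \<Longrightarrow> e > 0 \<Longrightarrow>
        \<exists>U. openin X U \<and> x \<in> U \<and> (\<forall>y\<in>U. d (f x) (f y) < e)"
  shows "continuous_map X (pseudometric_topology S P) f"
proof -
  have "f ` topspace X \<subseteq> \<Union>{{y \<in> S. d x y < \<epsilon>} | x d \<epsilon>. x \<in> S \<and> d \<in> P \<and> \<epsilon> > 0}"
    using maps topspace_pseudometric_topology[OF assms(1), of S]
    unfolding pseudometric_topology_def topology_generated_by_topspace by auto
  moreover have "openin X (f -` U \<inter> topspace X)"
    if U: "U \<in> {{y \<in> S. d x y < \<epsilon>} | x d \<epsilon>. x \<in> S \<and> d \<in> P \<and> \<epsilon> > 0}" for U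
  proof -
    obtain z d \<epsilon> where z: "z \<in> S" "d \<in> P" and Ueq: "U = {y \<in> S. d z y < \<epsilon>}" using U by blast
    show ?thesis
    proof (subst openin_subopen, intro ballI)
      fix x assume "x \<in> f -` U \<inter> topspace X"
      then have x: "x \<in> topspace X" "d z (f x) < \<epsilon>" by (auto simp: Ueq)
      then obtain V where V: "openin X V" "x \<in> V" "\<And>y. y \<in> V \<Longrightarrow> d (f x) (f y) < \<epsilon> - d z (f x)"
        using loc[of x d "\<epsilon> - d z (f x)"] z(2) by auto
      have "V \<subseteq> f -` U \<inter> topspace X"
      proof
        fix y assume y: "y \<in> V"
        then have yX: "y \<in> topspace X" using openin_subset[OF V(1)] by blast
        have "d z (f y) \<le> d z (f x) + d (f x) (f y)"
          by (rule triangle[OF z(2) z(1) maps[OF x(1)] maps[OF yX]])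
        then show "y \<in> f -` U \<inter> topspace X" using V(3)[OF y] yX maps[OF yX] by (simp add: Ueq)
      qed
      then show "\<exists>T. openin X T \<and> x \<in> T \<and> T \<subseteq> f -` U \<inter> topspace X" using V(1,2) by blast
    qed
  qed
  ultimately show ?thesis
    unfolding pseudometric_topology_def by (intro continuous_on_generated_topo)
qed

context curve_family
begin

definition seminorm_ball where
  "seminorm_ball a b W G e = {H \<in> LC p. curve_seminorm p a b W (\<lambda>t z. LC_rep H t z - LC_rep G t z) < e}"

lemma openin_seminorm_ball:
  assumes "G \<in> LC p" "(a, b, W) \<in> \<W>" "e > 0"
  shows "openin curve_topology (seminorm_ball a b W G e)"
  unfolding curve_topology_def LC_seminorm_topology_def seminorm_ball_def
  by (rule openin_pseudometric_ball[of G "LC p" "\<lambda>F H. curve_seminorm p a b W (\<lambda>t z. LC_rep H t z - LC_rep F t z)"])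
    (use assms in auto)

lemma centre_in_seminorm_ball:
  assumes "G \<in> LC p" "(a, b, W) \<in> \<W>" "e > 0"
  shows "G \<in> seminorm_ball a b W G e"
proof -
  have z: "(\<lambda>t z. LC_rep G t z - LC_rep G t z) \<in> LC_fun p"
    using LC_rep_LC_fun[OF assms(1)] by (intro LC_fun_diff p0)
  have "curve_seminorm p a b W (\<lambda>t z. LC_rep G t z - LC_rep G t z) \<le> 0"
    by (rule curve_seminorm_leI[OF assms(2) z]) (use p0 in \<open>simp_all add: pint_def power_0_left\<close>)
  then show ?thesis using assms by (simp add: seminorm_ball_def)
qed

lemma topspace_curve_topology: "topspace curve_topology = LC p"
  unfolding curve_topology_def LC_seminorm_topology_def
  by (rule topspace_pseudometric_topology) (use family_nonempty in auto)

lemma continuous_map_curve_topologyI: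
  assumes maps: "\<And>x. x \<in> topspace X \<Longrightarrow> f x \<in> LC p"
    and loc: "\<And>x a b W e. x \<in> topspace X \<Longrightarrow> (a, b, W) \<in> \<W> \<Longrightarrow> e > 0 \<Longrightarrow>
        \<exists>U. openin X U \<and> x \<in> U \<and> (\<forall>y\<in>U. curve_seminorm p a b W (\<lambda>t z. LC_rep (f y) t z - LC_rep (f x) t z) < e)"
  shows "continuous_map X curve_topology f"
  unfolding curve_topology_def LC_seminorm_topology_def
proof (rule continuous_map_pseudometric_topologyI)
  fix d and F G H :: "'n delay_field set"
  assume d: "d \<in> (\<lambda>\<nu> F G. \<nu> (\<lambda>t z. LC_rep G t z - LC_rep F t z)) ` {curve_seminorm p a b W |a b W. (a, b, W) \<in> \<W>}"
    and FGH: "F \<in> LC p" "G \<in> LC p" "H \<in> LC p"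
  then obtain a b W where W: "(a, b, W) \<in> \<W>"
    and d: "d = (\<lambda>F G. curve_seminorm p a b W (\<lambda>t z. LC_rep G t z - LC_rep F t z))" by auto
  show "d F H \<le> d F G + d G H"
    unfolding d using curve_seminorm_triangle[OF W LC_rep_LC_fun[OF FGH(3)] LC_rep_LC_fun[OF FGH(1)] LC_rep_LC_fun[OF FGH(2)]]
    by simp
next
  fix x d and e :: real
  assume x: "x \<in> topspace X" and d: "d \<in> (\<lambda>\<nu> F G. \<nu> (\<lambda>t z. LC_rep G t z - LC_rep F t z)) ` {curve_seminorm p a b W |a b W. (a, b, W) \<in> \<W>}"
    and e: "e > 0"
  then obtain a b W where W: "(a, b, W) \<in> \<W>"
    and d: "d = (\<lambda>F G. curve_seminorm p a b W (\<lambda>t z. LC_rep G t z - LC_rep F t z))" by auto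
  show "\<exists>U. openin X U \<and> x \<in> U \<and> (\<forall>y\<in>U. d (f x) (f y) < e)"
    unfolding d by (rule loc[OF x W e])
qed (use family_nonempty maps in auto)

text \<open>The difference of \<open>g\<close> translated by \<open>t\<close> and \<open>k\<close>
  translated by \<open>t0\<close> is the translate of \<open>g - k\<close> by \<open>t\<close> plus
  the difference of two translates of \<open>k\<close>. The first is controlled by one seminorm for
  all \<open>t\<close> near \<open>t0\<close>, the second concerns only the fixed field
  \<open>k\<close>.\<close>

lemma continuous_map_translate:
  "continuous_map (prod_topology euclideanreal curve_topology) curve_topology (\<lambda>(t, G). translate t ` G)"
proof (rule continuous_map_curve_topologyI)
  fix x assume "x \<in> topspace (prod_topology euclideanreal curve_topology)"
  then show "(case x of (t, G) \<Rightarrow> translate t ` G) \<in> LC p"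
    by (auto simp: topspace_curve_topology translate_image(2))
next
  fix x a b W and e :: real
  assume "x \<in> topspace (prod_topology euclideanreal curve_topology)" and W: "(a, b, W) \<in> \<W>" and e: "e > 0"
  then obtain t0 G0 where x: "x = (t0, G0)" and G0: "G0 \<in> LC p" by (auto simp: topspace_curve_topology)
  let ?k = "LC_rep G0"
  have g0: "?k \<in> LC_fun p" by (rule LC_rep_LC_fun[OF G0])
  obtain a' b' W' where W': "(a', b', W') \<in> \<W>" and le: "\<And>(h :: 'n delay_field) t. h \<in> LC_fun p \<Longrightarrow> \<bar>t\<bar> \<le> \<bar>t0\<bar> + 1 \<Longrightarrow>
      curve_seminorm p a b W (translate t h) \<le> curve_seminorm p a' b' W' h"
    using curve_seminorm_translate[OF W, of "\<bar>t0\<bar> + 1"] by blast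
  obtain d where d: "d > 0"
    "\<And>t. \<bar>t - t0\<bar> < d \<Longrightarrow> curve_seminorm p a b W (\<lambda>s z. translate t ?k s z - translate t0 ?k s z) < e / 2"
    using curve_seminorm_translation_continuous[OF W g0, of "e / 2" t0] e by auto
  define U where "U = ball t0 (min d 1) \<times> seminorm_ball a' b' W' G0 (e / 2)"
  have "openin (prod_topology euclideanreal curve_topology) U"
    unfolding U_def using e by (intro openin_prod_Times_iff[THEN iffD2] disjI2 conjI openin_seminorm_ball[OF G0 W']) auto
  moreover have "x \<in> U" unfolding U_def x using d(1) e centre_in_seminorm_ball[OF G0 W'] by simp
  moreover have "curve_seminorm p a b W (\<lambda>s z. LC_rep (case y of (t, G) \<Rightarrow> translate t ` G) s z
      - LC_rep (case x of (t, G) \<Rightarrow> translate t ` G) s z) < e" if y: "y \<in> U" for y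
  proof -
    obtain t G where yeq: "y = (t, G)" by force
    have t: "\<bar>t - t0\<bar> < d" "\<bar>t\<bar> \<le> \<bar>t0\<bar> + 1" and G: "G \<in> LC p"
      and GG0: "curve_seminorm p a' b' W' (\<lambda>s z. LC_rep G s z - ?k s z) < e / 2"
      using y by (auto simp: U_def yeq seminorm_ball_def dist_real_def)
    let ?g = "LC_rep G"
    have g: "?g \<in> LC_fun p" by (rule LC_rep_LC_fun[OF G])
    have trs: "translate t ?g \<in> LC_fun p" "translate t ?k \<in> LC_fun p" "translate t0 ?k \<in> LC_fun p"
      using g g0 by (auto intro: LC_fun_translate)
    have "curve_seminorm p a b W (\<lambda>s z. LC_rep (translate t ` G) s z - LC_rep (translate t0 ` G0) s z)
        = curve_seminorm p a b W (\<lambda>s z. translate t ?g s z - translate t0 ?k s z)"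
    proof (rule curve_seminorm_cong[OF W])
      show "AE s in lborel. \<forall>z. LC_rep (translate t ` G) s z - LC_rep (translate t0 ` G0) s z
          = translate t ?g s z - translate t0 ?k s z"
        using translate_image(3)[OF G, of t] translate_image(3)[OF G0, of t0]
        by eventually_elim (simp add: translate_def[of t "LC_rep G"] translate_def[of t0 "LC_rep G0"])
    qed (use trs translate_image(2)[OF G] translate_image(2)[OF G0] in \<open>auto intro!: LC_fun_diff p0 LC_rep_LC_fun\<close>)
    also have "\<dots> \<le> curve_seminorm p a b W (\<lambda>s z. translate t ?g s z - translate t ?k s z)
        + curve_seminorm p a b W (\<lambda>s z. translate t ?k s z - translate t0 ?k s z)"
      by (rule curve_seminorm_triangle[OF W trs(1,3,2)])
    finally have *: "curve_seminorm p a b W (\<lambda>s z. LC_rep (translate t ` G) s z - LC_rep (translate t0 ` G0) s z)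
       \<le> curve_seminorm p a b W (\<lambda>s z. translate t ?g s z - translate t ?k s z)
        + curve_seminorm p a b W (\<lambda>s z. translate t ?k s z - translate t0 ?k s z)" .
    have "curve_seminorm p a b W (translate t (\<lambda>s z. ?g s z - ?k s z)) \<le> curve_seminorm p a' b' W' (\<lambda>s z. ?g s z - ?k s z)"
      by (rule le[OF LC_fun_diff[OF p0 g g0] t(2)])
    then have "curve_seminorm p a b W (\<lambda>s z. translate t ?g s z - translate t ?k s z) < e / 2"
      using GG0 by (simp add: translate_def)
    then have "curve_seminorm p a b W (\<lambda>s z. LC_rep (translate t ` G) s z - LC_rep (translate t0 ` G0) s z) < e"
      using * d(2)[OF t(1)] by linarith
    then show ?thesis by (simp add: x yeq)
  qed
  ultimately show "\<exists>U. openin (prod_topology euclideanreal curve_topology) U \<and> x \<in> U \<and>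
      (\<forall>y\<in>U. curve_seminorm p a b W (\<lambda>s z. LC_rep (case y of (t, G) \<Rightarrow> translate t ` G) s z
        - LC_rep (case x of (t, G) \<Rightarrow> translate t ` G) s z) < e)" by blast
qed

lemma LC_hull_subset: "LC_hull p curve_topology f \<subseteq> LC p"
  unfolding LC_hull_def using closure_of_subset_topspace[of curve_topology] by (simp add: topspace_curve_topology)

lemma LC_hull_translate:
  assumes f: "f \<in> LC_fun p" and G: "G \<in> LC_hull p curve_topology f"
  shows "translate t ` G \<in> LC_hull p curve_topology f"
proof -
  let ?S = "range (\<lambda>t. LC_class p (translate t f))"
  have "continuous_map curve_topology (prod_topology euclideanreal curve_topology) (\<lambda>G. (t, G))"
    by (intro continuous_map_pairedI) auto
  then have "continuous_map curve_topology curve_topology ((\<lambda>(t, G). translate t ` G) \<circ> (\<lambda>G. (t, G)))"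
    using continuous_map_translate by (rule continuous_map_compose)
  then have "continuous_map curve_topology curve_topology (\<lambda>G. translate t ` G)" by (simp add: o_def)
  then have "(\<lambda>G. translate t ` G) ` (curve_topology closure_of ?S) \<subseteq> curve_topology closure_of ((\<lambda>G. translate t ` G) ` ?S)"
    by (rule continuous_map_image_closure_subset)
  moreover have "(\<lambda>G. translate t ` G) ` ?S \<subseteq> ?S"
    using translate_image_class[OF LC_fun_translate[OF f]] by (auto simp: translate_translate)
  then have "curve_topology closure_of ((\<lambda>G. translate t ` G) ` ?S) \<subseteq> curve_topology closure_of ?S"
    by (rule closure_of_mono)
  ultimately show ?thesis using G unfolding LC_hull_def by blast
qed

text \<open>The hull is a closure, so one translate of \<open>f\<close> lies in finitely many
  seminorm balls around \<open>G\<close> at once. A curve in \<open>W\<close> that is constant on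
  the interval turns the seminorm into an estimate at one point.\<close>

lemma hull_approximate:
  assumes f: "f \<in> LC_fun p" and G: "G \<in> LC_hull p curve_topology f" and F: "finite F"
    and FW: "\<And>i. i \<in> F \<Longrightarrow> \<exists>W. (a i, b i, W) \<in> \<W> \<and> (\<exists>w\<in>W. \<forall>t. a i \<le> t \<longrightarrow> t \<le> b i \<longrightarrow> w t = z i)"
    and e: "e > 0"
  obtains \<tau> where "\<And>i. i \<in> F \<Longrightarrow> pint p (a i) (b i) (\<lambda>t. f (t + \<tau>) (z i) - LC_rep G t (z i)) \<le> ennreal e"
proof -
  have GLC: "G \<in> LC p" using G LC_hull_subset by blast
  have "\<forall>i\<in>F. \<exists>W. (a i, b i, W) \<in> \<W> \<and> (\<exists>w\<in>W. \<forall>t. a i \<le> t \<longrightarrow> t \<le> b i \<longrightarrow> w t = z i)" using FW by blast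
  from bchoice[OF this] obtain W where
    "\<forall>i\<in>F. (a i, b i, W i) \<in> \<W> \<and> (\<exists>w\<in>W i. \<forall>t. a i \<le> t \<longrightarrow> t \<le> b i \<longrightarrow> w t = z i)" by (elim exE)
  then have W: "\<And>i. i \<in> F \<Longrightarrow> (a i, b i, W i) \<in> \<W>"
    "\<And>i. i \<in> F \<Longrightarrow> \<exists>w\<in>W i. \<forall>t. a i \<le> t \<longrightarrow> t \<le> b i \<longrightarrow> w t = z i" by simp_all
  define c where "c = root p e"
  have c: "c > 0" "c ^ p = e" using e p0 by (auto simp: c_def)
  define U where "U = (\<Inter>i\<in>F. seminorm_ball (a i) (b i) (W i) G c) \<inter> topspace curve_topology"
  have "openin curve_topology U"
  proof (cases "F = {}")
    case True
    then show ?thesis by (simp add: U_def)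
  next
    case False
    then show ?thesis unfolding U_def
      by (intro openin_Int openin_INT2 F openin_seminorm_ball[OF GLC W(1) c(1)]) auto
  qed
  moreover have "G \<in> U"
    using centre_in_seminorm_ball[OF GLC W(1) c(1)] GLC by (simp add: U_def topspace_curve_topology)
  ultimately have "\<exists>y\<in>range (\<lambda>t. LC_class p (translate t f)). y \<in> U"
    using G unfolding LC_hull_def in_closure_of by blast
  then obtain \<tau> where \<tau>: "LC_class p (translate \<tau> f) \<in> U" by blast
  show thesis
  proof (rule that[of \<tau>])
    fix i assume i: "i \<in> F"
    let ?h = "\<lambda>t z. LC_rep (LC_class p (translate \<tau> f)) t z - LC_rep G t z"
    have h: "?h \<in> LC_fun p"
      by (intro LC_fun_diff p0 LC_rep_LC_fun[OF GLC] LC_rep_LC_fun[OF LC_memI] LC_fun_translate f)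
    have lt: "curve_seminorm p (a i) (b i) (W i) ?h < c" using \<tau> i by (auto simp: U_def seminorm_ball_def)
    obtain w where w: "w \<in> W i" "\<And>t. a i \<le> t \<Longrightarrow> t \<le> b i \<Longrightarrow> w t = z i" using W(2)[OF i] by blast
    have "pint p (a i) (b i) (\<lambda>t. f (t + \<tau>) (z i) - LC_rep G t (z i)) = pint p (a i) (b i) (\<lambda>t. ?h t (w t))"
    proof (rule pint_cong_AE)
      show "AE s in lborel. a i \<le> s \<and> s \<le> b i \<longrightarrow> norm (f (s + \<tau>) (z i) - LC_rep G s (z i)) = norm (?h s (w s))"
        using LC_rep_class_AE[OF LC_fun_translate[OF f, of \<tau>]]
        by eventually_elim (simp add: w(2) translate_def)
    qed
    also have "\<dots> \<le> ennreal (curve_seminorm p (a i) (b i) (W i) ?h ^ p)"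
      by (rule pint_le_curve_seminorm[OF W(1)[OF i] w(1) h])
    also have "\<dots> \<le> ennreal (c ^ p)"
      using lt by (intro ennreal_leI power_mono curve_seminorm_nonneg[OF W(1)[OF i] h]) simp
    finally show "pint p (a i) (b i) (\<lambda>t. f (t + \<tau>) (z i) - LC_rep G t (z i)) \<le> ennreal e" by (simp add: c(2))
  qed
qed

text \<open>Convergence at the points of a countable set along a single sequence of translates, for
  almost every time: every quantity that is lower semicontinuous in the values of the field at
  these points then passes from \<open>f\<close> to its hull by Fatou's lemma.\<close>

lemma hull_AE_limit:
  assumes f: "f \<in> LC_fun p" and G: "G \<in> LC_hull p curve_topology f" and Z: "countable Z"
    and const_curves: "\<And>z k. z \<in> Z \<Longrightarrow> \<exists>a b W. a \<le> - real k \<and> real k \<le> b \<and> (a, b, W) \<in> \<W> \<and>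
        (\<exists>w\<in>W. \<forall>t. a \<le> t \<longrightarrow> t \<le> b \<longrightarrow> w t = z)"
  obtains \<tau> :: "nat \<Rightarrow> real" where
    "AE t in lborel. \<forall>z\<in>Z. (\<lambda>k. f (t + \<tau> k) z) \<longlonglongrightarrow> LC_rep G t z"
proof (cases "Z = {}")
  case True
  then show ?thesis using that by simp
next
  case False
  define z where "z = from_nat_into Z"
  have z: "range z = Z" unfolding z_def using False Z by (rule range_from_nat_into)
  have zZ: "z i \<in> Z" for i using z by blast
  \<comment> \<open>At stage \<open>k\<close> the first \<open>k\<close> points are controlled on
    \<open>[-k, k]\<close>. The denominator offsets the number of points, so the total error of the
    stage is at most \<open>(1/2) ^ k\<close> and the stages are summable.\<close>
  define \<epsilon> where "\<epsilon> k = (1/2) ^ k / (real k + 1)" for k :: nat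
  have \<epsilon>: "\<epsilon> k > 0" for k by (simp add: \<epsilon>_def)
  have "\<exists>\<tau>. \<forall>i<k. pint p (- real k) (real k) (\<lambda>t. f (t + \<tau>) (z i) - LC_rep G t (z i)) \<le> ennreal (\<epsilon> k)" for k
  proof -
    have "\<forall>i. \<exists>ab. fst ab \<le> - real k \<and> real k \<le> snd ab \<and> (\<exists>W. (fst ab, snd ab, W) \<in> \<W> \<and>
        (\<exists>w\<in>W. \<forall>t. fst ab \<le> t \<longrightarrow> t \<le> snd ab \<longrightarrow> w t = z i))"
      using const_curves[OF zZ, of k] by (metis fst_conv snd_conv)
    from choice[OF this] obtain ab where ab: "\<And>i. fst (ab i) \<le> - real k" "\<And>i. real k \<le> snd (ab i)"
      "\<And>i. \<exists>W. (fst (ab i), snd (ab i), W) \<in> \<W> \<and> (\<exists>w\<in>W. \<forall>t. fst (ab i) \<le> t \<longrightarrow> t \<le> snd (ab i) \<longrightarrow> w t = z i)"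
      by blast
    obtain \<tau> where \<tau>: "\<And>i. i \<in> {..<k} \<Longrightarrow>
        pint p (fst (ab i)) (snd (ab i)) (\<lambda>t. f (t + \<tau>) (z i) - LC_rep G t (z i)) \<le> ennreal (\<epsilon> k)"
      using hull_approximate[OF f G, of "{..<k}" "\<lambda>i. fst (ab i)" "\<lambda>i. snd (ab i)" z "\<epsilon> k"] ab(3) \<epsilon> by auto
    have "pint p (- real k) (real k) (\<lambda>t. f (t + \<tau>) (z i) - LC_rep G t (z i)) \<le> ennreal (\<epsilon> k)" if "i < k" for i
      using pint_mono_interval[OF ab(1,2)] \<tau>[of i] that by (meson lessThan_iff order_trans)
    then show ?thesis by blast
  qed
  then have "\<forall>k. \<exists>\<tau>. \<forall>i<k. pint p (- real k) (real k) (\<lambda>t. f (t + \<tau>) (z i) - LC_rep G t (z i)) \<le> ennreal (\<epsilon> k)"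
    by (rule allI)
  from choice[OF this] obtain \<tau> where "\<forall>k. \<forall>i<k.
      pint p (- real k) (real k) (\<lambda>t. f (t + \<tau> k) (z i) - LC_rep G t (z i)) \<le> ennreal (\<epsilon> k)" by (elim exE)
  then have \<tau>: "\<And>k i. i < k \<Longrightarrow>
      pint p (- real k) (real k) (\<lambda>t. f (t + \<tau> k) (z i) - LC_rep G t (z i)) \<le> ennreal (\<epsilon> k)" by simp
  define h where "h k i t = indicator {- real k..real k} t * norm (f (t + \<tau> k) (z i) - LC_rep G t (z i)) ^ p" for k i t
  \<comment> \<open>Since the integrals of \<open>E k\<close> are summable, the series of the
    \<open>E k t\<close> is finite for almost every \<open>t\<close>. Hence \<open>E k t\<close>
    tends to 0 along the whole sequence, with no passage to a subsequence.\<close>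
  define E where "E k t = (\<Sum>i<k. h k i t)" for k t
  have GLC: "LC_rep G \<in> LC_fun p" using G LC_hull_subset by (auto intro: LC_rep_LC_fun)
  have fm: "(\<lambda>t. f (t + \<tau> k) (z i)) \<in> borel_measurable borel" for k i
    using LC_fun_measurable[OF LC_fun_translate[OF f], of "\<lambda>_. z i" "\<tau> k"] by (simp add: translate_def)
  have gm: "(\<lambda>t. LC_rep G t (z i)) \<in> borel_measurable borel" for i
    by (rule LC_fun_measurable[OF GLC]) simp
  have hm: "h k i \<in> borel_measurable borel" for k i
    unfolding h_def[abs_def] using fm gm by (intro borel_measurable_times borel_measurable_power borel_measurable_norm borel_measurable_diff) auto
  have Em: "E k \<in> borel_measurable borel" for k
    unfolding E_def[abs_def] using hm by (rule borel_measurable_sum)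
  have h0: "h k i t \<ge> 0" for k i t by (simp add: h_def)
  have E0: "E k t \<ge> 0" for k t unfolding E_def by (intro sum_nonneg h0)
  have hint: "(\<integral>\<^sup>+t. ennreal (h k i t) \<partial>lborel) \<le> ennreal (\<epsilon> k)" if "i < k" for k i
  proof -
    have "(\<integral>\<^sup>+t. ennreal (h k i t) \<partial>lborel) = pint p (- real k) (real k) (\<lambda>t. f (t + \<tau> k) (z i) - LC_rep G t (z i))"
      unfolding pint_def h_def by (intro nn_integral_cong) (auto split: split_indicator)
    then show ?thesis using \<tau>[OF that] by simp
  qed
  have Eint: "(\<integral>\<^sup>+t. ennreal (E k t) \<partial>lborel) \<le> ennreal ((1/2) ^ k)" for k
  proof -
    have "(\<integral>\<^sup>+t. ennreal (E k t) \<partial>lborel) = (\<integral>\<^sup>+t. (\<Sum>i<k. ennreal (h k i t)) \<partial>lborel)"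
      unfolding E_def by (intro nn_integral_cong) (simp add: h0)
    also have "\<dots> = (\<Sum>i<k. \<integral>\<^sup>+t. ennreal (h k i t) \<partial>lborel)"
      using hm by (intro nn_integral_sum measurable_compose[OF _ measurable_ennreal]) auto
    also have "\<dots> \<le> (\<Sum>i<k. ennreal (\<epsilon> k))" by (intro sum_mono hint) auto
    also have "\<dots> = ennreal (real k * \<epsilon> k)"
      using \<epsilon>[of k] by (simp add: ennreal_mult ennreal_of_nat_eq_real_of_nat)
    also have "\<dots> \<le> ennreal ((1/2) ^ k)"
    proof (rule ennreal_leI)
      have "real k * \<epsilon> k = (1/2) ^ k * (real k / (real k + 1))" by (simp add: \<epsilon>_def)
      also have "\<dots> \<le> (1/2) ^ k * 1" by (intro mult_left_mono) auto
      finally show "real k * \<epsilon> k \<le> (1/2) ^ k" by simp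
    qed
    finally show ?thesis .
  qed
  have "(\<integral>\<^sup>+t. (\<Sum>k. ennreal (E k t)) \<partial>lborel) = (\<Sum>k. \<integral>\<^sup>+t. ennreal (E k t) \<partial>lborel)"
    using Em by (intro nn_integral_suminf measurable_compose[OF _ measurable_ennreal]) auto
  also have "\<dots> \<le> (\<Sum>k. ennreal ((1/2) ^ k))" by (intro suminf_le Eint) auto
  also have "\<dots> = ennreal (\<Sum>k. (1/2) ^ k)" by (intro suminf_ennreal2 summable_geometric) auto
  finally have "(\<integral>\<^sup>+t. (\<Sum>k. ennreal (E k t)) \<partial>lborel) \<noteq> \<infinity>" by (auto simp: top_unique)
  then have "AE t in lborel. (\<Sum>k. ennreal (E k t)) \<noteq> \<infinity>"
    using Em by (intro nn_integral_PInf_AE borel_measurable_suminf_order measurable_compose[OF _ measurable_ennreal]) auto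
  then have "AE t in lborel. \<forall>z\<in>Z. (\<lambda>k. f (t + \<tau> k) z) \<longlonglongrightarrow> LC_rep G t z"
  proof eventually_elim
    case (elim t)
    have "summable (\<lambda>k. E k t)" using elim by (intro summable_suminf_not_top E0) auto
    then have Elim: "(\<lambda>k. E k t) \<longlonglongrightarrow> 0" by (rule summable_LIMSEQ_zero)
    have "(\<lambda>k. f (t + \<tau> k) (z i)) \<longlonglongrightarrow> LC_rep G t (z i)" for i
    proof -
      have "eventually (\<lambda>k. norm (f (t + \<tau> k) (z i) - LC_rep G t (z i)) ^ p \<le> E k t) sequentially"
        \<comment> \<open>From this stage on the point with index \<open>i\<close> is among those
          controlled and \<open>t\<close> lies in the controlled interval.\<close>
        using eventually_ge_at_top[of "max (Suc i) (nat \<lceil>\<bar>t\<bar>\<rceil>)"]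
      proof eventually_elim
        case (elim k)
        then have "i < k" "\<bar>t\<bar> \<le> real k" by linarith+
        then have "i < k" "t \<in> {- real k..real k}" by (auto simp: abs_le_iff)
        then have "norm (f (t + \<tau> k) (z i) - LC_rep G t (z i)) ^ p = h k i t" by (simp add: h_def)
        also have "\<dots> \<le> E k t" unfolding E_def using \<open>i < k\<close> h0 by (intro member_le_sum) auto
        finally show ?case .
      qed
      then have "(\<lambda>k. norm (f (t + \<tau> k) (z i) - LC_rep G t (z i)) ^ p) \<longlonglongrightarrow> 0"
        by (intro tendsto_sandwich[OF _ _ tendsto_const Elim]) auto
      then have "(\<lambda>k. root p (norm (f (t + \<tau> k) (z i) - LC_rep G t (z i)) ^ p)) \<longlonglongrightarrow> root p 0"
        by (rule tendsto_real_root)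
      then have "(\<lambda>k. norm (f (t + \<tau> k) (z i) - LC_rep G t (z i))) \<longlonglongrightarrow> 0"
        using p0 by (simp add: real_root_power_cancel)
      then have "(\<lambda>k. f (t + \<tau> k) (z i) - LC_rep G t (z i)) \<longlonglongrightarrow> 0"
        by (rule tendsto_norm_zero_cancel)
      then show ?thesis by (simp add: LIM_zero_iff)
    qed
    then show ?case unfolding z[symmetric] by blast
  qed
  then show thesis by (rule that)
qed

end

section \<open>Truncated delay equations\<close>

definition ball_proj :: "real \<Rightarrow> 'a::euclidean_space \<Rightarrow> 'a" where
  "ball_proj r = closest_point (cball 0 r)"

lemma ball_proj_le: "0 \<le> r \<Longrightarrow> norm (ball_proj r x) \<le> r"
  using closest_point_in_set[of "cball 0 r" x] by (simp add: ball_proj_def)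

lemma ball_proj_id: "norm x \<le> r \<Longrightarrow> ball_proj r x = x"
  unfolding ball_proj_def by (rule closest_point_self) simp

lemma ball_proj_lipschitz: "0 \<le> r \<Longrightarrow> norm (ball_proj r x - ball_proj r y) \<le> norm (x - y)"
  using closest_point_lipschitz[of "cball 0 r" x y] by (simp add: ball_proj_def dist_norm)

lemma continuous_on_ball_proj: "0 \<le> r \<Longrightarrow> continuous_on S f \<Longrightarrow> continuous_on S (\<lambda>x. ball_proj r (f x))"
  unfolding ball_proj_def
  by (rule continuous_on_compose2[OF continuous_on_closest_point[of "cball 0 r" UNIV]]) auto

lemma norm_ball_proj_Pair_le: "0 \<le> r \<Longrightarrow> norm (ball_proj r x, ball_proj r y) \<le> 2 * r"
  using norm_Pair_le[of "ball_proj r x" "ball_proj r y"] ball_proj_le[of r x] ball_proj_le[of r y] by linarith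

text \<open>Projecting each component separately keeps the truncated equation a delay equation, and
  the nearest-point projection does not increase Lipschitz constants. The pair then has norm at most
  \<open>2 * r\<close>, which is why bounds on the ball of that radius are used.\<close>

definition truncated_field :: "'n::finite delay_field \<Rightarrow> real \<Rightarrow> (real \<Rightarrow> real ^ 'n) \<Rightarrow> real \<Rightarrow> real ^ 'n" where
  "truncated_field g r y s = g s (ball_proj r (y s), ball_proj r (y (s - 1)))"

definition truncated_solution :: "'n::finite delay_field \<Rightarrow> real \<Rightarrow> real \<Rightarrow> (real \<Rightarrow> real ^ 'n) \<Rightarrow> bool" where
  "truncated_solution g r n y \<longleftrightarrow> continuous_on {-1..n} y \<and> primitive_on 0 n y (truncated_field g r y)"

lemma set_borel_measurable_continuous:
  "continuous_on {a..b::real} (f :: real \<Rightarrow> 'a::real_normed_vector) \<Longrightarrow> set_borel_measurable borel {a..b} f"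
  unfolding set_borel_measurable_def by (intro borel_measurable_continuous_on_indicator) auto

lemma truncated_curve_measurable:
  fixes y :: "real \<Rightarrow> real ^ 'n"
  assumes y: "continuous_on {-1..n} y" and r: "0 \<le> r"
  shows "set_borel_measurable borel {0..n} (\<lambda>s. (ball_proj r (y s), ball_proj r (y (s - 1))))"
proof (rule set_borel_measurable_continuous)
  have "continuous_on {0..n} y" by (rule continuous_on_subset[OF y]) auto
  moreover have "continuous_on {0..n} (\<lambda>s. y (s - 1))"
    by (rule continuous_on_compose2[OF y]) (auto intro!: continuous_intros)
  ultimately show "continuous_on {0..n} (\<lambda>s. (ball_proj r (y s), ball_proj r (y (s - 1))))"
    using r by (intro continuous_on_Pair continuous_on_ball_proj)
qed

lemma truncated_field_measurable:
  assumes "g \<in> LC_fun p" "continuous_on {-1..n} y" "0 \<le> r"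
  shows "set_borel_measurable borel {0..n} (truncated_field g r y)"
  unfolding truncated_field_def[abs_def]
  by (rule LC_fun_set_measurable[OF assms(1) truncated_curve_measurable[OF assms(2,3)]])

lemma truncated_field_bound:
  assumes b: "lp_bounds p g (2 * r) m l" and r: "0 \<le> r"
  shows "AE s in lborel. norm (truncated_field g r y s) \<le> m s"
  using lp_boundsD(3)[OF b]
proof eventually_elim
  case (elim s)
  show ?case unfolding truncated_field_def
    by (rule elim[rule_format]) (simp add: norm_ball_proj_Pair_le[OF r])
qed

lemma truncated_field_lipschitz:
  assumes b: "lp_bounds p g (2 * r) m l" and r: "0 \<le> r"
  shows "AE s in lborel. norm (truncated_field g r y s - truncated_field g r y' s)
    \<le> l s * (norm (y s - y' s) + norm (y (s - 1) - y' (s - 1)))"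
  using lp_boundsD(4)[OF b]
proof eventually_elim
  case (elim s)
  let ?a = "(ball_proj r (y s), ball_proj r (y (s - 1)))" and ?b = "(ball_proj r (y' s), ball_proj r (y' (s - 1)))"
  have l0: "0 \<le> l s" using lp_boundsD(2)[OF b] by (simp add: lp_fun_def)
  have "norm (g s ?a - g s ?b) \<le> l s * norm (?a - ?b)"
    by (rule elim[rule_format]) (simp_all add: norm_ball_proj_Pair_le[OF r])
  also have "norm (?a - ?b) \<le> norm (ball_proj r (y s) - ball_proj r (y' s)) + norm (ball_proj r (y (s - 1)) - ball_proj r (y' (s - 1)))"
    using norm_Pair_le[of "ball_proj r (y s) - ball_proj r (y' s)" "ball_proj r (y (s - 1)) - ball_proj r (y' (s - 1))"] by simp
  also have "\<dots> \<le> norm (y s - y' s) + norm (y (s - 1) - y' (s - 1))"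
    by (intro add_mono ball_proj_lipschitz r)
  finally show ?case unfolding truncated_field_def using l0 by (simp add: mult_left_mono)
qed

lemma set_integrable_bound_AE:
  fixes u :: "real \<Rightarrow> 'a::{banach, second_countable_topology}"
  assumes m: "set_integrable lborel A m" and u: "set_borel_measurable borel A u"
    and le: "AE s in lborel. s \<in> A \<longrightarrow> norm (u s) \<le> (m s :: real)"
  shows "set_integrable lborel A u"
  unfolding set_integrable_def
proof (rule Bochner_Integration.integrable_bound[OF m[unfolded set_integrable_def]])
  show "(\<lambda>s. indicator A s *\<^sub>R u s) \<in> borel_measurable lborel"
    using u by (simp add: set_borel_measurable_def)
  show "AE s in lborel. norm (indicator A s *\<^sub>R u s) \<le> norm (indicator A s *\<^sub>R m s)"
    using le by eventually_elim (auto simp: indicator_def)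
qed

lemma truncated_field_integrable:
  assumes p: "p > 0" and g: "g \<in> LC_fun p" and y: "continuous_on {-1..n} y" and r: "0 \<le> r"
  shows "set_integrable lborel {0..n} (truncated_field g r y)"
proof -
  obtain m l where b: "lp_bounds p g (2 * r) m l" using LC_fun_lp_bounds[OF g] by blast
  show ?thesis
    by (rule set_integrable_bound_AE[OF lp_fun_integrable[OF lp_boundsD(1)[OF b] p] truncated_field_measurable[OF g y r]])
      (use truncated_field_bound[OF b r, of y] in eventually_elim, simp)
qed

text \<open>The derivative of \<open>y - y0\<close> is the difference of the two fields along
  \<open>y\<close>, whose integral is at most \<open>B\<close>, plus the difference of
  \<open>g0\<close> along \<open>y\<close> and \<open>y0\<close>, where the Lipschitz function
  \<open>l0\<close> applies. Gronwall's inequality with kernel \<open>l0\<close> does the rest; no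
  Lipschitz bound of \<open>g\<close> occurs in the result.\<close>

lemma truncated_solution_compare:
  fixes y y0 :: "real \<Rightarrow> real ^ 'n::finite"
  assumes p: "p > 0" and r: "0 \<le> r" and g: "g \<in> LC_fun p" and g0: "g0 \<in> LC_fun p"
    and b0: "lp_bounds p g0 (2 * r) m0 l0"
    and y: "truncated_solution g r n y" and y0: "truncated_solution g0 r n y0"
    and A: "\<And>t. -1 \<le> t \<Longrightarrow> t \<le> 0 \<Longrightarrow> norm (y t - y0 t) \<le> A"
    and B: "(\<integral>\<^sup>+s\<in>{0..n}. norm (truncated_field g r y s - truncated_field g0 r y s) \<partial>lborel) \<le> ennreal B" "B \<ge> 0"
    and t: "-1 \<le> t" "t \<le> n"
  shows "norm (y t - y0 t) \<le> 2 * (A + B) * exp (4 * kernel_int l0 n)"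
proof -
  interpret kernel l0 by (rule lp_fun_kernel[OF lp_boundsD(2)[OF b0] p])
  have cy: "continuous_on {-1..n} y" and cy0: "continuous_on {-1..n} y0"
    and py: "primitive_on 0 n y (truncated_field g r y)" and py0: "primitive_on 0 n y0 (truncated_field g0 r y0)"
    using y y0 by (auto simp: truncated_solution_def)
  have A0: "A \<ge> 0" using A[of 0] by (auto intro: order_trans[OF norm_ge_zero])
  have cW: "continuous_on {-1..n} (\<lambda>t. norm (y t - y0 t))" by (intro continuous_intros cy cy0)
  then have "bounded ((\<lambda>t. norm (y t - y0 t)) ` {-1..n})"
    by (intro compact_imp_bounded compact_continuous_image compact_Icc)
  then obtain C where "\<forall>z\<in>(\<lambda>t. norm (y t - y0 t)) ` {-1..n}. norm z \<le> C" unfolding bounded_iff by (elim exE)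
  then have C: "\<And>s. s \<in> {-1..n} \<Longrightarrow> norm (y s - y0 s) \<le> C" by simp
  have cW1: "continuous_on {0..n} (\<lambda>s. norm (y s - y0 s) + norm (y (s - 1) - y0 (s - 1)))"
  proof (intro continuous_on_add)
    show "continuous_on {0..n} (\<lambda>s. norm (y s - y0 s))" by (rule continuous_on_subset[OF cW]) auto
    show "continuous_on {0..n} (\<lambda>s. norm (y (s - 1) - y0 (s - 1)))"
      by (rule continuous_on_compose2[OF cW]) (auto intro!: continuous_intros)
  qed
  show ?thesis
  proof (rule delay_gronwall[where W = "\<lambda>t. norm (y t - y0 t)" and c = n and C = C])
    fix t assume "- 1 \<le> t" "t \<le> n"
    then show "0 \<le> norm (y t - y0 t) \<and> norm (y t - y0 t) \<le> C" using C by simp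
  next
    fix t :: real assume "- 1 \<le> t" "t \<le> 0"
    then show "norm (y t - y0 t) \<le> A + B" using A[of t] B(2) by simp
  next
    fix t assume t: "0 \<le> t" "t \<le> n"
    let ?F = "truncated_field g r y" and ?G = "truncated_field g0 r y" and ?H = "truncated_field g0 r y0"
    have m1: "set_borel_measurable borel {0..t} (\<lambda>s. norm (?F s - ?G s))"
    proof -
      have "set_borel_measurable borel {0..n} ?F" "set_borel_measurable borel {0..n} ?G"
        by (rule truncated_field_measurable[OF g cy r], rule truncated_field_measurable[OF g0 cy r])
      then have "set_borel_measurable borel {0..t} ?F" "set_borel_measurable borel {0..t} ?G"
        using t by (auto elim: set_borel_measurable_subset)
      then have "(\<lambda>s. norm (indicator {0..t} s *\<^sub>R ?F s - indicator {0..t} s *\<^sub>R ?G s)) \<in> borel_measurable borel"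
        unfolding set_borel_measurable_def by measurable
      then show ?thesis unfolding set_borel_measurable_def
        by (simp add: flip: scaleR_diff_right)
    qed
    have m2: "set_borel_measurable borel {0..t} (\<lambda>s. l0 s * (norm (y s - y0 s) + norm (y (s - 1) - y0 (s - 1))))"
    proof -
      have "set_borel_measurable borel {0..t} (\<lambda>s. norm (y s - y0 s) + norm (y (s - 1) - y0 (s - 1)))"
        by (rule set_borel_measurable_continuous[OF continuous_on_subset[OF cW1]]) (use t in auto)
      then have "(\<lambda>s. l0 s * (indicator {0..t} s *\<^sub>R (norm (y s - y0 s) + norm (y (s - 1) - y0 (s - 1))))) \<in> borel_measurable borel"
        unfolding set_borel_measurable_def by measurable
      then show ?thesis unfolding set_borel_measurable_def by (simp add: mult_ac)
    qed
    have "y t - y 0 = (LINT s:{0..t}|lborel. ?F s)" "y0 t - y0 0 = (LINT s:{0..t}|lborel. ?H s)"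
      using py py0 t unfolding primitive_on_def by blast+
    moreover have "set_integrable lborel {0..t} ?F" "set_integrable lborel {0..t} ?H"
      using py py0 t by (auto simp: primitive_on_def elim: set_integrable_Icc_subset)
    ultimately have "(y t - y0 t) - (y 0 - y0 0) = (LINT s:{0..t}|lborel. ?F s - ?H s)"
      by (simp add: set_integral_diff algebra_simps)
    then have "norm (y t - y0 t) \<le> norm (y 0 - y0 0) + norm (LINT s:{0..t}|lborel. ?F s - ?H s)"
      by (metis add.commute diff_add_cancel norm_triangle_ineq)
    then have "ennreal (norm (y t - y0 t)) \<le> ennreal (A + norm (LINT s:{0..t}|lborel. ?F s - ?H s))"
      using A[of 0] by (intro ennreal_leI) simp
    also have "\<dots> = ennreal A + ennreal (norm (LINT s:{0..t}|lborel. ?F s - ?H s))"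
      using A0 by (simp add: ennreal_plus)
    also have "\<dots> \<le> ennreal A + (\<integral>\<^sup>+s\<in>{0..t}. norm (?F s - ?H s) \<partial>lborel)"
      by (intro add_left_mono norm_set_integral_le_nn_integral)
    also have "(\<integral>\<^sup>+s\<in>{0..t}. norm (?F s - ?H s) \<partial>lborel)
       \<le> (\<integral>\<^sup>+s. ennreal (indicator {0..t} s *\<^sub>R norm (?F s - ?G s))
          + ennreal (indicator {0..t} s *\<^sub>R (l0 s * (norm (y s - y0 s) + norm (y (s - 1) - y0 (s - 1))))) \<partial>lborel)"
    proof (rule nn_integral_mono_AE)
      show "AE s in lborel. ennreal (norm (?F s - ?H s)) * indicator {0..t} s
        \<le> ennreal (indicator {0..t} s *\<^sub>R norm (?F s - ?G s))
          + ennreal (indicator {0..t} s *\<^sub>R (l0 s * (norm (y s - y0 s) + norm (y (s - 1) - y0 (s - 1)))))"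
        using truncated_field_lipschitz[OF b0 r, of y y0]
      proof eventually_elim
        case (elim s)
        have "norm (?F s - ?H s) \<le> norm (?F s - ?G s) + norm (?G s - ?H s)"
          using norm_triangle_ineq[of "?F s - ?G s" "?G s - ?H s"] by simp
        also have "\<dots> \<le> norm (?F s - ?G s) + l0 s * (norm (y s - y0 s) + norm (y (s - 1) - y0 (s - 1)))"
          using elim by simp
        finally show ?case
          by (cases "s \<in> {0..t}") (auto simp: l_nonneg ennreal_leI simp flip: ennreal_plus)
      qed
    qed
    also have "\<dots> = (\<integral>\<^sup>+s. ennreal (indicator {0..t} s *\<^sub>R norm (?F s - ?G s)) \<partial>lborel)
       + (\<integral>\<^sup>+s. ennreal (indicator {0..t} s *\<^sub>R (l0 s * (norm (y s - y0 s) + norm (y (s - 1) - y0 (s - 1))))) \<partial>lborel)"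
      using m1 m2 unfolding set_borel_measurable_def
      by (intro nn_integral_add measurable_compose[OF _ measurable_ennreal]) simp_all
    also have "(\<integral>\<^sup>+s. ennreal (indicator {0..t} s *\<^sub>R norm (?F s - ?G s)) \<partial>lborel)
       \<le> (\<integral>\<^sup>+s\<in>{0..n}. norm (?F s - ?G s) \<partial>lborel)"
      using t by (intro nn_integral_mono) (auto simp: indicator_def)
    also note B(1)
    also have "(\<integral>\<^sup>+s. ennreal (indicator {0..t} s *\<^sub>R (l0 s * (norm (y s - y0 s) + norm (y (s - 1) - y0 (s - 1))))) \<partial>lborel)
       = (\<integral>\<^sup>+s\<in>{0..t}. ennreal (l0 s * (norm (y s - y0 s) + norm (y (s - 1) - y0 (s - 1)))) \<partial>lborel)"
      by (intro nn_integral_cong) (auto simp: indicator_def)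
    finally show "ennreal (norm (y t - y0 t)) \<le> ennreal (A + B)
       + (\<integral>\<^sup>+s\<in>{0..t}. ennreal (l0 s * (norm (y s - y0 s) + norm (y (s - 1) - y0 (s - 1)))) \<partial>lborel)"
      using A0 B(2) by (simp add: ennreal_plus add.assoc add_mono)
  qed (use t A0 B(2) in auto)
qed

lemma truncated_solution_unique:
  assumes p: "p > 0" and r: "0 \<le> r" and g: "g \<in> LC_fun p"
    and y: "truncated_solution g r n y" and y0: "truncated_solution g r n y0"
    and init: "\<And>t. -1 \<le> t \<Longrightarrow> t \<le> 0 \<Longrightarrow> y t = y0 t"
    and t: "-1 \<le> t" "t \<le> n"
  shows "y t = y0 t"
proof -
  obtain m l where b: "lp_bounds p g (2 * r) m l" using LC_fun_lp_bounds[OF g] by blast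
  have "norm (y t - y0 t) \<le> 2 * (0 + 0) * exp (4 * kernel_int l n)"
    by (rule truncated_solution_compare[OF p r g g b y y0 _ _ _ t]) (auto simp: init)
  then show ?thesis by simp
qed

text \<open>Picard iteration converges in the weighted norm \<open>sup \<bar>y\<bar> / exp (4 \<integral> (m + l))\<close>.\<close>

lemma truncated_solution_exists:
  fixes g :: "'n::finite delay_field"
  assumes p: "p > 0" and r: "0 \<le> r" and g: "g \<in> LC_fun p" and \<phi>: "continuous_on {-1..0} \<phi>"
  obtains y where "continuous_on UNIV y" "\<And>t. -1 \<le> t \<Longrightarrow> t \<le> 0 \<Longrightarrow> y t = \<phi> t"
    "\<And>n. truncated_solution g r n y"
proof -
  obtain m l where b: "lp_bounds p g (2 * r) m l" using LC_fun_lp_bounds[OF g] by blast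
  \<comment> \<open>One kernel for two purposes: \<open>m\<close> bounds the first Picard step and
    \<open>l\<close> the contraction.\<close>
  define k where "k t = m t + l t" for t
  have kl: "lp_fun p k" unfolding k_def[abs_def] by (intro lp_fun_add p lp_boundsD[OF b])
  interpret kernel k by (rule lp_fun_kernel[OF kl p])
  have m0: "m s \<ge> 0" and l0: "l s \<ge> 0" for s using lp_boundsD(1,2)[OF b] by (auto simp: lp_fun_def)
  define E where "E t = exp (4 * kernel_int k t)" for t
  have E_mono: "s \<le> t \<Longrightarrow> E s \<le> E t" for s t by (simp add: E_def kernel_int_mono)
  have E1: "E t \<ge> 1" for t by (simp add: E_def kernel_int_nonneg)
  \<comment> \<open>The constant extension of \<phi> makes all iterates continuous on the whole
    line. In \<open>P\<close> the integral over \<open>{0..t}\<close> vanishes for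
    \<open>t \<le> 0\<close>, so the iterates keep the history.\<close>
  define \<psi> where "\<psi> t = \<phi> (max (-1) (min t 0))" for t
  have \<psi>c: "continuous_on UNIV \<psi>"
    unfolding \<psi>_def by (rule continuous_on_compose2[OF \<phi>]) (auto intro!: continuous_intros)
  define F where "F = truncated_field g r"
  define P where "P y t = \<psi> t + (LINT s:{0..t}|lborel. F y s)" for y t
  have Fint: "set_integrable lborel {0..n} (F y)" if "continuous_on UNIV y" for y n
    unfolding F_def by (rule truncated_field_integrable[OF p g continuous_on_subset[OF that] r]) simp
  have Fle: "ennreal (norm (LINT s:{a..c}|lborel. F y s)) \<le> (\<integral>\<^sup>+s\<in>{a..c}. ennreal (m s) \<partial>lborel)" for y a c
  proof (rule order_trans[OF norm_set_integral_le_nn_integral nn_integral_mono_AE])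
    show "AE s in lborel. ennreal (norm (F y s)) * indicator {a..c} s \<le> ennreal (m s) * indicator {a..c} s"
      using truncated_field_bound[OF b r, of y] unfolding F_def
      by eventually_elim (auto simp: indicator_def intro: ennreal_leI)
  qed
  have mk: "(\<integral>\<^sup>+s\<in>{a..c}. ennreal (m s) \<partial>lborel) \<le> ennreal (LINT s:{a..c}|lborel. k s)" for a c
  proof -
    have "(\<integral>\<^sup>+s\<in>{a..c}. ennreal (m s) \<partial>lborel) \<le> (\<integral>\<^sup>+s. ennreal (indicator {a..c} s *\<^sub>R k s) \<partial>lborel)"
      by (intro nn_integral_mono) (auto simp: indicator_def k_def l0 intro: ennreal_leI)
    also have "\<dots> = ennreal (LINT s:{a..c}|lborel. k s)"
      unfolding set_lebesgue_integral_def using l_integrable unfolding set_integrable_def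
      by (intro nn_integral_eq_integral) (auto simp: l_nonneg)
    finally show ?thesis .
  qed
  have Fk: "norm (LINT s:{a..c}|lborel. F y s) \<le> (LINT s:{a..c}|lborel. k s)" for y a c
  proof -
    have "0 \<le> (LINT s:{a..c}|lborel. k s)" by (simp add: set_lebesgue_integral_def l_nonneg)
    then show ?thesis using order_trans[OF Fle mk, of a c y] by (simp add: ennreal_le_iff)
  qed
  have Pc: "continuous_on UNIV (P y)" if y: "continuous_on UNIV y" for y
  proof -
    have "continuous_on {-n..n} (\<lambda>t. LINT s:{0..t}|lborel. F y s)" for n :: real
    proof -
      have "continuous_on {0..max n 0} (\<lambda>t. integral {0..t} (F y))"
        by (intro indefinite_integral_continuous_1 set_borel_integral_eq_integral(1) Fint y)
      then have "continuous_on {0..max n 0} (\<lambda>t. LINT s:{0..t}|lborel. F y s)"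
        by (rule continuous_on_eq) (simp add: set_borel_integral_eq_integral(2)[OF Fint[OF y]])
      then have "continuous_on {-n..n} (\<lambda>t. (\<lambda>t. LINT s:{0..t}|lborel. F y s) (max t 0))"
        by (rule continuous_on_compose2) (auto intro!: continuous_intros)
      then show ?thesis
      proof (rule continuous_on_eq)
        fix t
        show "(LINT s:{0..max t 0}|lborel. F y s) = (LINT s:{0..t}|lborel. F y s)"
        proof (cases "t \<ge> 0")
          case False
          have "(LINT s:{0..0::real}|lborel. F y s) = 0"
            using set_borel_integral_eq_integral(2)[OF Fint[OF y, of 0]] by simp
          then show ?thesis using False by (simp add: set_lebesgue_integral_def)
        qed simp
      qed
    qed
    note cont = this
    have "continuous_on (\<Union>n::nat. {-real n<..<real n}) (\<lambda>t. LINT s:{0..t}|lborel. F y s)"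
    proof (rule continuous_on_open_UN)
      fix n :: nat
      show "continuous_on {-real n<..<real n} (\<lambda>t. LINT s:{0..t}|lborel. F y s)"
        by (rule continuous_on_subset[OF cont[of "real n"]]) auto
    qed auto
    moreover have "(\<Union>n::nat. {-real n<..<real n}) = UNIV"
    proof -
      have "\<exists>n. t \<in> {-real n<..<real n}" for t
        using reals_Archimedean2[of "\<bar>t\<bar>"] by (auto simp: abs_less_iff minus_less_iff)
      then show ?thesis by blast
    qed
    ultimately show ?thesis unfolding P_def by (intro continuous_on_add \<psi>c) simp
  qed
  \<comment> \<open>The present and the delayed argument contribute a factor 2 and the weight with
    exponent factor 4 a factor 1/4, which leaves the contraction constant 1/2.\<close>
  have contract: "norm (P y t - P y' t) \<le> K / 2 * E t"
    if y: "continuous_on UNIV y" and y': "continuous_on UNIV y'" and K: "K \<ge> 0"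
      and le: "\<And>s. norm (y s - y' s) \<le> K * E s" for y y' K t
  proof -
    have "P y t - P y' t = (LINT s:{0..t}|lborel. F y s - F y' s)"
      by (simp add: P_def set_integral_diff[OF Fint[OF y] Fint[OF y']])
    then have "ennreal (norm (P y t - P y' t)) \<le> (\<integral>\<^sup>+s\<in>{0..t}. norm (F y s - F y' s) \<partial>lborel)"
      by (simp add: norm_set_integral_le_nn_integral)
    also have "\<dots> \<le> (\<integral>\<^sup>+s. ennreal (2 * K) * (ennreal (k s * E s) * indicator {0..t} s) \<partial>lborel)"
    proof (rule nn_integral_mono_AE)
      show "AE s in lborel. ennreal (norm (F y s - F y' s)) * indicator {0..t} s
        \<le> ennreal (2 * K) * (ennreal (k s * E s) * indicator {0..t} s)"
        using truncated_field_lipschitz[OF b r, of y y']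
      proof eventually_elim
        case (elim s)
        have "norm (y (s - 1) - y' (s - 1)) \<le> K * E (s - 1)" by (rule le)
        also have "\<dots> \<le> K * E s" using K by (intro mult_left_mono E_mono) auto
        finally have 1: "norm (y s - y' s) + norm (y (s - 1) - y' (s - 1)) \<le> 2 * K * E s" using le[of s] by simp
        have "norm (F y s - F y' s) \<le> l s * (norm (y s - y' s) + norm (y (s - 1) - y' (s - 1)))"
          using elim by (simp add: F_def)
        also have "\<dots> \<le> k s * (2 * K * E s)"
          using 1 l0[of s] m0[of s] by (intro mult_mono) (auto simp: k_def)
        also have "\<dots> = 2 * K * (k s * E s)" by simp
        finally show ?case
          using K l_nonneg[of s] E1[of s] by (cases "s \<in> {0..t}") (auto simp: ennreal_leI simp flip: ennreal_mult')
      qed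
    qed
    also have "\<dots> = ennreal (2 * K) * (\<integral>\<^sup>+s\<in>{0..t}. ennreal (k s * E s) \<partial>lborel)"
      unfolding E_def by (intro nn_integral_cmult) measurable
    also have "\<dots> \<le> ennreal (2 * K) * ennreal ((E t - 1) / 4)"
      using nn_integral_kernel_exp[of 4 t] by (intro mult_left_mono) (auto simp: E_def)
    also have "\<dots> = ennreal (2 * K * ((E t - 1) / 4))"
      using K E1[of t] by (intro ennreal_mult[symmetric]) auto
    also have "2 * K * ((E t - 1) / 4) = K / 2 * (E t - 1)" by simp
    also have "\<dots> \<le> ennreal (K / 2 * E t)" using K by (intro ennreal_leI mult_left_mono) auto
    finally show ?thesis using K E1[of t] by (subst (asm) ennreal_le_iff) auto
  qed
  define Y where "Y j = (P ^^ j) \<psi>" for j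
  have Y0: "Y 0 = \<psi>" and YS: "Y (Suc j) = P (Y j)" for j by (simp_all add: Y_def)
  have Yc: "continuous_on UNIV (Y j)" for j
    by (induction j) (auto simp: Y0 YS \<psi>c Pc)
  have step: "norm (Y (Suc j) t - Y j t) \<le> (1/2) ^ j * E t" for j t
  proof (induction j arbitrary: t)
    case 0
    have "norm (Y 1 t - Y 0 t) \<le> (LINT s:{0..t}|lborel. k s)" using Fk by (simp add: Y0 YS P_def)
    also have "\<dots> = kernel_int k t" by (simp add: kernel_int_def)
    also have "\<dots> \<le> E t" using exp_ge_add_one_self[of "4 * kernel_int k t"] kernel_int_nonneg[of t] unfolding E_def by linarith
    finally show ?case by simp
  next
    case (Suc j)
    have "norm (P (Y (Suc j)) t - P (Y j) t) \<le> (1/2) ^ j / 2 * E t"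
      by (rule contract[OF Yc Yc _ Suc]) simp
    then show ?case by (simp add: YS)
  qed
  define y where "y t = \<psi> t + (\<Sum>j. Y (Suc j) t - Y j t)" for t
  have tele: "(\<Sum>j<n. Y (Suc j) t - Y j t) = Y n t - \<psi> t" for n t
    using sum_lessThan_telescope[of "\<lambda>j. Y j t" n] by (simp add: Y0)
  have smb: "summable (\<lambda>j. (1/2) ^ j * E t)" for t by (intro summable_mult2 summable_geometric) simp
  have sm: "summable (\<lambda>j. Y (Suc j) t - Y j t)" for t
    by (rule summable_comparison_test[OF _ smb[of t]]) (auto intro: step)
  have err: "norm (y t - Y n t) \<le> 2 * (1/2) ^ n * E t" for n t
  proof -
    have "y t - Y n t = (\<Sum>j. Y (Suc (j + n)) t - Y (j + n) t)"
      using suminf_split_initial_segment[OF sm[of t], of n] tele[where n = n and t = t] by (simp add: y_def)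
    also have "norm \<dots> \<le> (\<Sum>j. norm (Y (Suc (j + n)) t - Y (j + n) t))"
    proof (rule summable_norm)
      show "summable (\<lambda>j. norm (Y (Suc (j + n)) t - Y (j + n) t))"
      proof (rule summable_comparison_test)
        show "\<exists>N. \<forall>j\<ge>N. norm (norm (Y (Suc (j + n)) t - Y (j + n) t)) \<le> (1/2) ^ (j + n) * E t"
          using step by auto
        show "summable (\<lambda>j. (1/2) ^ (j + n) * E t)" using smb[of t] by (subst summable_iff_shift[of "\<lambda>j. (1/2) ^ j * E t"])
      qed
    qed
    also have "\<dots> \<le> (\<Sum>j. ((1/2) ^ n * E t) * (1/2) ^ j)"
    proof (rule suminf_le)
      show "norm (Y (Suc (j + n)) t - Y (j + n) t) \<le> ((1/2) ^ n * E t) * (1/2) ^ j" for j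
        using step[of "j + n" t] by (simp add: power_add mult_ac)
      show s2: "summable (\<lambda>j. ((1/2) ^ n * E t) * (1/2) ^ j)" by (intro summable_mult summable_geometric) simp
      show "summable (\<lambda>j. norm (Y (Suc (j + n)) t - Y (j + n) t))"
        by (rule summable_comparison_test[OF _ s2]) (use step[of "_ + n" t] in \<open>auto simp: power_add mult_ac\<close>)
    qed
    also have "\<dots> = ((1/2) ^ n * E t) * 2"
      by (subst suminf_mult) (auto intro: summable_geometric simp: suminf_geometric)
    finally show ?thesis by simp
  qed
  have lim: "(\<lambda>n. Y n t) \<longlonglongrightarrow> y t" for t
  proof (rule Lim_null[THEN iffD2, OF tendsto_norm_zero_cancel])
    have "(\<lambda>n. 2 * (1/2) ^ n * E t) \<longlonglongrightarrow> 2 * 0 * E t"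
      by (intro tendsto_intros LIMSEQ_power_zero) simp
    then have z: "(\<lambda>n. 2 * (1/2) ^ n * E t) \<longlonglongrightarrow> 0" by simp
    show "(\<lambda>n. norm (Y n t - y t)) \<longlonglongrightarrow> 0"
      by (rule tendsto_sandwich[OF _ _ tendsto_const z]) (use err in \<open>auto simp: norm_minus_commute\<close>)
  qed
  have yc: "continuous_on UNIV y"
  proof -
    have "continuous_on {..c} y" for c
    proof (rule uniform_limit_theorem)
      show "uniform_limit {..c} Y y sequentially"
      proof (rule uniform_limitI)
        fix e :: real assume e: "e > 0"
        have "(\<lambda>n. 2 * (1/2) ^ n * E c) \<longlonglongrightarrow> 2 * 0 * E c"
          by (intro tendsto_intros LIMSEQ_power_zero) simp
        then have "eventually (\<lambda>n. 2 * (1/2) ^ n * E c < e) sequentially"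
          using e by (intro order_tendstoD(2)) auto
        then show "eventually (\<lambda>n. \<forall>t\<in>{..c}. dist (Y n t) (y t) < e) sequentially"
        proof eventually_elim
          case (elim n)
          show ?case
          proof
            fix t assume t: "t \<in> {..c}"
            have "norm (y t - Y n t) \<le> 2 * (1/2) ^ n * E t" by (rule err)
            also have "\<dots> \<le> 2 * (1/2) ^ n * E c" using t by (intro mult_left_mono E_mono) auto
            finally show "dist (Y n t) (y t) < e" using elim by (simp add: dist_norm norm_minus_commute)
          qed
        qed
      qed
      show "eventually (\<lambda>n. continuous_on {..c} (Y n)) sequentially"
        by (intro always_eventually allI continuous_on_subset[OF Yc]) simp
    qed simp
    note cont = this
    have "continuous_on (\<Union>n::nat. {..<real n}) y"
    proof (rule continuous_on_open_UN)
      fix n :: nat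
      show "continuous_on {..<real n} y" by (rule continuous_on_subset[OF cont[of "real n"]]) auto
    qed auto
    moreover have "(\<Union>n::nat. {..<real n}) = UNIV" using reals_Archimedean2 by auto
    ultimately show ?thesis by simp
  qed
  have fix_point: "y t = P y t" for t
  proof -
    have le: "norm (Y (Suc n) t - P y t) \<le> (1/2) ^ n * E t" for n
      using contract[OF yc Yc, of "2 * (1/2) ^ n" n t] err[of _ n] by (simp add: YS norm_minus_commute)
    have "(\<lambda>n. (1/2) ^ n * E t) \<longlonglongrightarrow> 0 * E t"
      by (intro tendsto_intros LIMSEQ_power_zero) simp
    then have z: "(\<lambda>n. (1/2) ^ n * E t) \<longlonglongrightarrow> 0" by simp
    have "(\<lambda>n. norm (Y (Suc n) t - P y t)) \<longlonglongrightarrow> 0"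
      by (rule tendsto_sandwich[OF always_eventually always_eventually tendsto_const z]) (simp_all add: le)
    then have "(\<lambda>n. Y (Suc n) t) \<longlonglongrightarrow> P y t"
      by (rule Lim_null[THEN iffD2, OF tendsto_norm_zero_cancel])
    moreover have "(\<lambda>n. Y (Suc n) t) \<longlonglongrightarrow> y t" using lim by (rule LIMSEQ_Suc)
    ultimately show ?thesis by (rule LIMSEQ_unique[rotated])
  qed
  show thesis
  proof (rule that[OF yc])
    fix t :: real assume t: "-1 \<le> t" "t \<le> 0"
    have "(LINT s:{0..t}|lborel. F y s) = 0"
    proof (cases "t = 0")
      case True
      then show ?thesis using set_borel_integral_eq_integral(2)[OF Fint[OF yc, of 0]] by simp
    next
      case False
      then show ?thesis using t by (simp add: set_lebesgue_integral_def)
    qed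
    then show "y t = \<phi> t" using t fix_point[of t] by (simp add: P_def \<psi>_def min_def max_def)
  next
    fix n
    have "y 0 = \<psi> 0"
      using fix_point[of 0] set_borel_integral_eq_integral(2)[OF Fint[OF yc, of 0]] by (simp add: P_def)
    then have "primitive_on 0 n y (F y)"
      using fix_point Fint[OF yc] by (intro primitive_onI) (auto simp: P_def \<psi>_def min_def)
    then show "truncated_solution g r n y"
      unfolding truncated_solution_def F_def by (auto intro: continuous_on_subset[OF yc])
  qed
qed

section \<open>Maximal solutions\<close>

lemma primitive_on_cong2:
  assumes 1: "primitive_on a b x X" and x: "\<And>t. a \<le> t \<Longrightarrow> t \<le> b \<Longrightarrow> x t = x' t"
    and X: "\<And>t. a \<le> t \<Longrightarrow> t \<le> b \<Longrightarrow> X t = X' t"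
  shows "primitive_on a b x' X'"
  unfolding primitive_on_def
proof (intro conjI allI impI)
  have "set_integrable lborel {a..b} X \<longleftrightarrow> set_integrable lborel {a..b} X'"
    by (rule set_integrable_cong) (auto simp: X)
  then show "set_integrable lborel {a..b} X'" using 1 by (simp add: primitive_on_def)
  fix s t assume st: "a \<le> s \<and> s \<le> t \<and> t \<le> b"
  have "(LINT r:{s..t}|lborel. X r) = (LINT r:{s..t}|lborel. X' r)"
    by (rule set_lebesgue_integral_cong) (use st X in auto)
  moreover have "x t - x s = (LINT r:{s..t}|lborel. X r)" using 1 st by (simp add: primitive_on_def)
  ultimately show "x' t - x' s = (LINT r:{s..t}|lborel. X' r)" using x[of s] x[of t] st by simp
qed

definition field_along :: "'n::finite delay_field \<Rightarrow> (real \<Rightarrow> real ^ 'n) \<Rightarrow> real \<Rightarrow> real ^ 'n" where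
  "field_along g x s = g s (x s, x (s - 1))"

definition local_solution :: "'n::finite delay_field \<Rightarrow> real \<Rightarrow> (real \<Rightarrow> real ^ 'n) \<Rightarrow> bool" where
  "local_solution g c x \<longleftrightarrow> continuous_on {-1..c} x \<and> primitive_on 0 c x (field_along g x)"

lemma truncated_field_eq:
  assumes "\<And>t. -1 \<le> t \<Longrightarrow> t \<le> c \<Longrightarrow> norm (x t) \<le> r" "0 \<le> s" "s \<le> c"
  shows "truncated_field g r x s = field_along g x s"
  using assms(1)[of s] assms(1)[of "s - 1"] assms(2,3)
  by (simp add: truncated_field_def field_along_def ball_proj_id)

lemma local_solution_iff_truncated:
  assumes "\<And>t. -1 \<le> t \<Longrightarrow> t \<le> c \<Longrightarrow> norm (x t) \<le> r"
  shows "local_solution g c x \<longleftrightarrow> truncated_solution g r c x"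
proof -
  have eq: "truncated_field g r x s = field_along g x s" if "0 \<le> s" "s \<le> c" for s
    by (rule truncated_field_eq[OF assms that])
  have "primitive_on 0 c x (field_along g x) \<longleftrightarrow> primitive_on 0 c x (truncated_field g r x)"
  proof
    assume "primitive_on 0 c x (field_along g x)"
    then show "primitive_on 0 c x (truncated_field g r x)" by (rule primitive_on_cong2) (simp_all add: eq)
  next
    assume "primitive_on 0 c x (truncated_field g r x)"
    then show "primitive_on 0 c x (field_along g x)" by (rule primitive_on_cong2) (simp_all add: eq)
  qed
  then show ?thesis unfolding local_solution_def truncated_solution_def by simp
qed

lemma continuous_on_Icc_bounded:
  fixes x :: "real \<Rightarrow> 'a::real_normed_vector"
  assumes "continuous_on {a..b} x"
  obtains r where "r \<ge> 0" "\<And>t. a \<le> t \<Longrightarrow> t \<le> b \<Longrightarrow> norm (x t) \<le> r"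
proof -
  have "bounded (x ` {a..b})" by (intro compact_imp_bounded compact_continuous_image compact_Icc assms)
  then obtain C where C: "\<forall>z\<in>x ` {a..b}. norm z \<le> C" unfolding bounded_iff by (elim exE)
  show thesis
  proof (rule that[of "\<bar>C\<bar>"])
    fix t assume "a \<le> t" "t \<le> b"
    then have "norm (x t) \<le> C" using C by simp
    then show "norm (x t) \<le> \<bar>C\<bar>" by linarith
  qed simp
qed

text \<open>Two continuous solutions on a compact interval lie in a common ball, so both solve the
  same truncated equation.\<close>

lemma local_solution_unique:
  assumes p: "p > 0" and g: "g \<in> LC_fun p" and x: "local_solution g c x" and y: "local_solution g c y"
    and init: "\<And>t. -1 \<le> t \<Longrightarrow> t \<le> 0 \<Longrightarrow> x t = y t" and t: "-1 \<le> t" "t \<le> c"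
  shows "x t = y t"
proof -
  obtain r1 where r1: "r1 \<ge> 0" "\<And>t. -1 \<le> t \<Longrightarrow> t \<le> c \<Longrightarrow> norm (x t) \<le> r1"
    using x continuous_on_Icc_bounded[of "-1" c x] unfolding local_solution_def by metis
  obtain r2 where r2: "r2 \<ge> 0" "\<And>t. -1 \<le> t \<Longrightarrow> t \<le> c \<Longrightarrow> norm (y t) \<le> r2"
    using y continuous_on_Icc_bounded[of "-1" c y] unfolding local_solution_def by metis
  define r where "r = max r1 r2"
  have rx: "norm (x t) \<le> r" if "-1 \<le> t" "t \<le> c" for t using r1(2)[OF that] by (simp add: r_def)
  have ry: "norm (y t) \<le> r" if "-1 \<le> t" "t \<le> c" for t using r2(2)[OF that] by (simp add: r_def)
  show ?thesis
  proof (rule truncated_solution_unique[OF p _ g _ _ init t])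
    show "0 \<le> r" using r1(1) by (simp add: r_def)
    show "truncated_solution g r c x" using x local_solution_iff_truncated[of c x r g] rx by blast
    show "truncated_solution g r c y" using y local_solution_iff_truncated[of c y r g] ry by blast
  qed
qed

lemma local_solution_subset: "local_solution g c x \<Longrightarrow> d \<le> c \<Longrightarrow> local_solution g d x"
  unfolding local_solution_def by (auto elim: continuous_on_subset primitive_on_subset)

lemma local_solution_cong:
  assumes "local_solution g c x" "\<And>t. -1 \<le> t \<Longrightarrow> t \<le> c \<Longrightarrow> x t = y t"
  shows "local_solution g c y"
  unfolding local_solution_def
proof
  have "continuous_on {-1..c} x" using assms(1) by (simp add: local_solution_def)
  then show "continuous_on {-1..c} y" by (rule continuous_on_eq) (use assms(2) in auto)
  have "primitive_on 0 c x (field_along g x)" using assms(1) by (simp add: local_solution_def)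
  then show "primitive_on 0 c y (field_along g y)"
    by (rule primitive_on_cong2) (auto simp: field_along_def assms(2))
qed

abbreviation solution_domain :: "ereal \<Rightarrow> real set" where
  "solution_domain b \<equiv> {t. -1 \<le> t \<and> ereal t < b}"

lemma continuous_on_solution_domain:
  fixes x :: "real \<Rightarrow> 'a::topological_space"
  assumes "\<And>c. 0 \<le> c \<Longrightarrow> ereal c < b \<Longrightarrow> continuous_on {-1..c} x" and b: "0 < b"
  shows "continuous_on (solution_domain b) x"
  unfolding continuous_on_eq_continuous_within
proof
  fix t assume t: "t \<in> solution_domain b"
  have "ereal (max t 0) < b" using t b by (auto simp: max_def zero_ereal_def)
  then obtain c where c: "ereal (max t 0) < ereal c" "ereal c < b" using ereal_dense2 by blast
  then have tc: "t < c" "0 \<le> c" by auto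
  have "continuous_on {-1..c} x" by (rule assms(1)[OF tc(2) c(2)])
  then have "continuous (at t within {-1..c}) x"
    using t tc by (simp add: continuous_on_eq_continuous_within)
  moreover have "at t within {-1..c} = at t within solution_domain b"
  proof (rule at_within_nhd[of t "{..<c}"])
    show "{-1..c} \<inter> {..<c} - {t} = solution_domain b \<inter> {..<c} - {t}"
    proof -
      have "ereal s < b" if "s < c" for s using that c(2) by (meson ereal_less_eq(3) less_imp_le order_le_less_trans)
      then show ?thesis by auto
    qed
  qed (use tc in auto)
  ultimately show "continuous (at t within solution_domain b) x" by simp
qed

text \<open>Reduces solutions to integral equations on compact intervals. The field along
  \<open>x\<close> is integrable there because it agrees with a truncated field. In the converse
  direction the null sets of countably many rational end points are united, since those of all
  \<open>c\<close> could not be.\<close>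

lemma is_solution_iff:
  assumes p: "p > 0" and g: "g \<in> LC_fun p"
  shows "is_solution g \<phi> b x \<longleftrightarrow> 0 < b \<and> x \<in> extensional (solution_domain b) \<and> (\<forall>t \<in> {-1..0}. x t = \<phi> t) \<and>
     (\<forall>c\<ge>0. ereal c < b \<longrightarrow> local_solution g c x)"
proof
  assume S: "is_solution g \<phi> b x"
  have "local_solution g c x" if c: "0 \<le> c" "ereal c < b" for c
    unfolding local_solution_def
  proof
    have le: "ereal t < b" if "t \<le> c" for t using that c(2) by (meson ereal_less_eq(3) order_le_less_trans)
    show cx: "continuous_on {-1..c} x"
      using S le unfolding is_solution_def by (auto intro: continuous_on_subset[of "solution_domain b"])
    obtain r where r: "r \<ge> 0" "\<And>t. -1 \<le> t \<Longrightarrow> t \<le> c \<Longrightarrow> norm (x t) \<le> r"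
      using continuous_on_Icc_bounded[OF cx] by metis
    have "set_integrable lborel {0..c} (truncated_field g r x)"
      by (rule truncated_field_integrable[OF p g cx r(1)])
    also have "set_integrable lborel {0..c} (truncated_field g r x) \<longleftrightarrow> set_integrable lborel {0..c} (field_along g x)"
      by (rule set_integrable_cong) (auto intro: truncated_field_eq[OF r(2)])
    finally have int: "set_integrable lborel {0..c} (field_along g x)" .
    have "AE t in lborel. 0 < t \<and> ereal t < b \<longrightarrow> (x has_vector_derivative g t (x t, x (t - 1))) (at t)"
      using S by (simp add: is_solution_def)
    then have "AE t in lborel. 0 < t \<and> t < c \<longrightarrow> (x has_vector_derivative field_along g x t) (at t)"
      by eventually_elim (simp add: le field_along_def)
    then show "primitive_on 0 c x (field_along g x)"
      using S c by (intro absolutely_continuous_imp_primitive_on int) (auto simp: is_solution_def)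
  qed
  then show "0 < b \<and> x \<in> extensional (solution_domain b) \<and> (\<forall>t \<in> {-1..0}. x t = \<phi> t) \<and>
     (\<forall>c\<ge>0. ereal c < b \<longrightarrow> local_solution g c x)"
    using S by (simp add: is_solution_def)
next
  assume R: "0 < b \<and> x \<in> extensional (solution_domain b) \<and> (\<forall>t \<in> {-1..0}. x t = \<phi> t) \<and>
     (\<forall>c\<ge>0. ereal c < b \<longrightarrow> local_solution g c x)"
  then have L: "local_solution g c x" if "0 \<le> c" "ereal c < b" for c using that by blast
  have "AE t in lborel. \<forall>c\<in>\<rat>. 0 \<le> c \<and> ereal c < b \<longrightarrow> 0 < t \<and> t < c \<longrightarrow> (x has_vector_derivative field_along g x t) (at t)"
  proof (subst AE_ball_countable[OF countable_rat], intro ballI)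
    fix c :: real
    show "AE t in lborel. 0 \<le> c \<and> ereal c < b \<longrightarrow> 0 < t \<and> t < c \<longrightarrow> (x has_vector_derivative field_along g x t) (at t)"
    proof (cases "0 \<le> c \<and> ereal c < b")
      case True
      then have "primitive_on 0 c x (field_along g x)" using L[of c] by (simp add: local_solution_def)
      from primitive_on_AE_deriv[OF this] show ?thesis by eventually_elim simp
    next
      case False
      then show ?thesis by (intro AE_I2) blast
    qed
  qed
  then have ae: "AE t in lborel. 0 < t \<and> ereal t < b \<longrightarrow> (x has_vector_derivative g t (x t, x (t - 1))) (at t)"
  proof eventually_elim
    case (elim t)
    show ?case
    proof
      assume t: "0 < t \<and> ereal t < b"
      then obtain d where "ereal t < ereal d" "ereal d < b" using ereal_dense2 by blast
      moreover obtain c where "c \<in> \<rat>" "t < c" "c < d" using Rats_dense_in_real[of t d] calculation by auto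
      ultimately have "c \<in> \<rat>" "0 \<le> c" "ereal c < b" "t < c"
        using t by (auto intro: less_trans[of "ereal c" "ereal d"])
      then show "(x has_vector_derivative g t (x t, x (t - 1))) (at t)"
        using elim[rule_format, of c] t by (simp add: field_along_def)
    qed
  qed
  show "is_solution g \<phi> b x"
    unfolding is_solution_def
  proof (intro conjI ae)
    show "continuous_on (solution_domain b) x"
      using L R by (intro continuous_on_solution_domain) (auto simp: local_solution_def)
    show "\<forall>c\<ge>0. ereal c < b \<longrightarrow> absolutely_continuous_on {0..c} x"
      using L unfolding local_solution_def by (auto intro: primitive_on_absolutely_continuous)
  qed (use R in auto)
qed

lemma is_solution_unique:
  assumes p: "p > 0" and g: "g \<in> LC_fun p" and x: "is_solution g \<phi> b x" and y: "is_solution g \<phi> b' y"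
    and t: "-1 \<le> t" "ereal t < b" "ereal t < b'"
  shows "x t = y t"
proof -
  note X = x[unfolded is_solution_iff[OF p g]] and Y = y[unfolded is_solution_iff[OF p g]]
  show ?thesis
  proof (cases "t \<le> 0")
    case True
    then show ?thesis using X Y t by auto
  next
    case False
    then have "local_solution g t x" "local_solution g t y" using X Y t by auto
    then show ?thesis
      by (rule local_solution_unique[OF p g]) (use X Y t in auto)
  qed
qed

lemma is_solutionI_local:
  assumes p: "p > 0" and g: "g \<in> LC_fun p" and c: "c > 0" and x: "\<And>d. 0 \<le> d \<Longrightarrow> ereal d < c \<Longrightarrow> local_solution g d x"
    and init: "\<And>t. -1 \<le> t \<Longrightarrow> t \<le> 0 \<Longrightarrow> x t = \<phi> t"
  shows "is_solution g \<phi> c (restrict x (solution_domain c))"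
  unfolding is_solution_iff[OF p g]
proof (intro conjI allI impI ballI c)
  fix t :: real assume t: "t \<in> {-1..0}"
  then have "ereal t < c" using c by (cases c) auto
  then show "restrict x (solution_domain c) t = \<phi> t" using t init by simp
next
  fix d assume d: "0 \<le> d" "ereal d < c"
  have le: "ereal t < c" if "t \<le> d" for t using that d(2) by (meson ereal_less_eq(3) order_le_less_trans)
  show "local_solution g d (restrict x (solution_domain c))"
    by (rule local_solution_cong[OF x[OF d]]) (simp add: le)
qed simp

section \<open>The maximal solution of one initial value problem\<close>

locale delay_ivp =
  fixes p :: nat and g :: "'n::finite delay_field" and \<phi> :: "real \<Rightarrow> real ^ 'n"
  assumes p0: "p > 0" and g: "g \<in> LC_fun p" and \<phi>: "continuous_on {-1..0} \<phi>"
begin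

lemma truncated_imp_is_solution:
  assumes y: "\<And>n. truncated_solution g r n y" and init: "\<And>t. -1 \<le> t \<Longrightarrow> t \<le> 0 \<Longrightarrow> y t = \<phi> t"
    and c: "c > 0" and r: "\<And>t. -1 \<le> t \<Longrightarrow> t \<le> c \<Longrightarrow> norm (y t) \<le> r"
  shows "is_solution g \<phi> (ereal c) (restrict y (solution_domain (ereal c)))"
proof (rule is_solutionI_local[OF p0 g])
  fix d :: real assume d: "0 \<le> d" "ereal d < ereal c"
  then have "norm (y t) \<le> r" if "-1 \<le> t" "t \<le> d" for t using r that by simp
  then show "local_solution g d y" using local_solution_iff_truncated[of d y r g] y by blast
qed (use c init in auto)

text \<open>The radius exceeds the bound of \<phi> by 1. By continuity at 0 the truncated solution
  stays below this radius for a short time, during which it solves the original equation.\<close>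

lemma solution_exists: "\<exists>b x. is_solution g \<phi> b x"
proof -
  obtain C where C: "C \<ge> 0" "\<And>t. -1 \<le> t \<Longrightarrow> t \<le> 0 \<Longrightarrow> norm (\<phi> t) \<le> C"
    using continuous_on_Icc_bounded[OF \<phi>] by metis
  obtain y where yc: "continuous_on UNIV y" and init: "\<And>t. -1 \<le> t \<Longrightarrow> t \<le> 0 \<Longrightarrow> y t = \<phi> t"
    and y: "\<And>n. truncated_solution g (C + 1) n y"
    using truncated_solution_exists[OF p0 _ g \<phi>, of "C + 1"] C(1) by auto
  have "isCont y 0" using yc by (simp add: continuous_on_eq_continuous_at)
  then obtain d where d: "d > 0" "\<And>t. dist t 0 < d \<Longrightarrow> dist (y t) (y 0) < 1"
    unfolding continuous_at_eps_delta by (metis zero_less_one)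
  have "norm (y t) \<le> C + 1" if t: "-1 \<le> t" "t \<le> d / 2" for t
  proof (cases "t \<le> 0")
    case True
    then show ?thesis using C(2)[of t] init[of t] t by simp
  next
    case False
    then have "dist (y t) (y 0) < 1" using t d(1) by (intro d(2)) auto
    then have "norm (y t - y 0) < 1" by (simp add: dist_norm)
    moreover have "norm (y 0) \<le> C" using init[of 0] C(2)[of 0] by simp
    moreover have "norm (y t) \<le> norm (y t - y 0) + norm (y 0)" by (metis diff_add_cancel norm_triangle_ineq)
    ultimately show ?thesis by linarith
  qed
  then have "is_solution g \<phi> (ereal (d / 2)) (restrict y (solution_domain (ereal (d / 2))))"
    using d(1) by (intro truncated_imp_is_solution[OF y init]) auto
  then show ?thesis by blast
qed

text \<open>Solutions agree wherever two of them are defined, so the value at \<open>t\<close> can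
  be taken from any solution alive at \<open>t\<close>. Every compact part of the glued function
  belongs to a single solution.\<close>

lemma Sup_is_solution:
  obtains B X where "is_solution g \<phi> B X" "\<And>b x. is_solution g \<phi> b x \<Longrightarrow> b \<le> B"
proof -
  define S where "S = {b. \<exists>x. is_solution g \<phi> b x}"
  define B where "B = Sup S"
  define X where "X t = (SOME x. \<exists>b x'. is_solution g \<phi> b x' \<and> ereal t < b \<and> x = x' t)" for t
  have Xeq: "X t = x t" if x: "is_solution g \<phi> b x" and t: "-1 \<le> t" "ereal t < b" for b x t
  proof -
    have "\<exists>b x'. is_solution g \<phi> b x' \<and> ereal t < b \<and> X t = x' t"
      unfolding X_def by (rule someI[of _ "x t"]) (use x t in blast)
    then obtain b' x' where "is_solution g \<phi> b' x'" "ereal t < b'" "X t = x' t" by (elim exE conjE)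
    then show ?thesis using is_solution_unique[OF p0 g _ x t(1) _ t(2)] by simp
  qed
  have up: "b \<le> B" if "is_solution g \<phi> b x" for b x
    unfolding B_def by (rule Sup_upper) (use that in \<open>auto simp: S_def\<close>)
  have pos: "b > 0" if "is_solution g \<phi> b x" for b x using that by (simp add: is_solution_def)
  have B: "B > 0" using solution_exists up pos by (metis order_less_le_trans)
  have "is_solution g \<phi> B (restrict X (solution_domain B))"
  proof (rule is_solutionI_local[OF p0 g B])
    fix d assume d: "0 \<le> d" "ereal d < B"
    obtain b x where b: "is_solution g \<phi> b x" "ereal d < b"
      using d(2) unfolding B_def less_Sup_iff S_def by blast
    have le: "ereal t < b" if "t \<le> d" for t using that b(2) by (meson ereal_less_eq(3) order_le_less_trans)
    have "local_solution g d x" using b d(1) is_solution_iff[OF p0 g] by blast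
    then show "local_solution g d X" by (rule local_solution_cong) (use Xeq[OF b(1)] le in auto)
  next
    fix t :: real assume t: "-1 \<le> t" "t \<le> 0"
    obtain b x where b: "is_solution g \<phi> b x" using solution_exists by blast
    have "ereal t < b" using pos[OF b] t(2) by (cases b) auto
    then have "X t = x t" using Xeq[OF b t(1)] by simp
    also have "\<dots> = \<phi> t" using b t by (simp add: is_solution_def)
    finally show "X t = \<phi> t" .
  qed
  then show thesis using up by (rule that)
qed

text \<open>The definition asks only that no solution extend \<open>x\<close> beyond
  \<open>b\<close>. By uniqueness the solution with the largest end point extends every other one,
  so it alone is maximal, and the definite description denotes it.\<close>

lemma maximal_solution:
  "is_solution g \<phi> (sol_end g \<phi>) (sol g \<phi>)" "is_solution g \<phi> b x \<Longrightarrow> b \<le> sol_end g \<phi>"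
proof -
  obtain B X where S: "is_solution g \<phi> B X" and up: "\<And>b x. is_solution g \<phi> b x \<Longrightarrow> b \<le> B"
    using Sup_is_solution by blast
  have max: "is_maximal_solution g \<phi> B X"
    unfolding is_maximal_solution_def using S up by (auto intro: antisym)
  have "maximal_solution g \<phi> = (B, X)"
    unfolding maximal_solution_def
  proof (rule the_equality)
    show "case (B, X) of (b, x) \<Rightarrow> is_maximal_solution g \<phi> b x" using max by simp
    fix q assume "case q of (b, x) \<Rightarrow> is_maximal_solution g \<phi> b x"
    then obtain b x where q: "q = (b, x)" and m: "is_maximal_solution g \<phi> b x" by (cases q) auto
    have s: "is_solution g \<phi> b x" using m by (simp add: is_maximal_solution_def)
    have bB: "b \<le> B" by (rule up[OF s])
    have ext: "X t = x t" if "-1 \<le> t" "ereal t < b" for t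
      using is_solution_unique[OF p0 g S s that(1) _ that(2)] that(2) bB by (meson order_less_le_trans)
    have "B = b" using m S bB ext unfolding is_maximal_solution_def by blast
    moreover have "X = x"
    proof (rule extensionalityI[of X "solution_domain b"])
      show "X \<in> extensional (solution_domain b)" using S \<open>B = b\<close> by (simp add: is_solution_def)
      show "x \<in> extensional (solution_domain b)" using s by (simp add: is_solution_def)
    qed (use ext in auto)
    ultimately show "q = (B, X)" using q by simp
  qed
  then show "is_solution g \<phi> (sol_end g \<phi>) (sol g \<phi>)" "is_solution g \<phi> b x \<Longrightarrow> b \<le> sol_end g \<phi>"
    using S up by (auto simp: sol_end_def sol_def)
qed

lemma sol_end_pos: "0 < sol_end g \<phi>"
  using maximal_solution(1) by (simp add: is_solution_def)

lemma sol_init: "-1 \<le> t \<Longrightarrow> t \<le> 0 \<Longrightarrow> sol g \<phi> t = \<phi> t"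
  using maximal_solution(1) by (simp add: is_solution_def)

lemma sol_local_solution: "ereal c < sol_end g \<phi> \<Longrightarrow> 0 \<le> c \<Longrightarrow> local_solution g c (sol g \<phi>)"
  using maximal_solution(1) is_solution_iff[OF p0 g] by blast

lemma sol_eq: "is_solution g \<phi> b x \<Longrightarrow> -1 \<le> t \<Longrightarrow> ereal t < b \<Longrightarrow> sol g \<phi> t = x t"
  using is_solution_unique[OF p0 g maximal_solution(1), of b x t] maximal_solution(2)[of b x]
  by (meson order_less_le_trans)

lemma sol_truncated:
  assumes y: "\<And>n. truncated_solution g r n y" and init: "\<And>t. -1 \<le> t \<Longrightarrow> t \<le> 0 \<Longrightarrow> y t = \<phi> t"
    and c: "c > 0" and r: "\<And>t. -1 \<le> t \<Longrightarrow> t \<le> c \<Longrightarrow> norm (y t) \<le> r"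
  shows "ereal c \<le> sol_end g \<phi>" "-1 \<le> t \<Longrightarrow> t < c \<Longrightarrow> sol g \<phi> t = y t"
proof -
  have s: "is_solution g \<phi> (ereal c) (restrict y (solution_domain (ereal c)))"
    by (rule truncated_imp_is_solution[OF y init c r])
  show "ereal c \<le> sol_end g \<phi>" by (rule maximal_solution(2)[OF s])
  show "-1 \<le> t \<Longrightarrow> t < c \<Longrightarrow> sol g \<phi> t = y t" using sol_eq[OF s, of t] by simp
qed

lemma truncated_eq_sol:
  assumes y: "truncated_solution g r c y" and init: "\<And>t. -1 \<le> t \<Longrightarrow> t \<le> 0 \<Longrightarrow> y t = \<phi> t"
    and c: "0 \<le> c" "ereal c < sol_end g \<phi>" and r: "\<And>t. -1 \<le> t \<Longrightarrow> t \<le> c \<Longrightarrow> norm (sol g \<phi> t) \<le> r"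
    and t: "-1 \<le> t" "t \<le> c"
  shows "sol g \<phi> t = y t"
proof (rule truncated_solution_unique[OF p0 _ g _ y _ t])
  show "0 \<le> r" using r[of "-1"] c(1) by (auto intro: order_trans[OF norm_ge_zero])
  show "truncated_solution g r c (sol g \<phi>)"
    using sol_local_solution[OF c(2,1)] local_solution_iff_truncated[of c "sol g \<phi>" r g] r by blast
qed (simp add: init sol_init)

end

text \<open>The equation is imposed at almost every time only; hence the flow depends on the class
  of a field and not on the representative.\<close>

lemma sol_cong_AE:
  assumes "AE t in lborel. \<forall>z. g t z = g' t z"
  shows "sol_end g \<phi> = sol_end g' \<phi>" "sol g \<phi> = sol g' \<phi>"
proof -
  have "is_solution g \<psi> b x \<longleftrightarrow> is_solution g' \<psi> b x" for \<psi> b x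
  proof -
    have "(AE t in lborel. 0 < t \<and> ereal t < b \<longrightarrow> (x has_vector_derivative g t (x t, x (t - 1))) (at t)) \<longleftrightarrow>
      (AE t in lborel. 0 < t \<and> ereal t < b \<longrightarrow> (x has_vector_derivative g' t (x t, x (t - 1))) (at t))"
    proof
      assume "AE t in lborel. 0 < t \<and> ereal t < b \<longrightarrow> (x has_vector_derivative g t (x t, x (t - 1))) (at t)"
      with assms show "AE t in lborel. 0 < t \<and> ereal t < b \<longrightarrow> (x has_vector_derivative g' t (x t, x (t - 1))) (at t)"
        by eventually_elim simp
    next
      assume "AE t in lborel. 0 < t \<and> ereal t < b \<longrightarrow> (x has_vector_derivative g' t (x t, x (t - 1))) (at t)"
      with assms show "AE t in lborel. 0 < t \<and> ereal t < b \<longrightarrow> (x has_vector_derivative g t (x t, x (t - 1))) (at t)"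
        by eventually_elim simp
    qed
    then show ?thesis unfolding is_solution_def by simp
  qed
  then have "is_solution g = is_solution g'" by (intro ext) simp
  then have "maximal_solution g \<phi> = maximal_solution g' \<phi>"
    unfolding maximal_solution_def is_maximal_solution_def by simp
  then show "sol_end g \<phi> = sol_end g' \<phi>" "sol g \<phi> = sol g' \<phi>" by (simp_all add: sol_end_def sol_def)
qed

text \<open>The solution of the translated problem, moved back by \<open>s\<close>, continues
  \<open>x\<close> beyond \<open>s\<close>. Maximality then places \<open>t + s\<close> before the
  end point, and uniqueness identifies the segments.\<close>

lemma sol_segment_semigroup:
  assumes p: "p > 0" and g: "g \<in> LC_fun p" and \<phi>: "continuous_on {-1..0} \<phi>"
    and s: "0 \<le> s" "ereal s < sol_end g \<phi>"
    and t: "0 \<le> t" "ereal t < sol_end (translate s g) (sol_segment g \<phi> s)"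
  shows "ereal (t + s) < sol_end g \<phi>"
    and "sol_segment g \<phi> (t + s) = sol_segment (translate s g) (sol_segment g \<phi> s) t"
proof -
  interpret G: delay_ivp p g \<phi> by unfold_locales (fact p g \<phi>)+
  define x where "x = sol g \<phi>"
  define \<psi> where "\<psi> = sol_segment g \<phi> s"
  have \<psi>x: "\<psi> u = x (s + u)" if "-1 \<le> u" "u \<le> 0" for u using that by (simp add: \<psi>_def sol_segment_def x_def)
  have xl: "local_solution g s x" unfolding x_def by (rule G.sol_local_solution[OF s(2,1)])
  then have xc: "continuous_on {-1..s} x" and xp: "primitive_on 0 s x (field_along g x)" by (auto simp: local_solution_def)
  have \<psi>c: "continuous_on {-1..0} \<psi>"
  proof (rule continuous_on_eq)
    show "continuous_on {-1..0} (\<lambda>u. x (s + u))"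
      by (rule continuous_on_compose2[OF xc]) (use s in \<open>auto intro!: continuous_intros\<close>)
  qed (simp add: \<psi>x)
  interpret T: delay_ivp p "translate s g" \<psi>
    by unfold_locales (fact p LC_fun_translate[OF g] \<psi>c)+
  define b where "b = sol_end (translate s g) \<psi>"
  define z where "z = sol (translate s g) \<psi>"
  define X where "X u = (if u \<le> s then x u else z (u - s))" for u
  have Xx: "X u = x u" if "u \<le> s" for u using that by (simp add: X_def)
  \<comment> \<open>Needed from \<open>s - 1\<close> on and not just from \<open>s\<close>: the
    delayed argument of a point in \<open>[s, s + c]\<close> reaches back by 1, where both formulas
    agree because \<open>z\<close> starts with the history of \<open>x\<close>.\<close>
  have Xz: "X u = z (u - s)" if "s - 1 \<le> u" for u
  proof (cases "u \<le> s")
    case True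
    then have "z (u - s) = \<psi> (u - s)" using T.sol_init[of "u - s"] that by (simp add: z_def)
    also have "\<dots> = x u" using \<psi>x[of "u - s"] True that by simp
    finally show ?thesis using True by (simp add: X_def)
  qed (simp add: X_def)
  have loc: "local_solution g (s + c) X" if c: "0 \<le> c" "ereal c < b" for c
    unfolding local_solution_def
  proof
    have zl: "local_solution (translate s g) c z" using T.sol_local_solution[of c] c by (simp add: b_def z_def)
    then have zc: "continuous_on {-1..c} z" and zp: "primitive_on 0 c z (field_along (translate s g) z)"
      by (auto simp: local_solution_def)
    have "continuous_on ({-1..s} \<union> {s..s + c}) X"
    proof (rule continuous_on_closed_Un)
      show "continuous_on {-1..s} X" by (rule continuous_on_eq[OF xc]) (simp add: Xx)
      have "continuous_on {s..s + c} (\<lambda>u. z (u - s))"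
        by (rule continuous_on_compose2[OF zc]) (auto intro!: continuous_intros)
      then show "continuous_on {s..s + c} X" by (rule continuous_on_eq) (simp add: Xz)
    qed auto
    moreover have "{-1..s} \<union> {s..s + c} = {-1..s + c}" using s c by auto
    ultimately show "continuous_on {-1..s + c} X" by simp
    show "primitive_on 0 (s + c) X (field_along g X)"
    proof (rule primitive_on_join[of 0 s])
      show "primitive_on 0 s X (field_along g X)"
        by (rule primitive_on_cong2[OF xp]) (simp_all add: Xx field_along_def)
      have "primitive_on (s + - s) (s + c + - s) z (field_along (translate s g) z)" using zp by simp
      then have "primitive_on s (s + c) (\<lambda>t. z (t + - s)) (\<lambda>t. field_along (translate s g) z (t + - s))"
        by (rule primitive_on_shift)
      then show "primitive_on s (s + c) X (field_along g X)"
      proof (rule primitive_on_cong2)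
        fix u assume u: "s \<le> u" "u \<le> s + c"
        show "z (u + - s) = X u" using u by (simp add: Xz)
        have "u - s - 1 = u - 1 - s" by simp
        then show "field_along (translate s g) z (u + - s) = field_along g X u"
          using u Xz[of u] Xz[of "u - 1"] by (simp add: field_along_def translate_def \<open>u - s - 1 = u - 1 - s\<close>)
      qed
    qed (use s c in auto)
  qed
  have bpos: "0 < b" unfolding b_def by (rule T.sol_end_pos)
  have sb0: "0 < ereal s + b" using s(1) bpos by (cases b) auto
  \<comment> \<open>The end point \<open>b\<close> may be infinite, hence the addition in
    \<open>ereal\<close> and the case distinctions on \<open>b\<close>.\<close>
  have SX: "is_solution g \<phi> (ereal s + b) (restrict X (solution_domain (ereal s + b)))"
  proof (rule is_solutionI_local[OF p g sb0])
    fix d assume d: "0 \<le> d" "ereal d < ereal s + b"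
    show "local_solution g d X"
    proof (cases "d \<le> s")
      case True
      have "local_solution g (s + 0) X" using bpos by (intro loc) (simp_all add: zero_ereal_def)
      then show ?thesis using True by (elim local_solution_subset) simp
    next
      case False
      have "ereal (d - s) < b" using d(2) by (cases b) auto
      then have "local_solution g (s + (d - s)) X" using False by (intro loc) auto
      then show ?thesis by simp
    qed
  next
    fix u :: real assume "-1 \<le> u" "u \<le> 0"
    then show "X u = \<phi> u" using s(1) G.sol_init[of u] by (simp add: Xx x_def)
  qed
  have tb: "ereal t < b" using t(2) by (simp add: b_def \<psi>_def)
  have lt: "ereal (t + s) < ereal s + b" using tb by (cases b) (auto simp: add.commute)
  also have "ereal s + b \<le> sol_end g \<phi>" by (rule G.maximal_solution(2)[OF SX])
  finally show "ereal (t + s) < sol_end g \<phi>" .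
  show "sol_segment g \<phi> (t + s) = sol_segment (translate s g) (sol_segment g \<phi> s) t"
    unfolding \<psi>_def[symmetric] sol_segment_def[of g \<phi> "t + s"] sol_segment_def[of "translate s g" \<psi> t]
  proof (rule restrict_ext)
    fix u :: real assume u: "u \<in> {-1..0}"
    have "ereal (t + s + u) \<le> ereal (t + s)" using u by simp
    then have le: "ereal (t + s + u) < ereal s + b" using lt by (rule order_le_less_trans)
    have "sol g \<phi> (t + s + u) = restrict X (solution_domain (ereal s + b)) (t + s + u)"
      by (rule G.sol_eq[OF SX _ le]) (use u t s in auto)
    also have "\<dots> = X (t + s + u)" using le u t s by simp
    also have "\<dots> = z (t + u)" using Xz[of "t + s + u"] u t by (simp add: algebra_simps)
    finally show "sol g \<phi> (t + s + u) = sol (translate s g) \<psi> (t + u)" by (simp add: z_def)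
  qed
qed

section \<open>Initial histories\<close>

lemma set_borel_measurable_diff:
  fixes u v :: "real \<Rightarrow> 'a::euclidean_space"
  assumes "set_borel_measurable borel A u" "set_borel_measurable borel A v"
  shows "set_borel_measurable borel A (\<lambda>s. u s - v s)"
  using borel_measurable_diff[OF assms[unfolded set_borel_measurable_def]]
  unfolding set_borel_measurable_def by (simp add: scaleR_diff_right)

lemma completion_ex_borel_measurable_euclidean:
  fixes y :: "real \<Rightarrow> 'a::euclidean_space"
  assumes y: "y \<in> borel_measurable lebesgue"
  obtains Y where "Y \<in> borel_measurable borel" "AE t in lborel. y t = Y t"
proof -
  have "\<forall>i\<in>Basis. \<exists>g\<in>borel_measurable lborel. AE t in lborel. y t \<bullet> i = g t"
    using y by (intro ballI completion_ex_borel_measurable_real borel_measurable_inner borel_measurable_const)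
  then obtain g where g: "\<And>i. i \<in> Basis \<Longrightarrow> g i \<in> borel_measurable lborel"
    "\<And>i. i \<in> Basis \<Longrightarrow> AE t in lborel. y t \<bullet> i = g i t" by metis
  show thesis
  proof
    show "(\<lambda>t. \<Sum>i\<in>Basis. g i t *\<^sub>R i) \<in> borel_measurable borel"
      using g(1) by (intro borel_measurable_sum borel_measurable_scaleR) auto
    have "AE t in lborel. \<forall>i\<in>Basis. y t \<bullet> i = g i t"
      using g(2) by (intro AE_finite_allI) auto
    then show "AE t in lborel. y t = (\<Sum>i\<in>Basis. g i t *\<^sub>R i)"
    proof eventually_elim
      case (elim t)
      have "y t = (\<Sum>i\<in>Basis. (y t \<bullet> i) *\<^sub>R i)" by (simp add: euclidean_representation)
      also have "\<dots> = (\<Sum>i\<in>Basis. g i t *\<^sub>R i)" using elim by (intro sum.cong) auto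
      finally show ?case .
    qed
  qed
qed

text \<open>Membership in \<open>C1p\<close> hides the derivative behind an existential quantifier
  and Lebesgue measurability. Here a Borel derivative \<open>Y\<close> is named, so that norms can
  be computed from \<open>x\<close> and \<open>Y\<close>.\<close>

definition lp_primitive :: "nat \<Rightarrow> (real \<Rightarrow> real ^ 'n::finite) \<Rightarrow> (real \<Rightarrow> real ^ 'n) \<Rightarrow> bool" where
  "lp_primitive p x Y \<longleftrightarrow> Y \<in> borel_measurable borel \<and> pint p (-1) 0 Y < \<infinity> \<and> primitive_on (-1) 0 x Y"

lemma set_integrable_of_pint:
  fixes u :: "real \<Rightarrow> 'a::{banach, second_countable_topology}"
  assumes p: "p > 0" and u: "set_borel_measurable borel {a..b} u" and fin: "pint p a b u < \<infinity>"
  shows "set_integrable lborel {a..b} u"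
  unfolding set_integrable_def
proof (rule integrableI_bounded)
  show "(\<lambda>s. indicator {a..b} s *\<^sub>R u s) \<in> borel_measurable lborel"
    using u by (simp add: set_borel_measurable_def)
  have "(\<integral>\<^sup>+s. ennreal (norm (indicator {a..b} s *\<^sub>R u s)) \<partial>lborel) = (\<integral>\<^sup>+s\<in>{a..b}. norm (u s) \<partial>lborel)"
    by (intro nn_integral_cong) (auto simp: indicator_def)
  also have "\<dots> \<le> ennreal (1 * (b - a)) + ennreal (1 / 1 ^ (p - 1)) * pint p a b u"
    by (rule nn_integral_le_pint[OF p _ u]) simp
  also have "\<dots> < \<infinity>" using fin by (simp add: ennreal_mult_less_top)
  finally show "(\<integral>\<^sup>+s. ennreal (norm (indicator {a..b} s *\<^sub>R u s)) \<partial>lborel) < \<infinity>" .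
qed

lemma C1p_imp_lp_primitive:
  assumes p: "p > 0" and x: "x \<in> C1p p"
  obtains Y where "lp_primitive p x Y"
proof -
  obtain y where y: "y \<in> borel_measurable lebesgue" and yi: "set_integrable lebesgue {-1..0} (\<lambda>t. norm (y t) ^ p)"
    and yd: "AE t in lebesgue. t \<in> {-1..0} \<longrightarrow> (x has_vector_derivative y t) (at t within {-1..0})"
    and ac: "absolutely_continuous_on {-1..0} x"
    using x by (auto simp: C1p_def)
  obtain Y where Y: "Y \<in> borel_measurable borel" and yY: "AE t in lborel. y t = Y t"
    using completion_ex_borel_measurable_euclidean[OF y] .
  have fin: "pint p (-1) 0 Y < \<infinity>"
  proof -
    have "(\<integral>\<^sup>+t. ennreal (norm (indicator {-1..0} t *\<^sub>R norm (y t) ^ p)) \<partial>lebesgue) < \<infinity>"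
      using yi by (simp add: set_integrable_def integrable_iff_bounded)
    then have "(\<integral>\<^sup>+t. ennreal (norm (indicator {-1..0} t *\<^sub>R norm (y t) ^ p)) \<partial>lborel) < \<infinity>"
      by (simp only: nn_integral_completion)
    also have "(\<integral>\<^sup>+t. ennreal (norm (indicator {-1..0} t *\<^sub>R norm (y t) ^ p)) \<partial>lborel) = pint p (-1) 0 Y"
      unfolding pint_def
    proof (rule nn_integral_cong_AE)
      show "AE t in lborel. ennreal (norm (indicator {-1..0} t *\<^sub>R norm (y t) ^ p)) = ennreal (norm (Y t) ^ p) * indicator {-1..0} t"
        using yY by eventually_elim (auto simp: indicator_def)
    qed
    finally show ?thesis .
  qed
  have Ys: "set_borel_measurable borel {-1..0} Y" using Y by (simp add: set_borel_measurable_def)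
  have "AE t in lborel. t \<in> {-1..0} \<longrightarrow> (x has_vector_derivative y t) (at t within {-1..0})"
    using yd by (simp add: AE_completion_iff)
  with yY have "AE t in lborel. -1 < t \<and> t < 0 \<longrightarrow> (x has_vector_derivative Y t) (at t)"
  proof eventually_elim
    case (elim t)
    then show ?case by (auto simp: at_within_Icc_at)
  qed
  then have "primitive_on (-1) 0 x Y"
    by (rule absolutely_continuous_imp_primitive_on[OF ac _ set_integrable_of_pint[OF p Ys fin]])
  then show thesis using that[of Y] Y fin by (simp add: lp_primitive_def)
qed

lemma primitive_on_AE_deriv_within:
  assumes "primitive_on (-1) 0 x Y"
  shows "AE t in lebesgue. t \<in> {-1..0} \<longrightarrow> (x has_vector_derivative Y t) (at t within {-1..0})"
proof -
  have "AE t in lborel. t \<in> {-1..0} \<longrightarrow> (x has_vector_derivative Y t) (at t within {-1..0})"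
    using primitive_on_AE_deriv[OF assms] AE_lborel_singleton[of "-1"] AE_lborel_singleton[of 0]
  proof eventually_elim
    case (elim t)
    then show ?case by (auto intro: has_vector_derivative_at_within)
  qed
  then show ?thesis by (rule AE_completion)
qed

lemma lp_primitive_imp_C1p:
  assumes x: "x \<in> extensional {-1..0}" and Y: "lp_primitive p x Y" and p: "p > 0"
  shows "x \<in> C1p p"
proof -
  have Ym: "Y \<in> borel_measurable borel" and fin: "pint p (-1) 0 Y < \<infinity>" and prim: "primitive_on (-1) 0 x Y"
    using Y by (auto simp: lp_primitive_def)
  have "set_integrable lborel {-1..0} (\<lambda>t. norm (Y t) ^ p)"
    using Ym by (intro pint_eq_set_integral(1) p fin) (simp add: set_borel_measurable_def)
  then have "set_integrable lebesgue {-1..0} (\<lambda>t. norm (Y t) ^ p)"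
    unfolding set_integrable_def using Ym by (subst integrable_completion) auto
  moreover have "Y \<in> borel_measurable lebesgue" using Ym by (intro measurable_completion) simp
  ultimately show ?thesis
    unfolding C1p_def using x primitive_on_absolutely_continuous[OF prim] primitive_on_AE_deriv_within[OF prim] by blast
qed

text \<open>\<open>vector_derivative\<close> has arbitrary values where no derivative exists. It
  agrees with \<open>Y\<close> almost everywhere on the interval, and completeness of Lebesgue
  measure passes measurability from \<open>Y\<close> to it.\<close>

lemma C1p_norm_eq:
  assumes p: "p > 0" and Y: "lp_primitive p x Y"
  shows "C1p_norm p x = (SUP t\<in>{-1..0}. norm (x t)) + root p (LINT t:{-1..0}|lborel. norm (Y t) ^ p)"
proof -
  have Ym [measurable]: "Y \<in> borel_measurable borel" and prim: "primitive_on (-1) 0 x Y"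
    using Y by (auto simp: lp_primitive_def)
  let ?V = "\<lambda>t. indicator {-1..0} t *\<^sub>R norm (vector_derivative x (at t within {-1..0})) ^ p"
  let ?Y = "\<lambda>t. indicator {-1..0} t *\<^sub>R norm (Y t) ^ p"
  have ae: "AE t in lebesgue. ?Y t = ?V t"
    using primitive_on_AE_deriv_within[OF prim]
  proof eventually_elim
    case (elim t)
    then show ?case
      by (cases "t \<in> {-1..0}") (auto simp: vector_derivative_within_closed_interval)
  qed
  have Yl: "?Y \<in> borel_measurable lebesgue" by (intro measurable_completion) measurable
  then have "?V \<in> borel_measurable lebesgue" by (rule borel_measurable_AE) (rule ae)
  then have "(LINT t|lebesgue. ?V t) = (LINT t|lebesgue. ?Y t)"
    using Yl ae by (intro integral_cong_AE) (auto elim: eventually_mono)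
  also have "\<dots> = (LINT t|lborel. ?Y t)" by (rule integral_completion) measurable
  finally show ?thesis by (simp add: C1p_norm_def set_lebesgue_integral_def)
qed

lemma continuous_on_primitive: "primitive_on a b x X \<Longrightarrow> continuous_on {a..b} x"
proof -
  assume P: "primitive_on a b x X"
  then have i: "set_integrable lborel {a..b} X" by (simp add: primitive_on_def)
  have "continuous_on {a..b} (\<lambda>t. x a + integral {a..t} X)"
    by (intro continuous_intros indefinite_integral_continuous_1 set_borel_integral_eq_integral(1) i)
  then show ?thesis
  proof (rule continuous_on_eq)
    fix t assume t: "t \<in> {a..b}"
    then have "x t - x a = (LINT r:{a..t}|lborel. X r)" using P by (auto simp: primitive_on_def)
    also have "\<dots> = integral {a..t} X"
      using t by (intro set_borel_integral_eq_integral(2) set_integrable_Icc_subset[OF i]) auto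
    finally have "x t - x a = integral {a..t} X" .
    from this[symmetric] show "x a + integral {a..t} X = x t" by simp
  qed
qed

lemma C1p_norm_bounds:
  assumes p: "p > 0" and Y: "lp_primitive p x Y"
  shows "-1 \<le> t \<Longrightarrow> t \<le> 0 \<Longrightarrow> norm (x t) \<le> C1p_norm p x" "pint p (-1) 0 Y \<le> ennreal (C1p_norm p x ^ p)" "0 \<le> C1p_norm p x"
proof -
  have Ym: "Y \<in> borel_measurable borel" and fin: "pint p (-1) 0 Y < \<infinity>" and prim: "primitive_on (-1) 0 x Y"
    using Y by (auto simp: lp_primitive_def)
  let ?S = "SUP t\<in>{-1..0}. norm (x t)" and ?I = "LINT t:{-1..0}|lborel. norm (Y t) ^ p"
  obtain r where r: "\<And>t. -1 \<le> t \<Longrightarrow> t \<le> 0 \<Longrightarrow> norm (x t) \<le> r"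
    using continuous_on_Icc_bounded[OF continuous_on_primitive[OF prim]] by metis
  have bdd: "bdd_above ((\<lambda>t. norm (x t)) ` {-1..0})" by (rule bdd_aboveI2[of _ _ r]) (auto intro: r)
  have S: "norm (x t) \<le> ?S" if "-1 \<le> t" "t \<le> 0" for t
    by (rule cSUP_upper[OF _ bdd]) (use that in auto)
  have I0: "0 \<le> ?I" unfolding set_lebesgue_integral_def by (rule Bochner_Integration.integral_nonneg) auto
  then have R0: "0 \<le> root p ?I" using p by simp
  have S0: "0 \<le> ?S" using S[of 0] by (auto intro: order_trans[OF norm_ge_zero])
  show "-1 \<le> t \<Longrightarrow> t \<le> 0 \<Longrightarrow> norm (x t) \<le> C1p_norm p x"
    unfolding C1p_norm_eq[OF p Y] using S[of t] R0 by linarith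
  show "0 \<le> C1p_norm p x" unfolding C1p_norm_eq[OF p Y] using S0 R0 by simp
  have "?I = root p ?I ^ p" using p I0 by simp
  also have "\<dots> \<le> C1p_norm p x ^ p" unfolding C1p_norm_eq[OF p Y] using S0 R0 by (intro power_mono) auto
  finally have "ennreal ?I \<le> ennreal (C1p_norm p x ^ p)" by (rule ennreal_leI)
  moreover have "pint p (-1) 0 Y = ennreal ?I"
    using Ym by (intro pint_eq_set_integral(2) p fin) (simp add: set_borel_measurable_def)
  ultimately show "pint p (-1) 0 Y \<le> ennreal (C1p_norm p x ^ p)" by simp
qed

lemma C1p_norm_leI:
  assumes p: "p > 0" and Y: "lp_primitive p x Y" and A: "\<And>t. -1 \<le> t \<Longrightarrow> t \<le> 0 \<Longrightarrow> norm (x t) \<le> A"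
    and B: "pint p (-1) 0 Y \<le> ennreal (B ^ p)" "B \<ge> 0"
  shows "C1p_norm p x \<le> A + B"
proof -
  have Ym: "Y \<in> borel_measurable borel" and fin: "pint p (-1) 0 Y < \<infinity>" using Y by (auto simp: lp_primitive_def)
  have "pint p (-1) 0 Y = ennreal (LINT t:{-1..0}|lborel. norm (Y t) ^ p)"
    using Ym by (intro pint_eq_set_integral(2) p fin) (simp add: set_borel_measurable_def)
  then have "(LINT t:{-1..0}|lborel. norm (Y t) ^ p) \<le> B ^ p" using B by (simp add: ennreal_le_iff)
  then have "root p (LINT t:{-1..0}|lborel. norm (Y t) ^ p) \<le> root p (B ^ p)" using p by simp
  then have "root p (LINT t:{-1..0}|lborel. norm (Y t) ^ p) \<le> B" using p B(2) by (simp add: real_root_power_cancel)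
  moreover have "(SUP t\<in>{-1..0}. norm (x t)) \<le> A" by (rule cSUP_least) (auto intro: A)
  ultimately show ?thesis unfolding C1p_norm_eq[OF p Y] by linarith
qed

lemma primitive_on_add:
  assumes "primitive_on a b x X" "primitive_on a b y Y"
  shows "primitive_on a b (\<lambda>t. x t + y t) (\<lambda>t. X t + Y t)"
  unfolding primitive_on_def
proof (intro conjI allI impI)
  have i: "set_integrable lborel {a..b} X" "set_integrable lborel {a..b} Y" using assms by (auto simp: primitive_on_def)
  show "set_integrable lborel {a..b} (\<lambda>t. X t + Y t)" by (rule set_integral_add(1)[OF i])
  fix s t assume st: "a \<le> s \<and> s \<le> t \<and> t \<le> b"
  then have "set_integrable lborel {s..t} X" "set_integrable lborel {s..t} Y"
    using i by (auto intro: set_integrable_Icc_subset)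
  then show "x t + y t - (x s + y s) = (LINT r:{s..t}|lborel. X r + Y r)"
  proof -
    have "x t - x s = (LINT r:{s..t}|lborel. X r)" "y t - y s = (LINT r:{s..t}|lborel. Y r)"
      using assms st unfolding primitive_on_def by blast+
    moreover have "x t + y t - (x s + y s) = (x t - x s) + (y t - y s)" by simp
    ultimately show ?thesis using set_integral_add(2)[OF \<open>set_integrable lborel {s..t} X\<close> \<open>set_integrable lborel {s..t} Y\<close>]
      by simp
  qed
qed

lemma primitive_on_uminus:
  assumes "primitive_on a b x X"
  shows "primitive_on a b (\<lambda>t. - x t) (\<lambda>t. - X t)"
proof -
  have "set_integrable lborel {a..b} (\<lambda>t. - X t)"
    using assms unfolding primitive_on_def set_integrable_def by simp
  moreover have "(LINT r:{s..t}|lborel. - X r) = - (LINT r:{s..t}|lborel. X r)" for s t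
    unfolding set_lebesgue_integral_def by simp
  moreover have "- x t - - x s = - (x t - x s)" for s t by simp
  ultimately show ?thesis using assms unfolding primitive_on_def by metis
qed

lemma lp_primitive_add:
  assumes p: "p > 0" and "lp_primitive p x X" "lp_primitive p y Y"
  shows "lp_primitive p (\<lambda>t. x t + y t) (\<lambda>t. X t + Y t)"
  unfolding lp_primitive_def
proof (intro conjI)
  have m: "X \<in> borel_measurable borel" "Y \<in> borel_measurable borel" using assms by (auto simp: lp_primitive_def)
  then show "(\<lambda>t. X t + Y t) \<in> borel_measurable borel" by measurable
  have "pint p (-1) 0 (\<lambda>t. X t + Y t) \<le> ennreal (2 ^ p) * (pint p (-1) 0 X + pint p (-1) 0 Y)"
    using m by (intro pint_add_le p) (auto simp: set_borel_measurable_def)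
  also have "\<dots> < \<infinity>" using assms by (auto simp: lp_primitive_def ennreal_mult_less_top)
  finally show "pint p (-1) 0 (\<lambda>t. X t + Y t) < \<infinity>" .
  show "primitive_on (-1) 0 (\<lambda>t. x t + y t) (\<lambda>t. X t + Y t)"
    using assms by (intro primitive_on_add) (auto simp: lp_primitive_def)
qed

lemma lp_primitive_uminus:
  assumes "lp_primitive p x X"
  shows "lp_primitive p (\<lambda>t. - x t) (\<lambda>t. - X t)"
  using assms unfolding lp_primitive_def by (auto intro: primitive_on_uminus simp: pint_def)

lemma lp_primitive_diff:
  assumes p: "p > 0" and "lp_primitive p x X" "lp_primitive p y Y"
  shows "lp_primitive p (\<lambda>t. x t - y t) (\<lambda>t. X t - Y t)"
  using lp_primitive_add[OF p assms(2) lp_primitive_uminus[OF assms(3)]] by simp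

lemma C1p_norm_triangle_add:
  assumes p: "p > 0" and X: "lp_primitive p x X" and Y: "lp_primitive p y Y"
  shows "C1p_norm p (\<lambda>t. x t + y t) \<le> C1p_norm p x + C1p_norm p y"
proof -
  have m: "X \<in> borel_measurable borel" "Y \<in> borel_measurable borel" using X Y by (auto simp: lp_primitive_def)
  let ?X = "\<lambda>t. indicator {-1..0} t *\<^sub>R X t" and ?Y = "\<lambda>t. indicator {-1..0} t *\<^sub>R Y t"
  have eq: "indicator {-1..0} t *\<^sub>R norm v ^ p = norm (indicator {-1..0} t *\<^sub>R v) ^ p" for t :: real and v :: "real ^ 'n"
    using p by (cases "t \<in> {-1..0}") auto
  have i: "integrable lborel (\<lambda>t. norm (indicator {-1..0} t *\<^sub>R Z t) ^ p)" if "lp_primitive p z Z" for z Z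
  proof -
    have "set_borel_measurable borel {-1..0} Z" "pint p (-1) 0 Z < \<infinity>"
      using that by (auto simp: lp_primitive_def set_borel_measurable_def)
    from pint_eq_set_integral(1)[OF p this] show ?thesis unfolding set_integrable_def eq .
  qed
  have "root p (LINT t|lborel. norm (?X t + ?Y t) ^ p) \<le> root p (LINT t|lborel. norm (?X t) ^ p) + root p (LINT t|lborel. norm (?Y t) ^ p)"
    using m by (intro Minkowski_inequality p i[OF X] i[OF Y]) auto
  then have R: "root p (LINT t:{-1..0}|lborel. norm (X t + Y t) ^ p)
     \<le> root p (LINT t:{-1..0}|lborel. norm (X t) ^ p) + root p (LINT t:{-1..0}|lborel. norm (Y t) ^ p)"
    unfolding set_lebesgue_integral_def eq scaleR_add_right .
  have bdd: "bdd_above ((\<lambda>t. norm (z t)) ` {-1..0})" if Z: "lp_primitive p z Z" for z Z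
    by (rule bdd_aboveI2[of _ _ "C1p_norm p z"]) (auto intro: C1p_norm_bounds(1)[OF p Z])
  have "(SUP t\<in>{-1..0}. norm (x t + y t)) \<le> (SUP t\<in>{-1..0}. norm (x t)) + (SUP t\<in>{-1..0}. norm (y t))"
  proof (rule cSUP_least)
    fix t :: real assume t: "t \<in> {-1..0}"
    have "norm (x t) \<le> (SUP t\<in>{-1..0}. norm (x t))" by (rule cSUP_upper[OF t bdd[OF X]])
    moreover have "norm (y t) \<le> (SUP t\<in>{-1..0}. norm (y t))" by (rule cSUP_upper[OF t bdd[OF Y]])
    ultimately show "norm (x t + y t) \<le> (SUP t\<in>{-1..0}. norm (x t)) + (SUP t\<in>{-1..0}. norm (y t))"
      using norm_triangle_ineq[of "x t" "y t"] by linarith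
  qed simp
  then show ?thesis
    using R unfolding C1p_norm_eq[OF p X] C1p_norm_eq[OF p Y] C1p_norm_eq[OF p lp_primitive_add[OF p X Y]] by linarith
qed

lemma C1p_norm_triangle:
  assumes p: "p > 0" and "x \<in> C1p p" "y \<in> C1p p" "z \<in> C1p p"
  shows "C1p_norm p (\<lambda>t. z t - x t) \<le> C1p_norm p (\<lambda>t. y t - x t) + C1p_norm p (\<lambda>t. z t - y t)"
proof -
  obtain X Y Z where X: "lp_primitive p x X" and Y: "lp_primitive p y Y" and Z: "lp_primitive p z Z"
    using C1p_imp_lp_primitive[OF p] assms(2-4) by metis
  have "C1p_norm p (\<lambda>t. (y t - x t) + (z t - y t)) \<le> C1p_norm p (\<lambda>t. y t - x t) + C1p_norm p (\<lambda>t. z t - y t)"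
    by (rule C1p_norm_triangle_add[OF p lp_primitive_diff[OF p Y X] lp_primitive_diff[OF p Z Y]])
  then show ?thesis by simp
qed

lemma C1p_norm_le_add_diff:
  assumes p: "p > 0" and "x \<in> C1p p" "y \<in> C1p p"
  shows "C1p_norm p y \<le> C1p_norm p x + C1p_norm p (\<lambda>t. y t - x t)"
proof -
  obtain X Y where X: "lp_primitive p x X" and Y: "lp_primitive p y Y"
    using C1p_imp_lp_primitive[OF p] assms(2,3) by metis
  show ?thesis using C1p_norm_triangle_add[OF p X lp_primitive_diff[OF p Y X]] by simp
qed

lemma C1p_continuous: "p > 0 \<Longrightarrow> x \<in> C1p p \<Longrightarrow> continuous_on {-1..0} x"
  by (metis C1p_imp_lp_primitive continuous_on_primitive lp_primitive_def)

text \<open>A derivative on \<open>[-1, T]\<close> of a solution with initial function \<open>\<phi>\<close>, where \<open>\<phi>' = Y\<close>.\<close>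

definition solution_deriv :: "'n::finite delay_field \<Rightarrow> (real \<Rightarrow> real ^ 'n) \<Rightarrow> (real \<Rightarrow> real ^ 'n) \<Rightarrow> real \<Rightarrow> real \<Rightarrow> real ^ 'n" where
  "solution_deriv g Y x T s = indicator {-1..0} s *\<^sub>R Y s + indicator {0<..T} s *\<^sub>R field_along g x s"

lemma primitive_on_cong_AE:
  assumes P: "primitive_on a b x X" and m: "set_borel_measurable borel {a..b} X'"
    and ae: "AE s in lborel. s \<in> {a..b} \<longrightarrow> X s = X' s"
  shows "primitive_on a b x X'"
  unfolding primitive_on_def
proof (intro conjI allI impI)
  have X: "set_integrable lborel {a..b} X" using P by (simp add: primitive_on_def)
  have ae': "AE s in lborel. indicator {a..b} s *\<^sub>R X s = indicator {a..b} s *\<^sub>R X' s"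
    using ae by eventually_elim (auto simp: indicator_def)
  show X': "set_integrable lborel {a..b} X'"
    unfolding set_integrable_def
    by (rule integrable_cong_AE_imp[OF X[unfolded set_integrable_def] _ ae']) (use m in \<open>simp add: set_borel_measurable_def\<close>)
  fix s t assume st: "a \<le> s \<and> s \<le> t \<and> t \<le> b"
  have "(LINT r:{s..t}|lborel. X r) = (LINT r:{s..t}|lborel. X' r)"
    unfolding set_lebesgue_integral_def
  proof (rule integral_cong_AE)
    show "(\<lambda>r. indicator {s..t} r *\<^sub>R X r) \<in> borel_measurable lborel"
      using set_integrable_Icc_subset[OF X, of s t] st by (simp add: set_integrable_def)
    show "(\<lambda>r. indicator {s..t} r *\<^sub>R X' r) \<in> borel_measurable lborel"
      using set_integrable_Icc_subset[OF X', of s t] st by (simp add: set_integrable_def)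
    show "AE r in lborel. indicator {s..t} r *\<^sub>R X r = indicator {s..t} r *\<^sub>R X' r"
      using ae by eventually_elim (use st in \<open>auto simp: indicator_def\<close>)
  qed
  then show "x t - x s = (LINT r:{s..t}|lborel. X' r)" using P st by (simp add: primitive_on_def)
qed

lemma field_along_measurable:
  assumes g: "g \<in> LC_fun p" and x: "continuous_on {-1..T} x"
  shows "set_borel_measurable borel {0..T} (field_along g x)"
  unfolding field_along_def[abs_def]
proof (rule LC_fun_set_measurable[OF g set_borel_measurable_continuous])
  have "continuous_on {0..T} x" by (rule continuous_on_subset[OF x]) auto
  moreover have "continuous_on {0..T} (\<lambda>s. x (s - 1))"
    by (rule continuous_on_compose2[OF x]) (auto intro!: continuous_intros)
  ultimately show "continuous_on {0..T} (\<lambda>s. (x s, x (s - 1)))" by (rule continuous_on_Pair)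
qed

lemma solution_deriv_measurable:
  assumes g: "g \<in> LC_fun p" and x: "continuous_on {-1..T} x" and Y: "Y \<in> borel_measurable borel"
  shows "solution_deriv g Y x T \<in> borel_measurable borel"
proof -
  have F [measurable]: "(\<lambda>s. indicator {0..T} s *\<^sub>R field_along g x s) \<in> borel_measurable borel"
    using field_along_measurable[OF g x] by (simp add: set_borel_measurable_def)
  note Y [measurable]
  have eq: "solution_deriv g Y x T = (\<lambda>s. indicator {-1..0} s *\<^sub>R Y s + indicator {0<..T} s *\<^sub>R (indicator {0..T} s *\<^sub>R field_along g x s))"
    by (auto simp: solution_deriv_def indicator_def)
  show ?thesis unfolding eq by measurable
qed

lemma solution_deriv_primitive:
  assumes g: "g \<in> LC_fun p" and x: "local_solution g T x" and T: "0 \<le> T"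
    and Y: "lp_primitive p \<phi> Y" and init: "\<And>t. -1 \<le> t \<Longrightarrow> t \<le> 0 \<Longrightarrow> x t = \<phi> t"
  shows "primitive_on (-1) T x (solution_deriv g Y x T)"
proof (rule primitive_on_join[of _ 0])
  have cx: "continuous_on {-1..T} x" and px: "primitive_on 0 T x (field_along g x)"
    using x by (auto simp: local_solution_def)
  have Ym: "Y \<in> borel_measurable borel" and PY: "primitive_on (-1) 0 \<phi> Y" using Y by (auto simp: lp_primitive_def)
  show "primitive_on (-1) 0 x (solution_deriv g Y x T)"
    by (rule primitive_on_cong2[OF PY]) (auto simp: init solution_deriv_def)
  show "primitive_on 0 T x (solution_deriv g Y x T)"
  proof (rule primitive_on_cong_AE[OF px])
    show "set_borel_measurable borel {0..T} (solution_deriv g Y x T)"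
      using solution_deriv_measurable[OF g cx Ym] by (simp add: set_borel_measurable_def)
    show "AE s in lborel. s \<in> {0..T} \<longrightarrow> field_along g x s = solution_deriv g Y x T s"
      using AE_lborel_singleton[of 0] by eventually_elim (auto simp: solution_deriv_def indicator_def)
  qed
qed (use T in auto)

lemma pint_solution_deriv_diff:
  assumes p: "p > 0" and g: "g \<in> LC_fun p" "g0 \<in> LC_fun p" and x: "continuous_on {-1..T} x" "continuous_on {-1..T} x0"
    and Y: "Y \<in> borel_measurable borel" "Y0 \<in> borel_measurable borel" and T: "0 \<le> T"
  shows "pint p (-1) T (\<lambda>s. solution_deriv g Y x T s - solution_deriv g0 Y0 x0 T s)
    \<le> pint p (-1) 0 (\<lambda>s. Y s - Y0 s) + pint p 0 T (\<lambda>s. field_along g x s - field_along g0 x0 s)"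
proof -
  let ?D = "\<lambda>s. solution_deriv g Y x T s - solution_deriv g0 Y0 x0 T s"
  have "pint p (-1) T ?D \<le> pint p (-1) 0 ?D + pint p 0 T ?D"
    using solution_deriv_measurable[OF g(1) x(1) Y(1)] solution_deriv_measurable[OF g(2) x(2) Y(2)] T
    by (intro pint_combine p) (auto simp: set_borel_measurable_def)
  also have "pint p (-1) 0 ?D = pint p (-1) 0 (\<lambda>s. Y s - Y0 s)"
    by (intro pint_cong_AE AE_I2) (auto simp: solution_deriv_def)
  also have "pint p 0 T ?D = pint p 0 T (\<lambda>s. field_along g x s - field_along g0 x0 s)"
  proof (rule pint_cong_AE)
    show "AE s in lborel. 0 \<le> s \<and> s \<le> T \<longrightarrow> norm (?D s) = norm (field_along g x s - field_along g0 x0 s)"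
      using AE_lborel_singleton[of 0] by eventually_elim (auto simp: solution_deriv_def)
  qed
  finally show ?thesis .
qed

lemma pint_field_along_finite:
  assumes g: "g \<in> LC_fun p" and x: "continuous_on {-1..T} x"
  shows "pint p 0 T (field_along g x) < \<infinity>"
proof -
  obtain r where r: "\<And>t. -1 \<le> t \<Longrightarrow> t \<le> T \<Longrightarrow> norm (x t) \<le> r" using continuous_on_Icc_bounded[OF x] by metis
  show ?thesis unfolding field_along_def[abs_def]
  proof (rule LC_fun_pint_finite[OF g])
    fix t assume "0 \<le> t" "t \<le> T"
    then have "norm (x t) \<le> r" "norm (x (t - 1)) \<le> r" by (auto intro: r)
    then show "norm (x t, x (t - 1)) \<le> r + r" using norm_Pair_le[of "x t" "x (t - 1)"] by linarith
  qed
qed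

lemma pint_solution_deriv_finite:
  assumes p: "p > 0" and g: "g \<in> LC_fun p" and x: "continuous_on {-1..T} x" and T: "0 \<le> T"
    and Y: "lp_primitive p \<phi> Y"
  shows "pint p a b (solution_deriv g Y x T) < \<infinity>"
proof -
  have Ym: "Y \<in> borel_measurable borel" and fin: "pint p (-1) 0 Y < \<infinity>" using Y by (auto simp: lp_primitive_def)
  let ?D = "solution_deriv g Y x T"
  have "pint p a b ?D \<le> pint p (-1) T ?D"
    unfolding pint_def using p T
    by (intro nn_integral_mono) (auto simp: indicator_def solution_deriv_def)
  also have "\<dots> \<le> pint p (-1) 0 ?D + pint p 0 T ?D"
    using solution_deriv_measurable[OF g x Ym] T by (intro pint_combine p) (auto simp: set_borel_measurable_def)
  also have "pint p (-1) 0 ?D = pint p (-1) 0 Y"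
    by (intro pint_cong_AE AE_I2) (auto simp: solution_deriv_def)
  also have "pint p 0 T ?D = pint p 0 T (field_along g x)"
  proof (rule pint_cong_AE)
    show "AE s in lborel. 0 \<le> s \<and> s \<le> T \<longrightarrow> norm (?D s) = norm (field_along g x s)"
      using AE_lborel_singleton[of 0] by eventually_elim (auto simp: solution_deriv_def)
  qed
  also have "pint p (-1) 0 Y + pint p 0 T (field_along g x) < \<infinity>"
    using fin pint_field_along_finite[OF g x] by simp
  finally show ?thesis .
qed

lemma segment_lp_primitive:
  assumes p: "p > 0" and D: "D \<in> borel_measurable borel" "pint p (t - 1) t D < \<infinity>" and P: "primitive_on (-1) T x D"
    and t: "0 \<le> t" "t \<le> T"
  shows "lp_primitive p (restrict (\<lambda>s. x (t + s)) {-1..0}) (\<lambda>s. D (s + t))"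
  unfolding lp_primitive_def
proof (intro conjI)
  show "(\<lambda>s. D (s + t)) \<in> borel_measurable borel"
    by (rule measurable_compose[OF _ D(1)]) measurable
  show "pint p (-1) 0 (\<lambda>s. D (s + t)) < \<infinity>" using D by (simp add: pint_shift)
  have "primitive_on (-1 + t) (0 + t) x D" by (rule primitive_on_subset[OF P]) (use t in auto)
  then have "primitive_on (-1) 0 (\<lambda>s. x (s + t)) (\<lambda>s. D (s + t))" by (rule primitive_on_shift)
  then show "primitive_on (-1) 0 (restrict (\<lambda>s. x (t + s)) {-1..0}) (\<lambda>s. D (s + t))"
    by (rule primitive_on_cong) (simp add: add.commute)
qed

section \<open>Continuity of the flow\<close>

text \<open>All that the estimate of \<open>g - g0\<close> has to know about the curve. The radius
  \<open>j / 2\<close> puts the pair of present and delayed state into the ball of radius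
  \<open>j\<close>. For positive times the increments are limited by the \<open>m\<close>-bound of
  \<open>g\<close>; on the history interval they are limited by those of some \<phi> in the ball of
  radius \<open>j\<close> of \<open>C1p\<close>, with an inequality because projection to the ball
  can shorten them.\<close>

definition admissible :: "nat \<Rightarrow> nat \<Rightarrow> 'n::finite delay_field \<Rightarrow> real \<Rightarrow> (real \<Rightarrow> real ^ 'n) \<Rightarrow> (real \<Rightarrow> real ^ 'n) \<Rightarrow> bool" where
  "admissible p j g n w \<phi> \<longleftrightarrow> continuous_on {-1..n} w \<and> (\<forall>t. -1 \<le> t \<longrightarrow> t \<le> n \<longrightarrow> norm (w t) \<le> real j / 2) \<and>
     (\<forall>s t. 0 \<le> s \<longrightarrow> s \<le> t \<longrightarrow> t \<le> n \<longrightarrow> ennreal (norm (w t - w s)) \<le> (\<integral>\<^sup>+u\<in>{s..t}. m_bound j g u \<partial>lborel)) \<and>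
     \<phi> \<in> C1p p \<and> C1p_norm p \<phi> \<le> real j \<and>
     (\<forall>s t. -1 \<le> s \<longrightarrow> s \<le> 0 \<longrightarrow> -1 \<le> t \<longrightarrow> t \<le> 0 \<longrightarrow> norm (w t - w s) \<le> norm (\<phi> t - \<phi> s))"

lemma norm_le_m_bound: "norm z \<le> real j \<Longrightarrow> ennreal (norm (g t z)) \<le> m_bound j g t"
  unfolding m_bound_def by (rule SUP_upper) simp

text \<open>The admissible curve is the projection of \<open>y\<close>, not \<open>y\<close> itself,
  since \<open>y\<close> may leave the ball; the truncated field sees only the projection.\<close>

lemma truncated_admissible:
  assumes y: "truncated_solution g (real j / 2) n y" and init: "\<And>t. -1 \<le> t \<Longrightarrow> t \<le> 0 \<Longrightarrow> y t = \<phi> t"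
    and \<phi>: "\<phi> \<in> C1p p" "C1p_norm p \<phi> \<le> real j"
  shows "admissible p j g n (\<lambda>t. ball_proj (real j / 2) (y t)) \<phi>"
  unfolding admissible_def
proof (intro conjI allI impI \<phi>)
  let ?r = "real j / 2"
  have r: "0 \<le> ?r" by simp
  have cy: "continuous_on {-1..n} y" and py: "primitive_on 0 n y (truncated_field g ?r y)"
    using y by (auto simp: truncated_solution_def)
  show "continuous_on {-1..n} (\<lambda>t. ball_proj ?r (y t))" by (rule continuous_on_ball_proj[OF r cy])
  show "norm (ball_proj ?r (y t)) \<le> ?r" for t by (rule ball_proj_le[OF r])
  fix s t assume st: "0 \<le> s" "s \<le> t" "t \<le> n"
  have "ennreal (norm (ball_proj ?r (y t) - ball_proj ?r (y s))) \<le> ennreal (norm (y t - y s))"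
    by (intro ennreal_leI ball_proj_lipschitz r)
  also have "\<dots> \<le> (\<integral>\<^sup>+u\<in>{s..t}. norm (truncated_field g ?r y u) \<partial>lborel)"
    by (rule primitive_on_norm_diff_le[OF py st])
  also have "\<dots> \<le> (\<integral>\<^sup>+u\<in>{s..t}. m_bound j g u \<partial>lborel)"
  proof (intro nn_integral_mono mult_right_mono)
    fix u
    show "ennreal (norm (truncated_field g ?r y u)) \<le> m_bound j g u"
      unfolding truncated_field_def by (rule norm_le_m_bound) (use norm_ball_proj_Pair_le[OF r] in auto)
  qed simp
  finally show "ennreal (norm (ball_proj ?r (y t) - ball_proj ?r (y s))) \<le> (\<integral>\<^sup>+u\<in>{s..t}. m_bound j g u \<partial>lborel)" .
next
  fix s t :: real assume "-1 \<le> s" "s \<le> 0" "-1 \<le> t" "t \<le> 0"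
  then have "norm (y t - y s) = norm (\<phi> t - \<phi> s)" by (simp add: init)
  moreover have "norm (ball_proj (real j / 2) (y t) - ball_proj (real j / 2) (y s)) \<le> norm (y t - y s)"
    by (rule ball_proj_lipschitz) simp
  ultimately show "norm (ball_proj (real j / 2) (y t) - ball_proj (real j / 2) (y s)) \<le> norm (\<phi> t - \<phi> s)" by simp
qed

lemma sol_segment_in_C1p:
  assumes p: "p > 0" and g: "g \<in> LC_fun p" and \<phi>: "\<phi> \<in> C1p p" and t: "0 \<le> t" "ereal t < sol_end g \<phi>"
  shows "sol_segment g \<phi> t \<in> C1p p"
proof -
  interpret S: delay_ivp p g \<phi> by unfold_locales (fact p g C1p_continuous[OF p \<phi>])+
  obtain Y where Y: "lp_primitive p \<phi> Y" using C1p_imp_lp_primitive[OF p \<phi>] .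
  have x: "local_solution g t (sol g \<phi>)" by (rule S.sol_local_solution[OF t(2,1)])
  then have cx: "continuous_on {-1..t} (sol g \<phi>)" by (simp add: local_solution_def)
  let ?D = "solution_deriv g Y (sol g \<phi>) t"
  have "lp_primitive p (restrict (\<lambda>s. sol g \<phi> (t + s)) {-1..0}) (\<lambda>s. ?D (s + t))"
  proof (rule segment_lp_primitive[OF p])
    show "?D \<in> borel_measurable borel" using Y by (intro solution_deriv_measurable[OF g cx]) (simp add: lp_primitive_def)
    show "pint p (t - 1) t ?D < \<infinity>" by (rule pint_solution_deriv_finite[OF p g cx t(1) Y])
    show "primitive_on (-1) t (sol g \<phi>) ?D" by (rule solution_deriv_primitive[OF g x t(1) Y S.sol_init])
  qed (use t in auto)
  then show ?thesis unfolding sol_segment_def by (intro lp_primitive_imp_C1p[OF _ _ p]) auto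
qed

text \<open>The assumption \<open>closeness\<close> isolates what differs between the three
  topologies. Its quantifiers matter: the neighbourhood \<open>V\<close> precedes the field
  \<open>G\<close>, the curve and its history, so smallness is uniform over all of them.\<close>

locale hull_flow = curve_family p \<W> for p :: nat and \<W> :: "(real \<times> real \<times> (real \<Rightarrow> (real ^ 'n::finite) \<times> (real ^ 'n)) set) set" +
  fixes f :: "'n delay_field"
  assumes f: "f \<in> LC_fun p"
    and closeness: "\<And>G0 n j e. G0 \<in> LC_hull p curve_topology f \<Longrightarrow> e > 0 \<Longrightarrow> \<exists>V. openin curve_topology V \<and> G0 \<in> V \<and>
      (\<forall>G w \<phi>. G \<in> V \<longrightarrow> G \<in> LC_hull p curve_topology f \<longrightarrow> admissible p j (LC_rep G) (real n) w \<phi> \<longrightarrow>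
        pint p 0 (real n) (\<lambda>s. LC_rep G s (w s, w (s - 1)) - LC_rep G0 s (w s, w (s - 1))) \<le> ennreal e)"
begin

abbreviation fhull where "fhull \<equiv> LC_hull p curve_topology f"

lemma hull_LC: "G \<in> fhull \<Longrightarrow> G \<in> LC p"
  using LC_hull_subset by blast

lemma hull_LC_fun: "G \<in> fhull \<Longrightarrow> LC_rep G \<in> LC_fun p"
  by (rule LC_rep_LC_fun[OF hull_LC])

lemma hull_delay_ivp: "G \<in> fhull \<Longrightarrow> \<phi> \<in> C1p p \<Longrightarrow> delay_ivp p (LC_rep G) \<phi>"
  by unfold_locales (auto simp: p0 hull_LC_fun intro: C1p_continuous[OF p0])

text \<open>Solutions of the truncated equations exist up to every time, so they can be compared on a
  fixed interval; a truncated solution that stays close to an untruncated one never notices the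
  truncation.\<close>

lemma flow_close:
  assumes G0: "G0 \<in> fhull" and \<phi>0: "\<phi>0 \<in> C1p p" and T: "0 \<le> T" "ereal T < sol_end (LC_rep G0) \<phi>0" and e: "e > 0"
  obtains V \<delta> where "openin curve_topology V" "G0 \<in> V" "\<delta> > 0"
    "\<And>G \<phi>. G \<in> V \<Longrightarrow> G \<in> fhull \<Longrightarrow> \<phi> \<in> C1p p \<Longrightarrow> C1p_norm p (\<lambda>t. \<phi> t - \<phi>0 t) < \<delta> \<Longrightarrow>
      ereal T < sol_end (LC_rep G) \<phi> \<and>
      (\<forall>t. -1 \<le> t \<longrightarrow> t \<le> T \<longrightarrow> norm (sol (LC_rep G) \<phi> t - sol (LC_rep G0) \<phi>0 t) \<le> e) \<and>
      pint p 0 T (\<lambda>s. field_along (LC_rep G) (sol (LC_rep G) \<phi>) s - field_along (LC_rep G0) (sol (LC_rep G0) \<phi>0) s) \<le> ennreal e"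
proof -
  let ?k = "LC_rep G0"
  have k: "?k \<in> LC_fun p" by (rule hull_LC_fun[OF G0])
  interpret S0: delay_ivp p ?k \<phi>0 by (rule hull_delay_ivp[OF G0 \<phi>0])
  \<comment> \<open>A margin beyond \<open>T\<close>: the truncated solution identifies
    \<open>sol\<close> only before \<open>T1\<close> and shows only that the end point is at least
    \<open>T1\<close>.\<close>
  obtain T1 where T1: "T < T1" "ereal T1 < sol_end ?k \<phi>0"
    using ereal_dense2[OF T(2)] by auto
  have T10: "0 \<le> T1" using T1 T by simp
  obtain r0 where r0: "r0 \<ge> 0" "\<And>t. -1 \<le> t \<Longrightarrow> t \<le> T1 \<Longrightarrow> norm (sol ?k \<phi>0 t) \<le> r0"
    using continuous_on_Icc_bounded[of "-1" T1 "sol ?k \<phi>0"] S0.sol_local_solution[OF T1(2) T10]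
    unfolding local_solution_def by metis
  \<comment> \<open>An integer, since the bounds are indexed by naturals. The added 1 in both
    entries leaves room for a deviation of at most 1 of the solution and of the initial
    function.\<close>
  define j where "j = nat \<lceil>max (2 * (r0 + 1)) (C1p_norm p \<phi>0 + 1)\<rceil>"
  have j: "2 * (r0 + 1) \<le> real j" "C1p_norm p \<phi>0 + 1 \<le> real j" unfolding j_def by linarith+
  define r where "r = real j / 2"
  have r: "r \<ge> 0" "r0 + 1 \<le> r" using j by (auto simp: r_def)
  define n where "n = nat \<lceil>T1\<rceil>"
  have n: "T1 \<le> real n" unfolding n_def by linarith
  obtain m0 l0 where b0: "lp_bounds p ?k (2 * r) m0 l0" using LC_fun_lp_bounds[OF k] by blast
  note l0 = lp_boundsD(2)[OF b0]
  define L where "L = exp (4 * kernel_int l0 (real n))"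
  have L: "L > 0" by (simp add: L_def)
  define I where "I = (LINT s:{0..real n}|lborel. l0 s ^ p)"
  have I: "I \<ge> 0" unfolding I_def set_lebesgue_integral_def using l0
    by (intro Bochner_Integration.integral_nonneg) (auto simp: lp_fun_def)
  define M where "M = I + 1"
  have M: "M > 0" "I \<le> M" using I by (auto simp: M_def)
  \<comment> \<open>The bound for the distance of the truncated solutions. At most 1, it keeps
    \<open>y\<close> inside radius \<open>r\<close>; at most \<open>e\<close>, it gives the uniform
    estimate; the third entry makes the Lipschitz part of the derivative estimate,
    \<open>2 ^ p * (2 * \<eta>) ^ p * I\<close>, at most \<open>e / 2\<close>.\<close>
  define \<eta> where "\<eta> = min 1 (min e (e / (2 * 4 ^ p * M)))"
  have \<eta>: "\<eta> > 0" "\<eta> \<le> 1" "\<eta> \<le> e" using e M by (auto simp: \<eta>_def)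
  have \<eta>I: "4 ^ p * (\<eta> * I) \<le> e / 2"
  proof -
    have "4 ^ p * (\<eta> * I) \<le> 4 ^ p * (e / (2 * 4 ^ p * M) * M)"
      using I M e by (intro mult_left_mono mult_mono) (auto simp: \<eta>_def)
    also have "\<dots> = e / 2" using M by (simp add: field_simps)
    finally show ?thesis .
  qed
  \<comment> \<open>\<open>K\<close> is the level in \<open>nn_integral_le_pint\<close>. The initial
    error \<delta>, the term \<open>K * real n\<close> and the term \<open>e1 / K ^ (p - 1)\<close>
    are each at most \<open>\<eta> / (6 * L)\<close>, so that Gronwall's bound
    \<open>2 * (\<delta> + B) * L\<close> is at most \<eta>. Hence \<open>e1\<close> is chosen after
    \<open>K\<close>.\<close>
  define K where "K = \<eta> / (6 * L) / (real n + 1)"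
  have K: "K > 0" using \<eta> L by (simp add: K_def)
  have Kn: "K * real n \<le> \<eta> / (6 * L)"
  proof -
    have "K * real n \<le> K * (real n + 1)" using K by (intro mult_left_mono) auto
    also have "\<dots> = \<eta> / (6 * L)" by (simp add: K_def)
    finally show ?thesis .
  qed
  define \<delta> where "\<delta> = min 1 (\<eta> / (6 * L))"
  have \<delta>: "\<delta> > 0" "\<delta> \<le> 1" "\<delta> \<le> \<eta> / (6 * L)" using \<eta> L by (auto simp: \<delta>_def)
  define e1 where "e1 = min (\<eta> / (6 * L) * K ^ (p - 1)) (e / (2 * 2 ^ p))"
  have e1: "e1 > 0" using \<eta> L K e by (auto simp: e1_def)
  have e1K: "1 / K ^ (p - 1) * e1 \<le> \<eta> / (6 * L)"
  proof -
    have "1 / K ^ (p - 1) * e1 \<le> 1 / K ^ (p - 1) * (\<eta> / (6 * L) * K ^ (p - 1))"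
      using K by (intro mult_left_mono) (auto simp: e1_def)
    also have "\<dots> = \<eta> / (6 * L)" using K by simp
    finally show ?thesis .
  qed
  have e1e: "2 ^ p * e1 \<le> e / 2"
  proof -
    have "2 ^ p * e1 \<le> 2 ^ p * (e / (2 * 2 ^ p))" by (intro mult_left_mono) (auto simp: e1_def)
    also have "\<dots> = e / 2" by simp
    finally show ?thesis .
  qed
  define B where "B = K * real n + 1 / K ^ (p - 1) * e1"
  have B: "B \<ge> 0" using K e1 by (simp add: B_def)
  have bound: "2 * (\<delta> + B) * L \<le> \<eta>"
  proof -
    have "2 * (\<delta> + B) * L \<le> 2 * (\<eta> / (6 * L) + (\<eta> / (6 * L) + \<eta> / (6 * L))) * L"
      unfolding B_def using L by (intro mult_right_mono mult_left_mono add_mono \<delta> Kn e1K) auto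
    also have "\<dots> = \<eta>" using L by (simp add: field_simps)
    finally show ?thesis .
  qed
  obtain y0 where "continuous_on UNIV y0" and y0: "\<And>t. -1 \<le> t \<Longrightarrow> t \<le> 0 \<Longrightarrow> y0 t = \<phi>0 t" "\<And>n. truncated_solution ?k r n y0"
    by (rule truncated_solution_exists[OF p0 r(1) k C1p_continuous[OF p0 \<phi>0]]) (rule that, assumption, simp_all)
  have s0_r: "norm (sol ?k \<phi>0 t) \<le> r" if "-1 \<le> t" "t \<le> T1" for t using r0(2)[OF that] r(2) by linarith
  have y0_sol: "sol ?k \<phi>0 t = y0 t" if "-1 \<le> t" "t \<le> T1" for t
    by (rule S0.truncated_eq_sol[OF y0(2) y0(1) T10 T1(2) s0_r that])
  have y0_le: "norm (y0 t) \<le> r0" if "-1 \<le> t" "t \<le> T1" for t using r0(2)[OF that] y0_sol[OF that] by simp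
  have y0_r: "norm (y0 t) \<le> r" if "-1 \<le> t" "t \<le> T1" for t using y0_le[OF that] r(2) by linarith
  from closeness[OF G0 e1, of j n] obtain V where V: "openin curve_topology V" "G0 \<in> V" and
    "\<forall>G w \<phi>. G \<in> V \<longrightarrow> G \<in> fhull \<longrightarrow> admissible p j (LC_rep G) (real n) w \<phi> \<longrightarrow>
      pint p 0 (real n) (\<lambda>s. LC_rep G s (w s, w (s - 1)) - ?k s (w s, w (s - 1))) \<le> ennreal e1"
    by (elim exE conjE)
  note close = this(3)[rule_format]
  show thesis
  proof (rule that[OF V \<delta>(1)])
    fix G \<phi> assume GV: "G \<in> V" and G: "G \<in> fhull" and \<phi>: "\<phi> \<in> C1p p" and d: "C1p_norm p (\<lambda>t. \<phi> t - \<phi>0 t) < \<delta>"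
    let ?g = "LC_rep G"
    have g: "?g \<in> LC_fun p" by (rule hull_LC_fun[OF G])
    interpret S: delay_ivp p ?g \<phi> by (rule hull_delay_ivp[OF G \<phi>])
    obtain y where "continuous_on UNIV y" and y: "\<And>t. -1 \<le> t \<Longrightarrow> t \<le> 0 \<Longrightarrow> y t = \<phi> t" "\<And>n. truncated_solution ?g r n y"
      by (rule truncated_solution_exists[OF p0 r(1) g C1p_continuous[OF p0 \<phi>]]) (rule that, assumption, simp_all)
    have \<phi>j: "C1p_norm p \<phi> \<le> real j"
      using C1p_norm_le_add_diff[OF p0 \<phi>0 \<phi>] d \<delta>(2) j(2) by linarith
    have "admissible p j ?g (real n) (\<lambda>t. ball_proj (real j / 2) (y t)) \<phi>"
      by (rule truncated_admissible[OF _ y(1) \<phi> \<phi>j]) (use y(2) r_def in auto)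
    from close[OF GV G this]
    have pe1: "pint p 0 (real n) (\<lambda>s. truncated_field ?g r y s - truncated_field ?k r y s) \<le> ennreal e1"
      by (simp add: truncated_field_def r_def)
    have cy: "continuous_on {-1..real n} y" using y(2)[of "real n"] by (simp add: truncated_solution_def)
    have fm: "set_borel_measurable borel {0..real n} (truncated_field ?g r y)"
      "set_borel_measurable borel {0..real n} (truncated_field ?k r y)"
      by (rule truncated_field_measurable[OF g cy r(1)], rule truncated_field_measurable[OF k cy r(1)])
    have "(\<integral>\<^sup>+s\<in>{0..real n}. norm (truncated_field ?g r y s - truncated_field ?k r y s) \<partial>lborel)
        \<le> ennreal (K * (real n - 0)) + ennreal (1 / K ^ (p - 1)) * pint p 0 (real n) (\<lambda>s. truncated_field ?g r y s - truncated_field ?k r y s)"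
      by (rule nn_integral_le_pint[OF p0 K set_borel_measurable_diff[OF fm]])
    also have "\<dots> \<le> ennreal (K * real n) + ennreal (1 / K ^ (p - 1)) * ennreal e1"
      using pe1 by (intro add_mono mult_left_mono) auto
    also have "\<dots> = ennreal B"
      using K e1 by (simp add: B_def ennreal_plus ennreal_mult[symmetric])
    finally have intB: "(\<integral>\<^sup>+s\<in>{0..real n}. norm (truncated_field ?g r y s - truncated_field ?k r y s) \<partial>lborel) \<le> ennreal B" .
    obtain Y where Y: "lp_primitive p \<phi> Y" by (rule C1p_imp_lp_primitive[OF p0 \<phi>])
    obtain Y0 where Y0: "lp_primitive p \<phi>0 Y0" by (rule C1p_imp_lp_primitive[OF p0 \<phi>0])
    have init: "norm (y t - y0 t) \<le> \<delta>" if t: "-1 \<le> t" "t \<le> 0" for t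
      using C1p_norm_bounds(1)[OF p0 lp_primitive_diff[OF p0 Y Y0] t] d y(1)[OF t] y0(1)[OF t] by simp
    have yy0: "norm (y t - y0 t) \<le> \<eta>" if t: "-1 \<le> t" "t \<le> real n" for t
    proof -
      have "norm (y t - y0 t) \<le> 2 * (\<delta> + B) * exp (4 * kernel_int l0 (real n))"
        by (rule truncated_solution_compare[OF p0 r(1) g k b0 y(2) y0(2) init intB B t])
      also have "\<dots> \<le> \<eta>" using bound by (simp add: L_def)
      finally show ?thesis .
    qed
    have y_le: "norm (y t) \<le> r" if t: "-1 \<le> t" "t \<le> T1" for t
    proof -
      have "norm (y t) \<le> norm (y t - y0 t) + norm (y0 t)" by (metis diff_add_cancel norm_triangle_ineq)
      also have "\<dots> \<le> 1 + r0" using yy0[of t] y0_le[OF t] t n \<eta>(2) by (intro add_mono) auto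
      finally show ?thesis using r(2) by simp
    qed
    have "T1 > 0" using T1 T by simp
    have end1: "ereal T1 \<le> sol_end ?g \<phi>" and y_sol: "\<And>t. -1 \<le> t \<Longrightarrow> t < T1 \<Longrightarrow> sol ?g \<phi> t = y t"
      using S.sol_truncated[OF y(2) y(1) \<open>T1 > 0\<close> y_le] by blast+
    have fg: "field_along ?g (sol ?g \<phi>) s = truncated_field ?g r y s" if s: "0 \<le> s" "s \<le> T" for s
    proof -
      have "truncated_field ?g r y s = field_along ?g y s" by (rule truncated_field_eq[OF y_le]) (use s T1 in auto)
      then show ?thesis using y_sol[of s] y_sol[of "s - 1"] s T1 by (simp add: field_along_def)
    qed
    have fk: "field_along ?k (sol ?k \<phi>0) s = truncated_field ?k r y0 s" if s: "0 \<le> s" "s \<le> T" for s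
    proof -
      have "truncated_field ?k r y0 s = field_along ?k y0 s"
        by (rule truncated_field_eq[OF y0_r]) (use s T1 in auto)
      then show ?thesis using y0_sol[of s] y0_sol[of "s - 1"] s T1 by (simp add: field_along_def)
    qed
    have cy0: "continuous_on {-1..real n} y0" using y0(2)[of "real n"] by (simp add: truncated_solution_def)
    have fm0: "set_borel_measurable borel {0..real n} (truncated_field ?k r y0)"
      by (rule truncated_field_measurable[OF k cy0 r(1)])
    have "pint p 0 T (\<lambda>s. field_along ?g (sol ?g \<phi>) s - field_along ?k (sol ?k \<phi>0) s)
        = pint p 0 T (\<lambda>s. truncated_field ?g r y s - truncated_field ?k r y0 s)"
      by (intro pint_cong_AE AE_I2) (simp add: fg fk)
    also have "\<dots> \<le> pint p 0 (real n) (\<lambda>s. (truncated_field ?g r y s - truncated_field ?k r y s) + (truncated_field ?k r y s - truncated_field ?k r y0 s))"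
      using T1 n by (simp add: pint_mono_interval)
    also have "\<dots> \<le> ennreal (2 ^ p) * (pint p 0 (real n) (\<lambda>s. truncated_field ?g r y s - truncated_field ?k r y s)
         + pint p 0 (real n) (\<lambda>s. truncated_field ?k r y s - truncated_field ?k r y0 s))"
      by (intro pint_add_le p0 set_borel_measurable_diff fm fm0)
    also have "\<dots> \<le> ennreal (2 ^ p) * (ennreal e1 + ennreal ((2 * \<eta>) ^ p * I))"
    proof (intro mult_left_mono add_mono pe1)
      have "pint p 0 (real n) (\<lambda>s. truncated_field ?k r y s - truncated_field ?k r y0 s) \<le> pint p 0 (real n) (\<lambda>s. 2 * \<eta> * l0 s)"
      proof (rule pint_mono_AE)
        show "AE s in lborel. 0 \<le> s \<and> s \<le> real n \<longrightarrow>
            norm (truncated_field ?k r y s - truncated_field ?k r y0 s) \<le> norm (2 * \<eta> * l0 s)"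
          using truncated_field_lipschitz[OF b0 r(1), of y y0]
        proof eventually_elim
          case (elim s)
          show ?case
          proof
            assume s: "0 \<le> s \<and> s \<le> real n"
            have l00: "0 \<le> l0 s" using l0 by (simp add: lp_fun_def)
            have "norm (y s - y0 s) + norm (y (s - 1) - y0 (s - 1)) \<le> \<eta> + \<eta>"
              using s by (intro add_mono yy0) auto
            then have "l0 s * (norm (y s - y0 s) + norm (y (s - 1) - y0 (s - 1))) \<le> l0 s * (\<eta> + \<eta>)"
              using l00 by (intro mult_left_mono)
            then show "norm (truncated_field ?k r y s - truncated_field ?k r y0 s) \<le> norm (2 * \<eta> * l0 s)"
              using elim l00 \<eta>(1) by (simp add: abs_mult mult_ac)
          qed
        qed
      qed
      also have "\<dots> = ennreal (LINT s:{0..real n}|lborel. (2 * \<eta> * l0 s) ^ p)"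
        using l0 \<eta>(1) by (intro lp_fun_pint lp_fun_cmult) auto
      also have "(LINT s:{0..real n}|lborel. (2 * \<eta> * l0 s) ^ p) = (2 * \<eta>) ^ p * I"
        unfolding I_def power_mult_distrib[of "2 * \<eta>"] by (rule set_integral_mult_right)
      finally show "pint p 0 (real n) (\<lambda>s. truncated_field ?k r y s - truncated_field ?k r y0 s) \<le> ennreal ((2 * \<eta>) ^ p * I)" .
    qed auto
    also have "\<dots> = ennreal (2 ^ p * (e1 + (2 * \<eta>) ^ p * I))"
      using e1 \<eta>(1) I by (simp add: ennreal_plus ennreal_mult)
    also have "\<dots> \<le> ennreal e"
    proof (rule ennreal_leI)
      have "\<eta> ^ p \<le> \<eta> ^ 1" using \<eta> p0 by (intro power_decreasing) auto
      then have "4 ^ p * (\<eta> ^ p * I) \<le> 4 ^ p * (\<eta> * I)" using I by (intro mult_left_mono mult_right_mono) auto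
      moreover have "2 ^ p * (e1 + (2 * \<eta>) ^ p * I) = 2 ^ p * e1 + 4 ^ p * (\<eta> ^ p * I)"
      proof -
        have "(4::real) ^ p = 2 ^ p * 2 ^ p" by (simp flip: power_mult_distrib)
        then show ?thesis by (simp add: power_mult_distrib algebra_simps)
      qed
      ultimately show "2 ^ p * (e1 + (2 * \<eta>) ^ p * I) \<le> e" using e1e \<eta>I by linarith
    qed
    finally have P: "pint p 0 T (\<lambda>s. field_along ?g (sol ?g \<phi>) s - field_along ?k (sol ?k \<phi>0) s) \<le> ennreal e" .
    have "ereal T < sol_end ?g \<phi>" using end1 T1(1) by (intro order_less_le_trans[OF _ end1]) simp
    moreover have "norm (sol ?g \<phi> t - sol ?k \<phi>0 t) \<le> e" if t: "-1 \<le> t" "t \<le> T" for t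
      using y_sol[of t] y0_sol[of t] yy0[of t] t T1 n \<eta>(3) by simp
    ultimately show "ereal T < sol_end ?g \<phi> \<and>
      (\<forall>t. -1 \<le> t \<longrightarrow> t \<le> T \<longrightarrow> norm (sol ?g \<phi> t - sol ?k \<phi>0 t) \<le> e) \<and>
      pint p 0 T (\<lambda>s. field_along ?g (sol ?g \<phi>) s - field_along ?k (sol ?k \<phi>0) s) \<le> ennreal e" using P by blast
  qed
qed

text \<open>The segments are taken at different times. The difference of the two solutions at time
  \<open>t\<close> is handled by \<open>flow_close\<close> on an interval that reaches beyond
  \<open>t0\<close>. The remaining time shift of the fixed solution needs uniform continuity of
  \<open>x0\<close>, and L^p continuity of translations for its derivative.\<close>

lemma segment_close:
  assumes G0: "G0 \<in> fhull" and \<phi>0: "\<phi>0 \<in> C1p p" and t0: "0 \<le> t0" "ereal t0 < sol_end (LC_rep G0) \<phi>0" and e: "e > 0"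
  obtains V \<delta> where "openin curve_topology V" "G0 \<in> V" "\<delta> > 0"
    "\<And>G \<phi> t. G \<in> V \<Longrightarrow> G \<in> fhull \<Longrightarrow> \<phi> \<in> C1p p \<Longrightarrow> C1p_norm p (\<lambda>t. \<phi> t - \<phi>0 t) < \<delta> \<Longrightarrow> 0 \<le> t \<Longrightarrow> \<bar>t - t0\<bar> < \<delta> \<Longrightarrow>
      ereal t < sol_end (LC_rep G) \<phi> \<and>
      C1p_norm p (\<lambda>s. sol_segment (LC_rep G) \<phi> t s - sol_segment (LC_rep G0) \<phi>0 t0 s) < e"
proof -
  let ?k = "LC_rep G0"
  have k: "?k \<in> LC_fun p" by (rule hull_LC_fun[OF G0])
  interpret S0: delay_ivp p ?k \<phi>0 by (rule hull_delay_ivp[OF G0 \<phi>0])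
  obtain T where T: "t0 < T" "ereal T < sol_end ?k \<phi>0" using ereal_dense2[OF t0(2)] by auto
  have T0: "0 \<le> T" using T t0 by simp
  define x0 where "x0 = sol ?k \<phi>0"
  have x0l: "local_solution ?k T x0" unfolding x0_def by (rule S0.sol_local_solution[OF T(2) T0])
  then have x0c: "continuous_on {-1..T} x0" by (simp add: local_solution_def)
  obtain Y0 where Y0: "lp_primitive p \<phi>0 Y0" using C1p_imp_lp_primitive[OF p0 \<phi>0] .
  then have Y0m: "Y0 \<in> borel_measurable borel" by (simp add: lp_primitive_def)
  define D0 where "D0 = solution_deriv ?k Y0 x0 T"
  have D0m: "D0 \<in> borel_measurable borel" unfolding D0_def by (rule solution_deriv_measurable[OF k x0c Y0m])
  have D0f: "pint p a b D0 < \<infinity>" for a b unfolding D0_def by (rule pint_solution_deriv_finite[OF p0 k x0c T0 Y0])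
  have D0p: "primitive_on (-1) T x0 D0"
    unfolding D0_def by (rule solution_deriv_primitive[OF k x0l T0 Y0]) (simp add: x0_def S0.sol_init)
  \<comment> \<open>Three errors of size \<open>c\<close>, from the derivative on the history, from
    the field and from the time shift, and one factor \<open>2 ^ p\<close> of
    \<open>pint_add_le\<close> give \<open>(e / 4) ^ p\<close>.\<close>
  define c where "c = (e / 4) ^ p / (3 * 2 ^ p)"
  have c: "c > 0" using e by (simp add: c_def)
  obtain d1 where d1: "d1 > 0" "\<And>t. \<bar>t - t0\<bar> < d1 \<Longrightarrow> pint p (-1) 0 (\<lambda>s. D0 (s + t) - D0 (s + t0)) < ennreal c"
    by (rule pint_translation_continuous[OF D0m p0 D0f c, of t0 "-1" 0]) (rule that, assumption, simp_all)
  have "uniformly_continuous_on {-1..T} x0" by (rule compact_uniformly_continuous[OF x0c]) simp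
  then have "\<exists>d>0. \<forall>s\<in>{-1..T}. \<forall>r\<in>{-1..T}. dist r s < d \<longrightarrow> dist (x0 r) (x0 s) < e / 8"
    unfolding uniformly_continuous_on_def by (elim allE[of _ "e / 8"] impE) (use e in simp)
  then obtain d2 where d2: "d2 > 0" "\<forall>s\<in>{-1..T}. \<forall>r\<in>{-1..T}. dist r s < d2 \<longrightarrow> dist (x0 r) (x0 s) < e / 8"
    by (elim exE conjE)
  define e2 where "e2 = min (e / 8) c"
  have e2: "e2 > 0" "e2 \<le> e / 8" "e2 \<le> c" using e c by (auto simp: e2_def)
  obtain V \<delta>1 where V: "openin curve_topology V" "G0 \<in> V" "\<delta>1 > 0" and close:
    "\<And>G \<phi>. G \<in> V \<Longrightarrow> G \<in> fhull \<Longrightarrow> \<phi> \<in> C1p p \<Longrightarrow> C1p_norm p (\<lambda>t. \<phi> t - \<phi>0 t) < \<delta>1 \<Longrightarrow>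
      ereal T < sol_end (LC_rep G) \<phi> \<and>
      (\<forall>t. -1 \<le> t \<longrightarrow> t \<le> T \<longrightarrow> norm (sol (LC_rep G) \<phi> t - sol ?k \<phi>0 t) \<le> e2) \<and>
      pint p 0 T (\<lambda>s. field_along (LC_rep G) (sol (LC_rep G) \<phi>) s - field_along ?k (sol ?k \<phi>0) s) \<le> ennreal e2"
    by (rule flow_close[OF G0 \<phi>0 T0 T(2) e2(1)]) (rule that, assumption, simp_all)
  \<comment> \<open>The entry \<open>root p c\<close> bounds the p-th power integral of the
    difference of the initial derivatives by \<open>c\<close>; \<open>T - t0\<close> keeps
    \<open>t\<close> below \<open>T\<close>.\<close>
  define \<delta> where "\<delta> = Min {\<delta>1, d1, d2, T - t0, root p c}"
  have "root p c > 0" using c p0 by simp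
  then have \<delta>: "\<delta> > 0" "\<delta> \<le> \<delta>1" "\<delta> \<le> d1" "\<delta> \<le> d2" "\<delta> \<le> T - t0" "\<delta> \<le> root p c"
    using V(3) d1(1) d2(1) T(1) by (auto simp: \<delta>_def)
  show thesis
  proof (rule that[OF V(1,2) \<delta>(1)])
    fix G \<phi> t assume GV: "G \<in> V" and G: "G \<in> fhull" and \<phi>: "\<phi> \<in> C1p p" and d: "C1p_norm p (\<lambda>t. \<phi> t - \<phi>0 t) < \<delta>"
      and t: "0 \<le> t" "\<bar>t - t0\<bar> < \<delta>"
    let ?g = "LC_rep G"
    have g: "?g \<in> LC_fun p" by (rule hull_LC_fun[OF G])
    interpret S: delay_ivp p ?g \<phi> by (rule hull_delay_ivp[OF G \<phi>])
    have tT: "t \<le> T" "t < T" using t \<delta>(5) by auto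
    define x where "x = sol ?g \<phi>"
    have cl: "ereal T < sol_end ?g \<phi>" "\<And>t. -1 \<le> t \<Longrightarrow> t \<le> T \<Longrightarrow> norm (x t - x0 t) \<le> e2"
      "pint p 0 T (\<lambda>s. field_along ?g x s - field_along ?k x0 s) \<le> ennreal e2"
      using close[OF GV G \<phi>] d \<delta>(2) by (auto simp: x_def x0_def)
    have "ereal t < sol_end ?g \<phi>" using tT by (intro order_less_trans[OF _ cl(1)]) simp
    moreover
    have xl: "local_solution ?g T x" unfolding x_def by (rule S.sol_local_solution[OF cl(1) T0])
    then have xc: "continuous_on {-1..T} x" by (simp add: local_solution_def)
    obtain Y where Y: "lp_primitive p \<phi> Y" using C1p_imp_lp_primitive[OF p0 \<phi>] .
    then have Ym: "Y \<in> borel_measurable borel" by (simp add: lp_primitive_def)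
    define D where "D = solution_deriv ?g Y x T"
    have Dm: "D \<in> borel_measurable borel" unfolding D_def by (rule solution_deriv_measurable[OF g xc Ym])
    have Df: "pint p a b D < \<infinity>" for a b unfolding D_def by (rule pint_solution_deriv_finite[OF p0 g xc T0 Y])
    have Dp: "primitive_on (-1) T x D"
      unfolding D_def by (rule solution_deriv_primitive[OF g xl T0 Y]) (simp add: x_def S.sol_init)
    have shm: "(\<lambda>s. E (s + a)) \<in> borel_measurable borel" if "E \<in> borel_measurable borel" for E :: "real \<Rightarrow> real ^ 'n" and a
      by (rule measurable_compose[OF _ that]) measurable
    have sm: "set_borel_measurable borel A E" if "E \<in> borel_measurable borel" "A \<in> sets borel" for E :: "real \<Rightarrow> real ^ 'n" and A
      using that by (simp add: set_borel_measurable_def)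
    have seg: "lp_primitive p (\<lambda>s. sol_segment ?g \<phi> t s - sol_segment ?k \<phi>0 t0 s) (\<lambda>s. D (s + t) - D0 (s + t0))"
      unfolding sol_segment_def x_def[symmetric] x0_def[symmetric]
      by (intro lp_primitive_diff p0 segment_lp_primitive[OF p0 Dm Df Dp t(1) tT(1)] segment_lp_primitive[OF p0 D0m D0f D0p t0(1)])
        (use T in simp)
    have "C1p_norm p (\<lambda>s. sol_segment ?g \<phi> t s - sol_segment ?k \<phi>0 t0 s) \<le> e / 4 + e / 4"
    proof (rule C1p_norm_leI[OF p0 seg])
      fix s :: real assume s: "-1 \<le> s" "s \<le> 0"
      have "norm (x (t + s) - x0 (t + s)) \<le> e / 8" using cl(2)[of "t + s"] e2(2) s t tT by auto
      moreover have "dist (x0 (t + s)) (x0 (t0 + s)) < e / 8"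
        by (rule d2(2)[rule_format]) (use s t tT t0 T \<delta>(4) in \<open>auto simp: dist_real_def\<close>)
      moreover have "norm (x (t + s) - x0 (t0 + s)) \<le> norm (x (t + s) - x0 (t + s)) + norm (x0 (t + s) - x0 (t0 + s))"
        using norm_triangle_ineq[of "x (t + s) - x0 (t + s)" "x0 (t + s) - x0 (t0 + s)"] by simp
      ultimately have "norm (x (t + s) - x0 (t0 + s)) \<le> e / 4" by (simp add: dist_norm)
      then show "norm (sol_segment ?g \<phi> t s - sol_segment ?k \<phi>0 t0 s) \<le> e / 4"
        using s by (simp add: sol_segment_def x_def x0_def)
    next
      have 1: "pint p (-1) 0 (\<lambda>s. D (s + t) - D0 (s + t)) \<le> ennreal (c + c)"
      proof -
        have "pint p (-1) 0 (\<lambda>s. D (s + t) - D0 (s + t)) = pint p (-1 + t) (0 + t) (\<lambda>s. D s - D0 s)"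
          using Dm D0m by (intro pint_shift) measurable
        also have "\<dots> \<le> pint p (-1) T (\<lambda>s. D s - D0 s)" by (rule pint_mono_interval) (use t tT in auto)
        also have "\<dots> \<le> pint p (-1) 0 (\<lambda>s. Y s - Y0 s) + pint p 0 T (\<lambda>s. field_along ?g x s - field_along ?k x0 s)"
          unfolding D_def D0_def by (rule pint_solution_deriv_diff[OF p0 g k xc x0c Ym Y0m T0])
        also have "\<dots> \<le> ennreal c + ennreal c"
        proof (rule add_mono)
          have "pint p (-1) 0 (\<lambda>s. Y s - Y0 s) \<le> ennreal (C1p_norm p (\<lambda>t. \<phi> t - \<phi>0 t) ^ p)"
            by (rule C1p_norm_bounds(2)[OF p0 lp_primitive_diff[OF p0 Y Y0]])
          also have "\<dots> \<le> ennreal (root p c ^ p)"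
            using d \<delta>(6) C1p_norm_bounds(3)[OF p0 lp_primitive_diff[OF p0 Y Y0]]
            by (intro ennreal_leI power_mono) auto
          also have "root p c ^ p = c" using c p0 by simp
          finally show "pint p (-1) 0 (\<lambda>s. Y s - Y0 s) \<le> ennreal c" .
          show "pint p 0 T (\<lambda>s. field_along ?g x s - field_along ?k x0 s) \<le> ennreal c"
            using cl(3) e2(3) by (meson ennreal_leI order_trans)
        qed
        also have "\<dots> = ennreal (c + c)" using c by (intro ennreal_plus[symmetric]) auto
        finally show ?thesis .
      qed
      have 2: "pint p (-1) 0 (\<lambda>s. D0 (s + t) - D0 (s + t0)) \<le> ennreal c"
        using d1(2)[of t] t \<delta>(3) by (auto intro: less_imp_le)
      have "pint p (-1) 0 (\<lambda>s. D (s + t) - D0 (s + t0)) = pint p (-1) 0 (\<lambda>s. (D (s + t) - D0 (s + t)) + (D0 (s + t) - D0 (s + t0)))"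
        by simp
      also have "\<dots> \<le> ennreal (2 ^ p) * (pint p (-1) 0 (\<lambda>s. D (s + t) - D0 (s + t)) + pint p (-1) 0 (\<lambda>s. D0 (s + t) - D0 (s + t0)))"
        by (intro pint_add_le p0 set_borel_measurable_diff sm shm Dm D0m) auto
      also have "\<dots> \<le> ennreal (2 ^ p) * (ennreal (c + c) + ennreal c)"
        by (intro mult_left_mono add_mono 1 2) simp
      also have "\<dots> = ennreal (2 ^ p * (c + c + c))"
        using c by (simp only: ennreal_mult ennreal_plus add_nonneg_nonneg less_imp_le zero_le_power zero_le_numeral)
      also have "2 ^ p * (c + c + c) = (e / 4) ^ p" by (simp add: c_def)
      finally show "pint p (-1) 0 (\<lambda>s. D (s + t) - D0 (s + t0)) \<le> ennreal ((e / 4) ^ p)" .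
    qed (use e in simp)
    then have "C1p_norm p (\<lambda>s. sol_segment ?g \<phi> t s - sol_segment ?k \<phi>0 t0 s) < e" using e by simp
    ultimately show "ereal t < sol_end ?g \<phi> \<and> C1p_norm p (\<lambda>s. sol_segment ?g \<phi> t s - sol_segment ?k \<phi>0 t0 s) < e" by blast
  qed
qed

end

section \<open>From neighbourhood estimates to the semiflow\<close>

lemma topspace_C1p_topology: "topspace (C1p_topology p) = C1p p"
  unfolding C1p_topology_def by (rule topspace_pseudometric_topology) simp

lemma openin_C1p_ball:
  "\<phi>0 \<in> C1p p \<Longrightarrow> \<delta> > 0 \<Longrightarrow> openin (C1p_topology p) {\<phi> \<in> C1p p. C1p_norm p (\<lambda>t. \<phi> t - \<phi>0 t) < \<delta>}"
  unfolding C1p_topology_def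
  by (rule openin_pseudometric_ball[of \<phi>0 "C1p p" "\<lambda>x y. C1p_norm p (\<lambda>t. y t - x t)"]) auto

lemma C1p_norm_diff_self:
  fixes \<phi> :: "real \<Rightarrow> real ^ 'n::finite"
  assumes p: "p > 0"
  shows "C1p_norm p (\<lambda>t. \<phi> t - \<phi> t) = 0"
proof -
  have "primitive_on (-1) 0 (\<lambda>t. 0 :: real ^ 'n) (\<lambda>t. 0)"
    unfolding primitive_on_def by (simp add: set_integrable_def set_lebesgue_integral_def)
  then have "lp_primitive p (\<lambda>t. 0 :: real ^ 'n) (\<lambda>t. 0)"
    using p by (simp add: lp_primitive_def pint_def power_0_left)
  from C1p_norm_leI[OF p this, of 0 0] C1p_norm_bounds(3)[OF p this] p show ?thesis
    by (simp add: pint_def power_0_left)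
qed

context hull_flow
begin

abbreviation phase_space where
  "phase_space \<equiv> prod_topology (top_of_set {0::real..}) (prod_topology (hull_topology p curve_topology f) (C1p_topology p))"

lemma topspace_hull_topology: "topspace (hull_topology p curve_topology f) = fhull"
  unfolding hull_topology_def using LC_hull_subset by (auto simp: topspace_curve_topology)

text \<open>One neighbourhood serves two purposes: openness of the domain and continuity of the
  second component of the flow.\<close>

lemma delay_domain_neighbourhood:
  assumes x: "(t0, G0, \<phi>0) \<in> delay_domain p curve_topology f" and e: "e > 0"
  obtains N where "openin phase_space N" "(t0, G0, \<phi>0) \<in> N"
    "\<And>t G \<phi>. (t, G, \<phi>) \<in> N \<Longrightarrow> (t, G, \<phi>) \<in> delay_domain p curve_topology f \<and>
      C1p_norm p (\<lambda>s. sol_segment (LC_rep G) \<phi> t s - sol_segment (LC_rep G0) \<phi>0 t0 s) < e"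
proof -
  have G0: "G0 \<in> fhull" and \<phi>0: "\<phi>0 \<in> C1p p" and t0: "0 \<le> t0" "ereal t0 < sol_end (LC_rep G0) \<phi>0"
    using x by (auto simp: delay_domain_def)
  obtain V \<delta> where V: "openin curve_topology V" "G0 \<in> V" and \<delta>: "\<delta> > 0" and close:
    "\<And>G \<phi> t. G \<in> V \<Longrightarrow> G \<in> fhull \<Longrightarrow> \<phi> \<in> C1p p \<Longrightarrow> C1p_norm p (\<lambda>t. \<phi> t - \<phi>0 t) < \<delta> \<Longrightarrow> 0 \<le> t \<Longrightarrow> \<bar>t - t0\<bar> < \<delta> \<Longrightarrow>
      ereal t < sol_end (LC_rep G) \<phi> \<and>
      C1p_norm p (\<lambda>s. sol_segment (LC_rep G) \<phi> t s - sol_segment (LC_rep G0) \<phi>0 t0 s) < e"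
    by (rule segment_close[OF G0 \<phi>0 t0 e]) (rule that, assumption, simp_all)
  define N where "N = ({0..} \<inter> ball t0 \<delta>) \<times> ((V \<inter> fhull) \<times> {\<phi> \<in> C1p p. C1p_norm p (\<lambda>t. \<phi> t - \<phi>0 t) < \<delta>})"
  show thesis
  proof (rule that[of N])
    have "openin (top_of_set {0..}) ({0..} \<inter> ball t0 \<delta>)" by (intro openin_open_Int) simp
    moreover have "openin (hull_topology p curve_topology f) (V \<inter> fhull)"
      unfolding hull_topology_def by (rule openin_subtopology_Int[OF V(1)])
    ultimately show "openin phase_space N"
      unfolding N_def using openin_C1p_ball[OF \<phi>0 \<delta>] by (simp add: openin_prod_Times_iff)
    show "(t0, G0, \<phi>0) \<in> N"
      unfolding N_def using t0(1) \<delta> V(2) G0 \<phi>0 C1p_norm_diff_self[OF p0, of \<phi>0] by simp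
    fix t G \<phi> assume "(t, G, \<phi>) \<in> N"
    then have "0 \<le> t" "\<bar>t - t0\<bar> < \<delta>" "G \<in> V" "G \<in> fhull" "\<phi> \<in> C1p p" "C1p_norm p (\<lambda>t. \<phi> t - \<phi>0 t) < \<delta>"
      by (auto simp: N_def dist_real_def)
    then show "(t, G, \<phi>) \<in> delay_domain p curve_topology f \<and>
      C1p_norm p (\<lambda>s. sol_segment (LC_rep G) \<phi> t s - sol_segment (LC_rep G0) \<phi>0 t0 s) < e"
      using close[of G \<phi> t] by (simp add: delay_domain_def)
  qed
qed

lemma delay_domain_subset: "delay_domain p curve_topology f \<subseteq> topspace phase_space"
  by (auto simp: delay_domain_def topspace_hull_topology topspace_C1p_topology)

lemma openin_delay_domain: "openin phase_space (delay_domain p curve_topology f)"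
proof (subst openin_subopen, intro ballI)
  fix x assume x: "x \<in> delay_domain p curve_topology f"
  obtain t0 G0 \<phi>0 where xeq: "x = (t0, G0, \<phi>0)" by (metis prod.collapse)
  obtain N where N: "openin phase_space N" "(t0, G0, \<phi>0) \<in> N" and
    sub: "\<And>t G \<phi>. (t, G, \<phi>) \<in> N \<Longrightarrow> (t, G, \<phi>) \<in> delay_domain p curve_topology f \<and>
      C1p_norm p (\<lambda>s. sol_segment (LC_rep G) \<phi> t s - sol_segment (LC_rep G0) \<phi>0 t0 s) < 1"
    by (rule delay_domain_neighbourhood[OF x[unfolded xeq] zero_less_one]) (rule that, assumption, simp_all)
  have "N \<subseteq> delay_domain p curve_topology f"
  proof
    fix y assume y: "y \<in> N"
    obtain t G \<phi> where "y = (t, G, \<phi>)" by (metis prod.collapse)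
    then show "y \<in> delay_domain p curve_topology f" using sub[of t G \<phi>] y by simp
  qed
  then show "\<exists>T. openin phase_space T \<and> x \<in> T \<and> T \<subseteq> delay_domain p curve_topology f"
    using N xeq by blast
qed

lemma continuous_map_delay_map:
  "continuous_map (subtopology phase_space (delay_domain p curve_topology f))
     (prod_topology (hull_topology p curve_topology f) (C1p_topology p)) (\<lambda>(t, x). delay_map t x)"
proof -
  let ?U = "delay_domain p curve_topology f"
  let ?X = "subtopology phase_space ?U"
  have tX: "topspace ?X = ?U" using delay_domain_subset by auto
  have "continuous_map ?X (subtopology curve_topology fhull) (\<lambda>(t, G, \<phi>). translate t ` G)"
  proof (rule continuous_map_into_subtopology)
    have "continuous_map phase_space euclideanreal fst"
      by (rule continuous_map_into_fulltopology[OF continuous_map_fst])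
    moreover have "continuous_map phase_space curve_topology (fst \<circ> snd)"
      using continuous_map_fst_of[OF continuous_map_snd[of "top_of_set {0::real..}"
            "prod_topology (hull_topology p curve_topology f) (C1p_topology p)"]]
      unfolding hull_topology_def by (rule continuous_map_into_fulltopology)
    ultimately have "continuous_map phase_space (prod_topology euclideanreal curve_topology) (\<lambda>x. (fst x, (fst \<circ> snd) x))"
      by (rule continuous_map_pairedI)
    from continuous_map_compose[OF this continuous_map_translate]
    have "continuous_map phase_space curve_topology (\<lambda>(t, G, \<phi>). translate t ` G)"
      by (simp add: o_def split_def)
    then show "continuous_map ?X curve_topology (\<lambda>(t, G, \<phi>). translate t ` G)"
      by (rule continuous_map_from_subtopology)
    show "(\<lambda>(t, G, \<phi>). translate t ` G) \<in> topspace ?X \<rightarrow> fhull"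
      unfolding tX by (auto simp: delay_domain_def intro: LC_hull_translate[OF f])
  qed
  then have c1: "continuous_map ?X (hull_topology p curve_topology f) (\<lambda>(t, G, \<phi>). translate t ` G)"
    by (simp only: hull_topology_def)
  have "continuous_map ?X (pseudometric_topology (C1p p) {\<lambda>x y. C1p_norm p (\<lambda>t. y t - x t)})
      (\<lambda>(t, G, \<phi>). sol_segment (LC_rep G) \<phi> t)"
  proof (rule continuous_map_pseudometric_topologyI)
    fix d :: "(real \<Rightarrow> real ^ 'n) \<Rightarrow> (real \<Rightarrow> real ^ 'n) \<Rightarrow> real" and x y z :: "real \<Rightarrow> real ^ 'n"
    assume "d \<in> {\<lambda>x y. C1p_norm p (\<lambda>t. y t - x t)}" "x \<in> C1p p" "y \<in> C1p p" "z \<in> C1p p"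
    then show "d x z \<le> d x y + d y z" using C1p_norm_triangle[OF p0, of x y z] by simp
  next
    fix x assume "x \<in> topspace ?X"
    then obtain t G \<phi> where "x = (t, G, \<phi>)" "(t, G, \<phi>) \<in> ?U" unfolding tX by (metis prod.collapse)
    then show "(case x of (t, G, \<phi>) \<Rightarrow> sol_segment (LC_rep G) \<phi> t) \<in> C1p p"
      by (auto simp: delay_domain_def intro!: sol_segment_in_C1p p0 hull_LC_fun)
  next
    fix x and d :: "(real \<Rightarrow> real ^ 'n) \<Rightarrow> (real \<Rightarrow> real ^ 'n) \<Rightarrow> real" and e :: real
    assume "x \<in> topspace ?X" and d: "d \<in> {\<lambda>x y. C1p_norm p (\<lambda>t. y t - x t)}" and e: "e > 0"
    then obtain t0 G0 \<phi>0 where xeq: "x = (t0, G0, \<phi>0)" and xU: "(t0, G0, \<phi>0) \<in> ?U" unfolding tX by (metis prod.collapse)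
    obtain N where N: "openin phase_space N" "(t0, G0, \<phi>0) \<in> N" and
      sub: "\<And>t G \<phi>. (t, G, \<phi>) \<in> N \<Longrightarrow> (t, G, \<phi>) \<in> ?U \<and>
        C1p_norm p (\<lambda>s. sol_segment (LC_rep G) \<phi> t s - sol_segment (LC_rep G0) \<phi>0 t0 s) < e"
      by (rule delay_domain_neighbourhood[OF xU e]) (rule that, assumption, simp_all)
    show "\<exists>W. openin ?X W \<and> x \<in> W \<and> (\<forall>y\<in>W. d (case x of (t, G, \<phi>) \<Rightarrow> sol_segment (LC_rep G) \<phi> t)
        (case y of (t, G, \<phi>) \<Rightarrow> sol_segment (LC_rep G) \<phi> t) < e)"
    proof (intro exI[of _ "N \<inter> ?U"] conjI ballI)
      show "openin ?X (N \<inter> ?U)" by (rule openin_subtopology_Int[OF N(1)])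
      show "x \<in> N \<inter> ?U" using N(2) xU xeq by simp
      fix y assume y: "y \<in> N \<inter> ?U"
      obtain t G \<phi> where yeq: "y = (t, G, \<phi>)" by (metis prod.collapse)
      show "d (case x of (t, G, \<phi>) \<Rightarrow> sol_segment (LC_rep G) \<phi> t) (case y of (t, G, \<phi>) \<Rightarrow> sol_segment (LC_rep G) \<phi> t) < e"
        using sub[of t G \<phi>] y d by (simp add: xeq yeq)
    qed
  qed simp
  then have c2: "continuous_map ?X (C1p_topology p) (\<lambda>(t, G, \<phi>). sol_segment (LC_rep G) \<phi> t)"
    by (simp only: C1p_topology_def)
  have "continuous_map ?X (prod_topology (hull_topology p curve_topology f) (C1p_topology p))
     (\<lambda>x. ((\<lambda>(t, G, \<phi>). translate t ` G) x, (\<lambda>(t, G, \<phi>). sol_segment (LC_rep G) \<phi> t) x))"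
    by (rule continuous_map_pairedI[OF c1 c2])
  then show ?thesis by (simp add: delay_map_def split_def)
qed

lemma delay_map_zero:
  assumes "G \<in> fhull" "\<phi> \<in> C1p p"
  shows "delay_map 0 (G, \<phi>) = (G, \<phi>)"
proof -
  interpret S: delay_ivp p "LC_rep G" \<phi> by (rule hull_delay_ivp[OF assms])
  have "sol_segment (LC_rep G) \<phi> 0 = \<phi>"
  proof (rule extensionalityI[of _ "{-1..0}"])
    show "\<phi> \<in> extensional {-1..0}" using assms(2) by (simp add: C1p_def)
  qed (auto simp: sol_segment_def S.sol_init)
  then show ?thesis by (simp add: delay_map_def translate_0[abs_def])
qed

theorem hull_semiflow:
  "continuous_skew_product_semiflow (hull_topology p curve_topology f) (C1p_topology p)
     (delay_domain p curve_topology f) delay_map"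
  unfolding continuous_skew_product_semiflow_def continuous_semiflow_def
proof (intro conjI openin_delay_domain continuous_map_delay_map)
  let ?X = "prod_topology (hull_topology p curve_topology f) (C1p_topology p)"
  have tX: "topspace ?X = fhull \<times> C1p p" by (simp add: topspace_hull_topology topspace_C1p_topology)
  show "{0} \<times> topspace ?X \<subseteq> delay_domain p curve_topology f"
    unfolding tX using delay_ivp.sol_end_pos[OF hull_delay_ivp] by (auto simp: delay_domain_def zero_ereal_def)
  show "\<forall>x\<in>topspace ?X. delay_map 0 x = x" unfolding tX using delay_map_zero by auto
  show "\<forall>s t x. (s, x) \<in> delay_domain p curve_topology f \<and> (t, delay_map s x) \<in> delay_domain p curve_topology f \<longrightarrow>
        (t + s, x) \<in> delay_domain p curve_topology f \<and> delay_map (t + s) x = delay_map t (delay_map s x)"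
  proof (intro allI impI)
    fix s t :: real and x :: "'n delay_field set \<times> (real \<Rightarrow> real ^ 'n)"
    assume H: "(s, x) \<in> delay_domain p curve_topology f \<and> (t, delay_map s x) \<in> delay_domain p curve_topology f"
    obtain G \<phi> where x: "x = (G, \<phi>)" by (metis prod.collapse)
    let ?g = "LC_rep G" and ?\<psi> = "sol_segment (LC_rep G) \<phi> s"
    have G: "G \<in> fhull" and \<phi>: "\<phi> \<in> C1p p" and s: "0 \<le> s" "ereal s < sol_end ?g \<phi>"
      using H by (auto simp: x delay_domain_def)
    have t: "0 \<le> t" "ereal t < sol_end (LC_rep (translate s ` G)) ?\<psi>"
      using H by (auto simp: x delay_domain_def delay_map_def)
    have g: "?g \<in> LC_fun p" by (rule hull_LC_fun[OF G])
    \<comment> \<open>The representative chosen for the translated class need not be the translate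
      of the representative; the two differ on a null set of times, which does not change
      solutions.\<close>
    have "AE u in lborel. \<forall>z. LC_rep (translate s ` G) u z = translate s ?g u z"
      using translate_image(3)[OF hull_LC[OF G], of s] unfolding translate_def[of s ?g] .
    note eq = sol_cong_AE[OF this]
    have t': "ereal t < sol_end (translate s ?g) ?\<psi>" using t(2) by (simp add: eq(1))
    note sg = sol_segment_semigroup[OF p0 g C1p_continuous[OF p0 \<phi>] s t(1) t']
    have "sol_segment (LC_rep (translate s ` G)) ?\<psi> t = sol_segment (translate s ?g) ?\<psi> t"
      unfolding sol_segment_def[of "LC_rep (translate s ` G)"] sol_segment_def[of "translate s ?g"] eq(2) ..
    then have "sol_segment ?g \<phi> (t + s) = sol_segment (LC_rep (translate s ` G)) ?\<psi> t" using sg(2) by simp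
    moreover have "translate (t + s) ` G = translate t ` translate s ` G" by (simp add: image_image translate_translate)
    ultimately show "(t + s, x) \<in> delay_domain p curve_topology f \<and> delay_map (t + s) x = delay_map t (delay_map s x)"
      using G \<phi> s(1) t(1) sg(1) by (simp add: x delay_domain_def delay_map_def)
  qed
  show "\<forall>t y z z'. (t, y, z) \<in> delay_domain p curve_topology f \<and> (t, y, z') \<in> delay_domain p curve_topology f \<longrightarrow>
      fst (delay_map t (y, z)) = fst (delay_map t (y, z'))"
    by (simp add: delay_map_def)
qed

end

section \<open>Optimal bounds and moduli of continuity\<close>

lemma SUP_ennreal_dense:
  fixes q :: "'i::metric_space \<Rightarrow> real"
  assumes q: "continuous_on A q" and A': "A' \<subseteq> A" "A \<subseteq> closure A'"
  shows "(SUP i\<in>A. ennreal (q i)) = (SUP i\<in>A'. ennreal (q i))"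
proof (rule antisym)
  show "(SUP i\<in>A'. ennreal (q i)) \<le> (SUP i\<in>A. ennreal (q i))" by (rule SUP_subset_mono[OF A'(1)]) simp
  show "(SUP i\<in>A. ennreal (q i)) \<le> (SUP i\<in>A'. ennreal (q i))"
  proof (rule SUP_least)
    fix i assume i: "i \<in> A"
    then obtain x where x: "\<And>n. x n \<in> A'" "x \<longlonglongrightarrow> i" using A'(2) closure_sequential by blast
    have "(\<lambda>n. q (x n)) \<longlonglongrightarrow> q i"
      by (rule continuous_on_tendsto_compose[OF q x(2) i], rule always_eventually) (use x(1) A'(1) in auto)
    then have "(\<lambda>n. ennreal (q (x n))) \<longlonglongrightarrow> ennreal (q i)" by (rule tendsto_ennrealI)
    moreover have "ennreal (q (x n)) \<le> (SUP i\<in>A'. ennreal (q i))" for n by (rule SUP_upper[OF x(1)])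
    ultimately show "ennreal (q i) \<le> (SUP i\<in>A'. ennreal (q i))"
      using LIMSEQ_le_const2[of "\<lambda>n. ennreal (q (x n))" "ennreal (q i)"] by (simp only:) blast
  qed
qed

text \<open>A supremum over an uncountable index set is a Borel function of time up to a null set, because
  the field is continuous in space at almost every time.\<close>

lemma SUP_AE_eq_borel:
  fixes q :: "'i::{metric_space, second_countable_topology} \<Rightarrow> ((real ^ 'n) \<times> (real ^ 'n) \<Rightarrow> real ^ 'n) \<Rightarrow> real"
  assumes f: "f \<in> LC_fun p" and q: "\<And>h. continuous_on UNIV h \<Longrightarrow> continuous_on A (\<lambda>i. q i h)"
    and m: "\<And>i. i \<in> A \<Longrightarrow> (\<lambda>t. q i (f t)) \<in> borel_measurable borel"
  obtains B where "B \<in> borel_measurable borel" "AE t in lborel. (SUP i\<in>A. ennreal (q i (f t))) = B t"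
proof -
  obtain A' where A': "countable A'" "A' \<subseteq> A" "A \<subseteq> closure A'" using separable[of A] by blast
  show thesis
  proof
    show "(\<lambda>t. SUP i\<in>A'. ennreal (q i (f t))) \<in> borel_measurable borel"
    proof (rule borel_measurable_SUP[OF A'(1)])
      fix i assume "i \<in> A'"
      then show "(\<lambda>t. ennreal (q i (f t))) \<in> borel_measurable borel"
        using m A'(2) by (intro measurable_compose[OF _ measurable_ennreal]) auto
    qed
    show "AE t in lborel. (SUP i\<in>A. ennreal (q i (f t))) = (SUP i\<in>A'. ennreal (q i (f t)))"
      using LC_fun_AE_continuous[OF f]
      by eventually_elim (rule SUP_ennreal_dense[OF q A'(2,3)])
  qed
qed

lemma LC_fun_section_measurable: "f \<in> LC_fun p \<Longrightarrow> (\<lambda>t. f t z) \<in> borel_measurable borel"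
  by (rule LC_fun_measurable) simp_all

lemma m_bound_AE_borel:
  assumes f: "f \<in> LC_fun p"
  obtains B where "B \<in> borel_measurable borel" "AE t in lborel. m_bound j f t = B t"
  unfolding m_bound_def
proof (rule SUP_AE_eq_borel[OF f, of "cball 0 (real j)" "\<lambda>z h. norm (h z)"])
  fix h :: "(real ^ 'a) \<times> (real ^ 'a) \<Rightarrow> real ^ 'a" assume "continuous_on UNIV h"
  then show "continuous_on (cball 0 (real j)) (\<lambda>z. norm (h z))"
    by (intro continuous_on_norm) (rule continuous_on_subset, auto)
next
  fix z show "(\<lambda>t. norm (f t z)) \<in> borel_measurable borel"
    by (rule measurable_compose[OF LC_fun_section_measurable[OF f] borel_measurable_norm])
qed

lemma l_bound_AE_borel:
  assumes f: "f \<in> LC_fun p"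
  obtains B where "B \<in> borel_measurable borel" "AE t in lborel. l_bound j f t = B t"
proof -
  define A where "A = {(z1, z2). z1 \<in> cball 0 (real j) \<and> z2 \<in> cball 0 (real j) \<and> z1 \<noteq> (z2 :: (real ^ 'a) \<times> (real ^ 'a))}"
  define q where "q i h = norm (h (fst i) - h (snd i)) / norm (fst i - snd i)"
    for i and h :: "(real ^ 'a) \<times> (real ^ 'a) \<Rightarrow> real ^ 'a"
  obtain B where B: "B \<in> borel_measurable borel" "AE t in lborel. (SUP i\<in>A. ennreal (q i (f t))) = B t"
  proof (rule SUP_AE_eq_borel[OF f, of A q])
    fix h :: "(real ^ 'a) \<times> (real ^ 'a) \<Rightarrow> real ^ 'a" assume h: "continuous_on UNIV h"
    show "continuous_on A (\<lambda>i. q i h)"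
      unfolding q_def
      by (intro continuous_intros continuous_on_compose2[OF h]) (auto simp: A_def)
  next
    fix i assume "i \<in> A"
    show "(\<lambda>t. q i (f t)) \<in> borel_measurable borel"
      unfolding q_def
      by (intro borel_measurable_divide measurable_compose[OF _ borel_measurable_norm] borel_measurable_diff
          LC_fun_section_measurable[OF f] borel_measurable_const)
  qed
  have "l_bound j f t = (SUP i\<in>A. ennreal (q i (f t)))" for t
    unfolding l_bound_def A_def q_def by (simp add: split_def)
  then show thesis using that[OF B(1)] B(2) by simp
qed

lemma l2_bound_AE_borel:
  assumes f: "f \<in> LC_fun p"
  obtains B where "B \<in> borel_measurable borel" "AE t in lborel. l2_bound j f t = B t"
proof -
  define A where "A = {(x :: real ^ 'a, u1, u2). (x, u1) \<in> cball 0 (real j) \<and> (x, u2) \<in> cball 0 (real j) \<and> u1 \<noteq> (u2 :: real ^ 'a)}"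
  define q where "q i h = norm (h (fst i, fst (snd i)) - h (fst i, snd (snd i))) / norm (fst (snd i) - snd (snd i))"
    for i and h :: "(real ^ 'a) \<times> (real ^ 'a) \<Rightarrow> real ^ 'a"
  obtain B where B: "B \<in> borel_measurable borel" "AE t in lborel. (SUP i\<in>A. ennreal (q i (f t))) = B t"
  proof (rule SUP_AE_eq_borel[OF f, of A q])
    fix h :: "(real ^ 'a) \<times> (real ^ 'a) \<Rightarrow> real ^ 'a" assume h: "continuous_on UNIV h"
    show "continuous_on A (\<lambda>i. q i h)"
      unfolding q_def
      by (intro continuous_intros continuous_on_compose2[OF h]) (auto simp: A_def)
  next
    fix i assume "i \<in> A"
    show "(\<lambda>t. q i (f t)) \<in> borel_measurable borel"
      unfolding q_def
      by (intro borel_measurable_divide measurable_compose[OF _ borel_measurable_norm] borel_measurable_diff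
          LC_fun_section_measurable[OF f] borel_measurable_const)
  qed
  have "l2_bound j f t = (SUP i\<in>A. ennreal (q i (f t)))" for t
    unfolding l2_bound_def A_def q_def by (simp add: split_def)
  then show thesis using that[OF B(1)] B(2) by simp
qed

lemma nn_integral_translate_borel:
  fixes B :: "real \<Rightarrow> ennreal"
  assumes B [measurable]: "B \<in> borel_measurable borel"
  shows "(\<integral>\<^sup>+u\<in>{a..b}. B (u + c) \<partial>lborel) = (\<integral>\<^sup>+u\<in>{a + c..b + c}. B u \<partial>lborel)"
proof -
  have "(\<integral>\<^sup>+u\<in>{a + c..b + c}. B u \<partial>lborel) = (\<integral>\<^sup>+u. B (c + 1 * u) * indicator {a + c..b + c} (c + 1 * u) \<partial>lborel)"
    by (subst nn_integral_real_affine[of _ 1 c]) auto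
  also have "\<dots> = (\<integral>\<^sup>+u\<in>{a..b}. B (u + c) \<partial>lborel)"
    by (intro nn_integral_cong) (auto simp: indicator_def add.commute)
  finally show ?thesis by simp
qed

lemma bound_translate:
  "m_bound j (translate c f) t = m_bound j f (t + c)" "l_bound j (translate c f) t = l_bound j f (t + c)"
  "l2_bound j (translate c f) t = l2_bound j f (t + c)"
  by (simp_all add: m_bound_def l_bound_def l2_bound_def translate_def)

lemma m_bound_integral_translate:
  assumes f: "f \<in> LC_fun p"
  shows "(\<integral>\<^sup>+u\<in>{a..b}. m_bound j (translate c f) u \<partial>lebesgue) = (\<integral>\<^sup>+u\<in>{a + c..b + c}. m_bound j f u \<partial>lebesgue)"
proof -
  obtain B where B: "B \<in> borel_measurable borel" "AE t in lborel. m_bound j f t = B t" by (rule m_bound_AE_borel[OF f])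
  have "(\<integral>\<^sup>+u\<in>{a..b}. m_bound j (translate c f) u \<partial>lborel) = (\<integral>\<^sup>+u\<in>{a..b}. B (u + c) \<partial>lborel)"
    by (intro nn_integral_cong_AE) (use AE_lborel_shift[OF B(2), of c] in eventually_elim, simp add: bound_translate)
  also have "\<dots> = (\<integral>\<^sup>+u\<in>{a + c..b + c}. B u \<partial>lborel)" by (rule nn_integral_translate_borel[OF B(1)])
  also have "\<dots> = (\<integral>\<^sup>+u\<in>{a + c..b + c}. m_bound j f u \<partial>lborel)"
    by (intro nn_integral_cong_AE) (use B(2) in eventually_elim, simp)
  finally show ?thesis by (simp only: nn_integral_completion)
qed

text \<open>Equicontinuity with \<epsilon> = 1 bounds the integral over all windows of one short
  length \<open>h\<close>, wherever they lie, because of the supremum over translations. A window of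
  length \<open>s\<close> is covered by finitely many of these, and their number does not depend on
  its position.\<close>

lemma m_moduli_finite:
  assumes f: "f \<in> LC_fun p" and eq: "L1_loc_equicontinuous_m_bounds f" and s: "0 \<le> s"
  shows "(SUP t. \<integral>\<^sup>+u\<in>{t..t + s}. m_bound j f u \<partial>lebesgue) < \<infinity>"
proof -
  obtain B where B [measurable]: "B \<in> borel_measurable borel" and Bm: "AE t in lborel. m_bound j f t = B t"
    by (rule m_bound_AE_borel[OF f])
  have mB: "(\<integral>\<^sup>+u\<in>{a..b}. m_bound j f u \<partial>lebesgue) = (\<integral>\<^sup>+u\<in>{a..b}. B u \<partial>lborel)" for a b
    unfolding nn_integral_completion by (intro nn_integral_cong_AE) (use Bm in eventually_elim, simp)
  obtain \<delta> where \<delta>: "\<delta> > 0" "\<And>a b. - 1 \<le> a \<Longrightarrow> a \<le> b \<Longrightarrow> b \<le> 1 \<Longrightarrow> b - a < \<delta> \<Longrightarrow>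
      (SUP \<tau>. \<integral>\<^sup>+u\<in>{a..b}. m_bound j (translate \<tau> f) u \<partial>lebesgue) < ennreal 1"
    using eq[unfolded L1_loc_equicontinuous_m_bounds_def, rule_format, of 1 1 j] by auto
  \<comment> \<open>The bound 1 keeps the model window \<open>[0, h]\<close> inside
    \<open>[-1, 1]\<close>, where equicontinuity is applied.\<close>
  define h where "h = min 1 (\<delta> / 2)"
  have h: "h > 0" "h \<le> 1" "h < \<delta>" using \<delta>(1) by (auto simp: h_def)
  have unit: "(\<integral>\<^sup>+u\<in>{t..t + h}. B u \<partial>lborel) \<le> 1" for t
  proof -
    have "(\<integral>\<^sup>+u\<in>{t..t + h}. B u \<partial>lborel) = (\<integral>\<^sup>+u\<in>{0..h}. m_bound j (translate t f) u \<partial>lebesgue)"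
      unfolding m_bound_integral_translate[OF f] mB by (simp add: add.commute)
    also have "\<dots> \<le> (SUP \<tau>. \<integral>\<^sup>+u\<in>{0..h}. m_bound j (translate \<tau> f) u \<partial>lebesgue)" by (rule SUP_upper) simp
    also have "\<dots> \<le> ennreal 1" using \<delta>(2)[of 0 h] h by (intro less_imp_le) auto
    finally show ?thesis by simp
  qed
  have many: "(\<integral>\<^sup>+u\<in>{t..t + real i * h}. B u \<partial>lborel) \<le> of_nat i" for i t
  proof (induction i)
    case 0
    have "(\<integral>\<^sup>+u\<in>{t..t + 0}. B u \<partial>lborel) = (\<integral>\<^sup>+u. 0 \<partial>(lborel :: real measure))"
      using AE_lborel_singleton[of t] by (intro nn_integral_cong_AE, eventually_elim) auto
    then show ?case by simp
  next
    case (Suc i)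
    have "(\<integral>\<^sup>+u\<in>{t..t + real (Suc i) * h}. B u \<partial>lborel)
       \<le> (\<integral>\<^sup>+u. B u * indicator {t..t + real i * h} u + B u * indicator {t + real i * h..t + real i * h + h} u \<partial>lborel)"
      by (intro nn_integral_mono) (auto simp: indicator_def algebra_simps)
    also have "\<dots> = (\<integral>\<^sup>+u\<in>{t..t + real i * h}. B u \<partial>lborel) + (\<integral>\<^sup>+u\<in>{t + real i * h..t + real i * h + h}. B u \<partial>lborel)"
      by (intro nn_integral_add) auto
    also have "\<dots> \<le> of_nat i + 1" by (intro add_mono Suc unit)
    finally show ?case by (simp add: add.commute)
  qed
  define i where "i = nat \<lceil>s / h\<rceil>"
  have "s / h \<le> real i" unfolding i_def by linarith
  then have i: "s \<le> real i * h" using h by (simp add: field_simps)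
  have "(SUP t. \<integral>\<^sup>+u\<in>{t..t + s}. m_bound j f u \<partial>lebesgue) \<le> of_nat i"
  proof (rule SUP_least)
    fix t
    have "(\<integral>\<^sup>+u\<in>{t..t + s}. B u \<partial>lborel) \<le> (\<integral>\<^sup>+u\<in>{t..t + real i * h}. B u \<partial>lborel)"
      using i by (intro nn_integral_mono) (auto simp: indicator_def)
    also have "\<dots> \<le> of_nat i" by (rule many)
    finally show "(\<integral>\<^sup>+u\<in>{t..t + s}. m_bound j f u \<partial>lebesgue) \<le> of_nat i" unfolding mB .
  qed
  also have "(of_nat i :: ennreal) < \<infinity>" by (simp add: of_nat_less_top)
  finally show ?thesis .
qed

text \<open>The inequality ranges over arbitrary pairs of intervals, so at nonnegative arguments
  such moduli do not depend on the interval at all. This lets a curve move to another interval and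
  stay in the corresponding set.\<close>

definition good_moduli :: "moduli \<Rightarrow> bool" where
  "good_moduli \<theta> \<longleftrightarrow> (\<forall>a b j s. 0 \<le> \<theta> a b j s) \<and>
     (\<forall>a b a' b' j s t. 0 \<le> s \<longrightarrow> s \<le> t \<longrightarrow> \<theta> a b j s \<le> \<theta> a' b' j t)"

lemma good_moduliD:
  assumes "good_moduli \<theta>"
  shows "0 \<le> \<theta> a b j s" "0 \<le> s \<Longrightarrow> s \<le> t \<Longrightarrow> \<theta> a b j s \<le> \<theta> a' b' j t"
  using assms unfolding good_moduli_def by blast+

lemma good_m_moduli:
  assumes f: "f \<in> LC_fun p" and eq: "L1_loc_equicontinuous_m_bounds f"
  shows "good_moduli (m_moduli f)"
  unfolding good_moduli_def
proof (intro conjI allI impI)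
  fix a b a' b' s t :: real and j :: nat assume st: "0 \<le> s" "s \<le> t"
  show "m_moduli f a b j s \<le> m_moduli f a' b' j t"
    unfolding m_moduli_def
  proof (rule enn2real_mono)
    show "(SUP x. \<integral>\<^sup>+u\<in>{x..x + s}. m_bound j f u \<partial>lebesgue) \<le> (SUP x. \<integral>\<^sup>+u\<in>{x..x + t}. m_bound j f u \<partial>lebesgue)"
      by (intro SUP_mono' nn_integral_mono) (use st in \<open>auto simp: indicator_def\<close>)
    show "(SUP x. \<integral>\<^sup>+u\<in>{x..x + t}. m_bound j f u \<partial>lebesgue) < top"
      using m_moduli_finite[OF f eq, of t j] st by simp
  qed
qed (simp add: m_moduli_def)

lemma m_bound_integral_le_m_moduli:
  assumes f: "f \<in> LC_fun p" and eq: "L1_loc_equicontinuous_m_bounds f" and st: "s \<le> t"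
  shows "(\<integral>\<^sup>+u\<in>{s..t}. m_bound j f (u + c) \<partial>lborel) \<le> ennreal (m_moduli f a b j (t - s))"
proof -
  have "(\<integral>\<^sup>+u\<in>{s..t}. m_bound j f (u + c) \<partial>lborel) = (\<integral>\<^sup>+u\<in>{s..t}. m_bound j (translate c f) u \<partial>lebesgue)"
    by (simp add: bound_translate nn_integral_completion)
  also have "\<dots> = (\<integral>\<^sup>+u\<in>{s + c..s + c + (t - s)}. m_bound j f u \<partial>lebesgue)"
    unfolding m_bound_integral_translate[OF f] by (simp add: algebra_simps)
  also have "\<dots> \<le> (SUP x. \<integral>\<^sup>+u\<in>{x..x + (t - s)}. m_bound j f u \<partial>lebesgue)" by (rule SUP_upper) simp
  also have "\<dots> = ennreal (m_moduli f a b j (t - s))"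
    unfolding m_moduli_def using m_moduli_finite[OF f eq, of "t - s" j] st by (intro ennreal_enn2real[symmetric]) auto
  finally show ?thesis .
qed

lemma zero_in_C1p:
  assumes p: "p > 0"
  shows "restrict (\<lambda>t. 0 :: real ^ 'n::finite) {-1..0} \<in> C1p p" "C1p_norm p (restrict (\<lambda>t. 0 :: real ^ 'n::finite) {-1..0}) = 0"
proof -
  let ?z = "restrict (\<lambda>t. 0 :: real ^ 'n) {-1..0}"
  have "primitive_on (-1) 0 (\<lambda>t. 0 :: real ^ 'n) (\<lambda>t. 0)"
    unfolding primitive_on_def by (simp add: set_integrable_def set_lebesgue_integral_def)
  then have "primitive_on (-1) 0 ?z (\<lambda>t. 0)" by (rule primitive_on_cong) simp
  then have z: "lp_primitive p ?z (\<lambda>t. 0)" using p by (simp add: lp_primitive_def pint_def power_0_left)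
  show "?z \<in> C1p p" by (rule lp_primitive_imp_C1p[OF _ z p]) simp
  show "C1p_norm p ?z = 0"
    using C1p_norm_leI[OF p z, of 0 0] C1p_norm_bounds(3)[OF p z] p by (simp add: pint_def power_0_left)
qed

section \<open>Increments of functions in a ball of \<open>C1p\<close>\<close>

context
  fixes p :: nat and N :: "'n::finite itself"
  assumes p: "p > 0"
begin

private definition increments :: "nat \<Rightarrow> real \<Rightarrow> real set" where
  "increments j h = {norm (\<phi> t - \<phi> s) | (\<phi> :: real \<Rightarrow> real ^ 'n) t s.
             \<phi> \<in> C1p p \<and> C1p_norm p \<phi> \<le> real j \<and>
             t \<in> {-1..0} \<and> s \<in> {-1..0} \<and> \<bar>t - s\<bar> < min h 1}"

private lemma bdd_increments: "bdd_above (increments j h)"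
proof (rule bdd_aboveI[of _ "2 * real j"])
  fix x assume "x \<in> increments j h"
  then obtain \<phi> :: "real \<Rightarrow> real ^ 'n" and t s where x: "x = norm (\<phi> t - \<phi> s)" "\<phi> \<in> C1p p" "C1p_norm p \<phi> \<le> real j"
    "t \<in> {-1..0}" "s \<in> {-1..0}" unfolding increments_def by blast
  obtain Y where Y: "lp_primitive p \<phi> Y" by (rule C1p_imp_lp_primitive[OF p x(2)])
  have "norm (\<phi> t) \<le> real j" "norm (\<phi> s) \<le> real j"
    using C1p_norm_bounds(1)[OF p Y, of t] C1p_norm_bounds(1)[OF p Y, of s] x by auto
  then show "x \<le> 2 * real j" using norm_triangle_ineq4[of "\<phi> t" "\<phi> s"] x(1) by linarith
qed

private lemma zero_in_increments: "h > 0 \<Longrightarrow> 0 \<in> increments j h"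
  unfolding increments_def
  by (rule CollectI, rule exI[of _ "restrict (\<lambda>t. 0) {-1..0}"], rule exI[of _ 0], rule exI[of _ 0])
    (simp add: zero_in_C1p[OF p])

private lemma C1p_modulus_eq: "C1p_modulus N p j h = (if h \<le> 0 then 0 else Sup (increments j h))"
  by (simp add: C1p_modulus_def increments_def)

lemma C1p_modulus_mono: "h \<le> h' \<Longrightarrow> C1p_modulus N p j h \<le> C1p_modulus N p j h'"
proof (cases "h \<le> 0")
  case True
  then show ?thesis
    using cSup_upper[OF zero_in_increments bdd_increments, of h' j] by (simp add: C1p_modulus_eq)
next
  case False
  assume hh: "h \<le> h'"
  have "Sup (increments j h) \<le> Sup (increments j h')"
  proof (rule cSup_subset_mono[OF _ bdd_increments])
    show "increments j h \<noteq> {}" using zero_in_increments[of h j] False by auto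
    show "increments j h \<subseteq> increments j h'" unfolding increments_def using hh by fastforce
  qed
  then show ?thesis using False hh by (simp add: C1p_modulus_eq)
qed

text \<open>The modulus at \<open>h\<close> is a supremum over pairs at distance strictly below
  \<open>min h 1\<close>, while the sets of curves need the estimate at distance exactly
  \<open>h\<close>. Continuity of \<phi> bridges the gap by approaching \<open>t\<close> from points
  closer to \<open>s\<close>.\<close>

lemma C1p_modulus_upper:
  fixes \<phi> :: "real \<Rightarrow> real ^ 'n"
  assumes \<phi>: "\<phi> \<in> C1p p" "C1p_norm p \<phi> \<le> real j" and t: "-1 \<le> t" "t \<le> 0" and s: "-1 \<le> s" "s \<le> 0"
  shows "norm (\<phi> t - \<phi> s) \<le> C1p_modulus N p j \<bar>t - s\<bar>"
proof (cases "t = s")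
  case True
  then show ?thesis by (simp add: C1p_modulus_eq)
next
  case False
  let ?h = "\<bar>t - s\<bar>"
  have h: "?h > 0" "?h \<le> 1" using False t s by auto
  \<comment> \<open>These points run along the segment from \<open>s\<close> to \<open>t\<close>;
    the factor is below 1 and tends to 1.\<close>
  define r where "r n = s + real n / real (Suc n) * (t - s)" for n
  have frac: "0 \<le> real n / real (Suc n)" "real n / real (Suc n) < 1" for n by (auto simp: field_simps)
  have rs: "\<bar>r n - s\<bar> < min ?h 1" for n
  proof -
    have "\<bar>r n - s\<bar> = real n / real (Suc n) * ?h" using frac(1)[of n] by (simp add: r_def abs_mult)
    also have "\<dots> < 1 * ?h" using frac(2)[of n] h by (intro mult_strict_right_mono) auto
    finally show ?thesis using h by simp
  qed
  have rI: "r n \<in> {-1..0}" for n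
  proof -
    have "s + c * (t - s) = (1 - c) * s + c * t" for c by (simp add: algebra_simps)
    from this[of "real n / real (Suc n)"]
    have "r n = (1 - real n / real (Suc n)) * s + real n / real (Suc n) * t" unfolding r_def .
    moreover have "(1 - real n / real (Suc n)) * s + real n / real (Suc n) * t \<in> {-1..0}"
      using convexD_alt[OF convex_real_interval(5)[of "-1" 0], of s t "real n / real (Suc n)"] frac(1)[of n] frac(2)[of n] s t
      by simp
    ultimately show ?thesis by simp
  qed
  have "(\<lambda>n. s + real n / real (Suc n) * (t - s)) \<longlonglongrightarrow> s + 1 * (t - s)"
    by (intro tendsto_intros LIMSEQ_n_over_Suc_n)
  then have rt: "r \<longlonglongrightarrow> t" by (simp add: r_def[abs_def])
  have "(\<lambda>n. \<phi> (r n)) \<longlonglongrightarrow> \<phi> t"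
    by (rule continuous_on_tendsto_compose[OF C1p_continuous[OF p \<phi>(1)] rt]) (use rI t in auto)
  then have "(\<lambda>n. norm (\<phi> (r n) - \<phi> s)) \<longlonglongrightarrow> norm (\<phi> t - \<phi> s)" by (intro tendsto_intros)
  then have "norm (\<phi> t - \<phi> s) \<le> Sup (increments j ?h)"
  proof (rule LIMSEQ_le_const2)
    have "norm (\<phi> (r n) - \<phi> s) \<in> increments j ?h" for n
      unfolding increments_def using rs[of n] rI[of n] \<phi> s by (intro CollectI exI[of _ \<phi>] exI[of _ "r n"] exI[of _ s]) auto
    then show "\<exists>N. \<forall>n\<ge>N. norm (\<phi> (r n) - \<phi> s) \<le> Sup (increments j ?h)"
      using cSup_upper[OF _ bdd_increments] by blast
  qed
  then show ?thesis using h by (simp add: C1p_modulus_eq)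
qed

end

lemma good_m_moduli_hat:
  fixes f :: "'n::finite delay_field"
  assumes p: "p > 0" and f: "f \<in> LC_fun p" and eq: "L1_loc_equicontinuous_m_bounds f"
  shows "good_moduli (m_moduli_hat p f)"
proof -
  note g = good_m_moduli[OF f eq]
  have 1: "0 \<le> m_moduli_hat p f a b j s" for a b j s
    using good_moduliD(1)[OF g, of a b j s] by (auto simp: m_moduli_hat_def)
  have 2: "m_moduli_hat p f a b j s \<le> m_moduli_hat p f a' b' j t" if "0 \<le> s" "s \<le> t" for a b a' b' j s t
    unfolding m_moduli_hat_def
    by (rule max.mono[OF good_moduliD(2)[OF g that] C1p_modulus_mono[OF p that(2)]])
  show ?thesis unfolding good_moduli_def using 1 2 by blast
qed

section \<open>Extension of estimates by density and by Fatou's lemma\<close>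

lemma dense_le_open:
  fixes F G :: "'i::metric_space \<Rightarrow> real"
  assumes S: "open S" and E: "closure E = UNIV" and F: "continuous_on UNIV F" and G: "continuous_on UNIV G"
    and le: "\<And>i. i \<in> E \<Longrightarrow> i \<in> S \<Longrightarrow> F i \<le> G i" and i: "i \<in> closure S"
  shows "F i \<le> G i"
proof -
  have "S \<subseteq> closure (S \<inter> E)" using open_Int_closure_subset[OF S, of E] E by simp
  then have "closure S \<subseteq> closure (S \<inter> E)" by (rule closure_minimal) simp
  moreover have "closed {i. F i \<le> G i}" by (rule closed_Collect_le[OF F G])
  then have "closure (S \<inter> E) \<subseteq> {i. F i \<le> G i}" by (rule closure_minimal[rotated]) (use le in auto)
  ultimately show ?thesis using i by blast
qed

text \<open>For almost every \<open>t\<close>, \<open>q i (g t)\<close> is the limit of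
  \<open>q i (f (t + \<tau> k))\<close>, which is at most \<open>B (t + \<tau> k)\<close>. So
  \<Lambda> is the lower limit of these translates of \<open>B\<close>, and Fatou's lemma bounds its
  integral by the common bound \<open>C\<close> of all translates. Only countably many translates
  occur, so their null sets can be united.\<close>

lemma hull_fatou:
  fixes q :: "'i \<Rightarrow> ((real ^ 'n) \<times> (real ^ 'n) \<Rightarrow> real ^ 'n) \<Rightarrow> real"
    and f g :: "'n::finite delay_field" and \<tau> :: "nat \<Rightarrow> real" and B :: "real \<Rightarrow> ennreal" and a b :: real
  assumes lim: "AE t in lborel. \<forall>z\<in>Z. (\<lambda>k. f (t + \<tau> k) z) \<longlonglongrightarrow> g t z"
    and q: "\<And>i h h'. i \<in> A \<Longrightarrow> (\<forall>z\<in>Z. (\<lambda>k. h k z) \<longlonglongrightarrow> h' z) \<Longrightarrow> (\<lambda>k. q i (h k)) \<longlonglongrightarrow> q i h'"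
    and B [measurable]: "B \<in> borel_measurable borel" and Bq: "AE t in lborel. \<forall>i\<in>A. ennreal (q i (f t)) \<le> B t"
    and int: "\<And>c. (\<integral>\<^sup>+u\<in>{a..b}. B (u + c) \<partial>lborel) \<le> C"
  obtains \<Lambda> where "\<Lambda> \<in> borel_measurable borel" "(\<integral>\<^sup>+u\<in>{a..b}. \<Lambda> u \<partial>lborel) \<le> C"
    "AE t in lborel. \<forall>i\<in>A. ennreal (q i (g t)) \<le> \<Lambda> t"
proof
  let ?L = "\<lambda>t. liminf (\<lambda>k. B (t + \<tau> k))"
  have Bk [measurable]: "(\<lambda>t. B (t + \<tau> k)) \<in> borel_measurable borel" for k
    by (rule measurable_compose[OF _ B]) measurable
  show "?L \<in> borel_measurable borel" by measurable
  have "(\<integral>\<^sup>+u\<in>{a..b}. ?L u \<partial>lborel) = (\<integral>\<^sup>+u. liminf (\<lambda>k. B (u + \<tau> k) * indicator {a..b} u) \<partial>lborel)"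
    by (intro nn_integral_cong) (auto simp: indicator_def Liminf_const)
  also have "\<dots> \<le> liminf (\<lambda>k. \<integral>\<^sup>+u\<in>{a..b}. B (u + \<tau> k) \<partial>lborel)"
    by (rule nn_integral_liminf) measurable
  also have "\<dots> \<le> C" by (rule Liminf_le) (auto intro: int always_eventually)
  finally show "(\<integral>\<^sup>+u\<in>{a..b}. ?L u \<partial>lborel) \<le> C" .
  have "AE t in lborel. \<forall>k. \<forall>i\<in>A. ennreal (q i (f (t + \<tau> k))) \<le> B (t + \<tau> k)"
    unfolding AE_all_countable using AE_lborel_shift[OF Bq] by simp
  with lim show "AE t in lborel. \<forall>i\<in>A. ennreal (q i (g t)) \<le> ?L t"
  proof eventually_elim
    case (elim t)
    show ?case
    proof
      fix i assume i: "i \<in> A"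
      have "(\<lambda>k. ennreal (q i (f (t + \<tau> k)))) \<longlonglongrightarrow> ennreal (q i (g t))"
        by (intro tendsto_ennrealI q[OF i] elim(1))
      then have "ennreal (q i (g t)) = liminf (\<lambda>k. ennreal (q i (f (t + \<tau> k))))"
        by (intro lim_imp_Liminf[symmetric]) auto
      also have "\<dots> \<le> ?L t" using elim(2) i by (intro Liminf_mono always_eventually) auto
      finally show "ennreal (q i (g t)) \<le> ?L t" .
    qed
  qed
qed

section \<open>The three families of curves\<close>

lemma const_in_K_set: "good_moduli \<theta> \<Longrightarrow> norm z \<le> real j \<Longrightarrow> (\<lambda>t. z) \<in> K_set \<theta> a b j"
  by (auto simp: K_set_def good_moduliD(1))

lemma K_setD:
  assumes "x \<in> K_set \<theta> a b j"
  shows "continuous_on {a..b} x" "a \<le> t \<Longrightarrow> t \<le> b \<Longrightarrow> norm (x t) \<le> real j"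
    "a \<le> t \<Longrightarrow> t \<le> b \<Longrightarrow> a \<le> s \<Longrightarrow> s \<le> b \<Longrightarrow> norm (x t - x s) \<le> \<theta> a b j \<bar>t - s\<bar>"
  using assms by (auto simp: K_set_def image_subset_iff)

text \<open>A translated curve is extended to a larger interval by its end values. The clamp is
  1-Lipschitz, so increments obey the same moduli by their monotonicity.\<close>

lemma K_set_clamp:
  assumes \<theta>: "good_moduli \<theta>" and x: "x \<in> K_set \<theta> a b j" and ab: "a \<le> b"
  shows "(\<lambda>s. x (max a (min b (s - t)))) \<in> K_set \<theta> a' b' j"
proof -
  let ?c = "\<lambda>s. max a (min b (s - t))"
  have I: "a \<le> ?c s" "?c s \<le> b" for s using ab by auto
  have cl: "norm (x (?c s) - x (?c r)) \<le> \<theta> a' b' j \<bar>s - r\<bar>" for s r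
  proof -
    have "norm (x (?c s) - x (?c r)) \<le> \<theta> a b j \<bar>?c s - ?c r\<bar>" by (rule K_setD(3)[OF x I I])
    also have "\<bar>?c s - ?c r\<bar> \<le> \<bar>s - r\<bar>" by linarith
    then have "\<theta> a b j \<bar>?c s - ?c r\<bar> \<le> \<theta> a' b' j \<bar>s - r\<bar>" by (intro good_moduliD(2)[OF \<theta>]) simp
    finally show ?thesis .
  qed
  have "continuous_on {a'..b'} (\<lambda>s. x (?c s))"
    by (rule continuous_on_compose2[OF K_setD(1)[OF x]]) (intro continuous_intros, use I in auto)
  moreover have "(\<lambda>s. x (?c s)) ` {a'..b'} \<subseteq> cball 0 (real j)" using K_setD(2)[OF x I] by auto
  ultimately show ?thesis unfolding K_set_def using cl by blast
qed

lemma norm_Pair_le: "norm x \<le> c \<Longrightarrow> norm y \<le> d \<Longrightarrow> norm (x, y) \<le> c + d"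
  using norm_Pair_le[of x y] by linarith

lemma rational_bounds:
  obtains b :: real where "b \<in> \<rat>" "-b \<in> \<rat>" "c \<le> b" "0 \<le> b"
proof
  show "real (nat \<lceil>c\<rceil>) \<in> \<rat>" "- real (nat \<lceil>c\<rceil>) \<in> \<rat>" "c \<le> real (nat \<lceil>c\<rceil>)" "0 \<le> real (nat \<lceil>c\<rceil>)"
    by (simp_all add: real_nat_ceiling_ge)
qed

definition moving_curves :: "moduli \<Rightarrow> moduli \<Rightarrow> real \<Rightarrow> real \<Rightarrow> nat \<Rightarrow> (real \<Rightarrow> (real ^ 'n::finite) \<times> (real ^ 'n)) set" where
  "moving_curves \<theta> \<theta>' a b j = (\<lambda>(x, u) t. (x t, u (t - 1))) ` (K_set \<theta> a b j \<times> K_set \<theta>' (a - 1) (b - 1) j)"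

definition half_moving_curves :: "moduli \<Rightarrow> real \<Rightarrow> real \<Rightarrow> nat \<Rightarrow> real ^ 'n::finite \<Rightarrow> (real \<Rightarrow> (real ^ 'n) \<times> (real ^ 'n)) set" where
  "half_moving_curves \<theta> a b j u = (\<lambda>x t. (x t, u)) ` K_set \<theta> a b j"

definition moving_family where
  "moving_family \<theta> \<theta>' = {(a, b, moving_curves \<theta> \<theta>' a b j) | a b j. a \<in> \<rat> \<and> b \<in> \<rat> \<and> a \<le> b}"

definition half_moving_family where
  "half_moving_family \<theta> D' = {(a, b, half_moving_curves \<theta> a b j u) | a b j u. a \<in> \<rat> \<and> b \<in> \<rat> \<and> a \<le> b \<and> u \<in> D'}"

definition constant_family :: "((real ^ 'n::finite) \<times> (real ^ 'n)) set \<Rightarrow> (real \<times> real \<times> (real \<Rightarrow> (real ^ 'n) \<times> (real ^ 'n)) set) set" where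
  "constant_family D = {(a, b, {\<lambda>t. z}) | a b z. a \<in> \<rat> \<and> b \<in> \<rat> \<and> a \<le> b \<and> z \<in> D}"

lemma moving_curvesE:
  assumes "w \<in> moving_curves \<theta> \<theta>' a b j"
  obtains x u where "w = (\<lambda>t. (x t, u (t - 1)))" "x \<in> K_set \<theta> a b j" "u \<in> K_set \<theta>' (a - 1) (b - 1) j"
proof -
  obtain q where "q \<in> K_set \<theta> a b j \<times> K_set \<theta>' (a - 1) (b - 1) j" "w = (\<lambda>(x, u) t. (x t, u (t - 1))) q"
    using assms unfolding moving_curves_def by (rule imageE)
  then show thesis by (intro that[of "fst q" "snd q"]) (simp_all add: split_def mem_Times_iff)
qed

lemma half_moving_curvesE:
  assumes "w \<in> half_moving_curves \<theta> a b j u"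
  obtains x where "w = (\<lambda>t. (x t, u))" "x \<in> K_set \<theta> a b j"
  using assms unfolding half_moving_curves_def by (rule imageE) (rule that)

lemma curve_family_moving:
  assumes p: "p > 1" and \<theta>: "good_moduli \<theta>" and \<theta>': "good_moduli \<theta>'"
  shows "curve_family p (moving_family \<theta> \<theta>' :: (real \<times> real \<times> (real \<Rightarrow> (real ^ 'n::finite) \<times> (real ^ 'n)) set) set)"
proof (rule curve_family.intro[OF p])
  show "(moving_family \<theta> \<theta>' :: (real \<times> real \<times> (real \<Rightarrow> (real ^ 'n) \<times> (real ^ 'n)) set) set) \<noteq> {}"
    unfolding moving_family_def using Rats_0 by blast
next
  fix a b :: real and W :: "(real \<Rightarrow> (real ^ 'n) \<times> (real ^ 'n)) set"
  assume "(a, b, W) \<in> moving_family \<theta> \<theta>'"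
  then obtain j where W: "W = moving_curves \<theta> \<theta>' a b j" unfolding moving_family_def by blast
  have "(\<lambda>t. 0 :: real ^ 'n) \<in> K_set \<theta> a b j" "(\<lambda>t. 0 :: real ^ 'n) \<in> K_set \<theta>' (a - 1) (b - 1) j"
    by (intro const_in_K_set \<theta> \<theta>', simp)+
  then have "W \<noteq> {}" unfolding W moving_curves_def by blast
  moreover have "set_borel_measurable borel {a..b} w \<and> (\<forall>t. a \<le> t \<longrightarrow> t \<le> b \<longrightarrow> norm (w t) \<le> real j + real j)"
    if "w \<in> W" for w
  proof -
    obtain x u where w: "w = (\<lambda>t. (x t, u (t - 1)))" "x \<in> K_set \<theta> a b j" "u \<in> K_set \<theta>' (a - 1) (b - 1) j"
      using \<open>w \<in> W\<close> unfolding W by (rule moving_curvesE)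
    have "continuous_on {a..b} (\<lambda>t. u (t - 1))"
      by (rule continuous_on_compose2[OF K_setD(1)[OF w(3)]]) (intro continuous_intros, auto)
    then have "continuous_on {a..b} w" unfolding w(1) by (intro continuous_on_Pair K_setD(1)[OF w(2)])
    then show ?thesis
      unfolding w(1) by (intro conjI allI impI norm_Pair_le set_borel_measurable_continuous K_setD(2)[OF w(2)] K_setD(2)[OF w(3)]) auto
  qed
  ultimately show "W \<noteq> {} \<and> (\<exists>r. \<forall>w\<in>W. set_borel_measurable borel {a..b} w \<and>
        (\<forall>t. a \<le> t \<longrightarrow> t \<le> b \<longrightarrow> norm (w t) \<le> r))" by blast
next
  fix a b R :: real and W :: "(real \<Rightarrow> (real ^ 'n) \<times> (real ^ 'n)) set"
  assume "(a, b, W) \<in> moving_family \<theta> \<theta>'"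
  then obtain j where W: "W = moving_curves \<theta> \<theta>' a b j" and ab: "a \<le> b" unfolding moving_family_def by blast
  \<comment> \<open>The interval \<open>[-B, B]\<close> contains every translate of
    \<open>[a, b]\<close> by at most \<open>R\<close>, and its end points are rational as the index
    set demands.\<close>
  obtain B where B: "B \<in> \<rat>" "-B \<in> \<rat>" "\<bar>a\<bar> + \<bar>b\<bar> + R \<le> B" "0 \<le> B" by (rule rational_bounds)
  have "\<exists>w'\<in>moving_curves \<theta> \<theta>' (-B) B j. \<forall>s. a \<le> s \<longrightarrow> s \<le> b \<longrightarrow> w' (s + t) = w s" if "w \<in> W" for w t
  proof -
    obtain x u where w: "w = (\<lambda>t. (x t, u (t - 1)))" "x \<in> K_set \<theta> a b j" "u \<in> K_set \<theta>' (a - 1) (b - 1) j"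
      using \<open>w \<in> W\<close> unfolding W by (rule moving_curvesE)
    let ?x = "\<lambda>s. x (max a (min b (s - t)))" and ?u = "\<lambda>s. u (max (a - 1) (min (b - 1) (s - t)))"
    have "(?x, ?u) \<in> K_set \<theta> (-B) B j \<times> K_set \<theta>' (-B - 1) (B - 1) j"
      using K_set_clamp[OF \<theta> w(2) ab] K_set_clamp[OF \<theta>' w(3)] ab by simp
    then have "(\<lambda>s. (?x s, ?u (s - 1))) \<in> moving_curves \<theta> \<theta>' (-B) B j"
      unfolding moving_curves_def by (rule rev_image_eqI) simp
    then show ?thesis by (rule bexI[rotated]) (auto simp: w(1) max_def min_def algebra_simps)
  qed
  moreover have "-B \<le> a + t \<and> b + t \<le> B" if "\<bar>t\<bar> \<le> R" for t using that B(3) by linarith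
  moreover have "(-B, B, moving_curves \<theta> \<theta>' (-B) B j) \<in> moving_family \<theta> \<theta>'"
    unfolding moving_family_def using B by force
  ultimately show "\<exists>a' b' W'. (a', b', W') \<in> moving_family \<theta> \<theta>' \<and> (\<forall>t. \<bar>t\<bar> \<le> R \<longrightarrow>
        a' \<le> a + t \<and> b + t \<le> b' \<and> (\<forall>w\<in>W. \<exists>w'\<in>W'. \<forall>s. a \<le> s \<longrightarrow> s \<le> b \<longrightarrow> w' (s + t) = w s))"
    by (intro exI[of _ "-B"] exI[of _ B] exI[of _ "moving_curves \<theta> \<theta>' (-B) B j"] conjI allI impI ballI) auto
qed

lemma curve_family_half_moving:
  fixes D' :: "(real ^ 'n::finite) set"
  assumes p: "p > 1" and \<theta>: "good_moduli \<theta>" and D': "D' \<noteq> {}"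
  shows "curve_family p (half_moving_family \<theta> D')"
proof (rule curve_family.intro[OF p])
  show "half_moving_family \<theta> D' \<noteq> {}" unfolding half_moving_family_def using Rats_0 D' by blast
next
  fix a b :: real and W :: "(real \<Rightarrow> (real ^ 'n) \<times> (real ^ 'n)) set"
  assume "(a, b, W) \<in> half_moving_family \<theta> D'"
  then obtain j u where W: "W = half_moving_curves \<theta> a b j u" unfolding half_moving_family_def by blast
  have "(\<lambda>t. 0 :: real ^ 'n) \<in> K_set \<theta> a b j" by (rule const_in_K_set[OF \<theta>]) simp
  then have "W \<noteq> {}" unfolding W half_moving_curves_def by blast
  moreover have "set_borel_measurable borel {a..b} w \<and> (\<forall>t. a \<le> t \<longrightarrow> t \<le> b \<longrightarrow> norm (w t) \<le> real j + norm u)"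
    if "w \<in> W" for w
  proof -
    obtain x where w: "w = (\<lambda>t. (x t, u))" "x \<in> K_set \<theta> a b j" using \<open>w \<in> W\<close> unfolding W by (rule half_moving_curvesE)
    have "continuous_on {a..b} w" unfolding w(1) by (intro continuous_on_Pair K_setD(1)[OF w(2)] continuous_on_const)
    then show ?thesis
      using K_setD(2)[OF w(2)] by (auto simp: w(1) intro!: norm_Pair_le set_borel_measurable_continuous)
  qed
  ultimately show "W \<noteq> {} \<and> (\<exists>r. \<forall>w\<in>W. set_borel_measurable borel {a..b} w \<and>
        (\<forall>t. a \<le> t \<longrightarrow> t \<le> b \<longrightarrow> norm (w t) \<le> r))" by blast
next
  fix a b R :: real and W :: "(real \<Rightarrow> (real ^ 'n) \<times> (real ^ 'n)) set"
  assume "(a, b, W) \<in> half_moving_family \<theta> D'"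
  then obtain j u where W: "W = half_moving_curves \<theta> a b j u" and ab: "a \<le> b" and u: "u \<in> D'"
    unfolding half_moving_family_def by blast
  obtain B where B: "B \<in> \<rat>" "-B \<in> \<rat>" "\<bar>a\<bar> + \<bar>b\<bar> + R \<le> B" "0 \<le> B" by (rule rational_bounds)
  have "\<exists>w'\<in>half_moving_curves \<theta> (-B) B j u. \<forall>s. a \<le> s \<longrightarrow> s \<le> b \<longrightarrow> w' (s + t) = w s" if "w \<in> W" for w t
  proof -
    obtain x where w: "w = (\<lambda>t. (x t, u))" "x \<in> K_set \<theta> a b j" using \<open>w \<in> W\<close> unfolding W by (rule half_moving_curvesE)
    let ?x = "\<lambda>s. x (max a (min b (s - t)))"
    have "(\<lambda>s. (?x s, u)) \<in> half_moving_curves \<theta> (-B) B j u"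
      unfolding half_moving_curves_def by (rule rev_image_eqI[OF K_set_clamp[OF \<theta> w(2) ab]]) simp
    then show ?thesis by (rule bexI[rotated]) (auto simp: w(1) max_def min_def)
  qed
  moreover have "-B \<le> a + t \<and> b + t \<le> B" if "\<bar>t\<bar> \<le> R" for t using that B(3) by linarith
  moreover have "(-B, B, half_moving_curves \<theta> (-B) B j u) \<in> half_moving_family \<theta> D'"
    unfolding half_moving_family_def using B u by force
  ultimately show "\<exists>a' b' W'. (a', b', W') \<in> half_moving_family \<theta> D' \<and> (\<forall>t. \<bar>t\<bar> \<le> R \<longrightarrow>
        a' \<le> a + t \<and> b + t \<le> b' \<and> (\<forall>w\<in>W. \<exists>w'\<in>W'. \<forall>s. a \<le> s \<longrightarrow> s \<le> b \<longrightarrow> w' (s + t) = w s))"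
    by (intro exI[of _ "-B"] exI[of _ B] exI[of _ "half_moving_curves \<theta> (-B) B j u"] conjI allI impI ballI) auto
qed

lemma curve_family_constant:
  fixes D :: "((real ^ 'n::finite) \<times> (real ^ 'n)) set"
  assumes p: "p > 1" and D: "D \<noteq> {}"
  shows "curve_family p (constant_family D)"
proof (rule curve_family.intro[OF p])
  show "constant_family D \<noteq> {}" unfolding constant_family_def using Rats_0 D by blast
next
  fix a b :: real and W :: "(real \<Rightarrow> (real ^ 'n) \<times> (real ^ 'n)) set"
  assume "(a, b, W) \<in> constant_family D"
  then obtain z where "W = {\<lambda>t. z}" unfolding constant_family_def by blast
  then show "W \<noteq> {} \<and> (\<exists>r. \<forall>w\<in>W. set_borel_measurable borel {a..b} w \<and>
        (\<forall>t. a \<le> t \<longrightarrow> t \<le> b \<longrightarrow> norm (w t) \<le> r))"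
    by (auto intro!: set_borel_measurable_continuous)
next
  fix a b R :: real and W :: "(real \<Rightarrow> (real ^ 'n) \<times> (real ^ 'n)) set"
  assume "(a, b, W) \<in> constant_family D"
  then obtain z where W: "W = {\<lambda>t. z}" and z: "z \<in> D" unfolding constant_family_def by blast
  obtain B where B: "B \<in> \<rat>" "-B \<in> \<rat>" "\<bar>a\<bar> + \<bar>b\<bar> + R \<le> B" "0 \<le> B" by (rule rational_bounds)
  have "-B \<le> a + t \<and> b + t \<le> B" if "\<bar>t\<bar> \<le> R" for t using that B(3) by linarith
  moreover have "(-B, B, W) \<in> constant_family D" unfolding constant_family_def W using B z by force
  ultimately show "\<exists>a' b' W'. (a', b', W') \<in> constant_family D \<and> (\<forall>t. \<bar>t\<bar> \<le> R \<longrightarrow>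
        a' \<le> a + t \<and> b + t \<le> b' \<and> (\<forall>w\<in>W. \<exists>w'\<in>W'. \<forall>s. a \<le> s \<longrightarrow> s \<le> b \<longrightarrow> w' (s + t) = w s))"
    by (intro exI[of _ "-B"] exI[of _ B] exI[of _ W] conjI allI impI ballI) (auto simp: W)
qed

lemma curve_topology_moving:
  assumes p: "p > 1" and \<theta>: "good_moduli \<theta>" and \<theta>': "good_moduli \<theta>'"
  shows "curve_family.curve_topology p (moving_family \<theta> \<theta>') = T_Theta_Theta p \<theta> \<theta>'"
proof -
  have S: "curve_seminorm p a b (moving_curves \<theta> \<theta>' a b j) =
      (\<lambda>g. SUP (x, u) \<in> K_set \<theta> a b j \<times> K_set \<theta>' (a - 1) (b - 1) j.
            root p (LINT t:{a..b}|lborel. norm (g t (x t, u (t - 1))) ^ p))" for a b j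
    by (simp add: fun_eq_iff curve_seminorm_def moving_curves_def image_image split_def)
  show ?thesis
    unfolding curve_family.curve_topology_def[OF curve_family_moving[OF assms]]
    unfolding T_Theta_Theta_def moving_family_def S[symmetric]
    by (rule arg_cong[where f = "LC_seminorm_topology p"]) blast
qed

lemma curve_topology_half_moving:
  assumes p: "p > 1" and \<theta>: "good_moduli \<theta>" and D': "D' \<noteq> {}"
  shows "curve_family.curve_topology p (half_moving_family \<theta> D') = T_Theta_D p \<theta> D'"
proof -
  have S: "curve_seminorm p a b (half_moving_curves \<theta> a b j u) =
      (\<lambda>g. SUP x \<in> K_set \<theta> a b j. root p (LINT t:{a..b}|lborel. norm (g t (x t, u)) ^ p))" for a b j u
    by (simp add: fun_eq_iff curve_seminorm_def half_moving_curves_def image_image)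
  show ?thesis
    unfolding curve_family.curve_topology_def[OF curve_family_half_moving[OF assms]]
    unfolding T_Theta_D_def half_moving_family_def S[symmetric]
    by (rule arg_cong[where f = "LC_seminorm_topology p"]) blast
qed

lemma curve_topology_constant:
  assumes p: "p > 1" and D: "D \<noteq> {}"
  shows "curve_family.curve_topology p (constant_family D) = T_D p D"
proof -
  have S: "curve_seminorm p a b {\<lambda>t. z} = (\<lambda>g. root p (LINT t:{a..b}|lborel. norm (g t z) ^ p))" for a b z
    by (simp add: fun_eq_iff curve_seminorm_def)
  show ?thesis
    unfolding curve_family.curve_topology_def[OF curve_family_constant[OF assms]]
    unfolding T_D_def constant_family_def S[symmetric]
    by (rule arg_cong[where f = "LC_seminorm_topology p"]) blast
qed

section \<open>Bounds inherited by the hull\<close>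

lemma dense_ennreal_le:
  fixes F :: "'i::metric_space \<Rightarrow> real"
  assumes S: "open S" and E: "closure E = UNIV" and F: "continuous_on UNIV F"
    and le: "\<And>i. i \<in> E \<Longrightarrow> i \<in> S \<Longrightarrow> ennreal (F i) \<le> L" and i: "i \<in> closure S"
  shows "ennreal (F i) \<le> L"
proof (cases L)
  case (real r)
  have "F i \<le> r"
    by (rule dense_le_open[OF S E F continuous_on_const _ i]) (use le real in \<open>simp add: ennreal_le_iff\<close>)
  then show ?thesis using real by (simp add: ennreal_leI)
qed simp

text \<open>The cover uses balls centred in the dense set \<open>E\<close>, so the net consists of
  points at which the seminorms evaluate fields.\<close>

lemma finite_net:
  fixes E :: "'a::euclidean_space set"
  assumes "closure E = UNIV" "\<epsilon> > 0"
  obtains F where "finite F" "F \<subseteq> E" "\<And>z. norm z \<le> r \<Longrightarrow> \<exists>y\<in>F. norm (z - y) < \<epsilon>"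
proof -
  have "cball 0 r \<subseteq> (\<Union>y\<in>E. ball y \<epsilon>)"
  proof
    fix z :: 'a
    obtain y where "y \<in> E" "dist y z < \<epsilon>" using assms closure_approachable[of z E] by auto
    then show "z \<in> (\<Union>y\<in>E. ball y \<epsilon>)" by auto
  qed
  then obtain F where F: "F \<subseteq> E" "finite F" "cball 0 r \<subseteq> (\<Union>y\<in>F. ball y \<epsilon>)"
    using compactE_image[OF compact_cball, of E "\<lambda>y. ball y \<epsilon>" 0 r] open_ball by metis
  show thesis
  proof
    fix z :: 'a assume "norm z \<le> r"
    then have "z \<in> cball 0 r" by simp
    then have "z \<in> (\<Union>y\<in>F. ball y \<epsilon>)" by (rule subsetD[OF F(3)])
    then show "\<exists>y\<in>F. norm (z - y) < \<epsilon>" by (auto simp: dist_norm norm_minus_commute)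
  qed (fact F)+
qed

lemma small_root:
  assumes p: "p > 0" and e: "e > 0" and M: "M > (0::real)"
  obtains c where "c > 0" "M * c ^ p = e"
proof
  show "root p (e / M) > 0" using assms by simp
  show "M * root p (e / M) ^ p = e" using assms by simp
qed

lemma set_borel_measurable_real:
  "(l :: real \<Rightarrow> real) \<in> borel_measurable borel \<Longrightarrow> set_borel_measurable borel {a..b::real} l"
  unfolding set_borel_measurable_def by measurable

lemma pint_point: "pint p a a u = 0"
proof -
  have "pint p a a u = (\<integral>\<^sup>+s. 0 \<partial>(lborel :: real measure))"
    unfolding pint_def using AE_lborel_singleton[of a] by (intro nn_integral_cong_AE, eventually_elim) auto
  then show ?thesis by simp
qed

context curve_family
begin

text \<open>The limit along translates is known only at the points of \<open>Z\<close>. For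
  \<open>j > 0\<close> those in the open ball are dense in the closed ball, and continuity in space
  does the rest; for \<open>j = 0\<close> the ball is the single point 0, which \<open>Z\<close> may
  miss.\<close>

lemma hull_m_bound:
  assumes f: "f \<in> LC_fun p" and eq: "L1_loc_equicontinuous_m_bounds f" and G: "G \<in> LC_hull p curve_topology f"
    and Z: "countable Z" "closure Z = UNIV"
    and const_curves: "\<And>z k. z \<in> Z \<Longrightarrow> \<exists>a b W. a \<le> - real k \<and> real k \<le> b \<and> (a, b, W) \<in> \<W> \<and>
        (\<exists>w\<in>W. \<forall>t. a \<le> t \<longrightarrow> t \<le> b \<longrightarrow> w t = z)"
    and st: "s \<le> t" and j: "j > 0"
  shows "(\<integral>\<^sup>+u\<in>{s..t}. m_bound j (LC_rep G) u \<partial>lborel) \<le> ennreal (m_moduli f a b j (t - s))"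
proof -
  let ?g = "LC_rep G"
  have g: "?g \<in> LC_fun p" using G LC_hull_subset by (intro LC_rep_LC_fun) auto
  obtain \<tau> :: "nat \<Rightarrow> real" where \<tau>: "AE t in lborel. \<forall>z\<in>Z. (\<lambda>k. f (t + \<tau> k) z) \<longlonglongrightarrow> ?g t z"
    by (rule hull_AE_limit[OF f G Z(1) const_curves])
  obtain B where B: "B \<in> borel_measurable borel" "AE t in lborel. m_bound j f t = B t" by (rule m_bound_AE_borel[OF f])
  have Bf: "AE t in lborel. \<forall>z\<in>Z \<inter> ball 0 (real j). ennreal (norm (f t z)) \<le> B t"
    using B(2)
  proof eventually_elim
    case (elim t)
    show ?case unfolding elim[symmetric] by (intro ballI norm_le_m_bound) simp
  qed
  have int: "(\<integral>\<^sup>+u\<in>{s..t}. B (u + c) \<partial>lborel) \<le> ennreal (m_moduli f a b j (t - s))" for c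
  proof -
    have "(\<integral>\<^sup>+u\<in>{s..t}. B (u + c) \<partial>lborel) = (\<integral>\<^sup>+u\<in>{s..t}. m_bound j f (u + c) \<partial>lborel)"
      by (intro nn_integral_cong_AE) (use AE_lborel_shift[OF B(2), of c] in eventually_elim, simp)
    also have "\<dots> \<le> ennreal (m_moduli f a b j (t - s))" by (rule m_bound_integral_le_m_moduli[OF f eq st])
    finally show ?thesis .
  qed
  obtain \<Lambda> where \<Lambda>: "(\<integral>\<^sup>+u\<in>{s..t}. \<Lambda> u \<partial>lborel) \<le> ennreal (m_moduli f a b j (t - s))"
    "AE t in lborel. \<forall>z\<in>Z \<inter> ball 0 (real j). ennreal (norm (?g t z)) \<le> \<Lambda> t"
  proof (rule hull_fatou[OF \<tau> _ B(1) Bf int])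
    fix i and h :: "nat \<Rightarrow> (real ^ 'n) \<times> (real ^ 'n) \<Rightarrow> real ^ 'n" and h' assume "i \<in> Z \<inter> ball 0 (real j)" "\<forall>z\<in>Z. (\<lambda>k. h k z) \<longlonglongrightarrow> h' z"
    then show "(\<lambda>k. norm (h k i)) \<longlonglongrightarrow> norm (h' i)" by (intro tendsto_norm) simp
  qed
  have "AE t in lborel. m_bound j ?g t \<le> \<Lambda> t"
    using LC_fun_AE_continuous[OF g] \<Lambda>(2)
  proof eventually_elim
    case (elim t)
    show ?case
      unfolding m_bound_def
    proof (rule SUP_least)
      fix z :: "(real ^ 'n) \<times> (real ^ 'n)" assume "z \<in> cball 0 (real j)"
      then have "z \<in> closure (ball 0 (real j))" using j by (simp add: closure_ball)
      then show "ennreal (norm (?g t z)) \<le> \<Lambda> t"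
        by (rule dense_ennreal_le[OF open_ball Z(2) continuous_on_norm[OF elim(1)], rotated])
          (rule elim(2)[rule_format, OF IntI])
    qed
  qed
  then have "(\<integral>\<^sup>+u\<in>{s..t}. m_bound j ?g u \<partial>lborel) \<le> (\<integral>\<^sup>+u\<in>{s..t}. \<Lambda> u \<partial>lborel)"
    by (intro nn_integral_mono_AE) (elim eventually_mono, auto intro: mult_right_mono)
  with \<Lambda>(1) show ?thesis by (rule order_trans[rotated])
qed

lemma admissible_modulus:
  assumes f: "f \<in> LC_fun p" and eq: "L1_loc_equicontinuous_m_bounds f" and G: "G \<in> LC_hull p curve_topology f"
    and Z: "countable Z" "closure Z = UNIV"
    and const_curves: "\<And>z k. z \<in> Z \<Longrightarrow> \<exists>a b W. a \<le> - real k \<and> real k \<le> b \<and> (a, b, W) \<in> \<W> \<and>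
        (\<exists>w\<in>W. \<forall>t. a \<le> t \<longrightarrow> t \<le> b \<longrightarrow> w t = z)"
    and adm: "admissible p j (LC_rep G) n w \<phi>" and s: "0 \<le> s" "s \<le> n" and t: "0 \<le> t" "t \<le> n"
  shows "norm (w t - w s) \<le> m_moduli f a b j \<bar>t - s\<bar>"
\<comment> \<open>For \<open>j = 0\<close> the curve vanishes identically, and the bound for the
  hull is needed only for positive \<open>j\<close>.\<close>
proof (cases "j = 0")
  case True
  have "norm (w t) \<le> 0" "norm (w s) \<le> 0" using adm s t True by (auto simp: admissible_def)
  then show ?thesis using good_moduliD(1)[OF good_m_moduli[OF f eq]] by simp
next
  case False
  have le: "norm (w v - w u) \<le> m_moduli f a b j (v - u)" if uv: "0 \<le> u" "u \<le> v" "v \<le> n" for u v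
  proof -
    have "ennreal (norm (w v - w u)) \<le> (\<integral>\<^sup>+x\<in>{u..v}. m_bound j (LC_rep G) x \<partial>lborel)"
      using adm uv unfolding admissible_def by (elim conjE) simp
    also have "\<dots> \<le> ennreal (m_moduli f a b j (v - u))"
      by (rule hull_m_bound[OF f eq G Z const_curves uv(2)]) (use False in simp_all)
    finally show ?thesis using good_moduliD(1)[OF good_m_moduli[OF f eq]] by (simp add: ennreal_le_iff)
  qed
  show ?thesis
  proof (cases "s \<le> t")
    case True
    then show ?thesis using le[OF s(1) True t(2)] by simp
  next
    case False
    then show ?thesis using le[OF t(1) _ s(2)] by (simp add: norm_minus_commute)
  qed
qed

text \<open>Outside a null set the limit field inherits from \<open>f\<close> the Lipschitz estimate between points of a
  countable dense set; continuity in space extends it.\<close>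

lemma hull_lipschitz:
  fixes A R :: "((real ^ 'n) \<times> (real ^ 'n)) rel"
  assumes f: "f \<in> LC_fun p" and G: "G \<in> LC_hull p curve_topology f" and Z: "countable Z" and A: "A \<subseteq> Z \<times> Z"
    and const_curves: "\<And>z k. z \<in> Z \<Longrightarrow> \<exists>a b W. a \<le> - real k \<and> real k \<le> b \<and> (a, b, W) \<in> \<W> \<and>
        (\<exists>w\<in>W. \<forall>t. a \<le> t \<longrightarrow> t \<le> b \<longrightarrow> w t = z)"
    and B: "B \<in> borel_measurable borel"
    and Bf: "AE t in lborel. \<forall>i\<in>A. ennreal (norm (f t (fst i) - f t (snd i)) / norm (fst i - snd i)) \<le> B t"
    and int: "\<And>c. (\<integral>\<^sup>+u\<in>{a..b}. B (u + c) ^ p \<partial>lborel) \<le> ennreal C"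
    and dense: "\<And>(h :: (real ^ 'n) \<times> (real ^ 'n) \<Rightarrow> real ^ 'n) K i. continuous_on UNIV h \<Longrightarrow> i \<in> R \<Longrightarrow>
        (\<And>i. i \<in> A \<Longrightarrow> norm (h (fst i) - h (snd i)) \<le> K * norm (fst i - snd i)) \<Longrightarrow>
        norm (h (fst i) - h (snd i)) \<le> K * norm (fst i - snd i)"
  shows "\<exists>l. l \<in> borel_measurable borel \<and> pint p a b (l :: real \<Rightarrow> real) \<le> ennreal C \<and>
    (AE s in lborel. a \<le> s \<and> s \<le> b \<longrightarrow> (\<forall>i\<in>R. norm (LC_rep G s (fst i) - LC_rep G s (snd i)) \<le> l s * norm (fst i - snd i)))"
proof -
  let ?g = "LC_rep G"
  have g: "?g \<in> LC_fun p" using G LC_hull_subset by (intro LC_rep_LC_fun) auto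
  obtain \<tau> :: "nat \<Rightarrow> real" where \<tau>: "AE t in lborel. \<forall>z\<in>Z. (\<lambda>k. f (t + \<tau> k) z) \<longlonglongrightarrow> ?g t z"
    by (rule hull_AE_limit[OF f G Z const_curves])
  \<comment> \<open>The p-th power is part of \<open>q\<close>, since it is the integrals of p-th
    powers that are bounded uniformly over the translates.\<close>
  define q where "q i h = (norm (h (fst i) - h (snd i)) / norm (fst i - snd i)) ^ p"
    for i and h :: "(real ^ 'n) \<times> (real ^ 'n) \<Rightarrow> real ^ 'n"
  have Bp: "(\<lambda>t. B t ^ p) \<in> borel_measurable borel" using B by measurable
  have Bq: "AE t in lborel. \<forall>i\<in>A. ennreal (q i (f t)) \<le> B t ^ p"
    using Bf
  proof eventually_elim
    case (elim t)
    show ?case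
    proof
      fix i assume "i \<in> A"
      then have "ennreal (norm (f t (fst i) - f t (snd i)) / norm (fst i - snd i)) ^ p \<le> B t ^ p"
        using elim by (intro power_mono) auto
      then show "ennreal (q i (f t)) \<le> B t ^ p" by (simp add: q_def ennreal_power)
    qed
  qed
  obtain \<Lambda> where \<Lambda>: "\<Lambda> \<in> borel_measurable borel" "(\<integral>\<^sup>+u\<in>{a..b}. \<Lambda> u \<partial>lborel) \<le> ennreal C"
    "AE t in lborel. \<forall>i\<in>A. ennreal (q i (?g t)) \<le> \<Lambda> t"
  proof (rule hull_fatou[OF \<tau> _ Bp Bq int])
    fix i and h :: "nat \<Rightarrow> (real ^ 'n) \<times> (real ^ 'n) \<Rightarrow> real ^ 'n" and h' assume "i \<in> A" and h: "\<forall>z\<in>Z. (\<lambda>k. h k z) \<longlonglongrightarrow> h' z"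
    then have "fst i \<in> Z" "snd i \<in> Z" using A by auto
    then have "(\<lambda>k. h k (fst i)) \<longlonglongrightarrow> h' (fst i)" "(\<lambda>k. h k (snd i)) \<longlonglongrightarrow> h' (snd i)" using h by auto
    then show "(\<lambda>k. q i (h k)) \<longlonglongrightarrow> q i h'"
      unfolding q_def divide_inverse by (intro tendsto_intros)
  qed
  have m: "(\<lambda>u. \<Lambda> u * indicator {a..b} u) \<in> borel_measurable lborel" using \<Lambda>(1) by measurable
  have "(\<integral>\<^sup>+u\<in>{a..b}. \<Lambda> u \<partial>lborel) \<noteq> \<infinity>" using \<Lambda>(2) by (auto simp: top_unique)
  from nn_integral_PInf_AE[OF m this] have fin: "AE u in lborel. \<Lambda> u * indicator {a..b} u \<noteq> \<infinity>" .
  \<comment> \<open>\<open>enn2real\<close> replaces an infinite value by 0. This can only lower the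
    integral, and it concerns only a null set of times in \<open>[a, b]\<close>.\<close>
  define l where "l u = root p (enn2real (\<Lambda> u))" for u
  have l [measurable]: "l \<in> borel_measurable borel" unfolding l_def[abs_def] using \<Lambda>(1) by measurable
  have "pint p a b l \<le> (\<integral>\<^sup>+u\<in>{a..b}. \<Lambda> u \<partial>lborel)"
    unfolding pint_def
  proof (intro nn_integral_mono mult_right_mono)
    fix u show "ennreal (norm (l u) ^ p) \<le> \<Lambda> u"
      using p0 by (cases "\<Lambda> u") (simp_all add: l_def)
  qed simp
  with \<Lambda>(2) have pl: "pint p a b l \<le> ennreal C" by (rule order_trans[rotated])
  have "AE s in lborel. a \<le> s \<and> s \<le> b \<longrightarrow> (\<forall>i\<in>R. norm (?g s (fst i) - ?g s (snd i)) \<le> l s * norm (fst i - snd i))"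
    using LC_fun_AE_continuous[OF g] \<Lambda>(3) fin
  proof eventually_elim
    case (elim s)
    show ?case
    proof (intro impI ballI)
      assume s: "a \<le> s \<and> s \<le> b"
      fix i assume i: "i \<in> R"
      have top: "\<Lambda> s \<noteq> top" using elim(3) s by simp
      show "norm (?g s (fst i) - ?g s (snd i)) \<le> l s * norm (fst i - snd i)"
      proof (rule dense[OF elim(1) i])
        fix i assume i: "i \<in> A"
        show "norm (?g s (fst i) - ?g s (snd i)) \<le> l s * norm (fst i - snd i)"
        proof (cases "fst i = snd i")
          case False
          let ?r = "norm (?g s (fst i) - ?g s (snd i)) / norm (fst i - snd i)"
          have "ennreal (?r ^ p) \<le> \<Lambda> s" using elim(2) i by (simp add: q_def)
          also have "\<Lambda> s = ennreal (enn2real (\<Lambda> s))" using top by (simp add: ennreal_enn2real_if)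
          finally have "?r ^ p \<le> enn2real (\<Lambda> s)" by (simp add: ennreal_le_iff)
          then have "root p (?r ^ p) \<le> l s" unfolding l_def using p0 by (intro real_root_le_mono)
          moreover have "root p (?r ^ p) = ?r" using p0 by (intro real_root_power_cancel) auto
          ultimately have "?r \<le> l s" by simp
          then show ?thesis using False by (simp add: divide_le_eq)
        qed simp
      qed
    qed
  qed
  then show ?thesis using l pl by blast
qed

text \<open>Common core of the two cases with Lipschitz-type bounds. The curves
  \<open>c i w\<close>, with \<open>i\<close> in a finite net, belong to the topology, and at each
  time one of them is near the pair of present and delayed state; \<open>R\<close> holds the pairs
  of points between which the Lipschitz estimate is available. The field difference is small along
  each net curve because \<open>G\<close> lies in finitely many seminorm balls, and passing to the
  nearby net curve costs \<epsilon> times a Lipschitz function bounded in L^p over the whole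
  hull.\<close>

lemma closeness_by_net:
  fixes c :: "'i \<Rightarrow> (real \<Rightarrow> real ^ 'n) \<Rightarrow> real \<Rightarrow> (real ^ 'n) \<times> (real ^ 'n)"
    and R :: "((real ^ 'n) \<times> (real ^ 'n)) rel" and e C :: real
  assumes G0: "G0 \<in> LC_hull p curve_topology f" and e: "e > 0" and C: "C \<ge> 0"
    and lip: "\<And>G. G \<in> LC_hull p curve_topology f \<Longrightarrow>
        \<exists>l. l \<in> borel_measurable borel \<and> pint p 0 (real n) (l :: real \<Rightarrow> real) \<le> ennreal C \<and>
        (AE s in lborel. 0 \<le> s \<and> s \<le> real n \<longrightarrow>
          (\<forall>i\<in>R. norm (LC_rep G s (fst i) - LC_rep G s (snd i)) \<le> l s * norm (fst i - snd i)))"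
    and net: "\<And>\<epsilon>. 0 < \<epsilon> \<Longrightarrow> \<epsilon> \<le> 1 \<Longrightarrow> \<exists>F. finite F \<and> (\<forall>i\<in>F. (0, real n, W i) \<in> \<W>) \<and>
        (\<forall>w. adm w \<longrightarrow> (\<forall>i\<in>F. c i w \<in> W i) \<and> (\<forall>s. 0 \<le> s \<longrightarrow> s \<le> real n \<longrightarrow>
          (\<exists>i\<in>F. ((w s, w (s - 1)), c i w s) \<in> R \<and> norm ((w s, w (s - 1)) - c i w s) \<le> \<epsilon>)))"
  shows "\<exists>V. openin curve_topology V \<and> G0 \<in> V \<and> (\<forall>G w. G \<in> V \<longrightarrow> G \<in> LC_hull p curve_topology f \<longrightarrow> adm w \<longrightarrow>
        pint p 0 (real n) (\<lambda>s. LC_rep G s (w s, w (s - 1)) - LC_rep G0 s (w s, w (s - 1))) \<le> ennreal e)"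
proof -
  \<comment> \<open>The mesh depends on \<open>e\<close> and the uniform bound \<open>C\<close>
    alone, so it precedes both the net and the neighbourhood; the summand 1 keeps the factor
    positive for \<open>C = 0\<close>. The net is available only for mesh at most 1, hence the
    minimum below.\<close>
  obtain \<epsilon>0 where \<epsilon>0: "\<epsilon>0 > 0" "(2 ^ p * (2 ^ p * (2 * C + 1))) * \<epsilon>0 ^ p = e / 2"
    by (rule small_root[OF p0, of "e / 2" "2 ^ p * (2 ^ p * (2 * C + 1))"]) (use e C in auto)
  define \<epsilon> where "\<epsilon> = min \<epsilon>0 1"
  have \<epsilon>: "\<epsilon> > 0" "\<epsilon> \<le> 1" "\<epsilon> \<le> \<epsilon>0" using \<epsilon>0(1) by (auto simp: \<epsilon>_def)
  obtain F where F: "finite F" "\<And>i. i \<in> F \<Longrightarrow> (0, real n, W i) \<in> \<W>"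
    and Fw: "\<And>w i. adm w \<Longrightarrow> i \<in> F \<Longrightarrow> c i w \<in> W i"
    and Fs: "\<And>w s. adm w \<Longrightarrow> 0 \<le> s \<Longrightarrow> s \<le> real n \<Longrightarrow>
          \<exists>i\<in>F. ((w s, w (s - 1)), c i w s) \<in> R \<and> norm ((w s, w (s - 1)) - c i w s) \<le> \<epsilon>"
  proof -
    from net[OF \<epsilon>(1,2)] obtain F where "finite F" "\<forall>i\<in>F. (0, real n, W i) \<in> \<W>" and
      w: "\<forall>w. adm w \<longrightarrow> (\<forall>i\<in>F. c i w \<in> W i) \<and> (\<forall>s. 0 \<le> s \<longrightarrow> s \<le> real n \<longrightarrow>
          (\<exists>i\<in>F. ((w s, w (s - 1)), c i w s) \<in> R \<and> norm ((w s, w (s - 1)) - c i w s) \<le> \<epsilon>))"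
      by (elim exE conjE)
    then show thesis
      by (intro that[of F]) (simp, erule (1) bspec, use w[rule_format, THEN conjunct1, rule_format] in assumption,
        use w[rule_format, THEN conjunct2, rule_format] in assumption)
  qed
  \<comment> \<open>The seminorm radius is chosen after the net, since it is divided among its
    points.\<close>
  obtain d where d: "d > 0" "(2 ^ p * (real (card F) + 1)) * d ^ p = e / 2"
    by (rule small_root[OF p0, of "e / 2" "2 ^ p * (real (card F) + 1)"]) (use e in auto)
  have G0L: "G0 \<in> LC p" using G0 LC_hull_subset by auto
  obtain l0 where l0: "l0 \<in> borel_measurable borel" "pint p 0 (real n) l0 \<le> ennreal C"
    "AE s in lborel. 0 \<le> s \<and> s \<le> real n \<longrightarrow>
          (\<forall>i\<in>R. norm (LC_rep G0 s (fst i) - LC_rep G0 s (snd i)) \<le> l0 s * norm (fst i - snd i))"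
    using lip[OF G0] by (elim exE conjE) (rule that)
  define V where "V = (\<Inter>i\<in>F. seminorm_ball 0 (real n) (W i) G0 d) \<inter> topspace curve_topology"
  have V: "openin curve_topology V" "G0 \<in> V"
    unfolding V_def
    by (intro openin_INT F(1) openin_seminorm_ball G0L F(2) d(1))
      (auto simp: topspace_curve_topology intro: centre_in_seminorm_ball[OF G0L F(2) d(1)] G0L)
  have "pint p 0 (real n) (\<lambda>s. LC_rep G s (w s, w (s - 1)) - LC_rep G0 s (w s, w (s - 1))) \<le> ennreal e"
    if GV: "G \<in> V" and G: "G \<in> LC_hull p curve_topology f" and w: "adm w" for G w
  proof -
    have GL: "G \<in> LC p" using G LC_hull_subset by auto
    define h where "h s z = LC_rep G s z - LC_rep G0 s z" for s z
    have h: "h \<in> LC_fun p" unfolding h_def[abs_def] by (intro LC_fun_diff p0 LC_rep_LC_fun GL G0L)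
    obtain l where l: "l \<in> borel_measurable borel" "pint p 0 (real n) l \<le> ennreal C"
      "AE s in lborel. 0 \<le> s \<and> s \<le> real n \<longrightarrow>
          (\<forall>i\<in>R. norm (LC_rep G s (fst i) - LC_rep G s (snd i)) \<le> l s * norm (fst i - snd i))"
      using lip[OF G] by (elim exE conjE) (rule that)
    define L where "L s = \<bar>l s\<bar> + \<bar>l0 s\<bar>" for s
    have labs: "(\<lambda>s. \<bar>l s\<bar>) \<in> borel_measurable borel" "(\<lambda>s. \<bar>l0 s\<bar>) \<in> borel_measurable borel"
      using l(1) l0(1) by measurable
    have L: "L \<in> borel_measurable borel" unfolding L_def[abs_def] by (intro borel_measurable_add labs)
    have "pint p 0 (real n) L \<le> ennreal (2 ^ p) * (pint p 0 (real n) (\<lambda>s. \<bar>l s\<bar>) + pint p 0 (real n) (\<lambda>s. \<bar>l0 s\<bar>))"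
      unfolding L_def by (intro pint_add_le p0 set_borel_measurable_real labs)
    also have "\<dots> \<le> ennreal (2 ^ p) * (ennreal C + ennreal C)"
    proof (intro mult_left_mono add_mono)
      have "pint p 0 (real n) (\<lambda>s. \<bar>l s\<bar>) = pint p 0 (real n) l" "pint p 0 (real n) (\<lambda>s. \<bar>l0 s\<bar>) = pint p 0 (real n) l0"
        by (simp_all add: pint_def)
      then show "pint p 0 (real n) (\<lambda>s. \<bar>l s\<bar>) \<le> ennreal C" "pint p 0 (real n) (\<lambda>s. \<bar>l0 s\<bar>) \<le> ennreal C"
        using l(2) l0(2) by simp_all
    qed simp
    also have "\<dots> = ennreal (2 ^ p * (2 * C))" using C by (simp add: ennreal_mult flip: ennreal_plus)
    finally have pL: "pint p 0 (real n) L \<le> ennreal (2 ^ p * (2 * C))" .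
    have "pint p 0 (real n) (\<lambda>s. h s (w s, w (s - 1))) \<le>
        ennreal (2 ^ p) * ((\<Sum>i\<in>F. pint p 0 (real n) (\<lambda>s. h s (c i w s))) + ennreal (\<epsilon> ^ p) * pint p 0 (real n) L)"
    proof (rule pint_sum_le[OF p0 F(1)])
      show "set_borel_measurable borel {0..real n} (\<lambda>s. h s (c i w s))" if "i \<in> F" for i
        by (rule LC_fun_set_measurable[OF h curve_measurable[OF F(2)[OF that] Fw[OF w that]]])
      show "set_borel_measurable borel {0..real n} L" by (rule set_borel_measurable_real[OF L])
      show "AE s in lborel. 0 \<le> s \<and> s \<le> real n \<longrightarrow>
          (\<exists>i\<in>F. norm (h s (w s, w (s - 1))) \<le> norm (h s (c i w s)) + \<epsilon> * norm (L s))"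
        using l(3) l0(3)
      proof eventually_elim
        case (elim s)
        show ?case
        proof
          assume s: "0 \<le> s \<and> s \<le> real n"
          obtain i where i: "i \<in> F" "((w s, w (s - 1)), c i w s) \<in> R" "norm ((w s, w (s - 1)) - c i w s) \<le> \<epsilon>"
            using Fs[OF w conjunct1[OF s] conjunct2[OF s]] by (elim bexE conjE)
          let ?y = "(w s, w (s - 1))" and ?z = "c i w s"
          have "norm (LC_rep G s ?y - LC_rep G s ?z) \<le> l s * norm (?y - ?z)"
            "norm (LC_rep G0 s ?y - LC_rep G0 s ?z) \<le> l0 s * norm (?y - ?z)"
            using elim(1)[THEN mp, OF s, THEN bspec, OF i(2)] elim(2)[THEN mp, OF s, THEN bspec, OF i(2)] by simp_all
          moreover have "l s * norm (?y - ?z) \<le> \<bar>l s\<bar> * \<epsilon>" "l0 s * norm (?y - ?z) \<le> \<bar>l0 s\<bar> * \<epsilon>"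
            using i(3) by (intro mult_mono, simp_all)+
          moreover have "norm (h s ?y) \<le> norm (h s ?z) +
              (norm (LC_rep G s ?y - LC_rep G s ?z) + norm (LC_rep G0 s ?y - LC_rep G0 s ?z))"
          proof -
            have eq: "h s ?y = h s ?z + ((LC_rep G s ?y - LC_rep G s ?z) - (LC_rep G0 s ?y - LC_rep G0 s ?z))"
              by (simp add: h_def)
            show ?thesis unfolding eq by (intro norm_triangle_mono order_refl norm_triangle_ineq4)
          qed
          moreover have "\<epsilon> * norm (L s) = \<bar>l s\<bar> * \<epsilon> + \<bar>l0 s\<bar> * \<epsilon>" by (simp add: L_def algebra_simps)
          ultimately have "norm (h s ?y) \<le> norm (h s ?z) + \<epsilon> * norm (L s)" by linarith
          then show "\<exists>i\<in>F. norm (h s ?y) \<le> norm (h s (c i w s)) + \<epsilon> * norm (L s)" using i(1) by blast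
        qed
      qed
    qed (use \<epsilon> in simp)
    also have "\<dots> \<le> ennreal (2 ^ p) * ((\<Sum>i\<in>F. ennreal (d ^ p)) + ennreal (\<epsilon>0 ^ p) * ennreal (2 ^ p * (2 * C)))"
    proof (intro mult_left_mono add_mono sum_mono mult_mono pL)
      show "ennreal (\<epsilon> ^ p) \<le> ennreal (\<epsilon>0 ^ p)" using \<epsilon> by (intro ennreal_leI power_mono) auto
      fix i assume i: "i \<in> F"
      have "G \<in> seminorm_ball 0 (real n) (W i) G0 d" using GV i unfolding V_def by blast
      then have lt: "curve_seminorm p 0 (real n) (W i) h < d" by (simp add: seminorm_ball_def h_def[abs_def])
      have "pint p 0 (real n) (\<lambda>s. h s (c i w s)) \<le> ennreal (curve_seminorm p 0 (real n) (W i) h ^ p)"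
        by (rule pint_le_curve_seminorm[OF F(2)[OF i] Fw[OF w i] h])
      also have "\<dots> \<le> ennreal (d ^ p)"
        using lt curve_seminorm_nonneg[OF F(2)[OF i] h] by (intro ennreal_leI power_mono) auto
      finally show "pint p 0 (real n) (\<lambda>s. h s (c i w s)) \<le> ennreal (d ^ p)" .
    qed simp_all
    also have "\<dots> = ennreal (2 ^ p * (real (card F) * d ^ p + \<epsilon>0 ^ p * (2 ^ p * (2 * C))))"
      using d(1) \<epsilon>0(1) C
      by (simp add: ennreal_mult ennreal_plus ennreal_of_nat_eq_real_of_nat)
    also have "\<dots> \<le> ennreal e"
    proof (rule ennreal_leI)
      have "2 ^ p * (real (card F) * d ^ p) \<le> (2 ^ p * (real (card F) + 1)) * d ^ p" using d(1) by (simp add: algebra_simps)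
      moreover have "2 ^ p * (\<epsilon>0 ^ p * (2 ^ p * (2 * C))) \<le> (2 ^ p * (2 ^ p * (2 * C + 1))) * \<epsilon>0 ^ p"
        using \<epsilon>0(1) by (simp add: algebra_simps)
      ultimately show "2 ^ p * (real (card F) * d ^ p + \<epsilon>0 ^ p * (2 ^ p * (2 * C))) \<le> e"
        unfolding d(2) \<epsilon>0(2) by (subst distrib_left) linarith
    qed
    finally show ?thesis by (simp add: h_def)
  qed
  then show ?thesis using V by blast
qed

end

section \<open>Closeness along truncated solutions in each of the three topologies\<close>

lemma bounded_power_integral:
  fixes l :: "real \<Rightarrow> ennreal"
  assumes B: "B \<in> borel_measurable borel" and lB: "AE t in lborel. l t = B t"
    and sup: "\<And>r. r > 0 \<Longrightarrow> (SUP \<tau>::real. \<integral>\<^sup>+t\<in>{-r..r}. l (t + \<tau>) ^ p \<partial>lebesgue) < \<infinity>"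
  obtains C where "C \<ge> 0" "\<And>c. (\<integral>\<^sup>+u\<in>{0..real n}. B (u + c) ^ p \<partial>lborel) \<le> ennreal C"
proof
  \<comment> \<open>The hypothesis is about positive radii, and \<open>n\<close> may be 0.\<close>
  let ?r = "real n + 1"
  let ?S = "SUP \<tau>::real. \<integral>\<^sup>+t\<in>{-?r..?r}. l (t + \<tau>) ^ p \<partial>lebesgue"
  show "enn2real ?S \<ge> 0" by simp
  fix c
  have "(\<integral>\<^sup>+u\<in>{0..real n}. B (u + c) ^ p \<partial>lborel) \<le> (\<integral>\<^sup>+u\<in>{-?r..?r}. B (u + c) ^ p \<partial>lborel)"
    by (intro nn_integral_mono) (auto simp: indicator_def)
  also have "\<dots> = (\<integral>\<^sup>+u\<in>{-?r..?r}. l (u + c) ^ p \<partial>lborel)"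
    by (intro nn_integral_cong_AE) (use AE_lborel_shift[OF lB, of c] in eventually_elim, simp)
  also have "\<dots> = (\<integral>\<^sup>+u\<in>{-?r..?r}. l (u + c) ^ p \<partial>lebesgue)" by (simp only: nn_integral_completion)
  also have "\<dots> \<le> ?S" by (rule SUP_upper) simp
  also have "?S = ennreal (enn2real ?S)" using sup[of ?r] by (intro ennreal_enn2real[symmetric]) simp
  finally show "(\<integral>\<^sup>+u\<in>{0..real n}. B (u + c) ^ p \<partial>lborel) \<le> ennreal (enn2real ?S)" .
qed

lemma le_l_bound:
  assumes "norm y \<le> real j" "norm z \<le> real j"
  shows "ennreal (norm (g t y - g t z) / norm (y - z)) \<le> l_bound j g t"
proof (cases "y = z")
  case False
  have "ennreal ((\<lambda>(z1, z2). norm (g t z1 - g t z2) / norm (z1 - z2)) (y, z)) \<le> l_bound j g t"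
    unfolding l_bound_def split_def by (rule SUP_upper2[of "(y, z)"]) (use assms False in auto)
  then show ?thesis by simp
qed simp

lemma le_l2_bound:
  assumes "norm y \<le> real j" "norm z \<le> real j" "fst y = fst z"
  shows "ennreal (norm (g t y - g t z) / norm (y - z)) \<le> l2_bound j g t"
proof (cases "y = z")
  case False
  obtain x u1 u2 where yz: "y = (x, u1)" "z = (x, u2)" using assms(3) by (metis prod.collapse)
  have "ennreal (norm (g t (x, u1) - g t (x, u2)) / norm (u1 - u2)) \<le> l2_bound j g t"
    unfolding l2_bound_def split_def by (rule SUP_upper2[of "(x, u1, u2)"]) (use assms False yz in auto)
  then show ?thesis by (simp add: yz norm_Pair)
qed simp

lemma norm_admissible_curve:
  assumes adm: "admissible p j g (real n) w \<phi>" and s: "0 \<le> s" "s \<le> real n"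
  shows "norm (w s, w (s - 1)) \<le> real j" "norm (w (s - 1)) \<le> real j"
proof -
  have "norm (w s) \<le> real j / 2" "norm (w (s - 1)) \<le> real j / 2" using adm s by (auto simp: admissible_def)
  then show "norm (w s, w (s - 1)) \<le> real j" "norm (w (s - 1)) \<le> real j"
    using norm_Pair_le[of "w s" "real j / 2" "w (s - 1)" "real j / 2"] norm_ge_zero[of "w s"] by linarith+
qed

lemma countable_dense_exists:
  obtains Z :: "'a::{metric_space, second_countable_topology} set" where "countable Z" "closure Z = UNIV"
proof -
  obtain Z :: "'a set" where "countable Z" "Z \<subseteq> UNIV" "UNIV \<subseteq> closure Z" by (rule separable)
  then show thesis by (intro that[of Z] top.extremum_uniqueI)
qed

lemma moving_familyI:
  "a \<in> \<rat> \<Longrightarrow> b \<in> \<rat> \<Longrightarrow> a \<le> b \<Longrightarrow> (a, b, moving_curves \<theta> \<theta>' a b j) \<in> moving_family \<theta> \<theta>'"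
  unfolding moving_family_def by blast

lemma half_moving_familyI:
  "a \<in> \<rat> \<Longrightarrow> b \<in> \<rat> \<Longrightarrow> a \<le> b \<Longrightarrow> u \<in> D' \<Longrightarrow> (a, b, half_moving_curves \<theta> a b j u) \<in> half_moving_family \<theta> D'"
  unfolding half_moving_family_def by blast

lemma constant_familyI: "a \<in> \<rat> \<Longrightarrow> b \<in> \<rat> \<Longrightarrow> a \<le> b \<Longrightarrow> z \<in> D \<Longrightarrow> (a, b, {\<lambda>t. z}) \<in> constant_family D"
  unfolding constant_family_def by blast

text \<open>The time interval is cut at the integers because the delayed curve on
  \<open>[k, k + 1]\<close> is \<open>w\<close> on \<open>[k - 1, k]\<close>. This is history for
  \<open>k = 0\<close> and lies in positive times otherwise, so the two kinds of moduli never have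
  to be combined within one piece. Their maximum, the hatted modulus, covers both
  possibilities.\<close>

lemma hull_flow_moving:
  fixes f :: "'n::finite delay_field"
  assumes p: "p > 1" and f: "f \<in> LC_fun p" and eq: "L1_loc_equicontinuous_m_bounds f"
  shows "hull_flow p (moving_family (m_moduli f) (m_moduli_hat p f)) f"
proof -
  let ?\<theta> = "m_moduli f" and ?\<theta>' = "m_moduli_hat p f"
  let ?\<W> = "moving_family ?\<theta> ?\<theta>' :: (real \<times> real \<times> (real \<Rightarrow> (real ^ 'n) \<times> (real ^ 'n)) set) set"
  have p0: "p > 0" using p by simp
  note \<theta> = good_m_moduli[OF f eq] and \<theta>' = good_m_moduli_hat[OF p0 f eq]
  interpret C: curve_family p ?\<W> by (rule curve_family_moving[OF p \<theta> \<theta>'])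
  obtain Z :: "((real ^ 'n) \<times> (real ^ 'n)) set" where Z: "countable Z" "closure Z = UNIV" by (rule countable_dense_exists)
  have cc: "\<exists>a b W. a \<le> - real k \<and> real k \<le> b \<and> (a, b, W) \<in> ?\<W> \<and> (\<exists>w\<in>W. \<forall>t. a \<le> t \<longrightarrow> t \<le> b \<longrightarrow> w t = z)" for z k
  proof -
    obtain j :: nat where j: "norm z \<le> real j" using real_arch_simple by blast
    have "norm (fst z) \<le> real j" "norm (snd z) \<le> real j" using j norm_fst_le[of "fst z" "snd z"] norm_snd_le[of "snd z" "fst z"] unfolding prod.collapse by linarith+
    then have "(\<lambda>t. fst z, \<lambda>t. snd z) \<in> K_set ?\<theta> (- real k) (real k) j \<times> K_set ?\<theta>' (- real k - 1) (real k - 1) j"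
      by (intro SigmaI const_in_K_set \<theta> \<theta>')
    then have "(\<lambda>t. z) \<in> moving_curves ?\<theta> ?\<theta>' (- real k) (real k) j"
      unfolding moving_curves_def by (rule rev_image_eqI) simp
    moreover have "(- real k, real k, moving_curves ?\<theta> ?\<theta>' (- real k) (real k) j) \<in> ?\<W>"
      by (rule moving_familyI) simp_all
    ultimately show ?thesis by (intro exI conjI) (auto intro!: bexI[of _ "\<lambda>t. z"])
  qed
  show ?thesis
  proof (rule hull_flow.intro[OF C.curve_family_axioms], rule hull_flow_axioms.intro[OF f])
    fix G0 n j and e :: real
    assume G0: "G0 \<in> LC_hull p C.curve_topology f" and e: "e > 0"
    \<comment> \<open>Each of the \<open>n\<close> pieces contributes at most \<open>c ^ p\<close>;
      the added 1 keeps the factor positive for \<open>n = 0\<close>.\<close>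
    obtain c where c: "c > 0" "(real n + 1) * c ^ p = e" by (rule small_root[OF p0 e, of "real n + 1"]) simp
    let ?W = "\<lambda>k. moving_curves ?\<theta> ?\<theta>' (real k) (real k + 1) j :: (real \<Rightarrow> (real ^ 'n) \<times> (real ^ 'n)) set"
    have W: "(real k, real k + 1, ?W k) \<in> ?\<W>" for k
      by (rule moving_familyI) simp_all
    have G0L: "G0 \<in> LC p" using G0 C.LC_hull_subset by auto
    define V where "V = (\<Inter>k\<in>{..<n}. C.seminorm_ball (real k) (real k + 1) (?W k) G0 c) \<inter> topspace C.curve_topology"
    have V: "openin C.curve_topology V" "G0 \<in> V"
      unfolding V_def
      by (intro openin_INT finite_lessThan C.openin_seminorm_ball G0L W c(1))
        (auto simp: C.topspace_curve_topology intro: C.centre_in_seminorm_ball[OF G0L W c(1)] G0L)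
    have "pint p 0 (real n) (\<lambda>s. LC_rep G s (w s, w (s - 1)) - LC_rep G0 s (w s, w (s - 1))) \<le> ennreal e"
      if GV: "G \<in> V" and G: "G \<in> LC_hull p C.curve_topology f" and adm: "admissible p j (LC_rep G) (real n) w \<phi>" for G w \<phi>
    proof -
      have GL: "G \<in> LC p" using G C.LC_hull_subset by auto
      define h where "h s z = LC_rep G s z - LC_rep G0 s z" for s z
      have h: "h \<in> LC_fun p" unfolding h_def[abs_def] by (intro LC_fun_diff p0 LC_rep_LC_fun GL G0L)
      let ?v = "\<lambda>s. (w s, w (s - 1))"
      have cw: "continuous_on {-1..real n} w" and bw: "\<And>t. -1 \<le> t \<Longrightarrow> t \<le> real n \<Longrightarrow> norm (w t) \<le> real j / 2"
        and \<phi>: "\<phi> \<in> C1p p" "C1p_norm p \<phi> \<le> real j"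
        and hist: "\<And>s t. -1 \<le> s \<Longrightarrow> s \<le> 0 \<Longrightarrow> -1 \<le> t \<Longrightarrow> t \<le> 0 \<Longrightarrow> norm (w t - w s) \<le> norm (\<phi> t - \<phi> s)"
        using adm by (simp_all add: admissible_def)
      have w\<theta>: "norm (w t - w s) \<le> ?\<theta> a b j \<bar>t - s\<bar>" if "0 \<le> s" "s \<le> real n" "0 \<le> t" "t \<le> real n" for a b s t
        by (rule C.admissible_modulus[OF f eq G Z cc adm that])
      have w\<theta>': "norm (w t - w s) \<le> ?\<theta>' a b j \<bar>t - s\<bar>"
        if k: "k < n" and s: "real k - 1 \<le> s" "s \<le> real k" and t: "real k - 1 \<le> t" "t \<le> real k" for a b s t k
      proof (cases k)
        case 0
        have "norm (w t - w s) \<le> norm (\<phi> t - \<phi> s)" using s t 0 by (intro hist) auto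
        also have "\<dots> \<le> C1p_modulus TYPE('n) p j \<bar>t - s\<bar>" using s t 0 by (intro C1p_modulus_upper p0 \<phi>) auto
        finally show ?thesis by (simp add: m_moduli_hat_def)
      next
        case (Suc k')
        have "norm (w t - w s) \<le> ?\<theta> a b j \<bar>t - s\<bar>" using s t Suc k by (intro w\<theta>) auto
        then show ?thesis by (simp add: m_moduli_hat_def)
      qed
      have bw': "norm (w t) \<le> real j" if "-1 \<le> t" "t \<le> real n" for t using bw[OF that] norm_ge_zero[of "w t"] by linarith
      have piece: "pint p (real k) (real k + 1) (\<lambda>s. h s (?v s)) \<le> ennreal (c ^ p)" if k: "k < n" for k
      proof -
        have kn: "real k + 1 \<le> real n" using k by linarith
        have "w \<in> K_set ?\<theta> (real k) (real k + 1) j"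
          unfolding K_set_def
          by (intro CollectI conjI ballI continuous_on_subset[OF cw] w\<theta>) (use kn bw' in auto)
        moreover have "w \<in> K_set ?\<theta>' (real k - 1) (real k + 1 - 1) j"
          unfolding K_set_def
          by (intro CollectI conjI ballI continuous_on_subset[OF cw] w\<theta>'[OF k]) (use kn bw' in auto)
        ultimately have vW: "?v \<in> ?W k" unfolding moving_curves_def by (intro image_eqI[of _ _ "(w, w)"]) simp_all
        have "G \<in> C.seminorm_ball (real k) (real k + 1) (?W k) G0 c" using GV k unfolding V_def by blast
        then have lt: "curve_seminorm p (real k) (real k + 1) (?W k) h < c" by (simp add: C.seminorm_ball_def h_def[abs_def])
        have "pint p (real k) (real k + 1) (\<lambda>s. h s (?v s)) \<le> ennreal (curve_seminorm p (real k) (real k + 1) (?W k) h ^ p)"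
          by (rule C.pint_le_curve_seminorm[OF W vW h])
        also have "\<dots> \<le> ennreal (c ^ p)"
          using lt C.curve_seminorm_nonneg[OF W h] by (intro ennreal_leI power_mono) auto
        finally show ?thesis .
      qed
      have "pint p 0 (real m) (\<lambda>s. h s (?v s)) \<le> ennreal (real m * c ^ p)" if "m \<le> n" for m
        using that
      proof (induction m)
        case 0
        show ?case by (simp add: pint_point)
      next
        case (Suc m)
        have "continuous_on {0..real m + 1} (\<lambda>s. w (s - 1))"
          by (rule continuous_on_compose2[OF cw]) (intro continuous_intros, use Suc.prems in auto)
        moreover have "continuous_on {0..real m + 1} w"
          by (rule continuous_on_subset[OF cw]) (use Suc.prems in auto)
        ultimately have "set_borel_measurable borel {0..real m + 1} (\<lambda>s. h s (?v s))"
          by (intro LC_fun_set_measurable[OF h] set_borel_measurable_continuous continuous_on_Pair)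
        then have "pint p 0 (real m + 1) (\<lambda>s. h s (?v s)) \<le>
            pint p 0 (real m) (\<lambda>s. h s (?v s)) + pint p (real m) (real m + 1) (\<lambda>s. h s (?v s))"
          by (rule pint_combine[OF _ p0]) simp_all
        also have "\<dots> \<le> ennreal (real m * c ^ p) + ennreal (c ^ p)"
          by (intro add_mono Suc.IH piece) (use Suc.prems in simp_all)
        also have "\<dots> = ennreal (real (Suc m) * c ^ p)" using c(1) by (simp add: algebra_simps flip: ennreal_plus)
        finally show ?case by (simp add: add.commute)
      qed
      from this[of n] have "pint p 0 (real n) (\<lambda>s. h s (?v s)) \<le> ennreal (real n * c ^ p)" by simp
      also have "\<dots> \<le> ennreal e" unfolding c(2)[symmetric] using c(1) by (intro ennreal_leI mult_right_mono) auto
      finally show ?thesis by (simp add: h_def)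
    qed
    then show "\<exists>V. openin C.curve_topology V \<and> G0 \<in> V \<and>
      (\<forall>G w \<phi>. G \<in> V \<longrightarrow> G \<in> LC_hull p C.curve_topology f \<longrightarrow> admissible p j (LC_rep G) (real n) w \<phi> \<longrightarrow>
        pint p 0 (real n) (\<lambda>s. LC_rep G s (w s, w (s - 1)) - LC_rep G0 s (w s, w (s - 1))) \<le> ennreal e)"
      using V by blast
  qed
qed

text \<open>Only the delayed state is replaced by a point of a net in \<open>D'\<close>; the present
  state stays on its own curve, which obeys the moduli on all of \<open>[0, n]\<close> because these
  are positive times. Points with equal first component are compared, so Lipschitz bounds in the
  second variable suffice.\<close>

lemma hull_flow_half_moving:
  fixes f :: "'n::finite delay_field" and D' :: "(real ^ 'n) set"
  assumes p: "p > 1" and f: "f \<in> LC_fun p" and eq: "L1_loc_equicontinuous_m_bounds f"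
    and l2: "Lp_loc_bounded_l2_bounds p f" and D': "countable D'" "closure D' = UNIV"
  shows "hull_flow p (half_moving_family (m_moduli f) D') f"
proof -
  let ?\<theta> = "m_moduli f"
  let ?\<W> = "half_moving_family ?\<theta> D'"
  have p0: "p > 0" using p by simp
  note \<theta> = good_m_moduli[OF f eq]
  have D'0: "D' \<noteq> {}" using D'(2) by auto
  interpret C: curve_family p ?\<W> by (rule curve_family_half_moving[OF p \<theta> D'0])
  obtain X :: "(real ^ 'n) set" where X: "countable X" "closure X = UNIV" by (rule countable_dense_exists)
  define Z where "Z = X \<times> D'"
  have Z: "countable Z" "closure Z = UNIV" unfolding Z_def using X D' by (simp_all add: closure_Times)
  have cc: "\<exists>a b W. a \<le> - real k \<and> real k \<le> b \<and> (a, b, W) \<in> ?\<W> \<and> (\<exists>w\<in>W. \<forall>t. a \<le> t \<longrightarrow> t \<le> b \<longrightarrow> w t = z)"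
    if z: "z \<in> Z" for z k
  proof -
    obtain j :: nat where j: "norm (fst z) \<le> real j" using real_arch_simple by blast
    have "(\<lambda>t. z) \<in> half_moving_curves ?\<theta> (- real k) (real k) j (snd z)"
      unfolding half_moving_curves_def by (rule image_eqI[of _ _ "\<lambda>t. fst z"]) (simp_all add: const_in_K_set[OF \<theta> j])
    moreover have "(- real k, real k, half_moving_curves ?\<theta> (- real k) (real k) j (snd z)) \<in> ?\<W>"
      by (rule half_moving_familyI) (use z in \<open>auto simp: Z_def\<close>)
    ultimately show ?thesis by (intro exI conjI) (auto intro!: bexI[of _ "\<lambda>t. z"])
  qed
  show ?thesis
  proof (rule hull_flow.intro[OF C.curve_family_axioms], rule hull_flow_axioms.intro[OF f])
    fix G0 n j and e :: real
    assume G0: "G0 \<in> LC_hull p C.curve_topology f" and e: "e > 0"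
    \<comment> \<open>The radius is \<open>Suc j\<close> because a net point lies within 1 of a pair
      of norm at most \<open>j\<close>. The balls are open so that a dense set stays dense in
      them.\<close>
    define A where "A = {(y, z). fst y = fst z \<and> y \<in> Z \<inter> ball 0 (real (Suc j)) \<and> z \<in> Z \<inter> ball 0 (real (Suc j))}"
    define R where "R = {(y :: (real ^ 'n) \<times> (real ^ 'n), z :: (real ^ 'n) \<times> (real ^ 'n)). fst y = fst z \<and> y \<in> ball 0 (real (Suc j)) \<and> z \<in> ball 0 (real (Suc j))}"
    obtain B where B: "B \<in> borel_measurable borel" "AE t in lborel. l2_bound (Suc j) f t = B t"
      by (rule l2_bound_AE_borel[OF f])
    have Bf: "AE t in lborel. \<forall>i\<in>A. ennreal (norm (f t (fst i) - f t (snd i)) / norm (fst i - snd i)) \<le> B t"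
      using B(2)
    proof eventually_elim
      case (elim t)
      show ?case unfolding elim[symmetric] by (intro ballI le_l2_bound) (auto simp: A_def)
    qed
    obtain C where C: "C \<ge> 0" "\<And>c. (\<integral>\<^sup>+u\<in>{0..real n}. B (u + c) ^ p \<partial>lborel) \<le> ennreal C"
      by (rule bounded_power_integral[OF B(1,2), of p n])
        (use l2 in \<open>simp_all add: Lp_loc_bounded_l2_bounds_def bound_translate\<close>)
    have dense: "norm (h (fst i) - h (snd i)) \<le> K * norm (fst i - snd i)"
      if h: "continuous_on UNIV h" and i: "i \<in> R"
        and le: "\<And>i. i \<in> A \<Longrightarrow> norm (h (fst i) - h (snd i)) \<le> K * norm (fst i - snd i)"
      for h :: "(real ^ 'n) \<times> (real ^ 'n) \<Rightarrow> real ^ 'n" and K i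
    proof -
      \<comment> \<open>Pairs of points with equal first component form a thin set, in which density
        of \<open>Z \<times> Z\<close> says nothing. Parametrised by the triple of first component
        and two second components, they fill an open set, in which
        \<open>X \<times> D' \<times> D'\<close> is dense.\<close>
      define y z where "y q = (fst q, fst (snd q))" and "z q = (fst q, snd (snd q))"
        for q :: "(real ^ 'n) \<times> (real ^ 'n) \<times> (real ^ 'n)"
      have cont: "continuous_on UNIV y" "continuous_on UNIV z" unfolding y_def[abs_def] z_def[abs_def] by (intro continuous_intros)+
      define S where "S = {q. norm (y q) < real (Suc j)} \<inter> {q. norm (z q) < real (Suc j)}"
      have S: "open S" unfolding S_def by (intro open_Int open_Collect_less continuous_on_norm continuous_on_const cont)
      have E: "closure (X \<times> D' \<times> D') = UNIV" using X D' by (simp add: closure_Times)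
      let ?q = "(fst (fst i), snd (fst i), snd (snd i))"
      have yz: "y ?q = fst i" "z ?q = snd i" using i by (auto simp: R_def y_def z_def prod_eq_iff)
      have "norm (h (y ?q) - h (z ?q)) \<le> K * norm (y ?q - z ?q)"
      proof (rule dense_le_open[OF S E])
        show "continuous_on UNIV (\<lambda>q. norm (h (y q) - h (z q)))"
          by (intro continuous_on_norm continuous_on_diff continuous_on_compose2[OF h] cont) simp_all
        show "continuous_on UNIV (\<lambda>q. K * norm (y q - z q))"
          by (intro continuous_on_norm continuous_on_diff continuous_on_mult continuous_on_const cont)
        show "norm (h (y q) - h (z q)) \<le> K * norm (y q - z q)" if "q \<in> X \<times> D' \<times> D'" "q \<in> S" for q
          using le[of "(y q, z q)"] that by (simp add: A_def S_def Z_def y_def z_def mem_Times_iff)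
        have "?q \<in> S" unfolding S_def Int_iff mem_Collect_eq yz using i by (auto simp: R_def)
        then show "?q \<in> closure S" by (rule subsetD[OF closure_subset])
      qed
      then show ?thesis unfolding yz .
    qed
    have AZ: "A \<subseteq> Z \<times> Z" by (auto simp: A_def)
    \<comment> \<open>The field that makes \<open>w\<close> admissible is forgotten; that it belongs
      to the hull is kept, since the moduli of \<open>w\<close> rest on the bounds inherited by the
      hull.\<close>
    define adm where "adm w \<longleftrightarrow> (\<exists>G \<phi>. G \<in> LC_hull p C.curve_topology f \<and> admissible p j (LC_rep G) (real n) w \<phi>)" for w
    have "\<exists>V. openin C.curve_topology V \<and> G0 \<in> V \<and> (\<forall>G w. G \<in> V \<longrightarrow> G \<in> LC_hull p C.curve_topology f \<longrightarrow> adm w \<longrightarrow>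
        pint p 0 (real n) (\<lambda>s. LC_rep G s (w s, w (s - 1)) - LC_rep G0 s (w s, w (s - 1))) \<le> ennreal e)"
    proof (rule C.closeness_by_net[OF G0 e C(1), where R = R and c = "\<lambda>u w s. (w s, u)" and W = "half_moving_curves ?\<theta> 0 (real n) j"])
      fix G assume G: "G \<in> LC_hull p C.curve_topology f"
      show "\<exists>l. l \<in> borel_measurable borel \<and> pint p 0 (real n) (l :: real \<Rightarrow> real) \<le> ennreal C \<and>
          (AE s in lborel. 0 \<le> s \<and> s \<le> real n \<longrightarrow>
            (\<forall>i\<in>R. norm (LC_rep G s (fst i) - LC_rep G s (snd i)) \<le> l s * norm (fst i - snd i)))"
        by (rule C.hull_lipschitz[OF f G Z(1) AZ cc B(1) Bf C(2) dense])
    next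
      fix \<epsilon> :: real assume \<epsilon>: "0 < \<epsilon>" "\<epsilon> \<le> 1"
      obtain F where F: "finite F" "F \<subseteq> D'" "\<And>u. norm u \<le> real j \<Longrightarrow> \<exists>y\<in>F. norm (u - y) < \<epsilon>"
        by (rule finite_net[OF D'(2) \<epsilon>(1), of "real j"]) (rule that, assumption, assumption, simp)
      have "(0, real n, half_moving_curves ?\<theta> 0 (real n) j u) \<in> ?\<W>" if "u \<in> F" for u
        by (rule half_moving_familyI) (use that F(2) in auto)
      moreover have "(\<lambda>s. (w s, u)) \<in> half_moving_curves ?\<theta> 0 (real n) j u" if w: "adm w" for w u
      proof -
        obtain G \<phi> where G: "G \<in> LC_hull p C.curve_topology f" and adm: "admissible p j (LC_rep G) (real n) w \<phi>"
          using w unfolding adm_def by (elim exE conjE)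
        have cw: "continuous_on {-1..real n} w" and bw: "\<And>t. -1 \<le> t \<Longrightarrow> t \<le> real n \<Longrightarrow> norm (w t) \<le> real j / 2"
          using adm by (simp_all add: admissible_def)
        have bw': "norm (w t) \<le> real j" if "-1 \<le> t" "t \<le> real n" for t using bw[OF that] norm_ge_zero[of "w t"] by linarith
        have "w \<in> K_set ?\<theta> 0 (real n) j"
          unfolding K_set_def
          by (intro CollectI conjI ballI continuous_on_subset[OF cw] C.admissible_modulus[OF f eq G Z cc adm])
            (use bw' in auto)
        then show ?thesis unfolding half_moving_curves_def by (rule imageI)
      qed
      moreover have "\<exists>u\<in>F. ((w s, w (s - 1)), (w s, u)) \<in> R \<and> norm ((w s, w (s - 1)) - (w s, u)) \<le> \<epsilon>"
        if w: "adm w" and s: "0 \<le> s" "s \<le> real n" for w s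
      proof -
        obtain G \<phi> where adm: "admissible p j (LC_rep G) (real n) w \<phi>" using w unfolding adm_def by (elim exE conjE)
        obtain u where u: "u \<in> F" "norm (w (s - 1) - u) < \<epsilon>" using F(3)[OF norm_admissible_curve(2)[OF adm s]] by (rule bexE)
        have d: "norm ((w s, w (s - 1)) - (w s, u)) < \<epsilon>" using u(2) by (simp add: norm_Pair)
        have "norm (w s, w (s - 1)) \<le> real j" by (rule norm_admissible_curve(1)[OF adm s])
        moreover from this have "norm (w s, u) < real j + 1"
          using d \<epsilon>(2) norm_triangle_ineq2[of "(w s, u)" "(w s, w (s - 1))"] norm_minus_commute[of "(w s, u)" "(w s, w (s - 1))"]
          by linarith
        ultimately show ?thesis using u(1) d by (intro bexI[of _ u]) (simp_all add: R_def)
      qed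
      ultimately show "\<exists>F. finite F \<and> (\<forall>u\<in>F. (0, real n, half_moving_curves ?\<theta> 0 (real n) j u) \<in> ?\<W>) \<and>
        (\<forall>w. adm w \<longrightarrow> (\<forall>u\<in>F. (\<lambda>s. (w s, u)) \<in> half_moving_curves ?\<theta> 0 (real n) j u) \<and> (\<forall>s. 0 \<le> s \<longrightarrow> s \<le> real n \<longrightarrow>
          (\<exists>u\<in>F. ((w s, w (s - 1)), w s, u) \<in> R \<and> norm ((w s, w (s - 1)) - (w s, u)) \<le> \<epsilon>)))"
        by (intro exI[of _ F] conjI allI impI ballI F(1))
    qed
    then obtain V where V: "openin C.curve_topology V" "G0 \<in> V"
      "\<And>G w. G \<in> V \<Longrightarrow> G \<in> LC_hull p C.curve_topology f \<Longrightarrow> adm w \<Longrightarrow>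
        pint p 0 (real n) (\<lambda>s. LC_rep G s (w s, w (s - 1)) - LC_rep G0 s (w s, w (s - 1))) \<le> ennreal e"
      by (elim exE conjE) simp
    show "\<exists>V. openin C.curve_topology V \<and> G0 \<in> V \<and>
      (\<forall>G w \<phi>. G \<in> V \<longrightarrow> G \<in> LC_hull p C.curve_topology f \<longrightarrow> admissible p j (LC_rep G) (real n) w \<phi> \<longrightarrow>
        pint p 0 (real n) (\<lambda>s. LC_rep G s (w s, w (s - 1)) - LC_rep G0 s (w s, w (s - 1))) \<le> ennreal e)"
      by (intro exI[of _ V] conjI allI impI V) (auto simp: adm_def)
  qed
qed

text \<open>Both the present and the delayed state are replaced by a point of the net, so no modulus
  of continuity of the curve enters, only its bound. This is why \<open>adm\<close> below may refer
  to an arbitrary field, and why full Lipschitz bounds take the place of the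
  \<open>m\<close>-bounds.\<close>

lemma hull_flow_constant:
  fixes f :: "'n::finite delay_field" and D :: "((real ^ 'n) \<times> (real ^ 'n)) set"
  assumes p: "p > 1" and f: "f \<in> LC_fun p" and l: "Lp_loc_bounded_l_bounds p f"
    and D: "countable D" "closure D = UNIV"
  shows "hull_flow p (constant_family D) f"
proof -
  let ?\<W> = "constant_family D"
  have p0: "p > 0" using p by simp
  have D0: "D \<noteq> {}" using D(2) by auto
  interpret C: curve_family p ?\<W> by (rule curve_family_constant[OF p D0])
  have cc: "\<exists>a b W. a \<le> - real k \<and> real k \<le> b \<and> (a, b, W) \<in> ?\<W> \<and> (\<exists>w\<in>W. \<forall>t. a \<le> t \<longrightarrow> t \<le> b \<longrightarrow> w t = z)"
    if z: "z \<in> D" for z k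
  proof -
    have "(- real k, real k, {\<lambda>t. z}) \<in> ?\<W>"
      by (rule constant_familyI) (use z in auto)
    then show ?thesis by (intro exI conjI) auto
  qed
  show ?thesis
  proof (rule hull_flow.intro[OF C.curve_family_axioms], rule hull_flow_axioms.intro[OF f])
    fix G0 n j and e :: real
    assume G0: "G0 \<in> LC_hull p C.curve_topology f" and e: "e > 0"
    let ?U = "ball (0 :: (real ^ 'n) \<times> (real ^ 'n)) (real (Suc j))"
    obtain B where B: "B \<in> borel_measurable borel" "AE t in lborel. l_bound (Suc j) f t = B t"
      by (rule l_bound_AE_borel[OF f])
    have Bf: "AE t in lborel. \<forall>i\<in>(D \<inter> ?U) \<times> (D \<inter> ?U). ennreal (norm (f t (fst i) - f t (snd i)) / norm (fst i - snd i)) \<le> B t"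
      using B(2)
    proof eventually_elim
      case (elim t)
      show ?case unfolding elim[symmetric] by (intro ballI le_l_bound) auto
    qed
    obtain C where C: "C \<ge> 0" "\<And>c. (\<integral>\<^sup>+u\<in>{0..real n}. B (u + c) ^ p \<partial>lborel) \<le> ennreal C"
      by (rule bounded_power_integral[OF B(1,2), of p n])
        (use l in \<open>simp_all add: Lp_loc_bounded_l_bounds_def bound_translate\<close>)
    have dense: "norm (h (fst i) - h (snd i)) \<le> K * norm (fst i - snd i)"
      if h: "continuous_on UNIV h" and i: "i \<in> ?U \<times> ?U"
        and le: "\<And>i. i \<in> (D \<inter> ?U) \<times> (D \<inter> ?U) \<Longrightarrow> norm (h (fst i) - h (snd i)) \<le> K * norm (fst i - snd i)"
      for h :: "(real ^ 'n) \<times> (real ^ 'n) \<Rightarrow> real ^ 'n" and K i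
    proof (rule dense_le_open[OF open_Times[OF open_ball open_ball], where E = "D \<times> D" and i = i
          and F = "\<lambda>i. norm (h (fst i) - h (snd i))" and G = "\<lambda>i. K * norm (fst i - snd i)"])
      show "closure (D \<times> D) = UNIV" using D by (simp add: closure_Times)
      show "continuous_on UNIV (\<lambda>i. norm (h (fst i) - h (snd i)))"
        by (intro continuous_on_norm continuous_on_diff continuous_on_compose2[OF h] continuous_on_fst continuous_on_snd
            continuous_on_id) simp_all
      show "continuous_on UNIV (\<lambda>i. K * norm (fst i - snd i))" by (intro continuous_intros)
      show "norm (h (fst i) - h (snd i)) \<le> K * norm (fst i - snd i)" if "i \<in> D \<times> D" "i \<in> ?U \<times> ?U" for i
        by (rule le) (use that in auto)
      show "i \<in> closure (?U \<times> ?U)" by (rule subsetD[OF closure_subset i])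
    qed
    define adm where "adm w \<longleftrightarrow> (\<exists>g \<phi>. admissible p j g (real n) w \<phi>)" for w :: "real \<Rightarrow> real ^ 'n"
    have "\<exists>V. openin C.curve_topology V \<and> G0 \<in> V \<and> (\<forall>G w. G \<in> V \<longrightarrow> G \<in> LC_hull p C.curve_topology f \<longrightarrow> adm w \<longrightarrow>
        pint p 0 (real n) (\<lambda>s. LC_rep G s (w s, w (s - 1)) - LC_rep G0 s (w s, w (s - 1))) \<le> ennreal e)"
    proof (rule C.closeness_by_net[OF G0 e C(1), where R = "?U \<times> ?U" and c = "\<lambda>z w s. z" and W = "\<lambda>z. {\<lambda>t. z}"])
      fix G assume G: "G \<in> LC_hull p C.curve_topology f"
      show "\<exists>l. l \<in> borel_measurable borel \<and> pint p 0 (real n) (l :: real \<Rightarrow> real) \<le> ennreal C \<and>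
          (AE s in lborel. 0 \<le> s \<and> s \<le> real n \<longrightarrow>
            (\<forall>i\<in>?U \<times> ?U. norm (LC_rep G s (fst i) - LC_rep G s (snd i)) \<le> l s * norm (fst i - snd i)))"
        by (rule C.hull_lipschitz[OF f G D(1) _ cc B(1) Bf C(2) dense]) auto
    next
      fix \<epsilon> :: real assume \<epsilon>: "0 < \<epsilon>" "\<epsilon> \<le> 1"
      obtain F where F: "finite F" "F \<subseteq> D" "\<And>y. norm y \<le> real j \<Longrightarrow> \<exists>z\<in>F. norm (y - z) < \<epsilon>"
        by (rule finite_net[OF D(2) \<epsilon>(1), of "real j"]) (rule that, assumption, assumption, simp)
      have "(0, real n, {\<lambda>t. z}) \<in> ?\<W>" if "z \<in> F" for z
        by (rule constant_familyI) (use that F(2) in auto)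
      moreover have "\<exists>z\<in>F. ((w s, w (s - 1)), z) \<in> ?U \<times> ?U \<and> norm ((w s, w (s - 1)) - z) \<le> \<epsilon>"
        if w: "adm w" and s: "0 \<le> s" "s \<le> real n" for w s
      proof -
        obtain g \<phi> where adm: "admissible p j g (real n) w \<phi>" using w unfolding adm_def by (elim exE)
        let ?y = "(w s, w (s - 1))"
        have y: "norm ?y \<le> real j" by (rule norm_admissible_curve(1)[OF adm s])
        obtain z where z: "z \<in> F" "norm (?y - z) < \<epsilon>" using F(3)[OF y] by (rule bexE)
        have "norm z < real j + 1"
          using y z(2) \<epsilon>(2) norm_triangle_ineq2[of z ?y] norm_minus_commute[of z ?y] by linarith
        then show ?thesis using y z by (intro bexI[of _ z]) simp_all
      qed
      ultimately show "\<exists>F. finite F \<and> (\<forall>z\<in>F. (0, real n, {\<lambda>t. z}) \<in> ?\<W>) \<and>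
        (\<forall>w. adm w \<longrightarrow> (\<forall>z\<in>F. (\<lambda>s. z) \<in> {\<lambda>t. z}) \<and> (\<forall>s. 0 \<le> s \<longrightarrow> s \<le> real n \<longrightarrow>
          (\<exists>z\<in>F. ((w s, w (s - 1)), z) \<in> ?U \<times> ?U \<and> norm ((w s, w (s - 1)) - z) \<le> \<epsilon>)))"
        by (intro exI[of _ F] conjI allI impI ballI F(1) singletonI)
    qed
    then obtain V where V: "openin C.curve_topology V" "G0 \<in> V"
      "\<And>G w. G \<in> V \<Longrightarrow> G \<in> LC_hull p C.curve_topology f \<Longrightarrow> adm w \<Longrightarrow>
        pint p 0 (real n) (\<lambda>s. LC_rep G s (w s, w (s - 1)) - LC_rep G0 s (w s, w (s - 1))) \<le> ennreal e"
      by (elim exE conjE) simp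
    show "\<exists>V. openin C.curve_topology V \<and> G0 \<in> V \<and>
      (\<forall>G w \<phi>. G \<in> V \<longrightarrow> G \<in> LC_hull p C.curve_topology f \<longrightarrow> admissible p j (LC_rep G) (real n) w \<phi> \<longrightarrow>
        pint p 0 (real n) (\<lambda>s. LC_rep G s (w s, w (s - 1)) - LC_rep G0 s (w s, w (s - 1))) \<le> ennreal e)"
      by (intro exI[of _ V] conjI allI impI V) (auto simp: adm_def)
  qed
qed

theorem theorem4p5:
  fixes p :: nat
    and D' :: "(real ^ 'n::finite) set"
    and D :: "((real ^ 'n) \<times> (real ^ 'n)) set"
    and f :: "'n delay_field"
  assumes "p > 1"
    and "countable D'" and "closure D' = UNIV"
    and "countable D" and "closure D = UNIV"
    and "f \<in> LC_fun p"
  shows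
    "(L1_loc_equicontinuous_m_bounds f \<longrightarrow>
       (let T = T_Theta_Theta p (m_moduli f) (m_moduli_hat p f) in
        continuous_skew_product_semiflow
          (hull_topology p T f) (C1p_topology p) (delay_domain p T f) delay_map)) \<and>
     (L1_loc_equicontinuous_m_bounds f \<and> Lp_loc_bounded_l2_bounds p f \<longrightarrow>
       (let T = T_Theta_D p (m_moduli f) D' in
        continuous_skew_product_semiflow
          (hull_topology p T f) (C1p_topology p) (delay_domain p T f) delay_map)) \<and>
     (Lp_loc_bounded_l_bounds p f \<longrightarrow>
       (let T = T_D p D in
        continuous_skew_product_semiflow
          (hull_topology p T f) (C1p_topology p) (delay_domain p T f) delay_map))"
  unfolding Let_def
proof (intro conjI impI)
  note p = \<open>p > 1\<close> and f = \<open>f \<in> LC_fun p\<close>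
  have p0: "p > 0" using p by simp
  have ne: "D' \<noteq> {}" "D \<noteq> {}" using \<open>closure D' = UNIV\<close> \<open>closure D = UNIV\<close> by auto
  {
    assume m: "L1_loc_equicontinuous_m_bounds f"
    note \<theta> = good_m_moduli[OF f m] and \<theta>' = good_m_moduli_hat[OF p0 f m]
    let ?T = "T_Theta_Theta p (m_moduli f) (m_moduli_hat p f)"
    show "continuous_skew_product_semiflow (hull_topology p ?T f) (C1p_topology p) (delay_domain p ?T f) delay_map"
      unfolding curve_topology_moving[OF p \<theta> \<theta>', symmetric] by (rule hull_flow.hull_semiflow[OF hull_flow_moving[OF p f m]])
  }
  {
    assume "L1_loc_equicontinuous_m_bounds f \<and> Lp_loc_bounded_l2_bounds p f"
    then have m: "L1_loc_equicontinuous_m_bounds f" and l2: "Lp_loc_bounded_l2_bounds p f" by simp_all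
    note \<theta> = good_m_moduli[OF f m]
    let ?T = "T_Theta_D p (m_moduli f) D'"
    show "continuous_skew_product_semiflow (hull_topology p ?T f) (C1p_topology p) (delay_domain p ?T f) delay_map"
      unfolding curve_topology_half_moving[OF p \<theta> ne(1), symmetric]
      by (rule hull_flow.hull_semiflow[OF hull_flow_half_moving[OF p f m l2 \<open>countable D'\<close> \<open>closure D' = UNIV\<close>]])
  }
  {
    assume l: "Lp_loc_bounded_l_bounds p f"
    let ?T = "T_D p D"
    show "continuous_skew_product_semiflow (hull_topology p ?T f) (C1p_topology p) (delay_domain p ?T f) delay_map"
      unfolding curve_topology_constant[OF p ne(2), symmetric]
      by (rule hull_flow.hull_semiflow[OF hull_flow_constant[OF p f l \<open>countable D\<close> \<open>closure D = UNIV\<close>]])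
  }
qed

end
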